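(* Let $(X,0)=(X^{(1)}\cup\cdots\cup X^{(r)},0)$ be a germ of singular reduced complex analytic curve in $(\mathbb{C}^n,0)$, $n\geq 2$, with branches $(X^{(i)},0)$ of multiplicity $m^{(i)}$. Then $$\sharp\{\mathrm{Irred}(C_5(X,0))\}\le \sum_{i\in S(X)}\bigl(\sigma(m^{(i)})-1\bigr)+\sum_{(i,j)\in T(X)}\gcd\bigl(m^{(i)},m^{(j)}\bigr)+\sharp\, NT(X).$$ In particular, if $(X,0)$ is irreducible of multiplicity $m(X,0)$, then $\sharp\{\mathrm{Irred}(C_5(X,0))\}\le\sigma(m(X,0))-1$.
   Context: **The cone $C_5$.** For an analytic germ $(X,0)\subset(\mathbb{C}^n,0)$, $C_5(X,0)$ is the set of $v\in\mathbb{C}^n$ for which there are sequences of points $w_s,w'_s\in X$ with $w_s\ne w'_s$, $w_s\to0$, $w'_s\to0$, and numbers $\lambda_s\in\mathbb{C}$ such that $\lambda_s(w_s-w'_s)\to v$. For a singular reduced curve germ, $C_5(X,0)$ is a finite union of two-dimensional complex linear subspaces (planes); $\sharp\{\mathrm{Irred}(C_5(X,0))\}$ is the number of its irreducible components, with $C_5(X,0)$ considered as a reduced analytic set. **Index sets.** $S(X)\subset\{1,\dots,r\}$ is the set of $i$ such that $(X^{(i)},0)$ is singular; $T(X)$ is the set of pairs $(i,j)$ with $i<j$ such that $X^{(i)}$ and $X^{(j)}$ have the same tangent line at $0$; $NT(X)$ is the set of pairs $(i,j)$ with $i<j$ such that they have different tangent lines at $0$. **The function $\sigma$.** For a positive integer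 $n$, a sequence of nested divisors of $n$ is a sequence of pairwise distinct positive integers $d_1=n,d_2,\dots,d_s=1$ such that $d_{i+1}$ divides $d_i$ for all $i$; its length is $s$. $\sigma(n)$ is the maximum length of sequences of nested divisors of $n$ (so $\sigma(1)=1$ and $\sigma(p)=2$ for $p$ prime). *)

theory Defs
  imports "HOL-Analysis.Analysis"
begin

section \<open>Analytic sets and analytic germs in complex n-space\<close>

text \<open>A reduced analytic germ at the origin is represented by a set; all notions
  for germs below depend only on the set near \<open>0\<close>.\<close>

definition holomorphic_fun :: "(complex^'n \<Rightarrow> complex) \<Rightarrow> (complex^'n) set \<Rightarrow> bool" where
  "holomorphic_fun f U \<longleftrightarrow>
     (\<forall>z\<in>U. \<exists>f'. (f has_derivative f') (at z) \<and> (\<forall>c v. f' (c *s v) = c * f' v))"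

definition holomorphic_map :: "(complex^'n \<Rightarrow> complex^'m) \<Rightarrow> (complex^'n) set \<Rightarrow> bool" where
  "holomorphic_map f U \<longleftrightarrow> (\<forall>i. holomorphic_fun (\<lambda>z. f z $ i) U)"

definition analytic_at :: "complex^'n \<Rightarrow> (complex^'n) set \<Rightarrow> bool" where
  "analytic_at p A \<longleftrightarrow>
     (\<exists>U F. open U \<and> p \<in> U \<and> finite F \<and> (\<forall>f\<in>F. holomorphic_fun f U) \<and>
            A \<inter> U = {z \<in> U. \<forall>f\<in>F. f z = 0})"

text \<open>The point \<open>p\<close> is not required to lie in \<open>A\<close>, so analytic subsets are closed.\<close>

definition analytic_subset :: "(complex^'n) set \<Rightarrow> bool" where
  "analytic_subset A \<longleftrightarrow> (\<forall>p. analytic_at p A)"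

definition irreducible_analytic :: "(complex^'n) set \<Rightarrow> bool" where
  "irreducible_analytic A \<longleftrightarrow>
     analytic_subset A \<and> A \<noteq> {} \<and>
     (\<forall>B C. analytic_subset B \<and> analytic_subset C \<and> A = B \<union> C \<longrightarrow> A = B \<or> A = C)"

definition Irred :: "(complex^'n) set \<Rightarrow> (complex^'n) set set" where
  "Irred A = {B. irreducible_analytic B \<and> B \<subseteq> A \<and>
                 (\<forall>B'. irreducible_analytic B' \<and> B \<subseteq> B' \<and> B' \<subseteq> A \<longrightarrow> B' = B)}"

definition germ_eq :: "(complex^'n) set \<Rightarrow> (complex^'n) set \<Rightarrow> bool" where
  "germ_eq A B \<longleftrightarrow> (\<forall>\<^sub>F z in nhds 0. z \<in> A \<longleftrightarrow> z \<in> B)"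

definition germ_le :: "(complex^'n) set \<Rightarrow> (complex^'n) set \<Rightarrow> bool" where
  "germ_le A B \<longleftrightarrow> (\<forall>\<^sub>F z in nhds 0. z \<in> A \<longrightarrow> z \<in> B)"

definition analytic_germ :: "(complex^'n) set \<Rightarrow> bool" where
  "analytic_germ A \<longleftrightarrow> 0 \<in> A \<and> analytic_at 0 A"

definition irreducible_germ :: "(complex^'n) set \<Rightarrow> bool" where
  "irreducible_germ A \<longleftrightarrow>
     analytic_germ A \<and>
     (\<forall>B C. analytic_at 0 B \<and> analytic_at 0 C \<and> germ_eq A (B \<union> C) \<longrightarrow>
            germ_eq A B \<or> germ_eq A C)"

definition irreducible_decomposition ::
    "(complex^'n) set \<Rightarrow> nat \<Rightarrow> (nat \<Rightarrow> (complex^'n) set) \<Rightarrow> bool" where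
  "irreducible_decomposition X r Xb \<longleftrightarrow>
     germ_eq X (\<Union>i\<in>{1..r}. Xb i) \<and>
     (\<forall>i\<in>{1..r}. irreducible_germ (Xb i)) \<and>
     (\<forall>i\<in>{1..r}. \<forall>j\<in>{1..r}. i \<noteq> j \<longrightarrow> \<not> germ_le (Xb i) (Xb j))"

text \<open>Analytic dimension in the sense of Grauert and Remmert: the least number of
  holomorphic germs vanishing at \<open>0\<close> whose common zero set on \<open>A\<close> is, near \<open>0\<close>,
  at most \<open>{0}\<close>.\<close>

definition germ_dim :: "(complex^'n) set \<Rightarrow> nat" where
  "germ_dim A =
     (LEAST d. \<exists>U F. open U \<and> 0 \<in> U \<and> finite F \<and> card F = d \<and>
        (\<forall>f\<in>F. holomorphic_fun f U \<and> f 0 = 0) \<and>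
        {z \<in> A \<inter> U. \<forall>f\<in>F. f z = 0} \<subseteq> {0})"

definition curve_germ :: "(complex^'n) set \<Rightarrow> nat \<Rightarrow> (nat \<Rightarrow> (complex^'n) set) \<Rightarrow> bool" where
  "curve_germ X r Xb \<longleftrightarrow>
     analytic_germ X \<and> irreducible_decomposition X r Xb \<and> (\<forall>i\<in>{1..r}. germ_dim (Xb i) = 1)"

text \<open>Smooth means that some biholomorphic change of coordinates near \<open>0\<close> turns the
  germ into the germ of a complex linear subspace.\<close>

definition smooth_germ :: "(complex^'n) set \<Rightarrow> bool" where
  "smooth_germ A \<longleftrightarrow>
     (\<exists>U V \<Phi> \<Psi> L. open U \<and> 0 \<in> U \<and> open V \<and> homeomorphism U V \<Phi> \<Psi> \<and>
        holomorphic_map \<Phi> U \<and> holomorphic_map \<Psi> V \<and> \<Phi> 0 = (0 :: complex^'n) \<and>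
        vec.subspace L \<and> \<Phi> ` (A \<inter> U) = L \<inter> V)"

section \<open>Multiplicity and cones\<close>

text \<open>For a linear form \<open>l\<close> having \<open>0\<close> as an isolated zero on the curve germ \<open>A\<close>, the
  restriction of \<open>l\<close> to \<open>A\<close> is, near \<open>0\<close>, a branched covering of a disc; its degree is
  the number of points of a nearby fibre. The multiplicity is the least such degree,
  attained by generic \<open>l\<close>.\<close>

definition projection_degree :: "(complex^'n) set \<Rightarrow> (complex^'n \<Rightarrow> complex) \<Rightarrow> nat \<Rightarrow> bool" where
  "projection_degree A l d \<longleftrightarrow>
     Vector_Spaces.linear (*s) (*) l \<and>
     (\<forall>\<^sub>F z in nhds 0. z \<in> A \<and> l z = 0 \<longrightarrow> z = 0) \<and>
     (\<forall>\<^sub>F \<rho> in at_right 0. \<forall>\<^sub>F x in at 0. card {z \<in> A. norm z < \<rho> \<and> l z = x} = d)"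

definition germ_mult :: "(complex^'n) set \<Rightarrow> nat" where
  "germ_mult A = (LEAST d. \<exists>l. projection_degree A l d)"

text \<open>For an irreducible curve germ the tangent cone is the tangent line.\<close>

definition tangent_cone :: "(complex^'n) set \<Rightarrow> (complex^'n) set" where
  "tangent_cone A =
     {v. \<exists>(w :: nat \<Rightarrow> complex^'n) (c :: nat \<Rightarrow> complex).
           (\<forall>s. w s \<in> A) \<and> w \<longlonglongrightarrow> 0 \<and> (\<lambda>s. c s *s w s) \<longlonglongrightarrow> v}"

definition C5 :: "(complex^'n) set \<Rightarrow> (complex^'n) set" where
  "C5 X =
     {v. \<exists>(w :: nat \<Rightarrow> complex^'n) (w' :: nat \<Rightarrow> complex^'n) (c :: nat \<Rightarrow> complex).
           (\<forall>s. w s \<in> X \<and> w' s \<in> X \<and> w s \<noteq> w' s) \<and> w \<longlonglongrightarrow> 0 \<and> w' \<longlonglongrightarrow> 0 \<and>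
           (\<lambda>s. c s *s (w s - w' s)) \<longlonglongrightarrow> v}"

section \<open>Index sets and nested divisors\<close>

definition S_set :: "nat \<Rightarrow> (nat \<Rightarrow> (complex^'n) set) \<Rightarrow> nat set" where
  "S_set r Xb = {i \<in> {1..r}. \<not> smooth_germ (Xb i)}"

definition T_set :: "nat \<Rightarrow> (nat \<Rightarrow> (complex^'n) set) \<Rightarrow> (nat \<times> nat) set" where
  "T_set r Xb = {(i, j). i \<in> {1..r} \<and> j \<in> {1..r} \<and> i < j \<and>
                         tangent_cone (Xb i) = tangent_cone (Xb j)}"

definition NT_set :: "nat \<Rightarrow> (nat \<Rightarrow> (complex^'n) set) \<Rightarrow> (nat \<times> nat) set" where
  "NT_set r Xb = {(i, j). i \<in> {1..r} \<and> j \<in> {1..r} \<and> i < j \<and>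
                          tangent_cone (Xb i) \<noteq> tangent_cone (Xb j)}"

definition nested_divisors :: "nat \<Rightarrow> nat list \<Rightarrow> bool" where
  "nested_divisors n ds \<longleftrightarrow>
     ds \<noteq> [] \<and> distinct ds \<and> (\<forall>d \<in> set ds. d > 0) \<and> hd ds = n \<and> last ds = 1 \<and>
     (\<forall>i. Suc i < length ds \<longrightarrow> ds ! Suc i dvd ds ! i)"

definition \<sigma> :: "nat \<Rightarrow> nat" where
  "\<sigma> n = Max {length ds | ds. nested_divisors n ds}"

end

theory Submission
  imports Defs "HOL-Complex_Analysis.Complex_Analysis"
begin

no_notation fps_nth (infixl "$" 75)

text \<open>Each branch has an injective parametrization which, after a change of parameter, satisfies
  \<open>l (\<phi> t) = t ^ m\<close> for one generic linear form \<open>l\<close>, where \<open>m\<close> is the multiplicity; it is obtained from Puiseux's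
  theorem and elimination of variables. For two branches \<open>\<phi>\<close>, \<open>\<psi>\<close> of multiplicities \<open>m\<close>, \<open>m'\<close> with tangent vectors
  \<open>u\<close>, \<open>u'\<close>, every point of the first branch is compared with the points of the second branch in the same fibre of
  \<open>l\<close>: for \<open>g = gcd m m'\<close> and each \<open>m'\<close>-th root of unity \<open>\<eta>\<close> let \<open>D\<close> be the leading coefficient of
  \<open>\<phi> (\<tau> ^ (m' div g)) - \<psi> (\<eta> * \<tau> ^ (m div g))\<close>. A limit of secants differs from a limit of
  secants in the fibres of \<open>l\<close> only by a multiple of \<open>u'\<close>, so that the pair contributes the planes spanned by \<open>u'\<close> and
  \<open>D\<close>. Rotating \<open>\<tau>\<close> shows that the plane depends only on \<open>\<eta> ^ (m' div g)\<close>, a \<open>g\<close>-th root of unity. For distinct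
  tangents \<open>D = u - u'\<close>. For \<open>\<psi> = \<phi>\<close>, \<open>D\<close> is a multiple of the coefficient of \<open>t ^ v\<close> in \<open>\<phi>\<close> for the least exponent
  \<open>v\<close> of \<open>\<phi>\<close> with \<open>\<eta> ^ v \<noteq> 1\<close>; the possible exponents cut out a strictly decreasing chain of groups of roots of
  unity, that is, a sequence of nested divisors of \<open>m\<close>.\<close>

section \<open>Norms over the zeros of a holomorphic family\<close>

text \<open>A germ is only given as the zero set of finitely many equations, so a parametrization
  has to be manufactured. The device used throughout is the norm polynomial of a holomorphic family:
  by the argument principle its coefficients depend holomorphically on the parameter, and this one
  construction yields Weierstrass polynomials, local factors, eliminants and the descent along
  \<open>t ^ e\<close>. Elimination produces, for each coordinate separately, finitely many possible
  branches; how they fit together is unknown, so all combinations are formed and the identity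
  theorem discards those that leave the germ. Irreducibility then selects one curve, and dividing by
  its rotational symmetries makes it injective. The linear form has to be common to all branches,
  since otherwise two branches have no fibres in which their points could be compared. Within a
  fibre the nearest point is taken: this bounds the error of the comparison by the difference of the
  values of the form. On a single branch \<eta> = 1 gives just the tangent line; it is absorbed by a
  plane because the germ is singular.\<close>

lemma continuous_on_contour_integral_circlepath:
  fixes h :: "'a::topological_space \<Rightarrow> complex \<Rightarrow> complex"
  assumes cont: "continuous_on (S \<times> sphere c r) (\<lambda>(x,\<zeta>). h x \<zeta>)" and "0 \<le> r"
  shows "continuous_on S (\<lambda>x. contour_integral (circlepath c r) (h x))"
proof -
  have "continuous_on (S \<times> cbox 0 1)
      (\<lambda>(x,t). h x (circlepath c r t) * (2 * of_real pi * \<i> * r * exp (2 * of_real pi * \<i> * of_real t)))"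
  proof -
    have "continuous_on (S \<times> cbox 0 1) (\<lambda>z. case (fst z, circlepath c r (snd z)) of (x,\<zeta>) \<Rightarrow> h x \<zeta>)"
    proof (rule continuous_on_compose2[OF cont])
      show "continuous_on (S \<times> cbox 0 (1::real)) (\<lambda>z. (fst z, circlepath c r (snd z)))"
        unfolding circlepath by (intro continuous_intros)
      show "(\<lambda>z. (fst z, circlepath c r (snd z))) ` (S \<times> cbox 0 (1::real)) \<subseteq> S \<times> sphere c r"
        using path_image_circlepath_nonneg[OF \<open>0 \<le> r\<close>, of c] by (auto simp: path_image_def)
    qed
    then show ?thesis
      by (simp only: case_prod_unfold fst_conv snd_conv) (intro continuous_intros)
  qed
  from integral_continuous_on_param[OF this] show ?thesis
    by (simp add: contour_integral_integral vector_derivative_circlepath cbox_interval)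
qed

lemma holomorphic_on_contour_integral_circlepath:
  fixes h :: "complex \<Rightarrow> complex \<Rightarrow> complex"
  assumes cont: "continuous_on (S \<times> sphere c r) (\<lambda>(x,\<zeta>). h x \<zeta>)" and "0 \<le> r"
    and hol: "\<And>\<zeta>. \<zeta> \<in> sphere c r \<Longrightarrow> (\<lambda>x. h x \<zeta>) holomorphic_on S" and "open S"
  shows "(\<lambda>x. contour_integral (circlepath c r) (h x)) holomorphic_on S"
proof -
  have "(\<lambda>x. contour_integral (circlepath c r) (h x)) field_differentiable (at s0)" if "s0 \<in> S" for s0
  proof -
    obtain \<rho> where \<rho>: "\<rho> > 0" "cball s0 \<rho> \<subseteq> S"
      using \<open>open S\<close> \<open>s0 \<in> S\<close> open_contains_cball by blast
    \<comment> \<open>Only joint continuity of \<open>h\<close> is at hand. Writing the derivative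
      in the parameter as a Cauchy integral over a circle around \<open>s0\<close> turns this into
      joint continuity of the derivative, which the Leibniz rule asks for.\<close>
    define fx where "fx s \<zeta> = 1 / (2 * of_real pi * \<i>) * contour_integral (circlepath s0 \<rho>) (\<lambda>\<sigma>. h \<sigma> \<zeta> / (\<sigma> - s)^2)" for s \<zeta>
    have der: "((\<lambda>s. h s \<zeta>) has_field_derivative fx s \<zeta>) (at s)" if "s \<in> ball s0 \<rho>" "\<zeta> \<in> sphere c r" for s \<zeta>
      unfolding fx_def
    proof (rule Cauchy_derivative_integral_circlepath(2))
      show "continuous_on (cball s0 \<rho>) (\<lambda>s. h s \<zeta>)"
        using hol[OF that(2)] \<rho> holomorphic_on_imp_continuous_on continuous_on_subset by blast
      show "(\<lambda>s. h s \<zeta>) holomorphic_on ball s0 \<rho>"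
        using hol[OF that(2)] \<rho> by (meson ball_subset_cball holomorphic_on_subset)
    qed (use that in auto)
    have contfx: "continuous_on (ball s0 \<rho> \<times> sphere c r) (\<lambda>p. fx (fst p) (snd p))"
      unfolding fx_def
    proof (intro continuous_intros continuous_on_contour_integral_circlepath)
      have "continuous_on ((ball s0 \<rho> \<times> sphere c r) \<times> sphere s0 \<rho>) (\<lambda>p. case (snd p, snd (fst p)) of (x,\<zeta>) \<Rightarrow> h x \<zeta>)"
      proof (rule continuous_on_compose2[OF cont])
        show "continuous_on ((ball s0 \<rho> \<times> sphere c r) \<times> sphere s0 \<rho>) (\<lambda>x. (snd x, snd (fst x)))"
          by (intro continuous_intros)
        show "(\<lambda>x. (snd x, snd (fst x))) ` ((ball s0 \<rho> \<times> sphere c r) \<times> sphere s0 \<rho>) \<subseteq> S \<times> sphere c r"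
          using \<rho> by auto
      qed
      then show "continuous_on ((ball s0 \<rho> \<times> sphere c r) \<times> sphere s0 \<rho>) (\<lambda>(p,\<sigma>). h \<sigma> (snd p) / (\<sigma> - fst p)^2)"
        by (simp only: case_prod_unfold fst_conv snd_conv) (intro continuous_intros; auto)
    qed (use \<rho> in auto)
    have "(\<lambda>x. contour_integral (circlepath c r) (h x)) holomorphic_on ball s0 \<rho>"
    proof -
      have contt: "continuous_on (ball s0 \<rho> \<times> cbox 0 (1::real)) (\<lambda>p. (fst p, circlepath c r (snd p)))"
        unfolding circlepath by (intro continuous_intros)
      have subt: "(\<lambda>p. (fst p, circlepath c r (snd p))) ` (ball s0 \<rho> \<times> cbox 0 (1::real)) \<subseteq> ball s0 \<rho> \<times> sphere c r"
        using path_image_circlepath_nonneg[OF \<open>0 \<le> r\<close>, of c] by (auto simp: path_image_def)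
      have insph: "circlepath c r t \<in> sphere c r" if "t \<in> cbox 0 1" for t
        using path_image_circlepath_nonneg[OF \<open>0 \<le> r\<close>, of c] that by (auto simp: path_image_def)
      have 2: "continuous_on (ball s0 \<rho> \<times> cbox 0 1)
         (\<lambda>(x,t). fx x (circlepath c r t) * (2 * of_real pi * \<i> * r * exp (2 * of_real pi * \<i> * of_real t)))"
        using continuous_on_compose2[OF contfx contt subt]
        by (simp only: case_prod_unfold fst_conv snd_conv) (intro continuous_intros)
      have "(\<lambda>x. integral (cbox 0 1) (\<lambda>t. h x (circlepath c r t) * (2 * of_real pi * \<i> * r * exp (2 * of_real pi * \<i> * of_real t)))) holomorphic_on ball s0 \<rho>"
      proof (rule leibniz_rule_holomorphic[OF _ _ 2])
        fix x t assume "x \<in> ball s0 \<rho>" "t \<in> cbox 0 (1::real)"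
        then show "((\<lambda>x. h x (circlepath c r t) * (2 * of_real pi * \<i> * r * exp (2 * of_real pi * \<i> * of_real t)))
            has_field_derivative fx x (circlepath c r t) * (2 * of_real pi * \<i> * r * exp (2 * of_real pi * \<i> * of_real t))) (at x within ball s0 \<rho>)"
          by (intro DERIV_cmult_right has_field_derivative_at_within[OF der] insph)
      next
        fix x assume x: "x \<in> ball s0 \<rho>"
        have "continuous_on (cbox 0 1) (\<lambda>t. case (x, circlepath c r t) of (x,\<zeta>) \<Rightarrow> h x \<zeta>)"
          by (rule continuous_on_compose2[OF cont]) (use x \<rho> insph in \<open>auto intro!: continuous_intros simp: circlepath\<close>)
        then show "(\<lambda>t. h x (circlepath c r t) * (2 * of_real pi * \<i> * r * exp (2 * of_real pi * \<i> * of_real t))) integrable_on cbox 0 1"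
          by (intro integrable_continuous continuous_intros) auto
      qed auto
      then show ?thesis
        by (simp add: contour_integral_integral vector_derivative_circlepath cbox_interval)
    qed
    then show ?thesis using \<rho> holomorphic_on_imp_differentiable_at by force
  qed
  then show ?thesis by (simp add: holomorphic_on_def field_differentiable_at_within)
qed

text \<open>Cauchy's formula on a circle of radius between \<epsilon> and \<open>R\<close> expresses
  the derivative by values of \<open>q\<close>, so joint continuity passes from \<open>q\<close> to
  its derivative.\<close>

lemma continuous_on_deriv_param:
  fixes q :: "'a::topological_space \<Rightarrow> complex \<Rightarrow> complex"
  assumes cont: "continuous_on (S \<times> ball 0 R) (\<lambda>(x,\<zeta>). q x \<zeta>)"
    and hol: "\<And>x. x \<in> S \<Longrightarrow> q x holomorphic_on ball 0 R"
    and "0 < \<epsilon>" "\<epsilon> < R"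
  shows "continuous_on (S \<times> cball 0 \<epsilon>) (\<lambda>(x,\<zeta>). deriv (q x) \<zeta>)"
proof -
  obtain \<rho> where \<rho>: "\<epsilon> < \<rho>" "\<rho> < R" using assms dense by blast
  have "continuous_on (S \<times> cball 0 \<epsilon>)
     (\<lambda>p. 1 / (2 * of_real pi * \<i>) * contour_integral (circlepath 0 \<rho>) (\<lambda>\<eta>. q (fst p) \<eta> / (\<eta> - snd p)^2))"
  proof (intro continuous_intros continuous_on_contour_integral_circlepath)
    have "continuous_on ((S \<times> cball 0 \<epsilon>) \<times> sphere 0 \<rho>) (\<lambda>p. case (fst (fst p), snd p) of (x,\<zeta>) \<Rightarrow> q x \<zeta>)"
      by (rule continuous_on_compose2[OF cont]) (use \<rho> in \<open>auto intro!: continuous_intros\<close>)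
    then show "continuous_on ((S \<times> cball 0 \<epsilon>) \<times> sphere 0 \<rho>) (\<lambda>(p,\<eta>). q (fst p) \<eta> / (\<eta> - snd p)^2)"
      by (simp only: case_prod_unfold fst_conv snd_conv) (intro continuous_intros; use \<rho> in auto)
  qed (use \<rho> assms in auto)
  moreover have "deriv (q x) \<zeta> = 1 / (2 * of_real pi * \<i>) * contour_integral (circlepath 0 \<rho>) (\<lambda>\<eta>. q x \<eta> / (\<eta> - \<zeta>)^2)"
    if "x \<in> S" "\<zeta> \<in> cball 0 \<epsilon>" for x \<zeta>
  proof (rule DERIV_imp_deriv, rule Cauchy_derivative_integral_circlepath(2))
    have "cball 0 \<rho> \<subseteq> ball 0 R" using \<rho> by auto
    then show "continuous_on (cball 0 \<rho>) (q x)" "q x holomorphic_on ball 0 \<rho>"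
      using hol[OF that(1)] by (meson holomorphic_on_imp_continuous_on ball_subset_cball holomorphic_on_subset)+
  qed (use \<rho> that in auto)
  ultimately show ?thesis
    by (subst continuous_on_cong[OF refl]) auto
qed

lemma holomorphic_on_deriv_param:
  fixes q :: "complex \<Rightarrow> complex \<Rightarrow> complex"
  assumes cont: "continuous_on (S \<times> ball 0 R) (\<lambda>(x,\<zeta>). q x \<zeta>)"
    and hol: "\<And>x. x \<in> S \<Longrightarrow> q x holomorphic_on ball 0 R"
    and hol': "\<And>\<zeta>. \<zeta> \<in> ball 0 R \<Longrightarrow> (\<lambda>x. q x \<zeta>) holomorphic_on S" and "open S"
    and "\<zeta> \<in> ball 0 R"
  shows "(\<lambda>x. deriv (q x) \<zeta>) holomorphic_on S"
proof -
  obtain \<rho> where \<rho>: "norm \<zeta> < \<rho>" "\<rho> < R" using assms(5) dense by auto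
  have "\<rho> > 0" using \<rho> by (meson norm_ge_zero order_le_less_trans)
  have "(\<lambda>x. 1 / (2 * of_real pi * \<i>) * contour_integral (circlepath 0 \<rho>) (\<lambda>\<eta>. q x \<eta> / (\<eta> - \<zeta>)^2)) holomorphic_on S"
  proof (intro holomorphic_intros holomorphic_on_contour_integral_circlepath)
    have "continuous_on (S \<times> sphere 0 \<rho>) (\<lambda>p. case (fst p, snd p) of (x,\<zeta>) \<Rightarrow> q x \<zeta>)"
      by (rule continuous_on_compose2[OF cont]) (use \<rho> in \<open>auto intro!: continuous_intros\<close>)
    then show "continuous_on (S \<times> sphere 0 \<rho>) (\<lambda>(x,\<eta>). q x \<eta> / (\<eta> - \<zeta>)^2)"
      by (simp only: case_prod_unfold fst_conv snd_conv) (intro continuous_intros; use \<rho> in auto)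
  qed (use \<rho> \<open>\<rho> > 0\<close> assms hol' in auto)
  moreover have "deriv (q x) \<zeta> = 1 / (2 * of_real pi * \<i>) * contour_integral (circlepath 0 \<rho>) (\<lambda>\<eta>. q x \<eta> / (\<eta> - \<zeta>)^2)"
    if "x \<in> S" for x
  proof (rule DERIV_imp_deriv, rule Cauchy_derivative_integral_circlepath(2))
    have "cball 0 \<rho> \<subseteq> ball 0 R" using \<rho> by auto
    then show "continuous_on (cball 0 \<rho>) (q x)" "q x holomorphic_on ball 0 \<rho>"
      using hol[OF that(1)] by (meson holomorphic_on_imp_continuous_on ball_subset_cball holomorphic_on_subset)+
  qed (use \<rho> that in auto)
  ultimately show ?thesis
    by (subst holomorphic_cong[OF refl]) auto
qed

section \<open>Zeros in a disc and the argument principle\<close>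

definition zeros_in :: "real \<Rightarrow> (complex \<Rightarrow> complex) \<Rightarrow> complex set" where
  "zeros_in \<epsilon> q = {\<alpha> \<in> ball 0 \<epsilon>. q \<alpha> = 0}"

text \<open>The characteristic polynomial of multiplication by \<open>G\<close> modulo \<open>q\<close>.\<close>

definition norm_poly :: "real \<Rightarrow> (complex \<Rightarrow> complex) \<Rightarrow> (complex \<Rightarrow> complex) \<Rightarrow> complex poly" where
  "norm_poly \<epsilon> q G = (\<Prod>\<alpha>\<in>zeros_in \<epsilon> q. [:- G \<alpha>, 1:] ^ nat (zorder q \<alpha>))"

text \<open>Nonvanishing on the circle excludes the zero function, so the identity theorem leaves
  finitely many zeros inside. The second claim is the form in which the order of a zero is
  controlled: \<open>zorder\<close> is meaningful where the function is frequently nonzero.\<close>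

lemma not_constant_ballI:
  assumes "0 < \<epsilon>" "\<epsilon> < R" "q holomorphic_on ball 0 R" "\<And>\<zeta>. \<zeta> \<in> sphere 0 \<epsilon> \<Longrightarrow> q \<zeta> \<noteq> (0::complex)"
  shows "finite {\<zeta> \<in> cball 0 \<epsilon>. q \<zeta> = 0}"
    and "\<And>\<zeta>. \<zeta> \<in> ball 0 \<epsilon> \<Longrightarrow> \<exists>\<^sub>F z in at \<zeta>. q z \<noteq> 0"
proof -
  have sub: "cball 0 \<epsilon> \<subseteq> ball 0 R" using assms by auto
  show fin: "finite {\<zeta> \<in> cball 0 \<epsilon>. q \<zeta> = 0}"
  proof (cases "q constant_on ball 0 R")
    case True
    then obtain c where "\<And>z. z \<in> ball 0 R \<Longrightarrow> q z = c" by (auto simp: constant_on_def)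
    moreover have "c \<noteq> 0"
      using assms(4)[of "of_real \<epsilon>"] calculation[of "of_real \<epsilon>"] assms(1,2) by auto
    ultimately have "{\<zeta> \<in> cball 0 \<epsilon>. q \<zeta> = 0} = {}" using sub by fastforce
    then show ?thesis by (metis finite.emptyI)
  qed (use holomorphic_compact_finite_zeros[of q "ball 0 R" "cball 0 \<epsilon>"] assms sub in auto)
  show "\<exists>\<^sub>F z in at \<zeta>. q z \<noteq> 0" if "\<zeta> \<in> ball 0 \<epsilon>" for \<zeta>
  proof (rule ccontr)
    assume "\<not> ?thesis"
    then have "\<forall>\<^sub>F z in at \<zeta>. q z = 0" by (simp add: frequently_def)
    moreover have "\<forall>\<^sub>F z in at \<zeta>. z \<in> ball 0 \<epsilon>" 
      using that eventually_at_in_open' open_ball by blast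
    ultimately have "\<forall>\<^sub>F z in at \<zeta>. z \<in> {\<zeta> \<in> cball 0 \<epsilon>. q \<zeta> = 0}"
      by eventually_elim auto
    then have "\<zeta> islimpt {\<zeta> \<in> cball 0 \<epsilon>. q \<zeta> = 0}"
      using eventually_frequently[of "at \<zeta>"] by (force simp: islimpt_iff_eventually frequently_def)
    then show False using fin islimpt_finite by blast
  qed
qed

lemma zeros_in_finite:
  assumes "0 < \<epsilon>" "\<epsilon> < R" "q holomorphic_on ball 0 R" "\<And>\<zeta>. \<zeta> \<in> sphere 0 \<epsilon> \<Longrightarrow> q \<zeta> \<noteq> (0::complex)"
  shows "finite (zeros_in \<epsilon> q)" "\<And>\<alpha>. \<alpha> \<in> zeros_in \<epsilon> q \<Longrightarrow> zorder q \<alpha> > 0"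
proof -
  show "finite (zeros_in \<epsilon> q)"
    by (rule finite_subset[OF _ not_constant_ballI(1)[OF assms]]) (auto simp: zeros_in_def)
  show "zorder q \<alpha> > 0" if "\<alpha> \<in> zeros_in \<epsilon> q" for \<alpha>
    using zorder_pos_iff[OF assms(3) open_ball _ not_constant_ballI(2)[OF assms]] that assms(2)
    by (auto simp: zeros_in_def)
qed

lemma norm_poly_zero_iff:
  assumes "0 < \<epsilon>" "\<epsilon> < R" "q holomorphic_on ball 0 R" "\<And>\<zeta>. \<zeta> \<in> sphere 0 \<epsilon> \<Longrightarrow> q \<zeta> \<noteq> (0::complex)"
  shows "poly (norm_poly \<epsilon> q G) w = 0 \<longleftrightarrow> (\<exists>\<alpha>. norm \<alpha> < \<epsilon> \<and> q \<alpha> = 0 \<and> G \<alpha> = w)"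
proof -
  have "poly (norm_poly \<epsilon> q G) w = (\<Prod>\<alpha>\<in>zeros_in \<epsilon> q. (w - G \<alpha>) ^ nat (zorder q \<alpha>))"
    unfolding norm_poly_def poly_prod poly_power by (intro prod.cong refl arg_cong[where f="\<lambda>x. x^_"]) simp
  then show ?thesis
    using zeros_in_finite[OF assms] by (auto simp: zeros_in_def)
qed

lemma norm_poly_degree:
  shows "degree (norm_poly \<epsilon> q G) = (\<Sum>\<alpha>\<in>zeros_in \<epsilon> q. nat (zorder q \<alpha>))" "lead_coeff (norm_poly \<epsilon> q G) = 1"
proof -
  show "lead_coeff (norm_poly \<epsilon> q G) = 1"
    by (simp add: norm_poly_def lead_coeff_prod lead_coeff_power)
  show "degree (norm_poly \<epsilon> q G) = (\<Sum>\<alpha>\<in>zeros_in \<epsilon> q. nat (zorder q \<alpha>))"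
    unfolding norm_poly_def by (subst degree_prod_eq_sum_degree) (auto simp: degree_power_eq)
qed

text \<open>The argument principle with weight \<open>h\<close>. It is applied on a ball slightly
  larger than the circle; zeros outside the circle have winding number 0 and drop out.\<close>

lemma contour_integral_zeros_in:
  assumes "0 < \<epsilon>" "\<epsilon> < R" "q holomorphic_on ball 0 R" "\<And>\<zeta>. \<zeta> \<in> sphere 0 \<epsilon> \<Longrightarrow> q \<zeta> \<noteq> (0::complex)"
    and "h holomorphic_on ball 0 R"
  shows "contour_integral (circlepath 0 \<epsilon>) (\<lambda>\<zeta>. deriv q \<zeta> * h \<zeta> / q \<zeta>)
     = 2 * of_real pi * \<i> * (\<Sum>\<alpha>\<in>zeros_in \<epsilon> q. of_nat (nat (zorder q \<alpha>)) * h \<alpha>)"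
proof -
  obtain \<rho> where \<rho>: "\<epsilon> < \<rho>" "\<rho> < R" using assms dense by blast
  have fin: "finite {\<zeta> \<in> ball 0 \<rho>. q \<zeta> = 0}"
  proof -
    have "\<not> q constant_on ball 0 R \<or> (\<forall>\<zeta>\<in>ball 0 R. q \<zeta> \<noteq> 0)"
      using assms(4)[of "of_real \<epsilon>"] assms(1,2) by (auto simp: constant_on_def)
    then show ?thesis
    proof
      assume "\<not> q constant_on ball 0 R"
      note * = holomorphic_compact_finite_zeros[OF assms(3) _ _ _ _ this, of "cball 0 \<rho>"]
      have "cball 0 \<rho> \<subseteq> ball (0::complex) R" using \<rho> by auto
      with * have "finite {z \<in> cball 0 \<rho>. q z = 0}" by auto
      then show ?thesis by (rule finite_subset[rotated]) auto
    next
      assume "\<forall>\<zeta>\<in>ball 0 R. q \<zeta> \<noteq> 0"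
      then have "{\<zeta> \<in> ball 0 \<rho>. q \<zeta> = 0} = {}" using \<rho> by auto
      then show ?thesis by (metis finite.emptyI)
    qed
  qed
  have "contour_integral (circlepath 0 \<epsilon>) (\<lambda>\<zeta>. deriv q \<zeta> * h \<zeta> / q \<zeta>) =
     2 * pi * \<i> * (\<Sum>p\<in>{w\<in>ball 0 \<rho>. q w = 0 \<or> w \<in> {}}. winding_number (circlepath 0 \<epsilon>) p * h p * zorder q p)"
  proof (rule argument_principle)
    show "q holomorphic_on ball 0 \<rho> - {}" "h holomorphic_on ball 0 \<rho>"
      using assms(3,5) \<rho> by (auto elim!: holomorphic_on_subset)
    show "path_image (circlepath 0 \<epsilon>) \<subseteq> ball 0 \<rho> - {w \<in> ball 0 \<rho>. q w = 0 \<or> w \<in> {}}"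
      using assms \<rho> by auto
    show "\<forall>z. z \<notin> ball 0 \<rho> \<longrightarrow> winding_number (circlepath 0 \<epsilon>) z = 0"
    proof (intro allI impI, rule winding_number_zero_outside[of _ "cball 0 \<epsilon>"])
    qed (use \<rho> assms in auto)
  qed (use fin in auto)
  also have "(\<Sum>p\<in>{w\<in>ball 0 \<rho>. q w = 0 \<or> w \<in> {}}. winding_number (circlepath 0 \<epsilon>) p * h p * zorder q p)
     = (\<Sum>p\<in>zeros_in \<epsilon> q. winding_number (circlepath 0 \<epsilon>) p * h p * zorder q p)"
  proof (rule sum.mono_neutral_right)
    show "finite {w \<in> ball 0 \<rho>. q w = 0 \<or> w \<in> {}}" using fin by simp
    show "zeros_in \<epsilon> q \<subseteq> {w \<in> ball 0 \<rho>. q w = 0 \<or> w \<in> {}}" using \<rho> by (auto simp: zeros_in_def)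
    show "\<forall>i\<in>{w \<in> ball 0 \<rho>. q w = 0 \<or> w \<in> {}} - zeros_in \<epsilon> q. winding_number (circlepath 0 \<epsilon>) i * h i * zorder q i = 0"
    proof
      fix i assume i: "i \<in> {w \<in> ball 0 \<rho>. q w = 0 \<or> w \<in> {}} - zeros_in \<epsilon> q"
      then have "norm i \<noteq> \<epsilon>" using assms(4)[of i] by auto
      then have "i \<notin> cball 0 \<epsilon>" using i by (auto simp: zeros_in_def)
      then have "winding_number (circlepath 0 \<epsilon>) i = 0"
        using assms by (intro winding_number_zero_outside[of _ "cball 0 \<epsilon>"]) auto
      then show "winding_number (circlepath 0 \<epsilon>) i * h i * zorder q i = 0" by simp
    qed
  qed
  also have "\<dots> = (\<Sum>\<alpha>\<in>zeros_in \<epsilon> q. of_nat (nat (zorder q \<alpha>)) * h \<alpha>)"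
  proof (rule sum.cong[OF refl])
    fix \<alpha> assume \<alpha>: "\<alpha> \<in> zeros_in \<epsilon> q"
    have "winding_number (circlepath 0 \<epsilon>) \<alpha> = 1"
      using \<alpha> by (intro winding_number_circlepath) (auto simp: zeros_in_def)
    moreover have "of_int (zorder q \<alpha>) = (of_nat (nat (zorder q \<alpha>)) :: complex)"
      using zeros_in_finite(2)[OF assms(1-4) \<alpha>] by (simp add: of_nat_nat)
    ultimately show "winding_number (circlepath 0 \<epsilon>) \<alpha> * h \<alpha> * zorder q \<alpha> = of_nat (nat (zorder q \<alpha>)) * h \<alpha>"
      by (simp add: mult.commute)
  qed
  finally show ?thesis by simp
qed

text \<open>The \<open>L k\<close> depend on the nodes alone. Coefficients thereby become fixed
  linear combinations of the values at the nodes, which carries continuity and holomorphy in a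
  parameter from values to coefficients.\<close>

lemma lagrange_interpolation:
  fixes w :: "nat \<Rightarrow> 'a::field"
  assumes inj: "inj_on w {..d}"
  obtains L where "\<And>p. degree p \<le> d \<Longrightarrow> p = (\<Sum>k\<le>d. smult (poly p (w k)) (L k))"
proof
  define L where "L k = (\<Prod>j\<in>{..d}-{k}. smult (inverse (w k - w j)) [:- w j, 1:])" for k
  have degL: "degree (L k) \<le> d" if "k \<le> d" for k
  proof -
    have "degree (L k) \<le> sum (degree \<circ> (\<lambda>j. smult (inverse (w k - w j)) [:- w j, 1:])) ({..d}-{k})"
      unfolding L_def by (rule degree_prod_sum_le) simp
    also have "\<dots> \<le> (\<Sum>j\<in>{..d}-{k}. 1)" by (intro sum_mono) (simp add: degree_smult_eq)
    finally show ?thesis using that by simp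
  qed
  have val: "poly (L k) (w i) = (if i = k then 1 else 0)" if "k \<le> d" "i \<le> d" for k i
  proof (cases "i = k")
    case True
    have "poly (smult (inverse (w k - w j)) [:- w j, 1:]) (w k) = 1" if "j \<in> {..d} - {k}" for j
      using inj_onD[OF inj, of k j] that \<open>k \<le> d\<close> left_inverse[of "w k - w j"]
      by (auto simp: algebra_simps simp del: left_inverse)
    then show ?thesis using True
      unfolding L_def poly_prod by (simp del: poly_smult)
  next
    case False
    then show ?thesis using that by (auto simp: L_def poly_prod intro!: prod_zero bexI[of _ i])
  qed
  fix p :: "'a poly" assume "degree p \<le> d"
  define r where "r = p - (\<Sum>k\<le>d. smult (poly p (w k)) (L k))"
  have "degree r \<le> d" unfolding r_def
    using degL \<open>degree p \<le> d\<close> by (intro degree_diff_le degree_sum_le) (auto intro: order_trans[OF degree_smult_le])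
  have "w ` {..d} \<subseteq> {x. poly r x = 0}"
  proof safe
    fix i assume "i \<le> d"
    have "poly (\<Sum>k\<le>d. smult (poly p (w k)) (L k)) (w i) = (\<Sum>k\<le>d. if i = k then poly p (w k) else 0)"
      unfolding poly_sum using val \<open>i \<le> d\<close> by (intro sum.cong) auto
    then show "poly r (w i) = 0" using \<open>i \<le> d\<close> by (simp add: r_def)
  qed
  have "r = 0"
  proof (rule ccontr)
    assume "r \<noteq> 0"
    then have "card (w ` {..d}) \<le> card {x. poly r x = 0}"
      using \<open>w ` {..d} \<subseteq> _\<close> by (intro card_mono poly_roots_finite) auto
    also have "\<dots> \<le> degree r" by (rule card_poly_roots_bound) fact
    finally show False using \<open>degree r \<le> d\<close> inj by (simp add: card_image)
  qed
  then show "p = (\<Sum>k\<le>d. smult (poly p (w k)) (L k))" by (simp add: r_def)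
qed

text \<open>For real \<open>w\<close> beyond the bound of \<open>G\<close> the logarithm of \<open>w - G\<close> is holomorphic, so the argument
  principle computes the norm as an exponential of an integral.\<close>

lemma poly_norm_poly_integral:
  fixes w :: real and G :: "complex \<Rightarrow> complex"
  assumes "0 < \<epsilon>" "\<epsilon> < R" "q holomorphic_on ball 0 R" "\<And>\<zeta>. \<zeta> \<in> sphere 0 \<epsilon> \<Longrightarrow> q \<zeta> \<noteq> (0::complex)"
    and "G holomorphic_on ball 0 R" "\<And>\<zeta>. \<zeta> \<in> ball 0 R \<Longrightarrow> norm (G \<zeta>) < w"
  shows "poly (norm_poly \<epsilon> q G) w = exp (1 / (2 * of_real pi * \<i>) *
     contour_integral (circlepath 0 \<epsilon>) (\<lambda>\<zeta>. deriv q \<zeta> * Ln (w - G \<zeta>) / q \<zeta>))"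
proof -
  have re: "Re (w - G \<zeta>) > 0" if "\<zeta> \<in> ball 0 R" for \<zeta>
    using assms(6)[OF that] complex_Re_le_cmod[of "G \<zeta>"] by simp
  have nonpos: "w - G \<zeta> \<notin> \<real>\<^sub>\<le>\<^sub>0" if "\<zeta> \<in> ball 0 R" for \<zeta>
    using re[OF that] by (auto simp: complex_nonpos_Reals_iff)
  have "(\<lambda>\<zeta>. Ln (w - G \<zeta>)) holomorphic_on ball 0 R"
    by (intro holomorphic_intros assms nonpos)
  from contour_integral_zeros_in[OF assms(1-4) this]
  have "exp (1 / (2 * of_real pi * \<i>) *
     contour_integral (circlepath 0 \<epsilon>) (\<lambda>\<zeta>. deriv q \<zeta> * Ln (w - G \<zeta>) / q \<zeta>))
    = exp (\<Sum>\<alpha>\<in>zeros_in \<epsilon> q. of_nat (nat (zorder q \<alpha>)) * Ln (w - G \<alpha>))"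
    by simp
  also have "\<dots> = (\<Prod>\<alpha>\<in>zeros_in \<epsilon> q. (w - G \<alpha>) ^ nat (zorder q \<alpha>))"
  proof (subst exp_sum)
    show "finite (zeros_in \<epsilon> q)" by (rule zeros_in_finite[OF assms(1-4)])
    show "(\<Prod>\<alpha>\<in>zeros_in \<epsilon> q. exp (of_nat (nat (zorder q \<alpha>)) * Ln (w - G \<alpha>))) = (\<Prod>\<alpha>\<in>zeros_in \<epsilon> q. (w - G \<alpha>) ^ nat (zorder q \<alpha>))"
    proof (rule prod.cong[OF refl])
      fix \<alpha> assume "\<alpha> \<in> zeros_in \<epsilon> q"
      then have "\<alpha> \<in> ball 0 R" using assms(2) by (auto simp: zeros_in_def)
      then have "w - G \<alpha> \<noteq> 0" using re[of \<alpha>] by (metis zero_complex.simps(1) less_irrefl)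
      then show "exp (of_nat (nat (zorder q \<alpha>)) * Ln (w - G \<alpha>)) = (w - G \<alpha>) ^ nat (zorder q \<alpha>)"
        by (simp add: exp_of_nat_mult)
    qed
  qed
  also have "\<dots> = poly (norm_poly \<epsilon> q G) w"
    unfolding norm_poly_def poly_prod poly_power by (intro prod.cong refl arg_cong[where f="\<lambda>x. x^_"]) simp
  finally show ?thesis by simp
qed

text \<open>The parameter space is an arbitrary topological space because it is a disc in the
  Puiseux argument and a polydisc in several variables in the elimination. \<open>K\<close> bounds
  \<open>G\<close> strictly, so that the logarithm of \<open>w - G\<close> is available for real
  \<open>w \<ge> K\<close>.\<close>

locale norm_family =
  fixes S :: "'a::topological_space set" and \<epsilon> R :: real and q G :: "'a \<Rightarrow> complex \<Rightarrow> complex" and K :: real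
  assumes eps: "0 < \<epsilon>" "\<epsilon> < R"
    and q_cont: "continuous_on (S \<times> ball 0 R) (\<lambda>(x,\<zeta>). q x \<zeta>)"
    and q_hol: "\<And>x. x \<in> S \<Longrightarrow> q x holomorphic_on ball 0 R"
    and q_nz: "\<And>x \<zeta>. x \<in> S \<Longrightarrow> \<zeta> \<in> sphere 0 \<epsilon> \<Longrightarrow> q x \<zeta> \<noteq> 0"
    and G_cont: "continuous_on (S \<times> ball 0 R) (\<lambda>(x,\<zeta>). G x \<zeta>)"
    and G_hol: "\<And>x. x \<in> S \<Longrightarrow> G x holomorphic_on ball 0 R"
    and G_bound: "\<And>x \<zeta>. x \<in> S \<Longrightarrow> \<zeta> \<in> ball 0 R \<Longrightarrow> norm (G x \<zeta>) < K"
begin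

lemma cont_sphere:
  assumes "continuous_on (S \<times> ball 0 R) (\<lambda>(x,\<zeta>). H x \<zeta>)"
  shows "continuous_on (S \<times> sphere 0 \<epsilon>) (\<lambda>p. H (fst p) (snd p))"
  using assms eps unfolding case_prod_unfold by (auto intro: continuous_on_subset)

lemma deriv_cont_sphere: "continuous_on (S \<times> sphere 0 \<epsilon>) (\<lambda>p. deriv (q (fst p)) (snd p))"
  using continuous_on_deriv_param[OF q_cont q_hol eps] unfolding case_prod_unfold by (auto intro: continuous_on_subset)

lemma nonpos: "x \<in> S \<Longrightarrow> \<zeta> \<in> ball 0 R \<Longrightarrow> w \<ge> K \<Longrightarrow> of_real w - G x \<zeta> \<notin> \<real>\<^sub>\<le>\<^sub>0"
  using G_bound[of x \<zeta>] complex_Re_le_cmod[of "G x \<zeta>"] by (force simp: complex_nonpos_Reals_iff)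

lemma integrand_cont:
  assumes "w \<ge> K"
  shows "continuous_on (S \<times> sphere 0 \<epsilon>) (\<lambda>(x,\<zeta>). deriv (q x) \<zeta> * Ln (of_real w - G x \<zeta>) / q x \<zeta>)"
  unfolding case_prod_unfold
  using assms eps
  by (intro continuous_intros deriv_cont_sphere cont_sphere[OF G_cont] cont_sphere[OF q_cont]) (auto simp: q_nz nonpos)

text \<open>With weight 1 the argument principle counts the zeros with multiplicity, and this count
  is the degree of the norm polynomial.\<close>

lemma count_continuous:
  "continuous_on S (\<lambda>x. of_nat (degree (norm_poly \<epsilon> (q x) (G x))) :: complex)"
proof -
  have "continuous_on S (\<lambda>x. 1 / (2 * of_real pi * \<i>) * contour_integral (circlepath 0 \<epsilon>) (\<lambda>\<zeta>. deriv (q x) \<zeta> * 1 / q x \<zeta>))"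
  proof (intro continuous_intros continuous_on_contour_integral_circlepath)
    show "continuous_on (S \<times> sphere 0 \<epsilon>) (\<lambda>(x, \<zeta>). deriv (q x) \<zeta> * 1 / q x \<zeta>)"
      unfolding case_prod_unfold
      by (intro continuous_intros deriv_cont_sphere cont_sphere[OF q_cont]) (auto simp: q_nz)
  qed (use eps in auto)
  moreover have "of_nat (degree (norm_poly \<epsilon> (q x) (G x))) =
     1 / (2 * of_real pi * \<i>) * contour_integral (circlepath 0 \<epsilon>) (\<lambda>\<zeta>. deriv (q x) \<zeta> * 1 / q x \<zeta>)" if "x \<in> S" for x
    using contour_integral_zeros_in[of \<epsilon> R "q x" "\<lambda>_. 1"] eps q_hol[OF that] q_nz[OF that]
    by (simp add: norm_poly_degree)
  ultimately show ?thesis by (subst continuous_on_cong[OF refl]) auto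
qed

lemma degree_const:
  assumes "connected S" "x \<in> S" "y \<in> S"
  shows "degree (norm_poly \<epsilon> (q x) (G x)) = degree (norm_poly \<epsilon> (q y) (G y))"
proof -
  define d where "d x = degree (norm_poly \<epsilon> (q x) (G x))" for x
  have "continuous_on S (\<lambda>x. Re (of_nat (d x)))"
    by (rule continuous_on_Re) (rule count_continuous[folded d_def])
  then have "continuous_on S (\<lambda>x. real (d x))" by (simp only: complex_Re_of_nat)
  then have "(\<lambda>x. real (d x)) constant_on S"
  proof (rule continuous_discrete_range_constant[OF \<open>connected S\<close>])
    fix x assume "x \<in> S"
    show "\<exists>e>0. \<forall>y. y \<in> S \<and> real (d y) \<noteq> real (d x) \<longrightarrow> e \<le> norm (real (d y) - real (d x))"
      by (intro exI[of _ 1]) auto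
  qed
  then have "real (d x) = real (d y)" using assms by (metis constant_on_def)
  then show ?thesis by (simp add: d_def)
qed

text \<open>The degree is the same for all parameters, so one set of nodes
  \<open>K, K + 1, ...\<close> beyond the bound of \<open>G\<close> serves all of them. At these
  nodes the value of the norm polynomial is the exponential of a contour integral.\<close>

lemma interpolation:
  assumes "connected S" "S \<noteq> {}"
  shows "\<exists>n L. \<forall>x\<in>S. \<forall>j. coeff (norm_poly \<epsilon> (q x) (G x)) j =
    (\<Sum>k\<le>n. exp (1 / (2 * of_real pi * \<i>) * contour_integral (circlepath 0 \<epsilon>)
        (\<lambda>\<zeta>. deriv (q x) \<zeta> * Ln (of_real (K + real k) - G x \<zeta>) / q x \<zeta>)) * L k j)"
proof -
  obtain x0 where "x0 \<in> S" using assms by auto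
  define d where "d = degree (norm_poly \<epsilon> (q x0) (G x0))"
  have "inj_on (\<lambda>k. of_real (K + real k) :: complex) {..d}" by (auto simp: inj_on_def)
  from lagrange_interpolation[OF this] obtain L where
    L: "\<And>p. degree p \<le> d \<Longrightarrow> p = (\<Sum>k\<le>d. smult (poly p (complex_of_real (K + real k))) (L k))" by blast
  show ?thesis
  proof (intro exI ballI allI)
    fix x j assume x: "x \<in> S"
    have "degree (norm_poly \<epsilon> (q x) (G x)) \<le> d"
      using degree_const[OF assms(1) x \<open>x0 \<in> S\<close>] by (simp add: d_def)
    from arg_cong[OF L[OF this], of "\<lambda>p. coeff p j"]
    have "coeff (norm_poly \<epsilon> (q x) (G x)) j = (\<Sum>k\<le>d. poly (norm_poly \<epsilon> (q x) (G x)) (complex_of_real (K + real k)) * coeff (L k) j)"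
      by (simp add: coeff_sum)
    also have "\<dots> = (\<Sum>k\<le>d. exp (1 / (2 * of_real pi * \<i>) * contour_integral (circlepath 0 \<epsilon>)
        (\<lambda>\<zeta>. deriv (q x) \<zeta> * Ln (of_real (K + real k) - G x \<zeta>) / q x \<zeta>)) * coeff (L k) j)"
    proof (intro sum.cong refl arg_cong2[where f="(*)"] poly_norm_poly_integral)
      fix k \<zeta> assume "\<zeta> \<in> ball (0::complex) R"
      then show "norm (G x \<zeta>) < K + real k" using G_bound[OF x, of \<zeta>] by linarith
    qed (use eps x q_hol q_nz G_hol in auto)
    finally show "coeff (norm_poly \<epsilon> (q x) (G x)) j = \<dots>" .
  qed
qed

lemma coeff_continuous:
  assumes "connected S"
  shows "continuous_on S (\<lambda>x. coeff (norm_poly \<epsilon> (q x) (G x)) j)"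
proof (cases "S = {}")
  case False
  from interpolation[OF assms(1) False] obtain n L where L: "\<forall>x\<in>S. \<forall>j. coeff (norm_poly \<epsilon> (q x) (G x)) j =
    (\<Sum>k\<le>n. exp (1 / (2 * of_real pi * \<i>) * contour_integral (circlepath 0 \<epsilon>)
        (\<lambda>\<zeta>. deriv (q x) \<zeta> * Ln (of_real (K + real k) - G x \<zeta>) / q x \<zeta>)) * L k j)"
    by (elim exE)
  have "continuous_on S (\<lambda>x. \<Sum>k\<le>n. exp (1 / (2 * of_real pi * \<i>) * contour_integral (circlepath 0 \<epsilon>)
        (\<lambda>\<zeta>. deriv (q x) \<zeta> * Ln (of_real (K + real k) - G x \<zeta>) / q x \<zeta>)) * L k j)"
    using eps by (intro continuous_intros continuous_on_contour_integral_circlepath integrand_cont) auto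
  then show ?thesis by (simp add: L cong: continuous_on_cong_simp)
qed auto

end

text \<open>Holomorphy is asserted along a map \<open>f\<close> from a plane domain into the
  parameter space. With \<open>f\<close> the identity this is the case of one variable; with
  \<open>f\<close> moving one coordinate it is separate holomorphy in several variables.\<close>

lemma (in norm_family) coeff_holomorphic:
  fixes f :: "complex \<Rightarrow> 'a"
  assumes "connected S" "open D" "continuous_on D f" "f ` D \<subseteq> S"
    and q': "\<And>\<zeta>. \<zeta> \<in> ball 0 R \<Longrightarrow> (\<lambda>s. q (f s) \<zeta>) holomorphic_on D"
    and G': "\<And>\<zeta>. \<zeta> \<in> ball 0 R \<Longrightarrow> (\<lambda>s. G (f s) \<zeta>) holomorphic_on D"
  shows "(\<lambda>s. coeff (norm_poly \<epsilon> (q (f s)) (G (f s))) j) holomorphic_on D"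
proof (cases "S = {}")
  case False
  from interpolation[OF assms(1) False] obtain n L where L: "\<forall>x\<in>S. \<forall>j. coeff (norm_poly \<epsilon> (q x) (G x)) j =
    (\<Sum>k\<le>n. exp (1 / (2 * of_real pi * \<i>) * contour_integral (circlepath 0 \<epsilon>)
        (\<lambda>\<zeta>. deriv (q x) \<zeta> * Ln (of_real (K + real k) - G x \<zeta>) / q x \<zeta>)) * L k j)"
    by (elim exE)
  have fS: "f s \<in> S" if "s \<in> D" for s using assms that by auto
  have contf: "continuous_on (D \<times> T) (\<lambda>p. (f (fst p), snd p))" for T :: "complex set"
    by (intro continuous_intros continuous_on_compose2[OF assms(3)]) auto
  have subf: "(\<lambda>p. (f (fst p), snd p)) ` (D \<times> T) \<subseteq> S \<times> T" for T :: "complex set"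
    using assms(4) by auto
  have qfc: "continuous_on (D \<times> ball 0 R) (\<lambda>(s,\<zeta>). q (f s) \<zeta>)"
    using continuous_on_compose2[OF q_cont contf subf] by (simp add: case_prod_unfold)
  have 1: "(\<lambda>s. deriv (q (f s)) \<zeta>) holomorphic_on D" if "\<zeta> \<in> ball 0 R" for \<zeta>
    using holomorphic_on_deriv_param[OF qfc _ q' \<open>open D\<close> that] q_hol fS by auto
  have 2: "(\<lambda>s. contour_integral (circlepath 0 \<epsilon>)
        (\<lambda>\<zeta>. deriv (q (f s)) \<zeta> * Ln (of_real (K + real k) - G (f s) \<zeta>) / q (f s) \<zeta>)) holomorphic_on D" for k
  proof (rule holomorphic_on_contour_integral_circlepath)
    show "continuous_on (D \<times> sphere 0 \<epsilon>) (\<lambda>(s,\<zeta>). deriv (q (f s)) \<zeta> * Ln (of_real (K + real k) - G (f s) \<zeta>) / q (f s) \<zeta>)"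
      using continuous_on_compose2[OF integrand_cont contf subf, of "K + real k"] by (simp add: case_prod_unfold)
    fix \<zeta> :: complex assume "\<zeta> \<in> sphere 0 \<epsilon>"
    then have z: "\<zeta> \<in> ball 0 R" "\<zeta> \<in> sphere 0 \<epsilon>" using eps by auto
    show "(\<lambda>s. deriv (q (f s)) \<zeta> * Ln (of_real (K + real k) - G (f s) \<zeta>) / q (f s) \<zeta>) holomorphic_on D"
      by (intro holomorphic_intros 1 q' G' z nonpos fS q_nz) auto
  qed (use eps assms in auto)
  have "(\<lambda>s. \<Sum>k\<le>n. exp (1 / (2 * of_real pi * \<i>) * contour_integral (circlepath 0 \<epsilon>)
        (\<lambda>\<zeta>. deriv (q (f s)) \<zeta> * Ln (of_real (K + real k) - G (f s) \<zeta>) / q (f s) \<zeta>)) * L k j) holomorphic_on D"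
    by (intro holomorphic_intros 2)
  moreover have "coeff (norm_poly \<epsilon> (q (f s)) (G (f s))) j = (\<Sum>k\<le>n. exp (1 / (2 * of_real pi * \<i>) * contour_integral (circlepath 0 \<epsilon>)
        (\<lambda>\<zeta>. deriv (q (f s)) \<zeta> * Ln (of_real (K + real k) - G (f s) \<zeta>) / q (f s) \<zeta>)) * L k j)" if "s \<in> D" for s
    using L fS[OF that] by simp
  ultimately show ?thesis
    using holomorphic_transform by fastforce
qed (use assms in \<open>auto simp: holomorphic_on_def\<close>)

section \<open>Puiseux series\<close>

text \<open>At \<open>x0\<close> the modulus has a positive minimum on the compact set, and
  continuity is uniform along a compact fibre: near \<open>x0\<close> the values change by at most
  half of this minimum.\<close>

lemma nonzero_near_compact:
  fixes f :: "'a::metric_space \<Rightarrow> 'b::topological_space \<Rightarrow> complex"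
  assumes cont: "continuous_on (U \<times> C) (\<lambda>(x,y). f x y)" and "compact C" "open U" "x0 \<in> U"
    and nz: "\<And>y. y \<in> C \<Longrightarrow> f x0 y \<noteq> 0"
  obtains \<delta> where "\<delta> > 0" "ball x0 \<delta> \<subseteq> U" "\<And>x y. x \<in> ball x0 \<delta> \<Longrightarrow> y \<in> C \<Longrightarrow> f x y \<noteq> 0"
proof (cases "C = {}")
  case True
  then show ?thesis using that assms(3,4) openE by (metis empty_iff)
next
  case False
  have "continuous_on C (\<lambda>y. case (x0, y) of (x,y) \<Rightarrow> f x y)"
    by (rule continuous_on_compose2[OF cont]) (use assms in \<open>auto intro!: continuous_intros\<close>)
  then have "continuous_on C (\<lambda>y. norm (f x0 y))" by (auto intro!: continuous_intros)
  then obtain y0 where y0: "y0 \<in> C" "\<And>y. y \<in> C \<Longrightarrow> norm (f x0 y0) \<le> norm (f x0 y)"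
    using continuous_attains_inf[OF \<open>compact C\<close> False] by metis
  define e where "e = norm (f x0 y0) / 2"
  have "e > 0" using nz[OF y0(1)] by (simp add: e_def)
  obtain X0 where X0: "x0 \<in> X0" "open X0" "\<forall>x\<in>X0 \<inter> U. \<forall>t \<in> C. dist (case (x, t) of (x,y) \<Rightarrow> f x y) (case (x0, t) of (x,y) \<Rightarrow> f x y) \<le> e"
    by (rule continuous_on_prod_compactE[OF cont \<open>compact C\<close> \<open>x0 \<in> U\<close> \<open>e > 0\<close>])
  obtain \<delta> where \<delta>: "\<delta> > 0" "ball x0 \<delta> \<subseteq> X0 \<inter> U"
    using X0 assms by (meson IntI openE open_Int)
  show ?thesis
  proof
    show "f x y \<noteq> 0" if "x \<in> ball x0 \<delta>" "y \<in> C" for x y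
    proof
      assume "f x y = 0"
      then have "norm (f x0 y) \<le> e" using X0(3) that \<delta> by (force simp: dist_norm)
      then show False using y0(2)[OF that(2)] \<open>e > 0\<close> unfolding e_def by linarith
    qed
  qed (use \<delta> in auto)
qed

lemma holomorphic_order_at_0:
  fixes f :: "complex \<Rightarrow> complex"
  assumes "f holomorphic_on ball 0 r" "r > 0"
  obtains n u \<delta> where "0 < \<delta>" "\<delta> \<le> r" "u holomorphic_on ball 0 \<delta>"
    "\<And>x. x \<in> ball 0 \<delta> \<Longrightarrow> f x = x ^ n * u x"
    "(\<forall>x\<in>ball 0 \<delta>. u x \<noteq> 0) \<or> (\<forall>x\<in>ball 0 \<delta>. u x = 0)"
proof (cases "f constant_on ball 0 r")
  case True
  then obtain c where c: "\<And>x. x \<in> ball 0 r \<Longrightarrow> f x = c" by (auto simp: constant_on_def)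
  show ?thesis
  proof (rule that[of r f 0])
    show "(\<forall>x\<in>ball 0 r. f x \<noteq> 0) \<or> (\<forall>x\<in>ball 0 r. f x = 0)" by (cases "c = 0") (simp_all add: c)
  qed (use assms in auto)
next
  case nc: False
  show ?thesis
  proof (cases "f 0 = 0")
    case True
    show ?thesis
    proof (rule holomorphic_factor_zero_nonconstant[OF assms(1) open_ball connected_ball _ True nc])
      fix g \<rho> n
      assume *: "0 < n" "0 < \<rho>" "ball 0 \<rho> \<subseteq> ball 0 r" "g holomorphic_on ball 0 \<rho>"
       "\<And>w. w \<in> ball 0 \<rho> \<Longrightarrow> f w = (w - 0) ^ n * g w" "\<And>w. w \<in> ball 0 \<rho> \<Longrightarrow> g w \<noteq> 0"
      have "g holomorphic_on ball 0 (min \<rho> r)" using *(4) by (rule holomorphic_on_subset) auto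
      then show ?thesis using * assms(2) by (intro that[of "min \<rho> r" g n]) auto
    qed (use assms in auto)
  next
    case False
    obtain e where e: "e > 0" "\<And>y. y \<in> ball 0 r \<Longrightarrow> dist 0 y < e \<Longrightarrow> f y \<noteq> 0"
      using continuous_on_avoid[OF holomorphic_on_imp_continuous_on[OF assms(1)] _ False] assms(2) by auto
    define \<delta> where "\<delta> = min e r"
    have \<delta>: "\<delta> > 0" "ball 0 \<delta> \<subseteq> ball (0::complex) r" "\<And>x. x \<in> ball 0 \<delta> \<Longrightarrow> f x \<noteq> 0"
      using e assms(2) by (auto simp: \<delta>_def)
    show ?thesis
    proof (rule that[of \<delta> f 0])
      show "f holomorphic_on ball 0 \<delta>" using assms(1) \<delta>(2) by (rule holomorphic_on_subset)
    qed (use \<delta> assms in \<open>auto simp: \<delta>_def\<close>)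
  qed
qed

text \<open>\<open>branch_cover M Y\<close>: after the substitution \<open>x = t ^ M\<close>, the multivalued function \<open>Y\<close> is covered, on a
  punctured disc, by finitely many holomorphic functions on the full disc.\<close>

definition branch_cover :: "nat \<Rightarrow> (complex \<Rightarrow> complex set) \<Rightarrow> bool" where
  "branch_cover M Y \<longleftrightarrow> M > 0 \<and> (\<exists>\<rho>>0. \<exists>\<B>. finite \<B> \<and> (\<forall>B\<in>\<B>. B holomorphic_on ball 0 \<rho>) \<and>
     (\<forall>t y. 0 < norm t \<longrightarrow> norm t < \<rho> \<longrightarrow> y \<in> Y (t ^ M) \<longrightarrow> (\<exists>B\<in>\<B>. y = B t)))"

section \<open>Substitutions and unions of branch covers\<close>

lemma power_less_min_1:
  fixes t :: complex
  assumes "norm t < \<rho>" "\<rho> \<le> 1" "k > 0"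
  shows "norm (t ^ k) < \<rho>"
proof -
  have "norm t ^ k \<le> norm t ^ 1" using assms by (intro power_decreasing) auto
  then show ?thesis using assms(1) by (simp add: norm_power)
qed

text \<open>A radius of at most 1 makes the disc invariant under \<open>t ^ k\<close>, which the
  substitutions below rely on.\<close>

lemma branch_coverE:
  assumes "branch_cover M Y"
  obtains \<rho> \<B> where "0 < \<rho>" "\<rho> \<le> 1" "finite \<B>" "\<And>B. B \<in> \<B> \<Longrightarrow> B holomorphic_on ball 0 \<rho>" "M > 0"
     "\<And>t y. 0 < norm t \<Longrightarrow> norm t < \<rho> \<Longrightarrow> y \<in> Y (t ^ M) \<Longrightarrow> \<exists>B\<in>\<B>. y = B t"
proof -
  from assms obtain \<rho> \<B> where *: "0 < \<rho>" "finite \<B>" "\<And>B. B \<in> \<B> \<Longrightarrow> B holomorphic_on ball 0 \<rho>" "M > 0"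
     "\<And>t y. 0 < norm t \<Longrightarrow> norm t < \<rho> \<Longrightarrow> y \<in> Y (t ^ M) \<Longrightarrow> \<exists>B\<in>\<B>. y = B t"
    unfolding branch_cover_def by metis
  show ?thesis
  proof (rule that[of "min \<rho> 1" \<B>])
    show "B holomorphic_on ball 0 (min \<rho> 1)" if "B \<in> \<B>" for B
      using *(3)[OF that] by (rule holomorphic_on_subset) auto
  qed (use * in auto)
qed

lemma branch_cover_mult:
  assumes "branch_cover M Y" "k > 0"
  shows "branch_cover (M * k) Y"
proof -
  from assms(1) obtain \<rho> \<B> where *: "0 < \<rho>" "\<rho> \<le> 1" "finite \<B>" "\<And>B. B \<in> \<B> \<Longrightarrow> B holomorphic_on ball 0 \<rho>" "M > 0"
     "\<And>t y. 0 < norm t \<Longrightarrow> norm t < \<rho> \<Longrightarrow> y \<in> Y (t ^ M) \<Longrightarrow> \<exists>B\<in>\<B>. y = B t" by (rule branch_coverE) blast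
  have pw: "norm (t ^ k) < \<rho>" if "norm t < \<rho>" for t :: complex
    using power_less_min_1[OF that *(2) assms(2)] .
  show ?thesis unfolding branch_cover_def
  proof (intro conjI exI[of _ \<rho>] exI[of _ "(\<lambda>B t. B (t ^ k)) ` \<B>"] ballI allI impI)
    fix B assume "B \<in> (\<lambda>B t. B (t ^ k)) ` \<B>"
    then obtain B' where B': "B' \<in> \<B>" "B = (\<lambda>t. B' (t ^ k))" by auto
    have "(B' \<circ> (\<lambda>t. t ^ k)) holomorphic_on ball 0 \<rho>"
      by (rule holomorphic_on_compose_gen[OF _ *(4)[OF B'(1)]]) (use pw in \<open>auto intro!: holomorphic_intros\<close>)
    then show "B holomorphic_on ball 0 \<rho>" by (simp add: B' o_def)
  next
    fix t y assume t: "0 < norm (t::complex)" "norm t < \<rho>" "y \<in> Y (t ^ (M * k))"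
    then show "\<exists>B\<in>(\<lambda>B t. B (t ^ k)) ` \<B>. y = B t"
      using *(6)[of "t ^ k" y] pw[of t] by (auto simp: power_mult[symmetric] mult.commute)
  qed (use * assms in auto)
qed

lemma branch_cover_common:
  assumes "finite I" "\<And>i. i \<in> I \<Longrightarrow> \<exists>M. branch_cover M (Y i)"
  shows "\<exists>M>0. \<forall>i\<in>I. branch_cover M (Y i)"
  using assms
proof (induction I rule: finite_induct)
  case (insert j I)
  then obtain M where M: "M > 0" "\<And>i. i \<in> I \<Longrightarrow> branch_cover M (Y i)" by auto
  obtain M' where M': "branch_cover M' (Y j)" using insert by auto
  then have "M' > 0" by (simp add: branch_cover_def)
  have "\<forall>i\<in>insert j I. branch_cover (M * M') (Y i)"
    using branch_cover_mult[OF M(2) \<open>M' > 0\<close>] branch_cover_mult[OF M' \<open>M > 0\<close>] by (auto simp: mult.commute)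
  then show ?case using M \<open>M' > 0\<close> by (intro exI[of _ "M * M'"]) auto
qed auto

lemma branch_cover_UN:
  assumes "finite I" "\<And>i. i \<in> I \<Longrightarrow> branch_cover M (Y i)" "M > 0" "\<delta> > 0"
    and sub: "\<And>t. 0 < norm t \<Longrightarrow> norm t < \<delta> \<Longrightarrow> Z t \<subseteq> (\<Union>i\<in>I. Y i t)"
  shows "branch_cover M Z"
  using assms(1,2,4) sub
proof (induction I arbitrary: Z rule: finite_induct)
  case empty
  show ?case unfolding branch_cover_def
  proof (intro conjI exI[of _ "min \<delta> 1"] exI[of _ "{}"] allI impI ballI)
    fix t y assume t: "0 < norm (t::complex)" "norm t < min \<delta> 1" "y \<in> Z (t ^ M)"
    have "norm (t ^ M) < min \<delta> 1" using t \<open>M > 0\<close> by (intro power_less_min_1) auto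
    then show "\<exists>B\<in>{}. y = B t" using empty(3)[of "t ^ M"] t \<open>\<delta> > 0\<close> by auto
  qed (use assms in auto)
next
  case (insert j I)
  define Z' where "Z' t = Z t - Y j t" for t
  have "branch_cover M Z'"
    by (rule insert.IH[OF _ \<open>\<delta> > 0\<close>]) (use insert in \<open>force simp: Z'_def\<close>)+
  then obtain \<rho> \<B> where *: "0 < \<rho>" "\<rho> \<le> 1" "finite \<B>" "\<And>B. B \<in> \<B> \<Longrightarrow> B holomorphic_on ball 0 \<rho>" "M > 0"
     "\<And>t y. 0 < norm t \<Longrightarrow> norm t < \<rho> \<Longrightarrow> y \<in> Z' (t ^ M) \<Longrightarrow> \<exists>B\<in>\<B>. y = B t" by (rule branch_coverE) blast
  obtain \<rho>' \<B>' where **: "0 < \<rho>'" "\<rho>' \<le> 1" "finite \<B>'" "\<And>B. B \<in> \<B>' \<Longrightarrow> B holomorphic_on ball 0 \<rho>'" "M > 0"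
     "\<And>t y. 0 < norm t \<Longrightarrow> norm t < \<rho>' \<Longrightarrow> y \<in> Y j (t ^ M) \<Longrightarrow> \<exists>B\<in>\<B>'. y = B t"
     by (rule branch_coverE[OF insert(4)[OF insertI1]]) blast
  show ?case unfolding branch_cover_def
  proof (intro conjI exI[of _ "min \<rho> \<rho>'"] exI[of _ "\<B> \<union> \<B>'"] allI impI ballI)
    fix B assume "B \<in> \<B> \<union> \<B>'"
    then show "B holomorphic_on ball 0 (min \<rho> \<rho>')" using *(4)[of B] **(4)[of B]
      by (auto elim!: holomorphic_on_subset)
  next
    fix t y assume t: "0 < norm (t::complex)" "norm t < min \<rho> \<rho>'" "y \<in> Z (t ^ M)"
    then show "\<exists>B\<in>\<B> \<union> \<B>'. y = B t" using *(6)[of t y] **(6)[of t y] by (auto simp: Z'_def)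
  qed (use * ** in auto)
qed

text \<open>An affine change of the unknown made after \<open>x = t ^ D\<close>; the two
  ramification exponents multiply. It serves the Tschirnhaus shift, the shift to a root and the
  scaling given by the Newton polygon.\<close>

lemma branch_cover_subst:
  assumes "branch_cover M Y" "\<delta> > 0" "c holomorphic_on ball 0 \<delta>" "e holomorphic_on ball 0 \<delta>" "D > 0"
    and sub: "\<And>t. 0 < norm t \<Longrightarrow> norm t < \<delta> \<Longrightarrow> Z (t ^ D) \<subseteq> (\<lambda>y. c t + e t * y) ` Y t"
  shows "branch_cover (D * M) Z"
proof -
  from assms(1) obtain \<rho> \<B> where *: "0 < \<rho>" "\<rho> \<le> 1" "finite \<B>" "\<And>B. B \<in> \<B> \<Longrightarrow> B holomorphic_on ball 0 \<rho>" "M > 0"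
     "\<And>t y. 0 < norm t \<Longrightarrow> norm t < \<rho> \<Longrightarrow> y \<in> Y (t ^ M) \<Longrightarrow> \<exists>B\<in>\<B>. y = B t" by (rule branch_coverE) blast
  define \<rho>' where "\<rho>' = min \<rho> \<delta>"
  have pw: "norm (t ^ M) < \<rho>'" if "norm t < \<rho>'" for t :: complex
    using power_less_min_1[OF that _ \<open>M > 0\<close>] * by (auto simp: \<rho>'_def)
  show ?thesis unfolding branch_cover_def
  proof (intro conjI exI[of _ \<rho>'] exI[of _ "(\<lambda>B t. c (t ^ M) + e (t ^ M) * B t) ` \<B>"] ballI allI impI)
    fix B assume "B \<in> (\<lambda>B t. c (t ^ M) + e (t ^ M) * B t) ` \<B>"
    then obtain B' where B': "B' \<in> \<B>" "B = (\<lambda>t. c (t ^ M) + e (t ^ M) * B' t)" by auto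
    have "(c \<circ> (\<lambda>t. t ^ M)) holomorphic_on ball 0 \<rho>'"
      by (rule holomorphic_on_compose_gen[OF _ assms(3)]) (use pw in \<open>force simp: \<rho>'_def intro!: holomorphic_intros\<close>)+
    moreover have "(e \<circ> (\<lambda>t. t ^ M)) holomorphic_on ball 0 \<rho>'"
      by (rule holomorphic_on_compose_gen[OF _ assms(4)]) (use pw in \<open>force simp: \<rho>'_def intro!: holomorphic_intros\<close>)+
    moreover have "B' holomorphic_on ball 0 \<rho>'"
      by (rule holomorphic_on_subset[OF *(4)[OF B'(1)]]) (auto simp: \<rho>'_def)
    ultimately show "B holomorphic_on ball 0 \<rho>'" unfolding B' by (auto simp: o_def intro!: holomorphic_intros)
  next
    fix t y assume t: "0 < norm (t::complex)" "norm t < \<rho>'" "y \<in> Z (t ^ (D * M))"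
    then have "y \<in> Z ((t ^ M) ^ D)" by (simp add: power_mult[symmetric] mult.commute)
    then obtain y' where y': "y = c (t ^ M) + e (t ^ M) * y'" "y' \<in> Y (t ^ M)"
      using sub[of "t ^ M"] t pw[of t] by (auto simp: \<rho>'_def)
    then show "\<exists>B\<in>(\<lambda>B t. c (t ^ M) + e (t ^ M) * B t) ` \<B>. y = B t"
      using *(6)[of t y'] t by (auto simp: \<rho>'_def)
  qed (use * assms in \<open>auto simp: \<rho>'_def\<close>)
qed

lemma poly_root_bound:
  fixes p :: "complex poly"
  assumes "lead_coeff p = 1" "poly p y = 0"
  shows "norm y \<le> 1 + (\<Sum>k<degree p. norm (coeff p k))"
proof (rule ccontr)
  define d where "d = degree p"
  define s where "s = (\<Sum>k<d. norm (coeff p k))"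
  assume "\<not> ?thesis"
  then have y: "norm y > 1 + s" by (simp add: s_def d_def)
  have "s \<ge> 0" by (simp add: s_def sum_nonneg)
  have "d \<noteq> 0"
  proof
    assume "d = 0"
    then obtain c where "p = [:c:]" unfolding d_def by (rule degree_eq_zeroE)
    then show False using assms by auto
  qed
  have "poly p y = (\<Sum>k<d. coeff p k * y ^ k) + y ^ d"
    using assms(1) by (simp add: poly_altdef d_def lessThan_Suc_atMost[symmetric])
  then have "norm (y ^ d) = norm (\<Sum>k<d. coeff p k * y ^ k)"
    using assms(2) by (metis add_eq_0_iff norm_minus_cancel)
  also have "\<dots> \<le> (\<Sum>k<d. norm (coeff p k) * norm y ^ (d - 1))"
    using y \<open>s \<ge> 0\<close> by (intro sum_norm_le) (auto simp: norm_mult norm_power intro!: mult_left_mono power_increasing)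
  also have "\<dots> = s * norm y ^ (d - 1)" by (simp add: s_def sum_distrib_right)
  also have "\<dots> < norm y * norm y ^ (d - 1)" using y \<open>s \<ge> 0\<close> by (intro mult_strict_right_mono zero_less_power) linarith+
  also have "\<dots> = norm (y ^ d)" using \<open>d \<noteq> 0\<close> by (cases d) (simp_all add: norm_power norm_mult)
  finally show False by simp
qed

text \<open>A root of multiplicity \<open>d\<close> would make \<open>p\<close> a constant multiple
  of \<open>[:- b, 1:] ^ d\<close>; the missing term of degree \<open>d - 1\<close> then forces
  \<open>b = 0\<close>, and no lower coefficient could be nonzero. This is what makes the degree
  drop in Puiseux's induction.\<close>

lemma order_less_degree:
  fixes p :: "complex poly"
  assumes "degree p = d" "d > 0" "coeff p (d - 1) = 0" "k < d" "coeff p k \<noteq> 0"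
  shows "order b p < d"
proof -
  have "p \<noteq> 0" using assms by auto
  have "order b p \<noteq> d"
  proof
    assume o: "order b p = d"
    from order_decomp[OF \<open>p \<noteq> 0\<close>, of b] obtain q where q: "p = [:- b, 1:] ^ d * q" "\<not> [:- b, 1:] dvd q"
      unfolding o by blast
    have "q \<noteq> 0" using q \<open>p \<noteq> 0\<close> by auto
    then have "degree p = d + degree q" using q by (simp add: degree_mult_eq degree_power_eq)
    then obtain c where c: "q = [:c:]" using assms(1) by (metis add_cancel_right_right degree_eq_zeroE)
    then have p: "p = smult c ([:- b, 1:] ^ d)" using q by simp
    have "c \<noteq> 0" using c \<open>q \<noteq> 0\<close> by auto
    have "coeff p (d - 1) = c * (of_nat d * - b)"
      using \<open>d > 0\<close> coeff_linear_poly_power[of "d - 1" d "- b" 1] binomial_symmetric[of 1 d] unfolding p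
      by simp
    then have "b = 0" using assms(2,3) \<open>c \<noteq> 0\<close> by auto
    then have "p = smult c (monom 1 d)" unfolding p by (simp add: monom_altdef)
    then show False using assms(4,5) by simp
  qed
  then show ?thesis using order_degree[OF \<open>p \<noteq> 0\<close>, of b] assms(1) by simp
qed

text \<open>When \<epsilon> isolates the root \<open>b\<close>, the only zero in the small disc is
  0, and its order is the multiplicity of \<open>b\<close>.\<close>

lemma norm_poly_degree_order:
  fixes p :: "complex poly"
  assumes "p \<noteq> 0" "\<epsilon> > 0" "poly p b = 0" "\<And>y. poly p y = 0 \<Longrightarrow> norm (y - b) \<le> \<epsilon> \<Longrightarrow> y = b"
  shows "degree (norm_poly \<epsilon> (\<lambda>\<zeta>. poly p (b + \<zeta>)) G) = order b p"
proof -
  have "zeros_in \<epsilon> (\<lambda>\<zeta>. poly p (b + \<zeta>)) = {0}"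
    using assms by (auto simp: zeros_in_def dest: assms(4)[of "b + _"])
  moreover have "zorder (\<lambda>\<zeta>. poly p (b + \<zeta>)) 0 = int (order b p)"
  proof -
    obtain q where q: "p = [:- b, 1:] ^ order b p * q" "\<not> [:- b, 1:] dvd q" using order_decomp[OF assms(1)] by blast
    show ?thesis
    proof (rule zorder_eqI[of UNIV])
      show "(\<lambda>\<zeta>. poly q (b + \<zeta>)) holomorphic_on UNIV" by (intro holomorphic_intros)
      show "poly q (b + 0) \<noteq> 0" using q(2) by (simp add: poly_eq_0_iff_dvd)
      show "poly p (b + w) = poly q (b + w) * (w - 0) powi int (order b p)" for w
        by (subst q(1)) (simp add: poly_mult poly_power)
    qed auto
  qed
  ultimately show ?thesis by (simp add: norm_poly_degree)
qed

section \<open>Monic polynomials with holomorphic coefficients\<close>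

definition monic_family :: "nat \<Rightarrow> real \<Rightarrow> (complex \<Rightarrow> complex poly) \<Rightarrow> bool" where
  "monic_family d r P \<longleftrightarrow> r > 0 \<and> (\<forall>k. (\<lambda>x. coeff (P x) k) holomorphic_on ball 0 r) \<and>
     (\<forall>x\<in>ball 0 r. degree (P x) = d \<and> coeff (P x) d = 1)"

lemma monic_familyD:
  assumes "monic_family d r P"
  shows "r > 0" "(\<lambda>x. coeff (P x) k) holomorphic_on ball 0 r"
    "x \<in> ball 0 r \<Longrightarrow> degree (P x) = d" "x \<in> ball 0 r \<Longrightarrow> coeff (P x) d = 1" "P 0 \<noteq> 0"
proof -
  show "r > 0" "(\<lambda>x. coeff (P x) k) holomorphic_on ball 0 r"
    "x \<in> ball 0 r \<Longrightarrow> degree (P x) = d" "x \<in> ball 0 r \<Longrightarrow> coeff (P x) d = 1"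
    using assms by (auto simp: monic_family_def)
  have "coeff (P 0) d = 1" using assms by (simp add: monic_family_def)
  then show "P 0 \<noteq> 0" by auto
qed

lemma monic_family_mono:
  assumes "monic_family d r P" "0 < r'" "r' \<le> r"
  shows "monic_family d r' P"
proof -
  have "ball 0 r' \<subseteq> ball (0::complex) r" using assms(3) by auto
  then show ?thesis using assms unfolding monic_family_def by (meson holomorphic_on_subset subsetD)
qed

lemma monic_familyI:
  assumes "r > 0" "\<And>k. k < d \<Longrightarrow> a k holomorphic_on ball 0 r"
  shows "monic_family d r (\<lambda>x. monom 1 d + (\<Sum>k<d. monom (a k x) k))"
proof -
  have co: "coeff (monom 1 d + (\<Sum>k<d. monom (a k x) k)) j = (if j = d then 1 else if j < d then a j x else 0)" for x j
    by (simp add: coeff_sum)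
  have "degree (monom 1 d + (\<Sum>k<d. monom (a k x) k)) = d" for x
    by (intro antisym degree_le le_degree) (simp_all add: co del: coeff_add)
  moreover have "(\<lambda>x. if j = d then 1 else if j < d then a j x else 0) holomorphic_on ball 0 r" for j
    using assms(2)[of j] by (cases "j = d"; cases "j < d") auto
  ultimately show ?thesis unfolding monic_family_def using assms(1) by (auto simp: co simp del: coeff_add)
qed

lemma monic_family_poly_eq:
  assumes "monic_family d r P" "x \<in> ball 0 r"
  shows "poly (P x) y = (\<Sum>k\<le>d. coeff (P x) k * y ^ k)"
  unfolding poly_altdef monic_familyD(3)[OF assms] ..

lemma monic_family_continuous:
  assumes "monic_family d r P"
  shows "continuous_on (ball 0 r \<times> A) (\<lambda>(x,y). poly (P x) (b + y))"
proof -
  have "continuous_on (ball 0 r \<times> A) (\<lambda>p. \<Sum>k\<le>d. coeff (P (fst p)) k * (b + snd p) ^ k)"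
  proof (intro continuous_intros)
    fix k
    have "continuous_on (ball 0 r) (\<lambda>x. coeff (P x) k)"
      using assms by (auto simp: monic_family_def intro: holomorphic_on_imp_continuous_on)
    then show "continuous_on (ball 0 r \<times> A) (\<lambda>p. coeff (P (fst p)) k)"
      by (rule continuous_on_compose2) (auto intro!: continuous_intros)
  qed
  then show ?thesis
    by (rule continuous_on_eq) (auto simp: monic_family_poly_eq[OF assms])
qed

lemma coeff_pcompose_shift:
  fixes p :: "complex poly"
  assumes "degree p = d"
  shows "coeff (pcompose p [:c, 1:]) k = (\<Sum>i\<le>d. coeff p i * (if k \<le> i then of_nat (i choose k) * c ^ (i - k) else 0))"
proof -
  have "pcompose p [:c, 1:] = (\<Sum>i\<le>d. smult (coeff p i) ([:c, 1:] ^ i))"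
    by (rule poly_ext) (simp add: poly_pcompose poly_sum poly_power poly_altdef[of p] assms)
  moreover have "coeff ([:c, 1:] ^ i) k = (if k \<le> i then of_nat (i choose k) * c ^ (i - k) else 0)" for i
    by (auto simp: coeff_linear_poly_power degree_power_eq intro!: coeff_eq_0)
  ultimately show ?thesis by (simp add: coeff_sum)
qed

lemma monic_family_shift:
  assumes "monic_family d r P" "c holomorphic_on ball 0 r"
  shows "monic_family d r (\<lambda>x. pcompose (P x) [:c x, 1:])"
  unfolding monic_family_def
proof (intro conjI allI ballI)
  show "r > 0" using assms by (simp add: monic_family_def)
  fix x assume x: "x \<in> ball (0::complex) r"
  show d: "degree (pcompose (P x) [:c x, 1:]) = d"
    using monic_familyD(3)[OF assms(1) x] by (simp add: degree_pcompose)
  have "lead_coeff (pcompose (P x) [:c x, 1:]) = 1"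
    using monic_familyD(3,4)[OF assms(1) x] by (subst lead_coeff_comp) simp_all
  then show "coeff (pcompose (P x) [:c x, 1:]) d = 1" unfolding d .
next
  fix k
  have "(\<lambda>x. \<Sum>i\<le>d. coeff (P x) i * (if k \<le> i then of_nat (i choose k) * c x ^ (i - k) else 0)) holomorphic_on ball 0 r"
  proof (intro holomorphic_intros)
    fix i
    show "(\<lambda>x. coeff (P x) i) holomorphic_on ball 0 r" using assms(1) by (simp add: monic_family_def)
    show "(\<lambda>x. if k \<le> i then of_nat (i choose k) * c x ^ (i - k) else 0) holomorphic_on ball 0 r"
      by (cases "k \<le> i") (auto intro!: holomorphic_intros assms(2))
  qed
  moreover have "coeff (pcompose (P x) [:c x, 1:]) k = (\<Sum>i\<le>d. coeff (P x) i * (if k \<le> i then of_nat (i choose k) * c x ^ (i - k) else 0))"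
    if "x \<in> ball 0 r" for x
    by (rule coeff_pcompose_shift) (use assms(1) that in \<open>simp add: monic_family_def\<close>)
  ultimately show "(\<lambda>x. coeff (pcompose (P x) [:c x, 1:]) k) holomorphic_on ball 0 r"
    by (subst holomorphic_cong[OF refl]) auto
qed

lemma monic_family_tschirnhaus:
  assumes "monic_family d r P" "d > 0"
  obtains c where "c holomorphic_on ball 0 r" "monic_family d r (\<lambda>x. pcompose (P x) [:c x, 1:])"
    "\<And>x. x \<in> ball 0 r \<Longrightarrow> coeff (pcompose (P x) [:c x, 1:]) (d - 1) = 0"
proof
  \<comment> \<open>The shift by \<open>c x\<close> adds \<open>d * c x\<close> to the coefficient
    of degree \<open>d - 1\<close>.\<close>
  define c where "c x = - coeff (P x) (d - 1) / of_nat d" for x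
  show c: "c holomorphic_on ball 0 r" unfolding c_def
    using assms by (intro holomorphic_intros) (auto simp: monic_family_def)
  show "monic_family d r (\<lambda>x. pcompose (P x) [:c x, 1:])" by (rule monic_family_shift[OF assms(1) c])
  fix x assume x: "x \<in> ball (0::complex) r"
  have P: "degree (P x) = d" "coeff (P x) d = 1" using assms(1) x by (auto simp: monic_family_def)
  obtain d' where d': "d = Suc d'" using assms(2) by (cases d) auto
  have "(\<Sum>i\<le>d. coeff (P x) i * (if d' \<le> i then of_nat (i choose d') * c x ^ (i - d') else 0))
     = (\<Sum>i\<in>{d', Suc d'}. coeff (P x) i * (if d' \<le> i then of_nat (i choose d') * c x ^ (i - d') else 0))"
    by (rule sum.mono_neutral_right) (auto simp: d')
  also have "\<dots> = coeff (P x) d' + of_nat d * c x" using P by (simp add: d')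
  also have "\<dots> = 0" by (simp add: c_def d' del: of_nat_Suc)
  finally show "coeff (pcompose (P x) [:c x, 1:]) (d - 1) = 0"
    using coeff_pcompose_shift[OF P(1), of "c x" d'] by (simp add: d')
qed

text \<open>The local factor at a root \<open>b\<close> of \<open>P 0\<close> is the norm polynomial
  of the identity over the zeros near \<open>b\<close>. Its degree is constant in \<open>x\<close>,
  hence equal to the multiplicity of \<open>b\<close> at \<open>x = 0\<close>. This takes the place
  of a factorization by Hensel's lemma; only the inclusion of zeros is recorded.\<close>

lemma monic_family_local_factor:
  assumes "monic_family d r P" "\<epsilon> > 0" "poly (P 0) b = 0" "\<And>y. poly (P 0) y = 0 \<Longrightarrow> norm (y - b) \<le> \<epsilon> \<Longrightarrow> y = b"
  obtains \<delta> Q where "\<delta> \<le> r" "monic_family (order b (P 0)) \<delta> Q"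
    "\<And>x y. x \<in> ball 0 \<delta> \<Longrightarrow> poly (P x) y = 0 \<Longrightarrow> norm (y - b) < \<epsilon> \<Longrightarrow> poly (Q x) (y - b) = 0"
proof -
  have r: "r > 0" using assms(1) by (simp add: monic_family_def)
  have nz: "poly (P 0) (b + \<zeta>) \<noteq> 0" if "\<zeta> \<in> sphere 0 \<epsilon>" for \<zeta>
    using assms(4)[of "b + \<zeta>"] that assms(2) by auto
  obtain \<delta> where \<delta>: "\<delta> > 0" "ball 0 \<delta> \<subseteq> ball (0::complex) r"
     "\<And>x \<zeta>. x \<in> ball 0 \<delta> \<Longrightarrow> \<zeta> \<in> sphere 0 \<epsilon> \<Longrightarrow> poly (P x) (b + \<zeta>) \<noteq> 0"
    using nonzero_near_compact[OF monic_family_continuous[OF assms(1)] compact_sphere open_ball _ nz] r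
    by (metis centre_in_ball)
  have \<delta>r: "\<delta> \<le> r" using \<delta>(1,2) r by (simp add: ball_subset_ball_iff)
  have mf: "monic_family d \<delta> P" using monic_family_mono[OF assms(1) \<delta>(1) \<delta>r] .
  interpret norm_family "ball (0::complex) \<delta>" \<epsilon> "2 * \<epsilon>" "\<lambda>x \<zeta>. poly (P x) (b + \<zeta>)" "\<lambda>x \<zeta>. \<zeta>" "2 * \<epsilon>"
  proof
    show "continuous_on (ball 0 \<delta> \<times> ball 0 (2 * \<epsilon>)) (\<lambda>(x, \<zeta>). poly (P x) (b + \<zeta>))"
      by (rule monic_family_continuous[OF mf])
  qed (use \<delta>(3) assms(2) in \<open>auto intro!: holomorphic_intros continuous_intros simp: case_prod_unfold\<close>)
  define Q where "Q x = norm_poly \<epsilon> (\<lambda>\<zeta>. poly (P x) (b + \<zeta>)) (\<lambda>\<zeta>. \<zeta>)" for x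
  note P0 = monic_familyD(5)[OF assms(1)]
  have deg: "degree (Q x) = order b (P 0)" if "x \<in> ball 0 \<delta>" for x
    using degree_const[OF connected_ball that, of 0] \<delta>(1) norm_poly_degree_order[OF P0 assms(2-4)]
    by (simp add: Q_def)
  have "coeff (Q x) (order b (P 0)) = 1" if "x \<in> ball 0 \<delta>" for x
    using norm_poly_degree(2)[of \<epsilon> "\<lambda>\<zeta>. poly (P x) (b + \<zeta>)" "\<lambda>\<zeta>. \<zeta>", folded Q_def] unfolding deg[OF that] .
  moreover have "(\<lambda>x. coeff (Q x) k) holomorphic_on ball 0 \<delta>" for k
    unfolding Q_def
  proof (rule coeff_holomorphic[where f = "\<lambda>x. x"])
    fix \<zeta>
    have "(\<lambda>x. \<Sum>k\<le>d. coeff (P x) k * (b + \<zeta>) ^ k) holomorphic_on ball 0 \<delta>"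
      using mf by (intro holomorphic_intros) (auto simp: monic_family_def)
    then show "(\<lambda>x. poly (P x) (b + \<zeta>)) holomorphic_on ball 0 \<delta>"
      by (subst holomorphic_cong[OF refl]) (auto simp: monic_family_poly_eq[OF mf])
  qed auto
  ultimately have "monic_family (order b (P 0)) \<delta> Q"
    using \<delta>(1) deg by (simp add: monic_family_def)
  moreover have "poly (Q x) (y - b) = 0" if x: "x \<in> ball 0 \<delta>" and y: "poly (P x) y = 0" "norm (y - b) < \<epsilon>" for x y
    unfolding Q_def
    using norm_poly_zero_iff[OF eps q_hol[OF x] q_nz[OF x], of "\<lambda>\<zeta>. \<zeta>" "y - b"] y by auto
  ultimately show ?thesis using that \<delta>r by blast
qed

text \<open>Puiseux's theorem, by induction on the degree: after a Tschirnhaus transformation and the rescaling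
  given by the smallest slope of the Newton polygon, the polynomial at \<open>0\<close> has two distinct
  roots, so that the local factors have smaller degree.\<close>

theorem puiseux:
  assumes "monic_family d r P"
  shows "\<exists>M. branch_cover M (\<lambda>x. {y. poly (P x) y = 0})"
  using assms
proof (induction d arbitrary: r P rule: less_induct)
  case (less d)
  have r: "r > 0" using less.prems by (simp add: monic_family_def)
  show ?case
  proof (cases "d = 0")
    case True
    have "poly (P x) y \<noteq> 0" if "x \<in> ball 0 r" for x y
      using monic_family_poly_eq[OF less.prems that, of y] monic_familyD(4)[OF less.prems that] True by simp
    then have "\<And>t. norm t < r \<Longrightarrow> {y. poly (P t) y = 0} \<subseteq> {}" by simp
    then have "branch_cover 1 (\<lambda>x. {y. poly (P x) y = 0})"
      unfolding branch_cover_def using r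
      by (intro conjI exI[of _ r] exI[of _ "{}"] allI impI) simp_all
    then show ?thesis by blast
  next
    case False
    then have d: "d > 0" by simp
    obtain c where c: "c holomorphic_on ball 0 r" "monic_family d r (\<lambda>x. pcompose (P x) [:c x, 1:])"
      "\<And>x. x \<in> ball 0 r \<Longrightarrow> coeff (pcompose (P x) [:c x, 1:]) (d - 1) = 0"
      by (rule monic_family_tschirnhaus[OF less.prems d]) blast
    define P1 where "P1 x = pcompose (P x) [:c x, 1:]" for x
    have P1: "monic_family d r P1" "\<And>x. x \<in> ball 0 r \<Longrightarrow> coeff (P1 x) (d - 1) = 0"
      using c(2,3) by (simp_all add: P1_def[abs_def])
    have "\<exists>M. branch_cover M (\<lambda>x. {y. poly (P1 x) y = 0})"
    proof -
      have "\<exists>n \<delta> u. 0 < \<delta> \<and> \<delta> \<le> r \<and> u holomorphic_on ball 0 \<delta> \<and> (\<forall>x\<in>ball 0 \<delta>. coeff (P1 x) k = x ^ n * u x) \<and>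
         ((\<forall>x\<in>ball 0 \<delta>. u x \<noteq> 0) \<or> (\<forall>x\<in>ball 0 \<delta>. u x = 0))" for k
      proof -
        have "(\<lambda>x. coeff (P1 x) k) holomorphic_on ball 0 r" using P1(1) by (simp add: monic_family_def)
        then show ?thesis by (rule holomorphic_order_at_0[OF _ r]) blast
      qed
      then obtain n \<delta>0 u where nu: "\<And>k. 0 < \<delta>0 k" "\<And>k. \<delta>0 k \<le> r" "\<And>k. u k holomorphic_on ball 0 (\<delta>0 k)"
        "\<And>k x. x\<in>ball 0 (\<delta>0 k) \<Longrightarrow> coeff (P1 x) k = x ^ n k * u k x"
        "\<And>k. (\<forall>x\<in>ball 0 (\<delta>0 k). u k x \<noteq> 0) \<or> (\<forall>x\<in>ball 0 (\<delta>0 k). u k x = 0)" by metis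
      define \<delta> where "\<delta> = Min (insert 1 (\<delta>0 ` {..d}))"
      have \<delta>: "\<delta> > 0" "\<delta> \<le> 1" using nu(1) by (auto simp: \<delta>_def)
      have \<delta>0: "\<delta> \<le> \<delta>0 k" if "k \<le> d" for k unfolding \<delta>_def by (rule Min_le) (use that in auto)
      have \<delta>r: "\<delta> \<le> r" using \<delta>0[of d] nu(2)[of d] by simp
      \<comment> \<open>The indices of the coefficients that are not identically zero near 0, that
        is, the points of the Newton polygon besides the leading one.\<close>
      define K where "K = {k. k < d \<and> u k 0 \<noteq> 0}"
      have u0: "u k x = 0" if "k < d" "k \<notin> K" "x \<in> ball 0 \<delta>" for k x
        using nu(5)[of k] that \<delta>0[of k] nu(1)[of k] by (auto simp: K_def)
      have P1eq: "poly (P1 x) y = y ^ d + (\<Sum>k<d. x ^ n k * u k x * y ^ k)" if "x \<in> ball 0 \<delta>" for x y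
      proof -
        have x: "x \<in> ball 0 r" "\<And>k. k \<le> d \<Longrightarrow> x \<in> ball 0 (\<delta>0 k)"
          using that \<delta>r \<delta>0 by (auto intro: order_less_le_trans)
        have "poly (P1 x) y = (\<Sum>k<d. coeff (P1 x) k * y ^ k) + coeff (P1 x) d * y ^ d"
          using monic_family_poly_eq[OF P1(1) x(1), of y] by (simp add: lessThan_Suc_atMost[symmetric])
        also have "coeff (P1 x) d = 1" using P1(1) x(1) by (auto simp: monic_family_def)
        also have "(\<Sum>k<d. coeff (P1 x) k * y ^ k) = (\<Sum>k<d. x ^ n k * u k x * y ^ k)"
          using nu(4) x(2) by (intro sum.cong) auto
        finally show ?thesis by simp
      qed
      show ?thesis
      proof (cases "K = {}")
        case True
        have "y = 0" if "x \<in> ball 0 \<delta>" "poly (P1 x) y = 0" for x y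
        proof -
          have "(\<Sum>k<d. x ^ n k * u k x * y ^ k) = 0"
            using u0 True that(1) by (intro sum.neutral) auto
          then show ?thesis using P1eq[OF that(1), of y] that(2) by simp
        qed
        then have "branch_cover 1 (\<lambda>x. {y. poly (P1 x) y = 0})"
          unfolding branch_cover_def using \<delta>(1) by (intro conjI exI[of _ \<delta>] exI[of _ "{\<lambda>_. 0}"]) auto
        then show ?thesis by blast
      next
        case False
        have "finite K" by (simp add: K_def)
        define slope where "slope k = real (n k) / real (d - k)" for k
        obtain k0 where k0: "k0 \<in> K" "\<And>k. k \<in> K \<Longrightarrow> slope k0 \<le> slope k"
          using arg_min_if_finite[OF \<open>finite K\<close> False, of slope] by (metis not_less)
        \<comment> \<open>Substituting \<open>t ^ D\<close> for \<open>x\<close> and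
          \<open>t ^ m * y\<close> for \<open>y\<close> gives the term of index \<open>k\<close> the
          factor \<open>t ^ (n k * D + m * k)\<close>. After division by \<open>t ^ (m * d)\<close>
          the exponent is \<open>n k * D - m * (d - k)\<close>, which is nonnegative by minimality
          of the slope and 0 for \<open>k0\<close>.\<close>
        define D where "D = d - k0"
        define m where "m = n k0"
        have D: "D > 0" using k0 by (auto simp: D_def K_def)
        have slope: "m * (d - k) \<le> n k * D" if "k \<in> K" for k
        proof -
          have "d - k > 0" using that by (auto simp: K_def)
          then have "real m * real (d - k) \<le> real (n k) * real D"
            using k0(2)[OF that] D by (simp add: slope_def m_def D_def field_simps)
          then show ?thesis by (metis of_nat_le_iff of_nat_mult)
        qed
        \<comment> \<open>By \<open>slope\<close> the natural subtraction does not truncate.\<close>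
        define a where "a k t = (if k \<in> K then t ^ (n k * D - m * (d - k)) * u k (t ^ D) else 0)" for k t
        define P2 where "P2 t = monom 1 d + (\<Sum>k<d. monom (a k t) k)" for t
        have pw: "norm (t ^ D) < \<delta>" if "norm t < \<delta>" for t :: complex
          using power_less_min_1[OF that \<delta>(2) D] .
        have P2: "monic_family d \<delta> P2" unfolding P2_def[abs_def]
        proof (rule monic_familyI)
          fix k assume "k < d"
          have "(u k \<circ> (\<lambda>t. t ^ D)) holomorphic_on ball 0 \<delta>"
            by (rule holomorphic_on_compose_gen[OF _ nu(3)]) (use pw \<delta>0[of k] \<open>k < d\<close> in \<open>force intro!: holomorphic_intros\<close>)+
          then show "a k holomorphic_on ball 0 \<delta>"
            unfolding a_def[abs_def] by (cases "k \<in> K") (auto simp: o_def intro!: holomorphic_intros)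
        qed (use \<delta> in auto)
        have coP2: "coeff (P2 t) j = (if j = d then 1 else if j < d then a j t else 0)" for t j
          by (simp add: P2_def coeff_sum)
        have scale: "poly (P1 (t ^ D)) (t ^ m * y) = t ^ (m * d) * poly (P2 t) y" if "norm t < \<delta>" for t y
        proof -
          have "poly (P1 (t ^ D)) (t ^ m * y) = (t ^ m * y) ^ d + (\<Sum>k<d. (t ^ D) ^ n k * u k (t ^ D) * (t ^ m * y) ^ k)"
            using P1eq[of "t ^ D"] pw[OF that] by simp
          also have "(\<Sum>k<d. (t ^ D) ^ n k * u k (t ^ D) * (t ^ m * y) ^ k) = (\<Sum>k<d. t ^ (m * d) * (a k t * y ^ k))"
          proof (rule sum.cong[OF refl])
            fix k assume "k \<in> {..<d}"
            show "(t ^ D) ^ n k * u k (t ^ D) * (t ^ m * y) ^ k = t ^ (m * d) * (a k t * y ^ k)"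
            proof (cases "k \<in> K")
              case True
              have "D * n k + m * k = m * d + (n k * D - m * (d - k))"
                using slope[OF True] \<open>k \<in> {..<d}\<close> by (simp add: algebra_simps diff_mult_distrib2)
              then have "t ^ (D * n k) * t ^ (m * k) = t ^ (m * d) * t ^ (n k * D - m * (d - k))"
                by (metis power_add)
              then have "u k (t ^ D) * y ^ k * (t ^ (D * n k) * t ^ (m * k)) = u k (t ^ D) * y ^ k * (t ^ (m * d) * t ^ (n k * D - m * (d - k)))"
                by simp
              then show ?thesis using True
                by (simp add: a_def power_mult_distrib power_mult[symmetric] mult_ac)
            next
              case False
              then show ?thesis using u0[of k "t ^ D"] pw[OF that] \<open>k \<in> {..<d}\<close> by (simp add: a_def)
            qed
          qed
          also have "(t ^ m * y) ^ d + \<dots> = t ^ (m * d) * (y ^ d + (\<Sum>k<d. a k t * y ^ k))"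
            by (simp add: power_mult_distrib power_mult[symmetric] sum_distrib_left distrib_left)
          also have "y ^ d + (\<Sum>k<d. a k t * y ^ k) = poly (P2 t) y"
            by (simp add: P2_def poly_sum poly_monom)
          finally show ?thesis .
        qed
        \<comment> \<open>The Tschirnhaus shift has removed the coefficient of degree
          \<open>d - 1\<close>, while that of degree \<open>k0\<close> survives at 0; so no root of
          \<open>P2 0\<close> has full multiplicity.\<close>
        have ord: "order b (P2 0) < d" for b
        proof (rule order_less_degree)
          show "degree (P2 0) = d" using P2 \<delta> by (auto simp: monic_family_def)
          have "d - 1 \<notin> K"
          proof
            assume K: "d - 1 \<in> K"
            define x where "x = (of_real (\<delta> / 2) :: complex)"
            have x: "x \<in> ball 0 \<delta>" "x \<noteq> 0" using \<delta> by (auto simp: x_def)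
            have "x \<in> ball 0 (\<delta>0 (d - 1))" "x \<in> ball 0 r" using x \<delta>0[of "d - 1"] \<delta>r by auto
            moreover have "u (d - 1) x \<noteq> 0" using nu(5)[of "d - 1"] K nu(1)[of "d - 1"] calculation by (auto simp: K_def)
            ultimately show False using P1(2)[of x] nu(4)[of x "d - 1"] x(2) by auto
          qed
          then show "coeff (P2 0) (d - 1) = 0" using d by (simp add: coP2 a_def)
          show "k0 < d" using k0 by (simp add: K_def)
          show "coeff (P2 0) k0 \<noteq> 0" using k0(1) D by (simp add: coP2 a_def K_def m_def D_def power_0_left mult.commute)
        qed (rule d)
        define Z where "Z = {b. poly (P2 0) b = 0}"
        note P20 = monic_familyD(5)[OF P2]
        have "finite Z" unfolding Z_def by (rule poly_roots_finite[OF P20])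
        obtain \<epsilon> where \<epsilon>: "\<epsilon> > 0" "\<And>b y. b \<in> Z \<Longrightarrow> poly (P2 0) y = 0 \<Longrightarrow> norm (y - b) \<le> \<epsilon> \<Longrightarrow> y = b"
        proof -
          have "\<exists>e>0. \<forall>y\<in>Z. y \<noteq> b \<longrightarrow> e \<le> dist b y" for b
            using finite_set_avoid[OF \<open>finite Z\<close>, of b] by blast
          then obtain e where e: "\<And>b. e b > 0" "\<And>b y. y \<in> Z \<Longrightarrow> y \<noteq> b \<Longrightarrow> e b \<le> dist b y" by metis
          define \<epsilon> where "\<epsilon> = Min (insert 1 (e ` Z)) / 2"
          have "Min (insert 1 (e ` Z)) > 0" using e(1) \<open>finite Z\<close> by auto
          then have "\<epsilon> > 0" by (simp add: \<epsilon>_def)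
          moreover have "y = b" if "b \<in> Z" "poly (P2 0) y = 0" "norm (y - b) \<le> \<epsilon>" for b y
          proof (rule ccontr)
            assume "y \<noteq> b"
            then have "e b \<le> norm (y - b)" using e(2)[of y b] that(2) by (simp add: Z_def dist_norm norm_minus_commute)
            moreover have "Min (insert 1 (e ` Z)) \<le> e b" by (rule Min_le) (use that(1) \<open>finite Z\<close> in auto)
            ultimately show False using that(3) \<open>\<epsilon> > 0\<close> unfolding \<epsilon>_def by linarith
          qed
          ultimately show thesis using that by blast
        qed
        have "\<exists>\<delta>1 Q. monic_family (order b (P2 0)) \<delta>1 Q \<and>
           (\<forall>x y. x \<in> ball 0 \<delta>1 \<longrightarrow> poly (P2 x) y = 0 \<longrightarrow> norm (y - b) < \<epsilon> \<longrightarrow> poly (Q x) (y - b) = 0)" if "b \<in> Z" for b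
        proof -
          have "poly (P2 0) b = 0" using that by (simp add: Z_def)
          then show ?thesis
            by (rule monic_family_local_factor[OF P2 \<epsilon>(1) _ \<epsilon>(2)[OF that]]) blast+
        qed
        then obtain \<delta>1 Q where Q: "\<And>b. b \<in> Z \<Longrightarrow> monic_family (order b (P2 0)) (\<delta>1 b) (Q b)"
           "\<And>b x y. b \<in> Z \<Longrightarrow> x \<in> ball 0 (\<delta>1 b) \<Longrightarrow> poly (P2 x) y = 0 \<Longrightarrow> norm (y - b) < \<epsilon> \<Longrightarrow> poly (Q b x) (y - b) = 0"
          by metis
        define Y where "Y b x = {y. poly (Q b x) (y - b) = 0}" for b x
        have "\<exists>M. branch_cover M (Y b)" if b: "b \<in> Z" for b
        proof -
          obtain M where "branch_cover M (\<lambda>x. {y. poly (Q b x) y = 0})"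
            using less.IH[OF ord Q(1)[OF b]] by blast
          then have "branch_cover (1 * M) (Y b)"
          proof (rule branch_cover_subst[where \<delta> = 1 and c = "\<lambda>_. b" and e = "\<lambda>_. 1"])
            show "Y b (t ^ 1) \<subseteq> (\<lambda>y. b + 1 * y) ` {y. poly (Q b t) y = 0}" for t
              by (auto simp: Y_def image_iff intro!: exI[of _ "_ - b"])
          qed auto
          then show ?thesis by blast
        qed
        then obtain M where M: "M > 0" "\<And>b. b \<in> Z \<Longrightarrow> branch_cover M (Y b)"
          using branch_cover_common[OF \<open>finite Z\<close>] by metis
        \<comment> \<open>For small \<open>t\<close> all roots stay near \<open>Z\<close>: the
          coefficients bound them uniformly, and on the compact set \<open>A\<close>, the bounding
          disc without the balls around \<open>Z\<close>, the polynomial \<open>P2 0\<close> has no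
          zero.\<close>
        have "\<exists>\<delta>2>0. \<delta>2 \<le> \<delta> \<and> (\<forall>t y. norm t < \<delta>2 \<longrightarrow> poly (P2 t) y = 0 \<longrightarrow> (\<exists>b\<in>Z. norm (y - b) < \<epsilon>))"
        proof -
          have "continuous_on (ball 0 \<delta>) (\<lambda>t. \<Sum>k<d. norm (coeff (P2 t) k))"
            using P2 by (intro continuous_intros holomorphic_on_imp_continuous_on) (auto simp: monic_family_def)
          then have "continuous_on (cball 0 (\<delta> / 2)) (\<lambda>t. \<Sum>k<d. norm (coeff (P2 t) k))"
            by (rule continuous_on_subset) (use \<delta> in auto)
          then have "bounded ((\<lambda>t. \<Sum>k<d. norm (coeff (P2 t) k)) ` cball 0 (\<delta> / 2))"
            by (intro compact_imp_bounded compact_continuous_image) auto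
          then obtain C where "\<forall>t\<in>cball 0 (\<delta> / 2). norm (\<Sum>k<d. norm (coeff (P2 t) k)) \<le> C"
            by (auto simp: bounded_iff)
          then have C: "(\<Sum>k<d. norm (coeff (P2 t) k)) \<le> C" if "t \<in> cball 0 (\<delta> / 2)" for t
            using that by (metis abs_le_D1 real_norm_def)
          define A where "A = cball 0 (1 + C) - (\<Union>b\<in>Z. ball b \<epsilon>)"
          have "compact A" unfolding A_def by (intro compact_diff compact_cball open_UN) auto
          have nzA: "poly (P2 0) (0 + y) \<noteq> 0" if "y \<in> A" for y
            using that \<epsilon>(1) by (auto simp: A_def Z_def)
          obtain \<delta>3 where \<delta>3: "\<delta>3 > 0" "\<And>x y. x \<in> ball 0 \<delta>3 \<Longrightarrow> y \<in> A \<Longrightarrow> poly (P2 x) (0 + y) \<noteq> 0"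
            using nonzero_near_compact[OF monic_family_continuous[OF P2, of A 0] \<open>compact A\<close> open_ball _ nzA] \<delta>
            by (metis centre_in_ball)
          show ?thesis
          proof (intro exI[of _ "min \<delta>3 (\<delta> / 2)"] conjI allI impI)
            fix t y assume t: "norm (t::complex) < min \<delta>3 (\<delta> / 2)" and y: "poly (P2 t) y = 0"
            have "t \<in> ball 0 \<delta>" using t \<delta> by auto
            then have P2t: "degree (P2 t) = d" "coeff (P2 t) d = 1" using monic_familyD[OF P2] by auto
            from poly_root_bound[OF _ y] have "norm y \<le> 1 + C"
              using C[of t] t unfolding P2t by auto
            moreover have "y \<notin> A" using \<delta>3(2)[of t y] t y by auto
            ultimately show "\<exists>b\<in>Z. norm (y - b) < \<epsilon>" by (auto simp: A_def dist_norm norm_minus_commute)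
          qed (use \<delta>3 \<delta> in auto)
        qed
        then obtain \<delta>2 where \<delta>2: "\<delta>2 > 0" "\<delta>2 \<le> \<delta>" "\<And>t y. norm t < \<delta>2 \<Longrightarrow> poly (P2 t) y = 0 \<Longrightarrow> \<exists>b\<in>Z. norm (y - b) < \<epsilon>" by blast
        define \<delta>4 where "\<delta>4 = Min (insert \<delta>2 (\<delta>1 ` Z))"
        have "\<delta>1 b > 0" if "b \<in> Z" for b using Q(1)[OF that] by (simp add: monic_family_def)
        then have \<delta>4: "\<delta>4 > 0" using \<open>finite Z\<close> \<delta>2(1) by (auto simp: \<delta>4_def)
        have \<delta>4': "\<delta>4 \<le> \<delta>2" "\<And>b. b \<in> Z \<Longrightarrow> \<delta>4 \<le> \<delta>1 b"
          unfolding \<delta>4_def by (rule Min_le; use \<open>finite Z\<close> in auto)+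
        have "branch_cover M (\<lambda>x. {y. poly (P2 x) y = 0})"
        proof (rule branch_cover_UN[OF \<open>finite Z\<close> M(2,1) \<delta>4])
          fix t assume t: "0 < norm (t::complex)" "norm t < \<delta>4"
          show "{y. poly (P2 t) y = 0} \<subseteq> (\<Union>i\<in>Z. Y i t)"
          proof safe
            fix y assume y: "poly (P2 t) y = 0"
            then obtain b where b: "b \<in> Z" "norm (y - b) < \<epsilon>" using \<delta>2(3)[of t y] t \<delta>4' by auto
            then have "poly (Q b t) (y - b) = 0" using Q(2)[OF b(1) _ y b(2)] t \<delta>4'(2)[OF b(1)] by auto
            then show "y \<in> (\<Union>i\<in>Z. Y i t)" using b(1) by (auto simp: Y_def)
          qed
        qed
        then have "branch_cover (D * M) (\<lambda>x. {y. poly (P1 x) y = 0})"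
        proof (rule branch_cover_subst[where \<delta> = \<delta> and c = "\<lambda>_. 0" and e = "\<lambda>t. t ^ m"])
          fix t assume t: "0 < norm (t::complex)" "norm t < \<delta>"
          show "{y. poly (P1 (t ^ D)) y = 0} \<subseteq> (\<lambda>y. 0 + t ^ m * y) ` {y. poly (P2 t) y = 0}"
          proof safe
            fix y assume y: "poly (P1 (t ^ D)) y = 0"
            have "t ^ (m * d) * poly (P2 t) (y / t ^ m) = 0"
              using scale[OF t(2), of "y / t ^ m"] t(1) y by simp
            then show "y \<in> (\<lambda>y. 0 + t ^ m * y) ` {y. poly (P2 t) y = 0}"
              using t(1) by (intro image_eqI[of _ _ "y / t ^ m"]) auto
          qed
        qed (use \<delta> D in \<open>auto intro!: holomorphic_intros\<close>)
        then show ?thesis by blast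
      qed
    qed
    then obtain M where M: "branch_cover M (\<lambda>x. {y. poly (P1 x) y = 0})" by blast
    have "branch_cover (1 * M) (\<lambda>x. {y. poly (P x) y = 0})"
    proof (rule branch_cover_subst[OF M r c(1), where e = "\<lambda>_. 1"])
      show "{y. poly (P (t ^ 1)) y = 0} \<subseteq> (\<lambda>y. c t + 1 * y) ` {y. poly (P1 t) y = 0}" for t
        by (auto simp: P1_def poly_pcompose image_iff intro!: exI[of _ "_ - c t"])
    qed auto
    then show ?thesis by blast
  qed
qed

section \<open>Elimination of variables\<close>

definition polydisc :: "real \<Rightarrow> (complex^'k) set" where
  "polydisc \<delta> = {z. \<forall>i. norm (z $ i) < \<delta>}"

definition upd :: "complex^'k \<Rightarrow> 'k \<Rightarrow> complex \<Rightarrow> complex^'k" where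
  "upd z i \<zeta> = (\<chi> j. if j = i then \<zeta> else z $ j)"

lemma upd_nth [simp]: "upd z i \<zeta> $ j = (if j = i then \<zeta> else z $ j)"
  by (simp add: upd_def)

lemma upd_upd [simp]: "upd (upd z i a) i b = upd z i b"
  by (simp add: vec_eq_iff)

lemma upd_commute: "i \<noteq> j \<Longrightarrow> upd (upd z i a) j b = upd (upd z j b) i a"
  by (auto simp: vec_eq_iff)

lemma upd_same [simp]: "upd z i (z $ i) = z"
  by (simp add: vec_eq_iff)

lemma upd_in_polydisc: "z \<in> polydisc \<delta> \<Longrightarrow> norm \<zeta> < \<delta> \<Longrightarrow> upd z i \<zeta> \<in> polydisc \<delta>"
  by (simp add: polydisc_def)

lemma polydisc_mono: "\<delta> \<le> \<delta>' \<Longrightarrow> polydisc \<delta> \<subseteq> polydisc \<delta>'"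
  by (auto simp: polydisc_def intro: less_le_trans)

lemma zero_in_polydisc [simp]: "\<delta> > 0 \<Longrightarrow> 0 \<in> polydisc \<delta>"
  by (simp add: polydisc_def)

lemma open_polydisc: "open (polydisc \<delta> :: (complex^'k) set)"
proof -
  have "open {z :: complex^'k. norm (z $ i) < \<delta>}" for i
    by (intro open_Collect_less continuous_intros)
  then have "open (\<Inter>i\<in>UNIV. {z :: complex^'k. norm (z $ i) < \<delta>})" by (intro open_INT) auto
  also have "(\<Inter>i\<in>UNIV. {z :: complex^'k. norm (z $ i) < \<delta>}) = polydisc \<delta>" by (auto simp: polydisc_def)
  finally show ?thesis .
qed

lemma convex_polydisc: "convex (polydisc \<delta> :: (complex^'k) set)"
proof (rule convexI)
  fix x y :: "complex^'k" and u v :: real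
  assume xy: "x \<in> polydisc \<delta>" "y \<in> polydisc \<delta>" and uv: "0 \<le> u" "0 \<le> v" "u + v = 1"
  show "u *\<^sub>R x + v *\<^sub>R y \<in> polydisc \<delta>" unfolding polydisc_def
  proof safe
    fix i
    have "u *\<^sub>R (x $ i) + v *\<^sub>R (y $ i) \<in> ball 0 \<delta>"
      by (rule convexD[OF convex_ball]) (use xy uv in \<open>auto simp: polydisc_def\<close>)
    then show "norm ((u *\<^sub>R x + v *\<^sub>R y) $ i) < \<delta>" by simp
  qed
qed

lemma polydisc_subset_open:
  fixes U :: "(complex^'k) set"
  assumes "open U" "0 \<in> U"
  obtains \<delta> where "\<delta> > 0" "polydisc \<delta> \<subseteq> U"
proof -
  obtain e where e: "e > 0" "ball 0 e \<subseteq> U" using assms openE by blast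
  define \<delta> where "\<delta> = e / real (CARD('k))"
  have "norm z < e" if "z \<in> polydisc \<delta>" for z :: "complex^'k"
  proof -
    have "norm z \<le> (\<Sum>i\<in>UNIV. norm (z $ i))" unfolding norm_vec_def by (rule L2_set_le_sum) simp
    also have "\<dots> < (\<Sum>i\<in>(UNIV::'k set). \<delta>)" using that by (intro sum_strict_mono) (auto simp: polydisc_def)
    also have "\<dots> = e" by (simp add: \<delta>_def)
    finally show ?thesis .
  qed
  moreover have "\<delta> > 0" using e by (simp add: \<delta>_def)
  ultimately show ?thesis using e that by force
qed

lemma continuous_on_upd: "continuous_on A (\<lambda>p. upd (fst p) i (snd p))"
  unfolding upd_def
proof (rule continuous_on_vec_lambda)
  show "continuous_on A (\<lambda>x. if j = i then snd x else fst x $ j)" for j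
    by (cases "j = i") (auto intro!: continuous_intros)
qed

lemma continuous_on_upd2: "continuous_on A (upd z i)"
proof -
  have "continuous_on A (\<lambda>\<zeta>. upd (fst (z, \<zeta>)) i (snd (z, \<zeta>)))"
    by (rule continuous_on_compose2[OF continuous_on_upd[of UNIV]]) (intro continuous_on_Pair continuous_on_const continuous_on_id, simp)
  then show ?thesis by simp
qed

text \<open>Continuity together with holomorphy in each coordinate is what the norm construction
  reproduces: \<open>coeff_continuous\<close> gives the former and \<open>coeff_holomorphic\<close>,
  applied along coordinate lines, the latter.\<close>

definition sephol :: "real \<Rightarrow> (complex^'k \<Rightarrow> complex) \<Rightarrow> bool" where
  "sephol \<delta> g \<longleftrightarrow> continuous_on (polydisc \<delta>) g \<and>
     (\<forall>z\<in>polydisc \<delta>. \<forall>i. (\<lambda>\<zeta>. g (upd z i \<zeta>)) holomorphic_on ball 0 \<delta>)"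

text \<open>If the row of \<alpha> is not zero, the numbers \<open>k\<close> that annihilate it are
  roots of a nonzero polynomial of degree at most \<open>s\<close>. Nonzero rows alone can therefore
  account for at most \<open>card Z * s\<close> of the \<open>m\<close> numbers. This converts many
  single equations into a simultaneous zero of all components.\<close>

lemma vandermonde_pigeonhole:
  fixes a :: "'b \<Rightarrow> nat \<Rightarrow> complex"
  assumes "finite Z" "card Z * s < m" "\<And>k. k < m \<Longrightarrow> \<exists>\<alpha>\<in>Z. (\<Sum>j<s. of_nat k ^ j * a \<alpha> j) = 0"
  shows "\<exists>\<alpha>\<in>Z. \<forall>j<s. a \<alpha> j = 0"
proof (rule ccontr)
  assume neg: "\<not> ?thesis"
  define R where "R \<alpha> = {k. k < m \<and> (\<Sum>j<s. of_nat k ^ j * a \<alpha> j) = 0}" for \<alpha>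
  have card: "card (R \<alpha>) \<le> s" if "\<alpha> \<in> Z" for \<alpha>
  proof -
    obtain j0 where j0: "j0 < s" "a \<alpha> j0 \<noteq> 0" using neg \<open>\<alpha> \<in> Z\<close> by auto
    define p where "p = (\<Sum>j<s. monom (a \<alpha> j) j)"
    have "coeff p j0 = a \<alpha> j0" using j0 by (simp add: p_def coeff_sum)
    then have "p \<noteq> 0" using j0 by auto
    have "degree p \<le> s" unfolding p_def
      by (intro degree_sum_le) (auto intro: order_trans[OF degree_monom_le])
    have "card (R \<alpha>) = card ((of_nat :: nat \<Rightarrow> complex) ` R \<alpha>)"
      by (rule card_image[symmetric]) (auto simp: inj_on_def)
    also have "\<dots> \<le> card {x. poly p x = 0}"
      by (rule card_mono[OF poly_roots_finite[OF \<open>p \<noteq> 0\<close>]])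
         (auto simp: R_def p_def poly_sum poly_monom mult.commute)
    also have "\<dots> \<le> degree p" by (rule card_poly_roots_bound) fact
    finally show ?thesis using \<open>degree p \<le> s\<close> by simp
  qed
  have "{..<m} \<subseteq> (\<Union>\<alpha>\<in>Z. R \<alpha>)" using assms(3) by (auto simp: R_def)
  then have "card {..<m} \<le> card (\<Union>\<alpha>\<in>Z. R \<alpha>)"
    using assms(1) by (intro card_mono finite_UN_I) (auto simp: R_def)
  also have "\<dots> \<le> (\<Sum>\<alpha>\<in>Z. card (R \<alpha>))" by (rule card_UN_le) fact
  also have "\<dots> \<le> (\<Sum>\<alpha>\<in>Z. s)" by (rule sum_mono) (rule card)
  finally show False using assms(2) by simp
qed

text \<open>A zero at 0 would be isolated, so small circles carry no zeros. The factor 4 leaves room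
  for the disc of radius \<open>2 * \<epsilon>\<close> on which the norm families live.\<close>

lemma nonvanishing_circle:
  assumes "f holomorphic_on ball 0 \<delta>" "\<delta> > 0" "\<And>e. e > 0 \<Longrightarrow> \<exists>\<zeta>. norm \<zeta> < e \<and> f \<zeta> \<noteq> (0::complex)"
  obtains \<epsilon> where "0 < \<epsilon>" "4 * \<epsilon> \<le> \<delta>" "\<And>\<zeta>. \<zeta> \<in> sphere 0 \<epsilon> \<Longrightarrow> f \<zeta> \<noteq> 0"
proof (rule holomorphic_order_at_0[OF assms(1,2)])
  fix n u \<delta>1
  assume *: "0 < \<delta>1" "\<delta>1 \<le> \<delta>" "\<And>x. x \<in> ball 0 \<delta>1 \<Longrightarrow> f x = x ^ n * u x"
    "(\<forall>x\<in>ball 0 \<delta>1. u x \<noteq> 0) \<or> (\<forall>x\<in>ball 0 \<delta>1. u x = 0)"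
  obtain \<zeta> where "norm \<zeta> < \<delta>1" "f \<zeta> \<noteq> 0" using assms(3) *(1) by blast
  then have nz: "u x \<noteq> 0" if "x \<in> ball 0 \<delta>1" for x using *(3)[of \<zeta>] *(4) that by auto
  show ?thesis
  proof (rule that[of "\<delta>1 / 4"])
    fix \<zeta> :: complex assume "\<zeta> \<in> sphere 0 (\<delta>1 / 4)"
    then have "\<zeta> \<in> ball 0 \<delta>1" "\<zeta> \<noteq> 0" using *(1) by auto
    then show "f \<zeta> \<noteq> 0" using *(3) nz by auto
  qed (use * in auto)
qed

text \<open>The \<open>N k\<close> play the part of resultants. Zeros of \<open>g\<close> are zeros
  of \<open>N\<close>, whereas a zero of \<open>N\<close> only has to lift to a zero of
  \<open>g\<close> in the larger polydisc of radius \<open>r\<close>, the coordinates outside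
  \<open>J\<close> being kept. This asymmetry lets \<delta> shrink with every elimination while the
  lifts stay in a fixed polydisc.\<close>

definition eliminates ::
    "nat \<Rightarrow> (nat \<Rightarrow> complex^'k \<Rightarrow> complex) \<Rightarrow> real \<Rightarrow> 'k set \<Rightarrow> real \<Rightarrow> nat \<Rightarrow> (nat \<Rightarrow> complex^'k \<Rightarrow> complex) \<Rightarrow> bool" where
  "eliminates s g r J \<delta> m N \<longleftrightarrow> 0 < \<delta> \<and> \<delta> \<le> r \<and> (\<forall>k<m. sephol \<delta> (N k)) \<and>
     (\<forall>j\<in>J. \<forall>k<m. \<forall>z \<zeta>. N k (upd z j \<zeta>) = N k z) \<and>
     (\<forall>w\<in>polydisc \<delta>. (\<forall>k<s. g k w = 0) \<longrightarrow> (\<forall>k<m. N k w = 0)) \<and>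
     (\<forall>z\<in>polydisc \<delta>. (\<forall>k<m. N k z = 0) \<longrightarrow> (\<exists>w\<in>polydisc r. (\<forall>k<s. g k w = 0) \<and> (\<forall>l. l \<notin> J \<longrightarrow> w $ l = z $ l)))"

text \<open>The combinations of the \<open>g k\<close> with powers of a number \<open>c\<close> as
  weights are normed over the zeros of \<open>g k0\<close> along coordinate \<open>i\<close>. The
  constant coefficient of the norm polynomial vanishes iff the combination and \<open>g k0\<close>
  have a common zero. The last clause ensures that coordinates eliminated earlier do not
  reappear.\<close>

lemma eliminate_coordinate:
  fixes g :: "nat \<Rightarrow> complex^'k \<Rightarrow> complex"
  assumes \<delta>: "\<delta> > 0" and g: "\<forall>k<s. sephol \<delta> (g k)" and k0: "k0 < s"
    and nz: "\<forall>e>0. \<exists>\<zeta>. norm \<zeta> < e \<and> g k0 (upd 0 i \<zeta>) \<noteq> 0"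
  shows "\<exists>\<delta>' m N. eliminates s g \<delta> {i} \<delta>' m N \<and>
     (\<forall>j. (\<forall>k<s. \<forall>z \<zeta>. g k (upd z j \<zeta>) = g k z) \<longrightarrow> (\<forall>k<m. \<forall>z \<zeta>. N k (upd z j \<zeta>) = N k z))"
proof -
  have gc: "continuous_on (polydisc \<delta>) (g k)" if "k < s" for k using g that by (simp add: sephol_def)
  have gh: "(\<lambda>\<zeta>. g k (upd z i \<zeta>)) holomorphic_on ball 0 \<delta>" if "k < s" "z \<in> polydisc \<delta>" for k z i
    using g that by (simp add: sephol_def)
  have "(0 :: complex^'k) \<in> polydisc \<delta>" using \<delta> by simp
  from nonvanishing_circle[OF gh[OF k0 this] \<delta> nz[rule_format]]
  obtain \<epsilon> where \<epsilon>: "0 < \<epsilon>" "4 * \<epsilon> \<le> \<delta>" "\<And>\<zeta>. \<zeta> \<in> sphere 0 \<epsilon> \<Longrightarrow> g k0 (upd 0 i \<zeta>) \<noteq> 0" by blast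
  have gcont: "continuous_on (polydisc \<delta> \<times> ball 0 \<delta>) (\<lambda>(z,\<zeta>). g k (upd z i \<zeta>))" if "k < s" for k
    unfolding case_prod_unfold
    by (rule continuous_on_compose2[OF gc[OF that] continuous_on_upd]) (auto intro: upd_in_polydisc)
  have sph: "sphere 0 \<epsilon> \<subseteq> ball (0::complex) \<delta>" using \<epsilon> by auto
  have "continuous_on (polydisc \<delta> \<times> sphere 0 \<epsilon>) (\<lambda>(z,\<zeta>). g k0 (upd z i \<zeta>))"
    by (rule continuous_on_subset[OF gcont[OF k0]]) (use sph in auto)
  from nonzero_near_compact[OF this compact_sphere open_polydisc _ \<epsilon>(3)]
  obtain \<delta>1 where \<delta>1: "\<delta>1 > 0" "\<And>z \<zeta>. z \<in> ball 0 \<delta>1 \<Longrightarrow> \<zeta> \<in> sphere 0 \<epsilon> \<Longrightarrow> g k0 (upd z i \<zeta>) \<noteq> 0"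
    using \<delta> by (metis zero_in_polydisc)
  obtain \<delta>2 where \<delta>2: "\<delta>2 > 0" "polydisc \<delta>2 \<subseteq> ball (0::complex^'k) \<delta>1"
    by (rule polydisc_subset_open[of "ball (0::complex^'k) \<delta>1"]) (use \<delta>1 in auto)
  define \<delta>' where "\<delta>' = min \<epsilon> \<delta>2"
  have \<delta>': "0 < \<delta>'" "\<delta>' \<le> \<epsilon>" "\<delta>' \<le> \<delta>" using \<epsilon> \<delta>2 by (auto simp: \<delta>'_def)
  have sub: "polydisc \<delta>' \<subseteq> (polydisc \<delta> :: (complex^'k) set)" by (rule polydisc_mono) fact
  have nz': "g k0 (upd z i \<zeta>) \<noteq> 0" if "z \<in> polydisc \<delta>'" "\<zeta> \<in> sphere 0 \<epsilon>" for z \<zeta>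
    using \<delta>1(2)[OF _ that(2)] \<delta>2(2) that(1) polydisc_mono[of \<delta>' \<delta>2] by (auto simp: \<delta>'_def)
  have inpd: "upd z i \<zeta> \<in> polydisc \<delta>" if "z \<in> polydisc \<delta>'" "\<zeta> \<in> ball 0 (2 * \<epsilon>)" for z :: "complex^'k" and \<zeta>
    using that sub \<epsilon> by (intro upd_in_polydisc) auto
  \<comment> \<open>The compact polydisc that supplies the bound on \<open>G c\<close> demanded by
    \<open>norm_family\<close>.\<close>
  define C where "C = {z :: complex^'k. \<forall>i. norm (z $ i) \<le> 2 * \<epsilon>}"
  have "closed C"
  proof -
    have "C = (\<Inter>i\<in>UNIV. {z. norm (z $ i) \<le> 2 * \<epsilon>})" by (auto simp: C_def)
    moreover have "closed {z :: complex^'k. norm (z $ i) \<le> 2 * \<epsilon>}" for i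
      by (intro closed_Collect_le continuous_intros)
    ultimately show ?thesis by (simp add: closed_INT)
  qed
  moreover have "bounded C"
  proof (rule boundedI)
    fix z :: "complex^'k" assume "z \<in> C"
    have "norm z \<le> (\<Sum>i\<in>UNIV. norm (z $ i))" unfolding norm_vec_def by (rule L2_set_le_sum) simp
    also have "\<dots> \<le> (\<Sum>i\<in>(UNIV::'k set). 2 * \<epsilon>)" using \<open>z \<in> C\<close> by (intro sum_mono) (auto simp: C_def)
    finally show "norm z \<le> (\<Sum>i\<in>(UNIV::'k set). 2 * \<epsilon>)" .
  qed
  ultimately have "compact C" by (simp add: compact_eq_bounded_closed)
  have C\<delta>: "C \<subseteq> polydisc \<delta>" unfolding C_def polydisc_def
  proof safe
    fix z :: "complex^'k" and i assume "\<forall>i. norm (z $ i) \<le> 2 * \<epsilon>"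
    then have "norm (z $ i) \<le> 2 * \<epsilon>" by blast
    then show "norm (z $ i) < \<delta>" using \<epsilon> by linarith
  qed
  define G where "G c z = (\<Sum>k<s. of_nat c ^ k * g k z)" for c :: nat and z
  have Gc: "continuous_on (polydisc \<delta>) (G c)" for c
    unfolding G_def[abs_def] using gc by (intro continuous_intros) auto
  have "\<exists>K. \<forall>z\<in>C. norm (G c z) < K" for c
  proof -
    have "bounded (G c ` C)"
      by (intro compact_imp_bounded compact_continuous_image continuous_on_subset[OF Gc C\<delta>] \<open>compact C\<close>)
    then obtain B where "\<And>z. z \<in> C \<Longrightarrow> norm (G c z) \<le> B" by (auto simp: bounded_iff)
    then show ?thesis by (intro exI[of _ "B + 1"]) force
  qed
  then obtain K where K: "\<And>c z. z \<in> C \<Longrightarrow> norm (G c z) < K c" by metis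
  have nf: "norm_family (polydisc \<delta>') \<epsilon> (2 * \<epsilon>) (\<lambda>z \<zeta>. g k0 (upd z i \<zeta>)) (\<lambda>z \<zeta>. G c (upd z i \<zeta>)) (K c)" for c
  proof
    show "continuous_on (polydisc \<delta>' \<times> ball 0 (2 * \<epsilon>)) (\<lambda>(z, \<zeta>). g k0 (upd z i \<zeta>))"
      unfolding case_prod_unfold
      by (rule continuous_on_compose2[OF gc[OF k0] continuous_on_upd]) (auto intro: inpd)
    show "continuous_on (polydisc \<delta>' \<times> ball 0 (2 * \<epsilon>)) (\<lambda>(z, \<zeta>). G c (upd z i \<zeta>))"
      unfolding case_prod_unfold
      by (rule continuous_on_compose2[OF Gc continuous_on_upd]) (auto intro: inpd)
    fix z :: "complex^'k" assume z: "z \<in> polydisc \<delta>'"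
    have b: "ball 0 (2 * \<epsilon>) \<subseteq> ball (0::complex) \<delta>" using \<epsilon> by auto
    show "(\<lambda>\<zeta>. g k0 (upd z i \<zeta>)) holomorphic_on ball 0 (2 * \<epsilon>)"
      using gh[OF k0] z sub b by (meson holomorphic_on_subset subsetD)
    show "(\<lambda>\<zeta>. G c (upd z i \<zeta>)) holomorphic_on ball 0 (2 * \<epsilon>)"
      unfolding G_def using gh z sub b by (intro holomorphic_intros) (meson holomorphic_on_subset subsetD lessThan_iff)
    show "norm (G c (upd z i \<zeta>)) < K c" if "\<zeta> \<in> ball 0 (2 * \<epsilon>)" for \<zeta>
    proof (rule K)
      have "norm (z $ j) \<le> 2 * \<epsilon>" for j
      proof -
        have "norm (z $ j) < \<delta>'" using z by (simp add: polydisc_def)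
        then show ?thesis using \<delta>' \<epsilon> by linarith
      qed
      then show "upd z i \<zeta> \<in> C" using that by (simp add: C_def)
    qed
    show "g k0 (upd z i \<zeta>) \<noteq> 0" if "\<zeta> \<in> sphere 0 \<epsilon>" for \<zeta> using nz'[OF z that] .
  qed (use \<epsilon> in auto)
  define np where "np c z = norm_poly \<epsilon> (\<lambda>\<zeta>. g k0 (upd z i \<zeta>)) (\<lambda>\<zeta>. G c (upd z i \<zeta>))" for c z
  define N where "N c z = coeff (np c z) 0" for c z
  define d where "d = degree (np 0 0)"
  \<comment> \<open>There are at most \<open>d\<close> zeros of \<open>g k0\<close> and
    \<open>s\<close> components, so one combination more than \<open>d * s\<close> forces a zero
    common to all components.\<close>
  define m where "m = d * s + 1"
  have conn: "connected (polydisc \<delta>' :: (complex^'k) set)" by (intro convex_connected convex_polydisc)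
  have N0: "N c z = 0 \<longleftrightarrow> (\<exists>\<alpha>. norm \<alpha> < \<epsilon> \<and> g k0 (upd z i \<alpha>) = 0 \<and> G c (upd z i \<alpha>) = 0)" if "z \<in> polydisc \<delta>'" for c z
  proof -
    interpret norm_family "polydisc \<delta>'" \<epsilon> "2 * \<epsilon>" "\<lambda>z \<zeta>. g k0 (upd z i \<zeta>)" "\<lambda>z \<zeta>. G c (upd z i \<zeta>)" "K c" by (rule nf)
    show ?thesis
      using norm_poly_zero_iff[OF eps q_hol[OF that] q_nz[OF that], of "\<lambda>\<zeta>. G c (upd z i \<zeta>)" 0]
      by (simp add: N_def np_def poly_0_coeff_0)
  qed
  have card: "card (zeros_in \<epsilon> (\<lambda>\<zeta>. g k0 (upd z i \<zeta>))) \<le> d" "finite (zeros_in \<epsilon> (\<lambda>\<zeta>. g k0 (upd z i \<zeta>)))"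
    if z: "z \<in> polydisc \<delta>'" for z
  proof -
    interpret norm_family "polydisc \<delta>'" \<epsilon> "2 * \<epsilon>" "\<lambda>z \<zeta>. g k0 (upd z i \<zeta>)" "\<lambda>z \<zeta>. G 0 (upd z i \<zeta>)" "K 0" by (rule nf)
    note zf = zeros_in_finite[OF eps q_hol[OF z] q_nz[OF z]]
    show "finite (zeros_in \<epsilon> (\<lambda>\<zeta>. g k0 (upd z i \<zeta>)))" by (rule zf(1))
    have "card (zeros_in \<epsilon> (\<lambda>\<zeta>. g k0 (upd z i \<zeta>))) = (\<Sum>\<alpha>\<in>zeros_in \<epsilon> (\<lambda>\<zeta>. g k0 (upd z i \<zeta>)). 1)" by simp
    also have "\<dots> \<le> (\<Sum>\<alpha>\<in>zeros_in \<epsilon> (\<lambda>\<zeta>. g k0 (upd z i \<zeta>)). nat (zorder (\<lambda>\<zeta>. g k0 (upd z i \<zeta>)) \<alpha>))"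
      by (rule sum_mono) (use zf(2) in force)
    also have "\<dots> = degree (np 0 z)" by (simp add: np_def norm_poly_degree)
    also have "\<dots> = d" unfolding d_def np_def by (rule degree_const[OF conn z]) (use \<delta>' in simp)
    finally show "card (zeros_in \<epsilon> (\<lambda>\<zeta>. g k0 (upd z i \<zeta>))) \<le> d" .
  qed
  have sep: "sephol \<delta>' (N k)" for k unfolding sephol_def
  proof (intro conjI ballI allI)
    interpret norm_family "polydisc \<delta>'" \<epsilon> "2 * \<epsilon>" "\<lambda>z \<zeta>. g k0 (upd z i \<zeta>)" "\<lambda>z \<zeta>. G k (upd z i \<zeta>)" "K k" by (rule nf)
    show "continuous_on (polydisc \<delta>') (N k)" unfolding N_def[abs_def] np_def by (rule coeff_continuous[OF conn])
    fix z :: "complex^'k" and j assume z: "z \<in> polydisc \<delta>'"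
    have hg: "(\<lambda>x. g l (upd (upd z j x) i \<zeta>)) holomorphic_on ball 0 \<delta>'" if "l < s" "\<zeta> \<in> ball 0 (2 * \<epsilon>)" for l \<zeta>
    proof (cases "j = i")
      case False
      have "ball 0 \<delta>' \<subseteq> ball (0::complex) \<delta>" using \<delta>' by auto
      with gh[OF that(1) inpd[OF z that(2)], of j] show ?thesis
        unfolding upd_commute[OF False] by (rule holomorphic_on_subset)
    qed simp
    show "(\<lambda>\<zeta>. N k (upd z j \<zeta>)) holomorphic_on ball 0 \<delta>'" unfolding N_def np_def
    proof (rule coeff_holomorphic[OF conn open_ball, of 0 \<delta>' "upd z j"])
      show "continuous_on (ball 0 \<delta>') (upd z j)"
        by (rule continuous_on_upd2)
      show "upd z j ` ball 0 \<delta>' \<subseteq> polydisc \<delta>'" using z by (auto intro: upd_in_polydisc)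
      fix \<zeta> assume \<zeta>: "\<zeta> \<in> ball (0::complex) (2 * \<epsilon>)"
      show "(\<lambda>x. g k0 (upd (upd z j x) i \<zeta>)) holomorphic_on ball 0 \<delta>'" by (rule hg[OF k0 \<zeta>])
      show "(\<lambda>x. G k (upd (upd z j x) i \<zeta>)) holomorphic_on ball 0 \<delta>'"
        unfolding G_def by (intro holomorphic_intros hg \<zeta>) auto
    qed
  qed
  show ?thesis
    unfolding eliminates_def
  proof (intro exI[of _ \<delta>'] exI[of _ m] exI[of _ N] conjI allI impI ballI)
    fix j k z \<zeta> assume ind: "\<forall>k<s. \<forall>z \<zeta>. g k (upd z j \<zeta>) = g k z"
    have *: "g l (upd (upd z j \<zeta>) i \<eta>) = g l (upd z i \<eta>)" if "l < s" for l \<eta>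
      using ind that by (cases "j = i") (auto simp: upd_commute[of j i])
    show "N k (upd z j \<zeta>) = N k z"
      using k0 by (simp add: N_def np_def G_def *)
  next
    fix k z assume z: "z \<in> polydisc \<delta>'" and 0: "\<forall>k<s. g k z = 0"
    have "norm (z $ i) < \<delta>'" using z by (simp add: polydisc_def)
    then show "N k z = 0" unfolding N0[OF z]
      using \<delta>' 0 k0 by (intro exI[of _ "z $ i"]) (simp add: G_def)
  next
    fix z assume z: "z \<in> polydisc \<delta>'" and 0: "\<forall>k<m. N k z = 0"
    have "\<exists>\<alpha>\<in>zeros_in \<epsilon> (\<lambda>\<zeta>. g k0 (upd z i \<zeta>)). \<forall>j<s. g j (upd z i \<alpha>) = 0"
    proof (rule vandermonde_pigeonhole[OF card(2)[OF z]])
      show "card (zeros_in \<epsilon> (\<lambda>\<zeta>. g k0 (upd z i \<zeta>))) * s < m"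
        using card(1)[OF z] by (auto simp: m_def less_Suc_eq_le)
      show "\<exists>\<alpha>\<in>zeros_in \<epsilon> (\<lambda>\<zeta>. g k0 (upd z i \<zeta>)). (\<Sum>j<s. of_nat k ^ j * g j (upd z i \<alpha>)) = 0" if "k < m" for k
        using 0 that N0[OF z, of k] by (auto simp: zeros_in_def G_def)
    qed
    then obtain \<alpha> where "norm \<alpha> < \<epsilon>" "\<forall>j<s. g j (upd z i \<alpha>) = 0" by (auto simp: zeros_in_def)
    moreover have "upd z i \<alpha> \<in> polydisc \<delta>" using z sub calculation \<epsilon> by (intro upd_in_polydisc) auto
    ultimately show "\<exists>w\<in>polydisc \<delta>. (\<forall>k<s. g k w = 0) \<and> (\<forall>l. l \<notin> {i} \<longrightarrow> w $ l = z $ l)"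
      by (intro bexI[of _ "upd z i \<alpha>"]) auto
  qed (use \<delta>' sep in \<open>auto simp: N_def np_def\<close>)
qed

lemma agree_off_eq:
  fixes z z' :: "complex^'k"
  assumes "finite J" "\<And>j z \<zeta>. j \<in> J \<Longrightarrow> N (upd z j \<zeta>) = N z" "\<And>l. l \<notin> J \<Longrightarrow> z $ l = z' $ l"
  shows "N z = N z'"
  using assms
proof (induction J arbitrary: z rule: finite_induct)
  case empty
  then have "z = z'" by (simp add: vec_eq_iff)
  then show ?case by simp
next
  case (insert j J)
  have "N (upd z j (z' $ j)) = N z'"
    by (rule insert.IH) (use insert in auto)
  then show ?case using insert.prems(1)[of j z "z' $ j"] by simp
qed

text \<open>Otherwise all \<open>N k\<close> would vanish at some nonzero point of the
  \<open>i\<close>-axis. That point lifts to a common zero \<open>w\<close> of the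
  \<open>g k\<close> with \<open>w $ x = 0\<close>, so \<open>w = 0\<close> by isolation, although
  the coordinate \<open>i\<close> has been kept.\<close>

lemma eliminates_nonvanishing:
  fixes g :: "nat \<Rightarrow> complex^'k \<Rightarrow> complex" and x :: 'k
  assumes iso: "\<And>w. w \<in> polydisc r \<Longrightarrow> w $ x = 0 \<Longrightarrow> \<forall>k<s. g k w = 0 \<Longrightarrow> w = 0"
    and el: "eliminates s g r J \<delta> m N" and "x \<notin> J" "i \<notin> J" "i \<noteq> x"
  shows "\<exists>k<m. \<forall>e>0. \<exists>\<zeta>. norm \<zeta> < e \<and> N k (upd 0 i \<zeta>) \<noteq> 0"
proof (rule ccontr)
  assume "\<not> ?thesis"
  then obtain e where e: "\<And>k. k < m \<Longrightarrow> e k > 0 \<and> (\<forall>\<zeta>. norm \<zeta> < e k \<longrightarrow> N k (upd 0 i \<zeta>) = 0)" by metis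
  have \<delta>: "\<delta> > 0" using el by (simp add: eliminates_def)
  define e0 where "e0 = Min (insert \<delta> (e ` {..<m}))"
  have e0: "e0 > 0" using e \<delta> by (auto simp: e0_def)
  have e0': "e0 \<le> \<delta>" "\<And>k. k < m \<Longrightarrow> e0 \<le> e k" unfolding e0_def by (rule Min_le; simp)+
  define \<zeta> where "\<zeta> = (of_real (e0 / 2) :: complex)"
  have \<zeta>: "norm \<zeta> < e0" "\<zeta> \<noteq> 0" using e0 by (auto simp: \<zeta>_def)
  have "upd 0 i \<zeta> \<in> polydisc \<delta>" using \<zeta>(1) e0' \<delta> by (intro upd_in_polydisc) auto
  moreover have "N k (upd 0 i \<zeta>) = 0" if "k < m" for k
    using e[OF that] e0'(2)[OF that] \<zeta>(1) by auto
  ultimately obtain w where w: "w \<in> polydisc r" "\<forall>k<s. g k w = 0" "\<forall>l. l \<notin> J \<longrightarrow> w $ l = upd 0 i \<zeta> $ l"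
    using el unfolding eliminates_def by blast
  have "w = 0" using w(3) assms(3,5) by (intro iso w) auto
  then show False using w(3) assms(4) \<zeta>(2) by auto
qed

text \<open>Induction on the set of coordinates. Since 0 is the only common zero with
  \<open>w $ x = 0\<close>, each step finds a function that does not vanish along the axis to be
  eliminated next.\<close>

lemma eliminate_coordinates:
  fixes g :: "nat \<Rightarrow> complex^'k \<Rightarrow> complex" and x :: 'k
  assumes r: "r > 0" and g: "\<And>k. k < s \<Longrightarrow> sephol r (g k)"
    and iso: "\<And>w. w \<in> polydisc r \<Longrightarrow> w $ x = 0 \<Longrightarrow> \<forall>k<s. g k w = 0 \<Longrightarrow> w = 0"
    and "finite J" "x \<notin> J"
  shows "\<exists>\<delta> m N. eliminates s g r J \<delta> m N"
  using assms(4,5)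
proof (induction J rule: finite_induct)
  case empty
  have "eliminates s g r {} r s g" unfolding eliminates_def using r g by auto
  then show ?case by blast
next
  case (insert i J)
  then obtain \<delta> m N where el: "eliminates s g r J \<delta> m N" by auto
  have \<delta>: "0 < \<delta>" "\<delta> \<le> r" "\<forall>k<m. sephol \<delta> (N k)"
     and Nind: "\<And>j k z \<zeta>. j \<in> J \<Longrightarrow> k < m \<Longrightarrow> N k (upd z j \<zeta>) = N k z"
     and Na: "\<And>w k. w \<in> polydisc \<delta> \<Longrightarrow> \<forall>k<s. g k w = 0 \<Longrightarrow> k < m \<Longrightarrow> N k w = 0"
     and Nb: "\<And>z. z\<in>polydisc \<delta> \<Longrightarrow> (\<forall>k<m. N k z = 0) \<Longrightarrow> (\<exists>w\<in>polydisc r. (\<forall>k<s. g k w = 0) \<and> (\<forall>l. l \<notin> J \<longrightarrow> w $ l = z $ l))"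
    using el by (simp_all add: eliminates_def)
  have "x \<notin> J" "i \<noteq> x" using insert by auto
  from eliminates_nonvanishing[where g = g, OF iso el this(1) insert(2) this(2)]
  obtain k0 where k0: "k0 < m" "\<forall>e>0. \<exists>\<zeta>. norm \<zeta> < e \<and> N k0 (upd 0 i \<zeta>) \<noteq> 0" by blast
  obtain \<delta>' m' N' where el': "eliminates m N \<delta> {i} \<delta>' m' N'"
     and ind': "\<And>j. \<forall>k<m. \<forall>z \<zeta>. N k (upd z j \<zeta>) = N k z \<Longrightarrow> \<forall>k<m'. \<forall>z \<zeta>. N' k (upd z j \<zeta>) = N' k z"
    using eliminate_coordinate[where g = N, OF \<delta>(1,3) k0] by blast
  have \<delta>': "0 < \<delta>'" "\<delta>' \<le> \<delta>" "\<forall>k<m'. sephol \<delta>' (N' k)"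
     and Nind': "\<forall>k<m'. \<forall>z \<zeta>. N' k (upd z i \<zeta>) = N' k z"
     and Na': "\<And>w. w \<in> polydisc \<delta>' \<Longrightarrow> \<forall>k<m. N k w = 0 \<Longrightarrow> \<forall>k<m'. N' k w = 0"
     and Nb': "\<And>z. z\<in>polydisc \<delta>' \<Longrightarrow> (\<forall>k<m'. N' k z = 0) \<Longrightarrow> (\<exists>w\<in>polydisc \<delta>. (\<forall>k<m. N k w = 0) \<and> (\<forall>l. l \<notin> {i} \<longrightarrow> w $ l = z $ l))"
    using el' by (simp_all add: eliminates_def)
  have "eliminates s g r (insert i J) \<delta>' m' N'" unfolding eliminates_def
  proof (intro conjI ballI impI)
    fix j assume "j \<in> insert i J"
    then show "\<forall>k<m'. \<forall>z \<zeta>. N' k (upd z j \<zeta>) = N' k z"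
      using Nind' ind'[of j] Nind by blast
  next
    fix w assume "w \<in> polydisc \<delta>'" "\<forall>k<s. g k w = 0"
    then show "\<forall>k<m'. N' k w = 0"
      using Na' Na[of w] polydisc_mono[OF \<delta>'(2)] by blast
  next
    fix z assume z: "z \<in> polydisc \<delta>'" "\<forall>k<m'. N' k z = 0"
    then obtain v where v: "v \<in> polydisc \<delta>" "\<forall>k<m. N k v = 0" "\<forall>l. l \<notin> {i} \<longrightarrow> v $ l = z $ l" using Nb' by blast
    from Nb[OF v(1,2)] obtain w where w: "w\<in>polydisc r" "\<forall>k<s. g k w = 0" "\<forall>l. l \<notin> J \<longrightarrow> w $ l = v $ l" by blast
    then show "\<exists>w\<in>polydisc r. (\<forall>k<s. g k w = 0) \<and> (\<forall>l. l \<notin> insert i J \<longrightarrow> w $ l = z $ l)"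
      using v(3) by (intro bexI[of _ w]) auto
  qed (use \<delta>' \<delta> in auto)
  then show ?case by blast
qed

text \<open>The norm polynomial of the identity is the Weierstrass polynomial of \<open>q\<close>,
  and Puiseux's theorem applies to it.\<close>

lemma weierstrass_branch_cover:
  fixes q :: "complex \<Rightarrow> complex \<Rightarrow> complex"
  assumes "\<delta> > 0" and cont: "continuous_on (ball 0 \<delta> \<times> ball 0 \<delta>) (\<lambda>(x,y). q x y)"
    and hol1: "\<And>y. y \<in> ball 0 \<delta> \<Longrightarrow> (\<lambda>x. q x y) holomorphic_on ball 0 \<delta>"
    and hol2: "\<And>x. x \<in> ball 0 \<delta> \<Longrightarrow> q x holomorphic_on ball 0 \<delta>"
    and nz: "\<And>e. e > 0 \<Longrightarrow> \<exists>y. norm y < e \<and> q 0 y \<noteq> 0"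
  obtains \<epsilon> M where "\<epsilon> > 0" "branch_cover M (\<lambda>x. {y. norm y < \<epsilon> \<and> q x y = 0})"
proof -
  from nonvanishing_circle[OF hol2 \<open>\<delta> > 0\<close> nz] assms(1)
  obtain \<epsilon> where \<epsilon>: "0 < \<epsilon>" "4 * \<epsilon> \<le> \<delta>" "\<And>\<zeta>. \<zeta> \<in> sphere 0 \<epsilon> \<Longrightarrow> q 0 \<zeta> \<noteq> 0" by (metis centre_in_ball)
  have sub: "sphere 0 \<epsilon> \<subseteq> ball (0::complex) \<delta>" "ball 0 (2 * \<epsilon>) \<subseteq> ball (0::complex) \<delta>" using \<epsilon> by auto
  have "continuous_on (ball 0 \<delta> \<times> sphere 0 \<epsilon>) (\<lambda>(x,y). q x y)"
    by (rule continuous_on_subset[OF cont]) (use sub in auto)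
  from nonzero_near_compact[OF this compact_sphere open_ball _ \<epsilon>(3)]
  obtain \<delta>1 where \<delta>1: "\<delta>1 > 0" "ball 0 \<delta>1 \<subseteq> ball (0::complex) \<delta>"
    "\<And>x y. x \<in> ball 0 \<delta>1 \<Longrightarrow> y \<in> sphere 0 \<epsilon> \<Longrightarrow> q x y \<noteq> 0"
    using assms(1) by (metis centre_in_ball)
  interpret norm_family "ball (0::complex) \<delta>1" \<epsilon> "2 * \<epsilon>" q "\<lambda>x y. y" "2 * \<epsilon>"
  proof
    show "continuous_on (ball 0 \<delta>1 \<times> ball 0 (2 * \<epsilon>)) (\<lambda>(x, y). q x y)"
      by (rule continuous_on_subset[OF cont]) (use sub \<delta>1 in auto)
    show "q x holomorphic_on ball 0 (2 * \<epsilon>)" if "x \<in> ball 0 \<delta>1" for x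
      using hol2[of x] \<delta>1(2) that sub(2) by (meson holomorphic_on_subset subsetD)
  qed (use \<epsilon> \<delta>1 in \<open>auto intro!: holomorphic_intros continuous_intros simp: case_prod_unfold\<close>)
  define Q where "Q x = norm_poly \<epsilon> (q x) (\<lambda>y. y)" for x
  define d where "d = degree (Q 0)"
  have deg: "degree (Q x) = d" if "x \<in> ball 0 \<delta>1" for x
    unfolding d_def Q_def by (rule degree_const[OF connected_ball that]) (use \<delta>1 in simp)
  have "coeff (Q x) d = 1" if "x \<in> ball 0 \<delta>1" for x
    using norm_poly_degree(2)[of \<epsilon> "q x" "\<lambda>y. y", folded Q_def] unfolding deg[OF that] .
  moreover have "(\<lambda>x. coeff (Q x) k) holomorphic_on ball 0 \<delta>1" for k
    unfolding Q_def
  proof (rule coeff_holomorphic[where f = "\<lambda>x. x"])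
    show "(\<lambda>x. q x \<zeta>) holomorphic_on ball 0 \<delta>1" if "\<zeta> \<in> ball 0 (2 * \<epsilon>)" for \<zeta>
      using hol1[of \<zeta>] that sub \<delta>1(2) by (meson holomorphic_on_subset subsetD)
  qed auto
  ultimately have "monic_family d \<delta>1 Q" using \<delta>1 deg by (simp add: monic_family_def)
  from puiseux[OF this] obtain M where M: "branch_cover M (\<lambda>x. {y. poly (Q x) y = 0})" by blast
  have "branch_cover M (\<lambda>x. {y. norm y < \<epsilon> \<and> q x y = 0})"
  proof (rule branch_cover_UN[where I = "{()}" and Y = "\<lambda>_ x. {y. poly (Q x) y = 0}" and \<delta> = \<delta>1])
    show "{y. norm y < \<epsilon> \<and> q t y = 0} \<subseteq> (\<Union>i\<in>{()}. {y. poly (Q t) y = 0})" if "norm t < \<delta>1" for t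
      using norm_poly_zero_iff[OF eps q_hol q_nz, of t "\<lambda>y. y"] that by (auto simp: Q_def)
  qed (use M \<delta>1 in \<open>auto simp: branch_cover_def\<close>)
  then show ?thesis using that \<epsilon>(1) by blast
qed

theorem coordinate_branch_cover:
  fixes g :: "nat \<Rightarrow> complex^'k \<Rightarrow> complex" and x j :: 'k
  assumes r: "r > 0" and g: "\<And>k. k < s \<Longrightarrow> sephol r (g k)"
    and iso: "\<And>w. w \<in> polydisc r \<Longrightarrow> w $ x = 0 \<Longrightarrow> \<forall>k<s. g k w = 0 \<Longrightarrow> w = 0"
    and "j \<noteq> x"
  obtains \<delta> M where "\<delta> > 0" "branch_cover M (\<lambda>t. {w $ j | w. w \<in> polydisc \<delta> \<and> w $ x = t \<and> (\<forall>k<s. g k w = 0)})"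
proof -
  \<comment> \<open>Eliminating all coordinates besides \<open>x\<close> and \<open>j\<close> leaves
    one equation between \<open>w $ x\<close> and \<open>w $ j\<close>.\<close>
  define J where "J = UNIV - {x, j}"
  have J: "finite J" "x \<notin> J" "j \<notin> J" by (auto simp: J_def)
  obtain \<delta> m N where el: "eliminates s g r J \<delta> m N"
    using eliminate_coordinates[where g = g, OF r g iso J(1,2)] by blast
  have \<delta>: "0 < \<delta>" "\<delta> \<le> r" "\<And>k. k < m \<Longrightarrow> sephol \<delta> (N k)"
     and Nind: "\<And>j k z \<zeta>. j \<in> J \<Longrightarrow> k < m \<Longrightarrow> N k (upd z j \<zeta>) = N k z"
     and Na: "\<And>w k. w \<in> polydisc \<delta> \<Longrightarrow> \<forall>k<s. g k w = 0 \<Longrightarrow> k < m \<Longrightarrow> N k w = 0"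
    using el by (simp_all add: eliminates_def)
  obtain k0 where k0: "k0 < m" "\<And>e. e > 0 \<Longrightarrow> \<exists>\<zeta>. norm \<zeta> < e \<and> N k0 (upd 0 j \<zeta>) \<noteq> 0"
    using eliminates_nonvanishing[where g = g, OF iso el J(2,3) \<open>j \<noteq> x\<close>] by blast
  define q where "q t y = N k0 (upd (upd 0 x t) j y)" for t y
  have sp: "sephol \<delta> (N k0)" using \<delta>(3) k0(1) .
  have inp: "upd 0 l t \<in> polydisc \<delta>" if "norm t < \<delta>" for t l
    using that \<delta>(1) by (intro upd_in_polydisc) auto
  show ?thesis
  proof (rule weierstrass_branch_cover[OF \<delta>(1), of q])
    have "continuous_on (ball 0 \<delta> \<times> ball 0 \<delta>) (\<lambda>p. upd 0 x (fst p))"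
      by (rule continuous_on_compose2[OF continuous_on_upd2[of UNIV]]) (auto intro!: continuous_intros)
    then have "continuous_on (ball 0 \<delta> \<times> ball 0 \<delta>) (\<lambda>p. (upd 0 x (fst p), snd p))"
      by (intro continuous_on_Pair continuous_on_snd continuous_on_id)
    then have cu: "continuous_on (ball 0 \<delta> \<times> ball 0 \<delta>) (\<lambda>p. upd (upd 0 x (fst p)) j (snd p))"
      using continuous_on_compose2[OF continuous_on_upd[of UNIV j], of "ball 0 \<delta> \<times> ball 0 \<delta>" "\<lambda>p. (upd 0 x (fst p), snd p)"]
      by simp
    have "continuous_on (polydisc \<delta>) (N k0)" using sp by (simp add: sephol_def)
    then show "continuous_on (ball 0 \<delta> \<times> ball 0 \<delta>) (\<lambda>(x, y). q x y)"
      unfolding case_prod_unfold q_def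
      by (rule continuous_on_compose2[OF _ cu]) (auto intro!: upd_in_polydisc inp)
    show "(\<lambda>t. q t y) holomorphic_on ball 0 \<delta>" if "y \<in> ball 0 \<delta>" for y
      using sp inp[of y j] that \<open>j \<noteq> x\<close> by (auto simp: q_def sephol_def upd_commute[of x j])
    show "q t holomorphic_on ball 0 \<delta>" if "t \<in> ball 0 \<delta>" for t
      using sp inp[of t x] that by (auto simp: q_def[abs_def] sephol_def)
    have "upd 0 x 0 = 0" by (simp add: vec_eq_iff)
    then show "\<exists>y. norm y < e \<and> q 0 y \<noteq> 0" if "e > 0" for e using k0(2)[OF that] by (simp add: q_def)
    fix \<epsilon> M assume \<epsilon>: "\<epsilon> > 0" and bc: "branch_cover M (\<lambda>x. {y. norm y < \<epsilon> \<and> q x y = 0})"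
    define \<delta>' where "\<delta>' = min \<epsilon> \<delta>"
    have "branch_cover M (\<lambda>t. {w $ j | w. w \<in> polydisc \<delta>' \<and> w $ x = t \<and> (\<forall>k<s. g k w = 0)})"
    proof (rule branch_cover_UN[where I = "{()}" and Y = "\<lambda>_ x. {y. norm y < \<epsilon> \<and> q x y = 0}" and \<delta> = 1])
      fix t :: complex
      have "norm (w $ j) < \<epsilon> \<and> q (w $ x) (w $ j) = 0" if w: "w \<in> polydisc \<delta>'" "\<forall>k<s. g k w = 0" for w
      proof
        show "norm (w $ j) < \<epsilon>" using w by (auto simp: polydisc_def \<delta>'_def)
        have "w \<in> polydisc \<delta>" using w(1) polydisc_mono[of \<delta>' \<delta>] by (auto simp: \<delta>'_def)
        then have "N k0 w = 0" using Na w(2) k0(1) by blast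
        moreover have "N k0 w = N k0 (upd (upd 0 x (w $ x)) j (w $ j))"
          by (rule agree_off_eq[OF J(1) Nind[OF _ k0(1)]]) (auto simp: J_def)
        ultimately show "q (w $ x) (w $ j) = 0" by (simp add: q_def)
      qed
      then show "{w $ j |w. w \<in> polydisc \<delta>' \<and> w $ x = t \<and> (\<forall>k<s. g k w = 0)} \<subseteq> (\<Union>i\<in>{()}. {y. norm y < \<epsilon> \<and> q t y = 0})"
        by auto
    qed (use bc in \<open>auto simp: branch_cover_def\<close>)
    then show ?thesis using that[of \<delta>'] \<epsilon> \<delta> by (auto simp: \<delta>'_def)
  qed
qed

section \<open>Parametrization of irreducible curve germs\<close>

definition curve_holomorphic :: "(complex \<Rightarrow> complex^'n) \<Rightarrow> complex set \<Rightarrow> bool" where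
  "curve_holomorphic s D \<longleftrightarrow> (\<forall>i. (\<lambda>t. s t $ i) holomorphic_on D)"

lemma curve_holomorphic_subset: "curve_holomorphic s D \<Longrightarrow> D' \<subseteq> D \<Longrightarrow> curve_holomorphic s D'"
  unfolding curve_holomorphic_def using holomorphic_on_subset by blast

lemma curve_holomorphic_continuous: "curve_holomorphic s D \<Longrightarrow> continuous_on D s"
  unfolding curve_holomorphic_def
  using continuous_on_vec_lambda[of D "\<lambda>i t. s t $ i"] holomorphic_on_imp_continuous_on
  by (metis (no_types, lifting) continuous_on_cong vec_lambda_eta)

lemma curve_holomorphic_compose:
  assumes "curve_holomorphic s D" "g holomorphic_on E" "g ` E \<subseteq> D"
  shows "curve_holomorphic (\<lambda>t. s (g t)) E"
  unfolding curve_holomorphic_def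
proof
  fix i
  have "((\<lambda>t. s t $ i) \<circ> g) holomorphic_on E"
    by (rule holomorphic_on_compose_gen[OF assms(2) _ assms(3)]) (use assms(1) in \<open>simp add: curve_holomorphic_def\<close>)
  then show "(\<lambda>t. s (g t) $ i) holomorphic_on E" by (simp add: o_def)
qed

lemma holomorphic_fun_continuous: "holomorphic_fun f U \<Longrightarrow> continuous_on U f"
  unfolding holomorphic_fun_def
  by (meson continuous_at_imp_continuous_on has_derivative_continuous)

lemma holomorphic_fun_subset: "holomorphic_fun f U \<Longrightarrow> U' \<subseteq> U \<Longrightarrow> holomorphic_fun f U'"
  unfolding holomorphic_fun_def by blast

lemma has_derivative_curve:
  fixes s :: "complex \<Rightarrow> complex^'n"
  assumes "\<And>i. ((\<lambda>t. s t $ i) has_field_derivative d $ i) (at t)"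
  shows "(s has_derivative (\<lambda>h. h *s d)) (at t)"
proof -
  have "((\<lambda>y. (s y - s t - (y - t) *s d) /\<^sub>R norm (y - t)) \<longlongrightarrow> 0) (at t)"
  proof (rule vec_tendstoI)
    fix i
    have "((\<lambda>t. s t $ i) has_derivative (\<lambda>h. d $ i * h)) (at t)"
      using assms[of i] by (simp add: has_field_derivative_def)
    then have "((\<lambda>y. (s y $ i - s t $ i - d $ i * (y - t)) /\<^sub>R norm (y - t)) \<longlongrightarrow> 0) (at t)"
      by (simp add: has_derivative_def)
    then show "((\<lambda>y. ((s y - s t - (y - t) *s d) /\<^sub>R norm (y - t)) $ i) \<longlongrightarrow> 0 $ i) (at t)"
      by (simp add: algebra_simps)
  qed
  moreover have "bounded_linear (\<lambda>h. h *s d)"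
    by (rule linear_conv_bounded_linear[THEN iffD1], rule linearI) (simp_all add: vec_eq_iff algebra_simps)
  ultimately show ?thesis by (simp add: has_derivative_def)
qed

text \<open>The derivative in \<open>holomorphic_fun\<close> is a real one; its complex homogeneity
  is what turns the chain rule into a complex derivative.\<close>

lemma holomorphic_fun_curve:
  assumes "holomorphic_fun f U" "curve_holomorphic s D" "open D" "s ` D \<subseteq> U"
  shows "(\<lambda>t. f (s t)) holomorphic_on D"
  unfolding holomorphic_on_def
proof
  fix t assume t: "t \<in> D"
  define d where "d = (\<chi> i. deriv (\<lambda>t. s t $ i) t)"
  have "((\<lambda>t. s t $ i) has_field_derivative d $ i) (at t)" for i
    using holomorphic_derivI[OF _ \<open>open D\<close> t] assms(2) by (simp add: d_def curve_holomorphic_def)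
  then have 1: "(s has_derivative (\<lambda>h. h *s d)) (at t)" by (rule has_derivative_curve)
  obtain f' where f': "(f has_derivative f') (at (s t))" "\<And>c v. f' (c *s v) = c * f' v"
    using assms(1,4) t unfolding holomorphic_fun_def by blast
  have "((\<lambda>t. f (s t)) has_derivative (\<lambda>h. f' (h *s d))) (at t)"
    using diff_chain_at[OF 1 f'(1)] by (simp add: o_def)
  then have "((\<lambda>t. f (s t)) has_field_derivative f' d) (at t)"
    by (simp add: has_field_derivative_def f'(2) mult_commute_abs)
  then show "(\<lambda>t. f (s t)) field_differentiable at t within D"
    using field_differentiable_def field_differentiable_at_within by blast
qed

lemma holomorphic_funI:
  assumes "\<And>z. z \<in> U \<Longrightarrow> (f has_derivative f' z) (at z)" "\<And>z c v. z \<in> U \<Longrightarrow> f' z (c *s v) = c * f' z v"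
  shows "holomorphic_fun f U"
  using assms unfolding holomorphic_fun_def by blast

lemma holomorphic_fun_nth: "holomorphic_fun (\<lambda>z. z $ i) U"
  by (rule holomorphic_funI[where f' = "\<lambda>_ v. v $ i"])
     (auto intro!: bounded_linear_imp_has_derivative bounded_linear_vec_nth)

lemma holomorphic_fun_const: "holomorphic_fun (\<lambda>z. c) U"
  by (rule holomorphic_funI[where f' = "\<lambda>_ v. 0"]) auto

lemma holomorphic_fun_add: "holomorphic_fun f U \<Longrightarrow> holomorphic_fun g U \<Longrightarrow> holomorphic_fun (\<lambda>z. f z + g z) U"
  unfolding holomorphic_fun_def
proof
  fix z assume *: "\<forall>z\<in>U. \<exists>f'. (f has_derivative f') (at z) \<and> (\<forall>c v. f' (c *s v) = c * f' v)"
    "\<forall>z\<in>U. \<exists>g'. (g has_derivative g') (at z) \<and> (\<forall>c v. g' (c *s v) = c * g' v)" "z \<in> U"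
  then obtain f' g' where "(f has_derivative f') (at z)" "\<forall>c v. f' (c *s v) = c * f' v"
    "(g has_derivative g') (at z)" "\<forall>c v. g' (c *s v) = c * g' v" by blast
  then show "\<exists>h'. ((\<lambda>z. f z + g z) has_derivative h') (at z) \<and> (\<forall>c v. h' (c *s v) = c * h' v)"
    by (intro exI[of _ "\<lambda>v. f' v + g' v"]) (auto intro!: derivative_intros simp: algebra_simps)
qed

lemma holomorphic_fun_mult: "holomorphic_fun f U \<Longrightarrow> holomorphic_fun g U \<Longrightarrow> holomorphic_fun (\<lambda>z. f z * g z) U"
  unfolding holomorphic_fun_def
proof
  fix z assume *: "\<forall>z\<in>U. \<exists>f'. (f has_derivative f') (at z) \<and> (\<forall>c v. f' (c *s v) = c * f' v)"
    "\<forall>z\<in>U. \<exists>g'. (g has_derivative g') (at z) \<and> (\<forall>c v. g' (c *s v) = c * g' v)" "z \<in> U"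
  then obtain f' g' where "(f has_derivative f') (at z)" "\<forall>c v. f' (c *s v) = c * f' v"
    "(g has_derivative g') (at z)" "\<forall>c v. g' (c *s v) = c * g' v" by blast
  then show "\<exists>h'. ((\<lambda>z. f z * g z) has_derivative h') (at z) \<and> (\<forall>c v. h' (c *s v) = c * h' v)"
    by (intro exI[of _ "\<lambda>v. f z * g' v + f' v * g z"]) (auto intro!: derivative_intros simp: algebra_simps)
qed

lemma holomorphic_fun_sum:
  "(\<And>i. i \<in> I \<Longrightarrow> holomorphic_fun (f i) U) \<Longrightarrow> holomorphic_fun (\<lambda>z. \<Sum>i\<in>I. f i z) U"
  by (induction I rule: infinite_finite_induct) (auto intro!: holomorphic_fun_const holomorphic_fun_add)

lemma holomorphic_fun_power: "holomorphic_fun f U \<Longrightarrow> holomorphic_fun (\<lambda>z. f z ^ k) U"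
  by (induction k) (auto intro!: holomorphic_fun_const holomorphic_fun_mult)

lemma holomorphic_fun_compose:
  assumes "holomorphic_fun f U" "a holomorphic_on D" "open D" "f ` U \<subseteq> D"
  shows "holomorphic_fun (\<lambda>z. a (f z)) U"
  unfolding holomorphic_fun_def
proof
  fix z assume z: "z \<in> U"
  obtain f' where f': "(f has_derivative f') (at z)" "\<And>c v. f' (c *s v) = c * f' v"
    using assms(1) z unfolding holomorphic_fun_def by blast
  have "(a has_derivative (\<lambda>h. deriv a (f z) * h)) (at (f z))"
    using holomorphic_derivI[OF assms(2,3), of "f z"] assms(4) z by (auto simp: has_field_derivative_def)
  from diff_chain_at[OF f'(1) this] f'(2)
  show "\<exists>g'. ((\<lambda>z. a (f z)) has_derivative g') (at z) \<and> (\<forall>c v. g' (c *s v) = c * g' v)"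
    by (intro exI[of _ "\<lambda>v. deriv a (f z) * f' v"]) (auto simp: o_def)
qed

lemma analytic_at_Un:
  assumes "analytic_at p A" "analytic_at p B"
  shows "analytic_at p (A \<union> B)"
proof -
  obtain U F where F: "open U" "p \<in> U" "finite F" "\<forall>f\<in>F. holomorphic_fun f U" "A \<inter> U = {z \<in> U. \<forall>f\<in>F. f z = 0}"
    using assms(1) unfolding analytic_at_def by blast
  obtain V G where G: "open V" "p \<in> V" "finite G" "\<forall>f\<in>G. holomorphic_fun f V" "B \<inter> V = {z \<in> V. \<forall>f\<in>G. f z = 0}"
    using assms(2) unfolding analytic_at_def by blast
  define H where "H = (\<lambda>(f,g) z. f z * g z) ` (F \<times> G)"
  have "holomorphic_fun h (U \<inter> V)" if "h \<in> H" for h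
    using that F(4) G(4) by (auto simp: H_def intro!: holomorphic_fun_mult intro: holomorphic_fun_subset)
  moreover have "(A \<union> B) \<inter> (U \<inter> V) = {z \<in> U \<inter> V. \<forall>h\<in>H. h z = 0}"
  proof -
    have "z \<in> A \<union> B \<longleftrightarrow> (\<forall>h\<in>H. h z = 0)" if z: "z \<in> U \<inter> V" for z
    proof -
      have "z \<in> A \<longleftrightarrow> (\<forall>f\<in>F. f z = 0)" "z \<in> B \<longleftrightarrow> (\<forall>f\<in>G. f z = 0)" using F(5) G(5) z by auto
      then show ?thesis by (auto simp: H_def)
    qed
    then show ?thesis by blast
  qed
  moreover have "finite H" using F G by (simp add: H_def)
  ultimately show ?thesis unfolding analytic_at_def
    using F G by (intro exI[of _ "U \<inter> V"] exI[of _ H]) auto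
qed

lemma germ_eq_sym: "germ_eq A B \<Longrightarrow> germ_eq B A"
  unfolding germ_eq_def by (auto elim: eventually_mono)

lemma germ_eq_trans: "germ_eq A B \<Longrightarrow> germ_eq B C \<Longrightarrow> germ_eq A C"
  unfolding germ_eq_def by (auto elim: eventually_elim2)

lemma analytic_at_empty: "analytic_at p {}"
  unfolding analytic_at_def
  by (rule exI[of _ UNIV], rule exI[of _ "{\<lambda>_. 1}"]) (auto intro!: holomorphic_fun_const)

lemma analytic_at_UN:
  "finite K \<Longrightarrow> (\<And>k. k \<in> K \<Longrightarrow> analytic_at p (B k)) \<Longrightarrow> analytic_at p (\<Union>k\<in>K. B k)"
  by (induction K rule: finite_induct) (auto intro!: analytic_at_empty analytic_at_Un)

lemma irreducible_germ_UN:
  assumes "irreducible_germ A" "finite K" "\<And>k. k \<in> K \<Longrightarrow> analytic_at 0 (B k)" "germ_eq A (\<Union>k\<in>K. B k)"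
  shows "\<exists>k\<in>K. germ_eq A (B k)"
  using assms(2-)
proof (induction K rule: finite_induct)
  case empty
  then have "\<forall>\<^sub>F z in nhds 0. z \<notin> A" by (simp add: germ_eq_def)
  then have "0 \<notin> A" by (rule eventually_nhds_x_imp_x)
  then show ?case using assms(1) by (simp add: irreducible_germ_def analytic_germ_def)
next
  case (insert k K)
  have "germ_eq A (B k \<union> (\<Union>k\<in>K. B k))" using insert.prems(2) by simp
  then have "germ_eq A (B k) \<or> germ_eq A (\<Union>k\<in>K. B k)"
    using assms(1) insert analytic_at_UN[of K 0 B] unfolding irreducible_germ_def by blast
  then show ?case using insert by auto
qed

lemma germ_dim_1D:
  fixes A :: "(complex^'n) set"
  assumes "germ_dim A = 1"
  obtains U f where "open U" "0 \<in> U" "holomorphic_fun f U" "f 0 = 0" "\<And>z. z \<in> A \<Longrightarrow> z \<in> U \<Longrightarrow> f z = 0 \<Longrightarrow> z = 0"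
    "\<And>V. open V \<Longrightarrow> 0 \<in> V \<Longrightarrow> \<exists>z\<in>A \<inter> V. z \<noteq> 0"
proof -
  define P where "P d \<longleftrightarrow> (\<exists>U F. open U \<and> 0 \<in> U \<and> finite F \<and> card F = d \<and>
        (\<forall>f\<in>F. holomorphic_fun f U \<and> f 0 = 0) \<and>
        {z \<in> A \<inter> U. \<forall>f\<in>F. f z = 0} \<subseteq> {0})" for d
  have gd: "germ_dim A = (LEAST d. P d)" by (simp add: germ_dim_def P_def)
  \<comment> \<open>The coordinate functions show that the minimum defining \<open>germ_dim\<close>
    is attained.\<close>
  have "P (card (range (\<lambda>i z. z $ i :: complex) :: (complex^'n \<Rightarrow> complex) set))"
    unfolding P_def
    by (rule exI[of _ UNIV], rule exI[of _ "range (\<lambda>i (z :: complex^'n). z $ i)"]) (auto intro!: holomorphic_fun_nth simp: vec_eq_iff)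
  then have "P 1" using LeastI[of P] assms gd by metis
  then obtain U F where UF: "open U" "0 \<in> U" "card F = 1" "\<forall>f\<in>F. holomorphic_fun f U \<and> f 0 = 0"
    "{z \<in> A \<inter> U. \<forall>f\<in>F. f z = 0} \<subseteq> {0}" unfolding P_def by blast
  then obtain f where f: "F = {f}" by (auto simp: card_1_singleton_iff)
  \<comment> \<open>With no equations at all the condition says that \<open>A\<close> is at most the
    point 0 near 0; minimality rules this out.\<close>
  have "\<not> P 0" using not_less_Least[of 0 P] assms gd by simp
  have "\<exists>z\<in>A \<inter> V. z \<noteq> 0" if "open V" "0 \<in> V" for V
  proof (rule ccontr)
    assume "\<not> ?thesis"
    then have "P 0" unfolding P_def using that by (intro exI[of _ V] exI[of _ "{}"]) auto
    then show False using \<open>\<not> P 0\<close> by blast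
  qed
  then show ?thesis using that[of U f] UF f by auto
qed

lemma holomorphic_zero_dichotomy:
  fixes f :: "complex \<Rightarrow> complex"
  assumes "f holomorphic_on ball 0 r" "r > 0"
  obtains \<delta> where "0 < \<delta>" "\<delta> \<le> r"
    "(\<forall>t\<in>ball 0 \<delta>. f t = 0) \<or> (\<forall>t\<in>ball 0 \<delta>. t \<noteq> 0 \<longrightarrow> f t \<noteq> 0)"
proof (rule holomorphic_order_at_0[OF assms])
  fix n u \<delta>
  assume *: "0 < \<delta>" "\<delta> \<le> r" "\<And>x. x \<in> ball 0 \<delta> \<Longrightarrow> f x = x ^ n * u x"
    "(\<forall>x\<in>ball 0 \<delta>. u x \<noteq> 0) \<or> (\<forall>x\<in>ball 0 \<delta>. u x = 0)"
  show ?thesis by (rule that[of \<delta>]) (use * in auto)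
qed

lemma complex_root_exists:
  fixes x :: complex
  assumes "M > 0"
  obtains t where "t ^ M = x" "norm t ^ M = norm x"
proof -
  obtain t where "t ^ M = x"
  proof (cases "x = 0")
    case True
    then show ?thesis using that[of 0] assms by simp
  next
    case False
    have "exp (Ln x / of_nat M) ^ M = x"
      using assms False by (simp add: exp_of_nat_mult[symmetric])
    then show ?thesis using that by blast
  qed
  then show ?thesis using that by (metis norm_power)
qed

text \<open>The graph of \<open>f\<close> turns the possibly nonlinear function \<open>f\<close> into a coordinate, here the coordinate \<open>None\<close>.\<close>

definition forget :: "complex^('n option) \<Rightarrow> complex^'n" where
  "forget w = (\<chi> j. w $ Some j)"

lemma continuous_on_forget: "continuous_on A forget"
  unfolding forget_def by (intro continuous_intros)

lemma forget_polydisc: "w \<in> polydisc r \<Longrightarrow> forget w \<in> polydisc r"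
  by (simp add: forget_def polydisc_def)

lemma curve_holomorphic_forget_upd: "curve_holomorphic (\<lambda>\<zeta>. forget (upd w i \<zeta>)) D"
  unfolding curve_holomorphic_def
proof
  fix j
  show "(\<lambda>t. forget (upd w i t) $ j) holomorphic_on D"
    by (cases "Some j = i") (auto simp: forget_def intro!: holomorphic_intros)
qed

lemma sephol_forget:
  assumes "holomorphic_fun h W" "polydisc r \<subseteq> W"
  shows "sephol r (\<lambda>w. h (forget w))"
  unfolding sephol_def
proof (intro conjI ballI allI)
  show "continuous_on (polydisc r) (\<lambda>w. h (forget w))"
    by (rule continuous_on_compose2[OF holomorphic_fun_continuous[OF assms(1)] continuous_on_forget])
       (use assms(2) forget_polydisc in blast)
  fix w :: "complex^('a option)" and i assume w: "w \<in> polydisc r"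
  show "(\<lambda>\<zeta>. h (forget (upd w i \<zeta>))) holomorphic_on ball 0 r"
  proof (rule holomorphic_fun_curve[OF assms(1) curve_holomorphic_forget_upd open_ball])
    show "(\<lambda>\<zeta>. forget (upd w i \<zeta>)) ` ball 0 r \<subseteq> W"
      using w assms(2) forget_polydisc upd_in_polydisc by fastforce
  qed
qed

lemma sephol_None_minus:
  assumes "sephol r g"
  shows "sephol r (\<lambda>w. w $ None - g w)"
  unfolding sephol_def
proof (intro conjI ballI allI)
  show "continuous_on (polydisc r) (\<lambda>w. w $ None - g w)"
    using assms by (auto simp: sephol_def intro!: continuous_intros)
  fix w :: "complex^('a option)" and i assume w: "w \<in> polydisc r"
  show "(\<lambda>\<zeta>. upd w i \<zeta> $ None - g (upd w i \<zeta>)) holomorphic_on ball 0 r"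
    using assms w by (cases "i = None") (auto simp: sephol_def intro!: holomorphic_intros)
qed

lemma curve_cover:
  fixes A :: "(complex^'n) set"
  assumes U: "open U" "0 \<in> U" "finite F" "\<And>h. h \<in> F \<Longrightarrow> holomorphic_fun h U" "A \<inter> U = {z \<in> U. \<forall>h\<in>F. h z = 0}"
    and f: "holomorphic_fun f U" "f 0 = 0" "\<And>z. z \<in> A \<Longrightarrow> z \<in> U \<Longrightarrow> f z = 0 \<Longrightarrow> z = 0"
  obtains M \<rho> \<S> \<eta> where "M > 0" "\<rho> > 0" "finite \<S>" "\<And>s. s \<in> \<S> \<Longrightarrow> curve_holomorphic s (ball 0 \<rho>)"
    "\<eta> > 0" "\<And>z. z \<in> A \<Longrightarrow> norm z < \<eta> \<Longrightarrow> z \<noteq> 0 \<Longrightarrow> \<exists>s\<in>\<S>. \<exists>t. 0 < norm t \<and> norm t < \<rho> \<and> z = s t \<and> f z = t ^ M"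
proof -
  obtain r where r: "r > 0" "polydisc r \<subseteq> U" by (rule polydisc_subset_open[OF U(1,2)])
  obtain h m where h: "F = h ` {i::nat. i < m}"
    using finite_imp_nat_seg_image_inj_on[OF U(3)] by blast
  define s where "s = Suc m"
  \<comment> \<open>The added equation is that of the graph of \<open>f\<close>. It makes
    \<open>f\<close> the coordinate \<open>None\<close>, and the isolated zero of \<open>f\<close>
    on \<open>A\<close> becomes the isolation hypothesis of the elimination.\<close>
  define g where "g k = (if k < m then (\<lambda>w. h k (forget w)) else (\<lambda>w. w $ None - f (forget w)))" for k
  have zero_iff: "(\<forall>k<s. g k w = 0) \<longleftrightarrow> forget w \<in> A \<and> w $ None = f (forget w)" if "forget w \<in> U" for w
  proof -
    have "(\<forall>k<s. g k w = 0) \<longleftrightarrow> (\<forall>h\<in>F. h (forget w) = 0) \<and> w $ None = f (forget w)"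
      unfolding s_def less_Suc_eq by (auto simp: g_def h)
    also have "(\<forall>h\<in>F. h (forget w) = 0) \<longleftrightarrow> forget w \<in> A" using U(5) that by blast
    finally show ?thesis .
  qed
  have inU: "forget w \<in> U" if "w \<in> polydisc r" for w using forget_polydisc[OF that] r(2) by blast
  have g: "sephol r (g k)" if "k < s" for k
  proof (cases "k < m")
    case True
    then show ?thesis using sephol_forget[OF U(4) r(2), of "h k"] h by (auto simp: g_def)
  next
    case False
    then show ?thesis using sephol_None_minus[OF sephol_forget[OF f(1) r(2)]] by (auto simp: g_def)
  qed
  have iso: "w = 0" if w: "w \<in> polydisc r" "w $ None = 0" "\<forall>k<s. g k w = 0" for w
  proof -
    have "forget w = 0" using zero_iff[OF inU[OF w(1)]] w f(3) inU[OF w(1)] by auto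
    then have "w $ Some j = 0" for j by (simp add: forget_def vec_eq_iff)
    then show ?thesis unfolding vec_eq_iff using w(2) by (metis option.exhaust zero_index)
  qed
  define Y0 where "Y0 \<delta> j t = {w $ Some j | w. w \<in> polydisc \<delta> \<and> w $ None = t \<and> (\<forall>k<s. g k w = 0)}" for \<delta> j t
  have "\<exists>\<delta> M. \<delta> > 0 \<and> branch_cover M (Y0 \<delta> j)" for j
    unfolding Y0_def by (rule coordinate_branch_cover[of r s g None "Some j", OF r(1) g iso]) blast+
  then obtain \<delta> where \<delta>M: "\<And>j. \<delta> j > 0" "\<And>j. \<exists>M. branch_cover M (Y0 (\<delta> j) j)" by metis
  define Y where "Y j = Y0 (\<delta> j) j" for j
  obtain M where M: "M > 0" "\<And>j. branch_cover M (Y j)"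
    using branch_cover_common[of "UNIV :: 'n set" Y] \<delta>M(2) by (auto simp: Y_def)
  have "\<exists>\<rho>>0. \<exists>\<B>. finite \<B> \<and> (\<forall>B\<in>\<B>. B holomorphic_on ball 0 \<rho>) \<and>
     (\<forall>t y. 0 < norm t \<longrightarrow> norm t < \<rho> \<longrightarrow> y \<in> Y j (t ^ M) \<longrightarrow> (\<exists>B\<in>\<B>. y = B t))" for j
    using M(2)[of j] by (simp add: branch_cover_def)
  then obtain \<rho>0 \<B> where B: "\<And>j. \<rho>0 j > 0" "\<And>j. finite (\<B> j)" "\<And>j B. B \<in> \<B> j \<Longrightarrow> B holomorphic_on ball 0 (\<rho>0 j)"
    "\<And>j t y. 0 < norm t \<Longrightarrow> norm t < \<rho>0 j \<Longrightarrow> y \<in> Y j (t ^ M) \<Longrightarrow> \<exists>B\<in>\<B> j. y = B t" by metis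
  define \<rho> where "\<rho> = Min (range \<rho>0)"
  have \<rho>: "\<rho> > 0" "\<And>j. \<rho> \<le> \<rho>0 j" using B(1) by (auto simp: \<rho>_def)
  define \<delta>0 where "\<delta>0 = Min (insert r (range \<delta>))"
  have \<delta>0: "\<delta>0 > 0" "\<delta>0 \<le> r" using \<delta>M(1) r by (auto simp: \<delta>0_def)
  have \<delta>0': "\<delta>0 \<le> \<delta> j" for j unfolding \<delta>0_def by (rule Min_le) auto
  define \<S> where "\<S> = (\<lambda>b t. \<chi> j. b j t) ` (PiE UNIV \<B>)"
  have contf: "isCont f 0"
    using holomorphic_fun_continuous[OF f(1)] U(1,2) continuous_on_eq_continuous_at by blast
  have "\<exists>e>0. \<forall>z. norm z < e \<longrightarrow> norm (f z) < min (\<rho> ^ M) \<delta>0"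
  proof -
    have "min (\<rho> ^ M) \<delta>0 > 0" using \<rho> \<delta>0 by simp
    from contf[unfolded continuous_at_eps_delta, rule_format, OF this] f(2) show ?thesis by (simp add: dist_norm)
  qed
  then obtain e where e: "e > 0" "\<And>z. norm z < e \<Longrightarrow> norm (f z) < \<rho> ^ M" "\<And>z. norm z < e \<Longrightarrow> norm (f z) < \<delta>0" by auto
  show ?thesis
  proof (rule that[of M \<rho> \<S> "min e \<delta>0"])
    show "finite \<S>" unfolding \<S>_def by (intro finite_imageI finite_PiE) (auto intro: B(2))
    show "curve_holomorphic s (ball 0 \<rho>)" if "s \<in> \<S>" for s
      unfolding curve_holomorphic_def
    proof
      fix j
      obtain b where b: "b \<in> PiE UNIV \<B>" "s = (\<lambda>t. \<chi> j. b j t)"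
        using \<open>s \<in> \<S>\<close> unfolding \<S>_def by blast
      have "b j holomorphic_on ball 0 \<rho>"
        by (rule holomorphic_on_subset[OF B(3)]) (use b(1) \<rho>(2)[of j] in auto)
      then show "(\<lambda>t. s t $ j) holomorphic_on ball 0 \<rho>" by (simp add: b(2))
    qed
    fix z assume z: "z \<in> A" "norm z < min e \<delta>0" "z \<noteq> 0"
    obtain t where t: "t ^ M = f z" "norm t ^ M = norm (f z)" by (rule complex_root_exists[OF M(1)])
    define w where "w = (\<chi> i. case i of None \<Rightarrow> f z | Some j \<Rightarrow> z $ j)"
    have fw: "forget w = z" by (simp add: w_def forget_def)
    have wd: "w \<in> polydisc \<delta>0" unfolding polydisc_def
    proof safe
      fix i show "norm (w $ i) < \<delta>0"
        using e(3)[of z] z(2) Finite_Cartesian_Product.norm_nth_le[of z]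
        by (cases i) (auto simp: w_def intro: le_less_trans)
    qed
    have wr: "w \<in> polydisc r" using wd polydisc_mono[OF \<delta>0(2)] by blast
    have g0: "\<forall>k<s. g k w = 0" using zero_iff[OF inU[OF wr]] z(1) by (simp add: fw) (simp add: w_def)
    have "f z \<noteq> 0" using f(3)[OF z(1)] inU[OF wr] z(3) by (auto simp: fw)
    then have tn: "0 < norm t" using t(1) M(1) by (metis power_eq_0_iff zero_less_norm_iff)
    have tr: "norm t < \<rho>" using e(2)[of z] z(2) t(2) \<rho>(1) by (metis min_less_iff_conj not_le power_mono less_imp_le)
    have "z $ j \<in> Y j (t ^ M)" for j
    proof -
      have "w \<in> polydisc (\<delta> j)" using wd polydisc_mono[OF \<delta>0'] by blast
      then show ?thesis using g0 unfolding Y_def Y0_def by (intro CollectI exI[of _ w]) (auto simp: w_def t)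
    qed
    then have "\<exists>b\<in>\<B> j. z $ j = b t" for j using B(4)[OF tn, of j] tr \<rho>(2)[of j] by (meson order_less_le_trans)
    then obtain b where b: "\<And>j. b j \<in> \<B> j" "\<And>j. z $ j = b j t" by metis
    have "(\<lambda>t. \<chi> j. b j t) \<in> \<S>" unfolding \<S>_def using b(1) by blast
    then show "\<exists>s\<in>\<S>. \<exists>t. 0 < norm t \<and> norm t < \<rho> \<and> z = s t \<and> f z = t ^ M"
      using tn tr t(1) b(2) by (intro bexI[of _ "\<lambda>t. \<chi> j. b j t"] exI[of _ t]) (auto simp: vec_eq_iff)
  qed (use M \<rho> e \<delta>0 in auto)
qed

text \<open>A candidate through 0 either satisfies all equations near 0 or, zeros being isolated,
  violates one of them for all small \<open>t \<noteq> 0\<close>. A candidate that misses 0 stays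
  outside some ball around 0, which is what \<eta> records.\<close>

lemma curve_dichotomy:
  fixes A :: "(complex^'n) set"
  assumes U: "open U" "0 \<in> U" "finite F" "\<And>h. h \<in> F \<Longrightarrow> holomorphic_fun h U" "A \<inter> U = {z \<in> U. \<forall>h\<in>F. h z = 0}"
    and f: "holomorphic_fun f U"
    and s: "curve_holomorphic s (ball 0 \<rho>)" "\<rho> > 0"
  shows "\<exists>\<delta>>0. \<exists>\<eta>>0. \<delta> \<le> \<rho> \<and> ((\<forall>t\<in>ball 0 \<delta>. s t \<in> A \<and> s t \<in> U \<and> f (s t) = t ^ M) \<or>
     (\<forall>t. 0 < norm t \<longrightarrow> norm t < \<delta> \<longrightarrow> norm (s t) < \<eta> \<longrightarrow> \<not> (s t \<in> A \<and> f (s t) = t ^ M)))"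
proof -
  have cont: "continuous_on (ball 0 \<rho>) s" by (rule curve_holomorphic_continuous[OF s(1)])
  have nbhd: "\<exists>\<delta>>0. \<delta> \<le> \<rho> \<and> s ` ball 0 \<delta> \<subseteq> V" if V: "open V" "s 0 \<in> V" for V
  proof -
    have "open (s -` V \<inter> ball 0 \<rho>)" using continuous_open_preimage[OF cont open_ball V(1)] by (simp add: Int_commute)
    moreover have "0 \<in> s -` V \<inter> ball 0 \<rho>" using V s(2) by simp
    ultimately obtain d where "d > 0" "ball 0 d \<subseteq> s -` V \<inter> ball 0 \<rho>" using openE by blast
    then show ?thesis using s(2) by (intro exI[of _ "min d \<rho>"]) auto
  qed
  show ?thesis
  proof (cases "s 0 = 0")
    case False
    have "s 0 \<in> - cball 0 (norm (s 0) / 2)" using False by auto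
    then obtain \<delta> where \<delta>: "\<delta> > 0" "\<delta> \<le> \<rho>" "s ` ball 0 \<delta> \<subseteq> - cball 0 (norm (s 0) / 2)"
      using nbhd[of "- cball 0 (norm (s 0) / 2)"] by blast
    have "\<not> norm (s t) < norm (s 0) / 2" if "norm t < \<delta>" for t
      using \<delta>(3) that by (force simp: image_subset_iff)
    moreover have "norm (s 0) / 2 > 0" using False by simp
    ultimately show ?thesis using \<delta>(1,2) by blast
  next
    case True
    then obtain \<rho>1 where \<rho>1: "\<rho>1 > 0" "\<rho>1 \<le> \<rho>" "s ` ball 0 \<rho>1 \<subseteq> U" using nbhd[OF U(1)] U(2) by auto
    have s1: "curve_holomorphic s (ball 0 \<rho>1)" by (rule curve_holomorphic_subset[OF s(1)]) (use \<rho>1 in auto)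
    define K where "K = insert (\<lambda>t. f (s t) - t ^ M) ((\<lambda>h t. h (s t)) ` F)"
    have "finite K" using U(3) by (simp add: K_def)
    have hol: "k holomorphic_on ball 0 \<rho>1" if "k \<in> K" for k
      using that f U(4) by (auto simp: K_def intro!: holomorphic_intros holomorphic_fun_curve[OF _ s1 open_ball \<rho>1(3)])
    have zero: "(\<forall>k\<in>K. k t = 0) \<longleftrightarrow> s t \<in> A \<and> f (s t) = t ^ M" if "t \<in> ball 0 \<rho>1" for t
    proof -
      have "s t \<in> U" using \<rho>1(3) that by blast
      then have "s t \<in> A \<longleftrightarrow> (\<forall>h\<in>F. h (s t) = 0)" using U(5) by blast
      then show ?thesis by (auto simp: K_def)
    qed
    have "\<exists>\<delta>. 0 < \<delta> \<and> \<delta> \<le> \<rho>1 \<and> ((\<forall>t\<in>ball 0 \<delta>. k t = 0) \<or> (\<forall>t\<in>ball 0 \<delta>. t \<noteq> 0 \<longrightarrow> k t \<noteq> 0))" if "k \<in> K" for k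
      by (rule holomorphic_zero_dichotomy[OF hol[OF that] \<rho>1(1)]) blast
    then obtain d where d: "\<And>k. k \<in> K \<Longrightarrow> 0 < d k" "\<And>k. k \<in> K \<Longrightarrow> d k \<le> \<rho>1"
      "\<And>k. k \<in> K \<Longrightarrow> (\<forall>t\<in>ball 0 (d k). k t = 0) \<or> (\<forall>t\<in>ball 0 (d k). t \<noteq> 0 \<longrightarrow> k t \<noteq> 0)" by metis
    define \<delta> where "\<delta> = Min (insert \<rho>1 (d ` K))"
    have \<delta>: "\<delta> > 0" using \<open>finite K\<close> d(1) \<rho>1(1) by (auto simp: \<delta>_def)
    have \<delta>': "\<delta> \<le> \<rho>1" "\<And>k. k \<in> K \<Longrightarrow> \<delta> \<le> d k" unfolding \<delta>_def by (rule Min_le; use \<open>finite K\<close> in auto)+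
    have "(\<forall>t\<in>ball 0 \<delta>. s t \<in> A \<and> s t \<in> U \<and> f (s t) = t ^ M) \<or>
     (\<forall>t. 0 < norm t \<longrightarrow> norm t < \<delta> \<longrightarrow> norm (s t) < 1 \<longrightarrow> \<not> (s t \<in> A \<and> f (s t) = t ^ M))"
    proof (cases "\<forall>k\<in>K. \<forall>t\<in>ball 0 (d k). k t = 0")
      case True
      have "s t \<in> A \<and> s t \<in> U \<and> f (s t) = t ^ M" if t: "t \<in> ball 0 \<delta>" for t
      proof -
        have "t \<in> ball 0 \<rho>1" "\<And>k. k \<in> K \<Longrightarrow> t \<in> ball 0 (d k)" using t \<delta>' by force+
        then have "\<forall>k\<in>K. k t = 0" using True by blast
        then show ?thesis using zero[OF \<open>t \<in> ball 0 \<rho>1\<close>] \<rho>1(3) \<open>t \<in> ball 0 \<rho>1\<close> by blast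
      qed
      then show ?thesis by blast
    next
      case False
      then obtain k where k: "k \<in> K" "\<forall>t\<in>ball 0 (d k). t \<noteq> 0 \<longrightarrow> k t \<noteq> 0" using d(3) by blast
      have "\<not> (s t \<in> A \<and> f (s t) = t ^ M)" if t: "0 < norm t" "norm t < \<delta>" for t
      proof -
        have "t \<in> ball 0 \<rho>1" "t \<in> ball 0 (d k)" "t \<noteq> 0" using t \<delta>' k(1) by force+
        then show ?thesis using zero k by blast
      qed
      then show ?thesis by blast
    qed
    moreover have "\<delta> \<le> \<rho>" using \<delta>' \<rho>1 by linarith
    moreover have "(1::real) > 0" by simp
    ultimately show ?thesis using \<delta> by blast
  qed
qed

lemma isCont_small:
  fixes f :: "'a::real_normed_vector \<Rightarrow> complex"
  assumes "isCont f 0" "f 0 = 0" "c > 0"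
  obtains e where "e > 0" "\<And>z. norm z < e \<Longrightarrow> norm (f z) < c"
  using assms(1)[unfolded continuous_at_eps_delta, rule_format, OF assms(3)] assms(2) by (auto simp: dist_norm)

text \<open>Dropping the bad candidates loses no point of \<open>A\<close> near 0: such a point lies
  on a candidate at a parameter with \<open>t ^ M = f z\<close>, which is small together with
  \<open>z\<close>.\<close>

lemma curve_union:
  fixes A :: "(complex^'n) set"
  assumes U: "open U" "0 \<in> U" "finite F" "\<And>h. h \<in> F \<Longrightarrow> holomorphic_fun h U" "A \<inter> U = {z \<in> U. \<forall>h\<in>F. h z = 0}"
    and f: "holomorphic_fun f U" "f 0 = 0" "\<And>z. z \<in> A \<Longrightarrow> z \<in> U \<Longrightarrow> f z = 0 \<Longrightarrow> z = 0"
  obtains M \<rho> \<G> \<eta> where "M > 0" "\<rho> > 0" "finite \<G>" "\<And>s. s \<in> \<G> \<Longrightarrow> curve_holomorphic s (ball 0 \<rho>)"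
    "\<And>s t. s \<in> \<G> \<Longrightarrow> t \<in> ball 0 \<rho> \<Longrightarrow> s t \<in> A \<and> s t \<in> U \<and> f (s t) = t ^ M"
    "\<eta> > 0" "\<And>z. z \<in> A \<Longrightarrow> norm z < \<eta> \<Longrightarrow> z \<noteq> 0 \<Longrightarrow> \<exists>s\<in>\<G>. z \<in> s ` ball 0 \<rho>"
proof (rule curve_cover[OF U f])
  fix M \<rho> \<S> \<eta>
  assume *: "M > 0" "\<rho> > 0" "finite \<S>" "\<And>s. s \<in> \<S> \<Longrightarrow> curve_holomorphic s (ball 0 \<rho>)" "\<eta> > 0"
    "\<And>z. z \<in> A \<Longrightarrow> norm z < \<eta> \<Longrightarrow> z \<noteq> 0 \<Longrightarrow> \<exists>s\<in>\<S>. \<exists>t. 0 < norm t \<and> norm t < \<rho> \<and> z = s t \<and> f z = t ^ M"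
  define good where "good s \<delta> \<longleftrightarrow> (\<forall>t\<in>ball 0 \<delta>. s t \<in> A \<and> s t \<in> U \<and> f (s t) = t ^ M)" for s \<delta>
  have "\<exists>\<delta>>0. \<exists>\<eta>>0. \<delta> \<le> \<rho> \<and> (good s \<delta> \<or>
     (\<forall>t. 0 < norm t \<longrightarrow> norm t < \<delta> \<longrightarrow> norm (s t) < \<eta> \<longrightarrow> \<not> (s t \<in> A \<and> f (s t) = t ^ M)))" if "s \<in> \<S>" for s
    unfolding good_def using curve_dichotomy[OF U f(1) *(4)[OF that] *(2)] .
  then obtain \<delta> \<eta>' where d: "\<And>s. s \<in> \<S> \<Longrightarrow> \<delta> s > 0" "\<And>s. s \<in> \<S> \<Longrightarrow> \<eta>' s > 0" "\<And>s. s \<in> \<S> \<Longrightarrow> \<delta> s \<le> \<rho>"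
     "\<And>s. s \<in> \<S> \<Longrightarrow> good s (\<delta> s) \<or>
     (\<forall>t. 0 < norm t \<longrightarrow> norm t < \<delta> s \<longrightarrow> norm (s t) < \<eta>' s \<longrightarrow> \<not> (s t \<in> A \<and> f (s t) = t ^ M))" by metis
  define \<delta>0 where "\<delta>0 = Min (insert \<rho> (\<delta> ` \<S>))"
  define \<eta>0 where "\<eta>0 = Min (insert \<eta> (\<eta>' ` \<S>))"
  have pos: "\<delta>0 > 0" "\<eta>0 > 0" using d * by (auto simp: \<delta>0_def \<eta>0_def)
  have le: "\<delta>0 \<le> \<rho>" "\<And>s. s \<in> \<S> \<Longrightarrow> \<delta>0 \<le> \<delta> s" unfolding \<delta>0_def by (rule Min_le; use *(3) in auto)+
  have le': "\<eta>0 \<le> \<eta>" "\<And>s. s \<in> \<S> \<Longrightarrow> \<eta>0 \<le> \<eta>' s" unfolding \<eta>0_def by (rule Min_le; use *(3) in auto)+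
  have "isCont f 0"
    using holomorphic_fun_continuous[OF f(1)] U(1,2) continuous_on_eq_continuous_at by blast
  from isCont_small[OF this f(2), of "\<delta>0 ^ M"] pos obtain e where e: "e > 0" "\<And>z. norm z < e \<Longrightarrow> norm (f z) < \<delta>0 ^ M"
    by auto
  define \<G> where "\<G> = {s \<in> \<S>. good s (\<delta> s)}"
  show ?thesis
  proof (rule that[of M \<delta>0 \<G> "min e \<eta>0"])
    show "curve_holomorphic s (ball 0 \<delta>0)" if "s \<in> \<G>" for s
      by (rule curve_holomorphic_subset[OF *(4)]) (use that le in \<open>auto simp: \<G>_def\<close>)
    show "s t \<in> A \<and> s t \<in> U \<and> f (s t) = t ^ M" if "s \<in> \<G>" "t \<in> ball 0 \<delta>0" for s t
      using that le(2)[of s] by (auto simp: \<G>_def good_def)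
    fix z assume z: "z \<in> A" "norm z < min e \<eta>0" "z \<noteq> 0"
    then obtain s t where st: "s \<in> \<S>" "0 < norm t" "z = s t" "f z = t ^ M" using *(6)[of z] le' by auto
    have "norm t ^ M < \<delta>0 ^ M" using e(2)[of z] z(2) st(4) by (simp add: norm_power)
    then have t: "norm t < \<delta>0" using pos(1) by (meson not_le power_mono less_imp_le)
    have "\<not> (0 < norm t \<longrightarrow> norm t < \<delta> s \<longrightarrow> norm (s t) < \<eta>' s \<longrightarrow> \<not> (s t \<in> A \<and> f (s t) = t ^ M))"
      using st t le(2)[OF st(1)] le'(2)[OF st(1)] z by auto
    then have "s \<in> \<G>" using d(4)[OF st(1)] st(1) by (auto simp: \<G>_def)
    then show "\<exists>s\<in>\<G>. z \<in> s ` ball 0 \<delta>0" using st(3) t by (intro bexI[of _ s]) auto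
  qed (use * pos e in \<open>auto simp: \<G>_def\<close>)
qed

section \<open>Norms over the fibres of a power map\<close>

lemma power_minus_family:
  assumes "e > 0" "0 < \<epsilon>" "4 * \<epsilon> \<le> \<rho>" "E holomorphic_on ball 0 \<rho>"
  obtains K where "norm_family (ball (0::complex) (\<epsilon> ^ e)) \<epsilon> (2 * \<epsilon>) (\<lambda>x \<zeta>. \<zeta> ^ e - x) (\<lambda>x. E) K"
proof -
  have "continuous_on (ball 0 \<rho>) E" by (rule holomorphic_on_imp_continuous_on) fact
  then have "continuous_on (cball 0 (2 * \<epsilon>)) E" by (rule continuous_on_subset) (use assms in auto)
  then have "bounded (E ` cball 0 (2 * \<epsilon>))" by (intro compact_imp_bounded compact_continuous_image) auto
  then obtain B where B: "\<forall>\<zeta>\<in>cball 0 (2 * \<epsilon>). norm (E \<zeta>) \<le> B" by (auto simp: bounded_iff)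
  have "norm_family (ball (0::complex) (\<epsilon> ^ e)) \<epsilon> (2 * \<epsilon>) (\<lambda>x \<zeta>. \<zeta> ^ e - x) (\<lambda>x. E) (B + 1)"
  proof
    show "continuous_on (ball 0 (\<epsilon> ^ e) \<times> ball 0 (2 * \<epsilon>)) (\<lambda>(x::complex, \<zeta>). E \<zeta>)"
      unfolding case_prod_unfold
      by (rule continuous_on_compose2[OF \<open>continuous_on (ball 0 \<rho>) E\<close>]) (use assms in \<open>auto intro!: continuous_intros\<close>)
    show "E holomorphic_on ball 0 (2 * \<epsilon>)" by (rule holomorphic_on_subset[OF assms(4)]) (use assms in auto)
    show "norm (E \<zeta>) < B + 1" if "\<zeta> \<in> ball 0 (2 * \<epsilon>)" for \<zeta>
      using B[rule_format, of \<zeta>] that by auto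
    show "\<zeta> ^ e - x \<noteq> 0" if "x \<in> ball 0 (\<epsilon> ^ e)" "\<zeta> \<in> sphere 0 \<epsilon>" for x \<zeta> :: complex
      using that by (auto simp: norm_power)
  qed (use assms in \<open>auto intro!: continuous_intros holomorphic_intros simp: case_prod_unfold\<close>)
  then show ?thesis by (rule that)
qed

lemma power_minus_norm_poly:
  assumes "e > 0" "0 < \<epsilon>" "4 * \<epsilon> \<le> \<rho>" "E holomorphic_on ball 0 \<rho>"
  shows "\<And>j. (\<lambda>x. coeff (norm_poly \<epsilon> (\<lambda>\<zeta>. \<zeta> ^ e - x) E) j) holomorphic_on ball 0 (\<epsilon> ^ e)"
    and "\<And>x. norm x < \<epsilon> ^ e \<Longrightarrow> degree (norm_poly \<epsilon> (\<lambda>\<zeta>. \<zeta> ^ e - x) E) = degree (norm_poly \<epsilon> (\<lambda>\<zeta>. \<zeta> ^ e) E)"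
    and "\<And>x w. norm x < \<epsilon> ^ e \<Longrightarrow> poly (norm_poly \<epsilon> (\<lambda>\<zeta>. \<zeta> ^ e - x) E) w = 0 \<longleftrightarrow> (\<exists>\<zeta>. norm \<zeta> < \<epsilon> \<and> \<zeta> ^ e = x \<and> E \<zeta> = w)"
proof -
  obtain K where nf: "norm_family (ball (0::complex) (\<epsilon> ^ e)) \<epsilon> (2 * \<epsilon>) (\<lambda>x \<zeta>. \<zeta> ^ e - x) (\<lambda>x. E) K"
    by (rule power_minus_family[OF assms])
  interpret norm_family "ball (0::complex) (\<epsilon> ^ e)" \<epsilon> "2 * \<epsilon>" "\<lambda>x \<zeta>. \<zeta> ^ e - x" "\<lambda>x. E" K by (rule nf)
  show "(\<lambda>x. coeff (norm_poly \<epsilon> (\<lambda>\<zeta>. \<zeta> ^ e - x) E) j) holomorphic_on ball 0 (\<epsilon> ^ e)" for j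
    by (rule coeff_holomorphic[where f = "\<lambda>x. x"]) (auto intro!: holomorphic_intros)
  show "degree (norm_poly \<epsilon> (\<lambda>\<zeta>. \<zeta> ^ e - x) E) = degree (norm_poly \<epsilon> (\<lambda>\<zeta>. \<zeta> ^ e) E)" if "norm x < \<epsilon> ^ e" for x
    using degree_const[of x 0] that assms(2) by simp
  show "poly (norm_poly \<epsilon> (\<lambda>\<zeta>. \<zeta> ^ e - x) E) w = 0 \<longleftrightarrow> (\<exists>\<zeta>. norm \<zeta> < \<epsilon> \<and> \<zeta> ^ e = x \<and> E \<zeta> = w)" if "norm x < \<epsilon> ^ e" for x w
    using norm_poly_zero_iff[OF eps q_hol q_nz, of x E w] that by simp
qed

text \<open>As \<open>E\<close> is constant on the fibres of \<open>t ^ e\<close>, its norm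
  polynomial over a fibre is a pure power of \<open>[:- E t, 1:]\<close>, and the coefficient below
  the leading one, divided by minus the degree, returns \<open>E\<close>. Holomorphy of the quotient
  function, including the branch point 0, comes with the construction.\<close>

lemma descend_power:
  assumes "e > 0" "\<rho> > 0" and E: "E holomorphic_on ball 0 \<rho>"
    and inv: "\<And>t t'. t \<in> ball 0 \<rho> \<Longrightarrow> t' \<in> ball 0 \<rho> \<Longrightarrow> t ^ e = t' ^ e \<Longrightarrow> E t = E t'"
  shows "\<exists>g. g holomorphic_on ball 0 ((\<rho> / 4) ^ e) \<and> (\<forall>t\<in>ball 0 (\<rho> / 4). E t = g (t ^ e))"
proof -
  define \<epsilon> where "\<epsilon> = \<rho> / 4"
  have \<epsilon>: "0 < \<epsilon>" "4 * \<epsilon> \<le> \<rho>" using assms by (auto simp: \<epsilon>_def)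
  note P = power_minus_norm_poly[OF \<open>e > 0\<close> \<epsilon> E]
  define d where "d = degree (norm_poly \<epsilon> (\<lambda>\<zeta>. \<zeta> ^ e) E)"
  define g where "g x = - coeff (norm_poly \<epsilon> (\<lambda>\<zeta>. \<zeta> ^ e - x) E) (d - 1) / of_nat d" for x
  have "d > 0"
  proof (rule ccontr)
    assume "\<not> d > 0"
    then obtain c where c: "norm_poly \<epsilon> (\<lambda>\<zeta>. \<zeta> ^ e) E = [:c:]" unfolding d_def by (metis degree_eq_zeroE gr0I)
    have "poly (norm_poly \<epsilon> (\<lambda>\<zeta>. \<zeta> ^ e) E) (E 0) = 0"
      using P(3)[of 0 "E 0"] \<epsilon> \<open>e > 0\<close> by auto
    then have "c = 0" using c by simp
    then show False using c norm_poly_degree(2)[of \<epsilon> "\<lambda>\<zeta>. \<zeta> ^ e" E] by simp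
  qed
  have "E t = g (t ^ e)" if t: "t \<in> ball 0 \<epsilon>" for t
  proof -
    have x: "norm (t ^ e) < \<epsilon> ^ e" using t assms(1) by (simp add: norm_power power_strict_mono)
    define Z where "Z = zeros_in \<epsilon> (\<lambda>\<zeta>. \<zeta> ^ e - t ^ e)"
    have "norm_poly \<epsilon> (\<lambda>\<zeta>. \<zeta> ^ e - t ^ e) E = (\<Prod>\<alpha>\<in>Z. [:- E t, 1:] ^ nat (zorder (\<lambda>\<zeta>. \<zeta> ^ e - t ^ e) \<alpha>))"
      unfolding norm_poly_def Z_def[symmetric]
    proof (rule prod.cong[OF refl])
      fix \<alpha> assume "\<alpha> \<in> Z"
      then have "E \<alpha> = E t" using t \<epsilon> by (intro inv) (auto simp: Z_def zeros_in_def)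
      then show "[:- E \<alpha>, 1:] ^ nat (zorder (\<lambda>\<zeta>. \<zeta> ^ e - t ^ e) \<alpha>) = [:- E t, 1:] ^ nat (zorder (\<lambda>\<zeta>. \<zeta> ^ e - t ^ e) \<alpha>)" by simp
    qed
    also have "\<dots> = [:- E t, 1:] ^ d"
      unfolding power_sum[symmetric] Z_def using P(2)[OF x] by (simp only: norm_poly_degree d_def)
    finally have "coeff (norm_poly \<epsilon> (\<lambda>\<zeta>. \<zeta> ^ e - t ^ e) E) (d - 1) = of_nat d * - E t"
      using \<open>d > 0\<close> coeff_linear_poly_power[of "d - 1" d "- E t" 1] binomial_symmetric[of 1 d] by simp
    then show ?thesis using \<open>d > 0\<close> by (simp add: g_def)
  qed
  moreover have "g holomorphic_on ball 0 (\<epsilon> ^ e)"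
    unfolding g_def[abs_def] using \<open>d > 0\<close> by (intro holomorphic_intros P(1)) auto
  ultimately show ?thesis unfolding \<epsilon>_def by blast
qed

text \<open>A point \<open>z\<close> lies on the curve iff it agrees with some \<open>s \<zeta>\<close>, \<open>\<zeta> ^ M = f z\<close>, under enough linear forms
  \<open>\<Sum>i. k ^ i * z $ i\<close>; for a single form this is the vanishing of a norm polynomial.\<close>

lemma analytic_at_curve_image:
  fixes s :: "complex \<Rightarrow> complex^'n"
  assumes "M > 0" "\<rho> > 0" and s: "curve_holomorphic s (ball 0 \<rho>)"
    and U: "open U" "0 \<in> U" and f: "holomorphic_fun f U" "f 0 = 0"
    and sf: "\<And>t. t \<in> ball 0 \<rho> \<Longrightarrow> s t \<in> U \<and> f (s t) = t ^ M"
  shows "analytic_at 0 (s ` ball 0 \<rho>)"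
proof -
  define \<epsilon> where "\<epsilon> = \<rho> / 4"
  have \<epsilon>: "0 < \<epsilon>" "4 * \<epsilon> \<le> \<rho>" using assms by (auto simp: \<epsilon>_def)
  obtain n where n: "bij_betw n (UNIV :: 'n set) {..<CARD('n)}"
    using ex_bij_betw_finite_nat[of "UNIV :: 'n set"] by (auto simp: lessThan_atLeast0)
  define l where "l k z = (\<Sum>i\<in>UNIV. of_nat k ^ n i * z $ i :: complex)" for k :: nat and z :: "complex^'n"
  define E where "E k t = l k (s t)" for k t
  have E: "E k holomorphic_on ball 0 \<rho>" for k
    unfolding E_def[abs_def] l_def using s by (intro holomorphic_intros) (auto simp: curve_holomorphic_def)
  note P = power_minus_norm_poly[OF \<open>M > 0\<close> \<epsilon> E]
  define d where "d k = degree (norm_poly \<epsilon> (\<lambda>\<zeta>. \<zeta> ^ M) (E k))" for k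
  \<comment> \<open>The norm polynomial of \<open>l k\<close> along the curve over the fibre of
    \<open>f z\<close>, evaluated at \<open>l k z\<close>.\<close>
  define Q where "Q k z = (\<Sum>j\<le>d k. coeff (norm_poly \<epsilon> (\<lambda>\<zeta>. \<zeta> ^ M - f z) (E k)) j * l k z ^ j)" for k z
  define V where "V = U \<inter> f -` ball 0 (\<epsilon> ^ M)"
  have V: "open V" "0 \<in> V"
    using continuous_open_preimage[OF holomorphic_fun_continuous[OF f(1)] U(1) open_ball] U(2) f(2) \<epsilon>(1)
    by (auto simp: V_def)
  have fV: "f ` V \<subseteq> ball 0 (\<epsilon> ^ M)" "holomorphic_fun f V"
    using f(1) by (auto simp: V_def intro: holomorphic_fun_subset)
  have holQ: "holomorphic_fun (Q k) V" for k
    unfolding Q_def[abs_def] l_def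
    by (intro holomorphic_fun_sum holomorphic_fun_mult holomorphic_fun_power holomorphic_fun_nth holomorphic_fun_const
         holomorphic_fun_compose[OF fV(2) P(1) open_ball fV(1)])
  have Q0: "Q k z = 0 \<longleftrightarrow> (\<exists>\<zeta>. norm \<zeta> < \<epsilon> \<and> \<zeta> ^ M = f z \<and> l k (s \<zeta>) = l k z)" if "z \<in> V" for k z
  proof -
    have x: "norm (f z) < \<epsilon> ^ M" using that by (simp add: V_def)
    have "Q k z = poly (norm_poly \<epsilon> (\<lambda>\<zeta>. \<zeta> ^ M - f z) (E k)) (l k z)"
      unfolding Q_def d_def poly_altdef P(2)[OF x] ..
    then show ?thesis using P(3)[OF x] by (simp add: E_def)
  qed
  \<comment> \<open>At most \<open>M\<close> parameters lie over \<open>f z\<close>, and a point has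
    \<open>CARD('n)\<close> coordinates; this is the count for the pigeonhole argument.\<close>
  define m where "m = M * CARD('n) + 1"
  have "s ` ball 0 \<rho> \<inter> V = {z \<in> V. \<forall>h\<in>Q ` {..<m}. h z = 0}"
  proof (intro equalityI subsetI)
    fix z assume z: "z \<in> s ` ball 0 \<rho> \<inter> V"
    then obtain t where t: "t \<in> ball 0 \<rho>" "z = s t" by auto
    have ft: "f z = t ^ M" using sf[OF t(1)] t(2) by simp
    have "norm t ^ M < \<epsilon> ^ M" using z ft by (auto simp: V_def norm_power)
    then have "norm t < \<epsilon>" using \<epsilon>(1) by (meson not_le power_mono less_imp_le)
    then have "Q k z = 0" for k using Q0[of z k] z ft t(2) by auto
    then show "z \<in> {z \<in> V. \<forall>h\<in>Q ` {..<m}. h z = 0}" using z by auto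
  next
    fix z assume z: "z \<in> {z \<in> V. \<forall>h\<in>Q ` {..<m}. h z = 0}"
    define Z where "Z = {\<zeta>. \<zeta> ^ M = f z \<and> norm \<zeta> < \<epsilon>}"
    define p where "p = monom 1 M - [:f z:]"
    have "coeff p M = 1" using \<open>M > 0\<close> by (simp add: p_def coeff_pCons split: nat.split)
    then have "p \<noteq> 0" by auto
    have "degree p \<le> M" unfolding p_def by (intro degree_diff_le) (auto simp: degree_monom_le)
    have Zp: "Z \<subseteq> {x. poly p x = 0}" by (auto simp: Z_def p_def poly_monom)
    have "finite Z" by (rule finite_subset[OF Zp poly_roots_finite[OF \<open>p \<noteq> 0\<close>]])
    have "card Z \<le> M"
      using card_mono[OF poly_roots_finite[OF \<open>p \<noteq> 0\<close>] Zp] card_poly_roots_bound[OF \<open>p \<noteq> 0\<close>] \<open>degree p \<le> M\<close> by linarith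
    define a where "a \<zeta> j = (z - s \<zeta>) $ inv_into UNIV n j" for \<zeta> j
    have lsum: "(\<Sum>j<CARD('n). of_nat k ^ j * a \<zeta> j) = l k z - l k (s \<zeta>)" for k \<zeta>
    proof -
      have "(\<Sum>j<CARD('n). of_nat k ^ j * a \<zeta> j) = (\<Sum>i\<in>UNIV. of_nat k ^ n i * a \<zeta> (n i))"
        by (rule sum.reindex_bij_betw[OF n, symmetric])
      also have "\<dots> = (\<Sum>i\<in>UNIV. of_nat k ^ n i * (z $ i - s \<zeta> $ i))"
        using n by (simp add: a_def bij_betw_def)
      finally show ?thesis by (simp add: l_def right_diff_distrib sum_subtractf)
    qed
    have "\<exists>\<zeta>\<in>Z. \<forall>j<CARD('n). a \<zeta> j = 0"
    proof (rule vandermonde_pigeonhole[OF \<open>finite Z\<close>])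
      show "card Z * CARD('n) < m" using \<open>card Z \<le> M\<close> by (auto simp: m_def less_Suc_eq_le)
      show "\<exists>\<zeta>\<in>Z. (\<Sum>j<CARD('n). of_nat k ^ j * a \<zeta> j) = 0" if "k < m" for k
        using z that Q0[of z k] unfolding lsum by (auto simp: Z_def)
    qed
    then obtain \<zeta> where \<zeta>: "\<zeta> \<in> Z" "\<forall>j<CARD('n). a \<zeta> j = 0" by blast
    have "z $ i = s \<zeta> $ i" for i
    proof -
      have "n i < CARD('n)" "inv_into UNIV n (n i) = i" using n by (auto simp: bij_betw_def)
      then show ?thesis using \<zeta>(2)[rule_format, of "n i"] by (simp add: a_def)
    qed
    then have "z = s \<zeta>" by (simp add: vec_eq_iff)
    moreover have "\<zeta> \<in> ball 0 \<rho>" using \<zeta>(1) \<epsilon> by (auto simp: Z_def)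
    ultimately show "z \<in> s ` ball 0 \<rho> \<inter> V" using z by auto
  qed
  then show ?thesis unfolding analytic_at_def
    by (intro exI[of _ V] exI[of _ "Q ` {..<m}"]) (use V holQ in auto)
qed

text \<open>Each curve of the covering has an analytic image, so the germ is a finite union of
  analytic germs and irreducibility selects one of them.\<close>

lemma irreducible_germ_curve:
  fixes A :: "(complex^'n) set"
  assumes "irreducible_germ A" "germ_dim A = 1"
  obtains M \<rho> s f U where "M > 0" "\<rho> > 0" "curve_holomorphic s (ball 0 \<rho>)" "open U" "0 \<in> U" "holomorphic_fun f U" "f 0 = 0"
    "\<And>t. t \<in> ball 0 \<rho> \<Longrightarrow> s t \<in> U \<and> f (s t) = t ^ M" "s 0 = 0" "germ_eq A (s ` ball 0 \<rho>)"
proof -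
  have A: "0 \<in> A" "analytic_at 0 A" using assms(1) by (auto simp: irreducible_germ_def analytic_germ_def)
  obtain U1 F where F: "open U1" "0 \<in> U1" "finite F" "\<forall>h\<in>F. holomorphic_fun h U1" "A \<inter> U1 = {z \<in> U1. \<forall>h\<in>F. h z = 0}"
    using A(2) unfolding analytic_at_def by blast
  obtain U2 f where f: "open U2" "0 \<in> U2" "holomorphic_fun f U2" "f 0 = 0" "\<And>z. z \<in> A \<Longrightarrow> z \<in> U2 \<Longrightarrow> f z = 0 \<Longrightarrow> z = 0"
    "\<And>V. open V \<Longrightarrow> 0 \<in> V \<Longrightarrow> \<exists>z\<in>A \<inter> V. z \<noteq> 0" by (rule germ_dim_1D[OF assms(2)]) blast
  define U where "U = U1 \<inter> U2"
  have U: "open U" "0 \<in> U" using F f by (auto simp: U_def)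
  have FU: "\<And>h. h \<in> F \<Longrightarrow> holomorphic_fun h U" "A \<inter> U = {z \<in> U. \<forall>h\<in>F. h z = 0}"
    using F(4,5) by (auto simp: U_def intro: holomorphic_fun_subset)
  have fU: "holomorphic_fun f U" "\<And>z. z \<in> A \<Longrightarrow> z \<in> U \<Longrightarrow> f z = 0 \<Longrightarrow> z = 0"
    using f(3,5) by (auto simp: U_def intro: holomorphic_fun_subset)
  show ?thesis
  proof (rule curve_union[OF U F(3) FU fU(1) f(4) fU(2)])
    fix M \<rho> \<G> \<eta>
    assume *: "M > 0" "\<rho> > 0" "finite \<G>" "\<And>s. s \<in> \<G> \<Longrightarrow> curve_holomorphic s (ball 0 \<rho>)"
      "\<And>s t. s \<in> \<G> \<Longrightarrow> t \<in> ball 0 \<rho> \<Longrightarrow> s t \<in> A \<and> s t \<in> U \<and> f (s t) = t ^ M"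
      "\<eta> > 0" "\<And>z. z \<in> A \<Longrightarrow> norm z < \<eta> \<Longrightarrow> z \<noteq> 0 \<Longrightarrow> \<exists>s\<in>\<G>. z \<in> s ` ball 0 \<rho>"
    have s0: "s 0 = 0" if "s \<in> \<G>" for s
      using *(5)[OF that, of 0] *(1,2) fU(2)[of "s 0"] by auto
    obtain z0 where "z0 \<in> A \<inter> ball 0 \<eta>" "z0 \<noteq> 0" using f(6)[of "ball 0 \<eta>"] *(6) by auto
    then obtain s1 where s1: "s1 \<in> \<G>" using *(7)[of z0] by auto
    have "z \<in> A \<longleftrightarrow> z \<in> (\<Union>s\<in>\<G>. s ` ball 0 \<rho>)" if z: "norm z < \<eta>" for z
    proof
      assume "z \<in> A"
      show "z \<in> (\<Union>s\<in>\<G>. s ` ball 0 \<rho>)"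
      proof (cases "z = 0")
        case True
        have "0 \<in> s1 ` ball 0 \<rho>" by (rule image_eqI[of _ _ 0]) (use s0[OF s1] *(2) in auto)
        then show ?thesis using True s1 by blast
      qed (use *(7)[OF \<open>z \<in> A\<close> z] in auto)
    qed (use *(5) in auto)
    moreover have "\<forall>\<^sub>F z in nhds 0. z \<in> ball (0 :: complex^'n) \<eta>"
      by (rule eventually_nhds_in_open) (use *(6) in auto)
    ultimately have "germ_eq A (\<Union>s\<in>\<G>. s ` ball 0 \<rho>)"
      unfolding germ_eq_def by (auto elim!: eventually_mono)
    moreover have "analytic_at 0 (s ` ball 0 \<rho>)" if "s \<in> \<G>" for s
      by (rule analytic_at_curve_image[OF *(1,2) *(4)[OF that] U fU(1) f(4)]) (use *(5)[OF that] in auto)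
    ultimately obtain s where s: "s \<in> \<G>" "germ_eq A (s ` ball 0 \<rho>)"
      using irreducible_germ_UN[OF assms(1) *(3), of "\<lambda>s. s ` ball 0 \<rho>"] by auto
    show ?thesis
      by (rule that[OF *(1,2) *(4)[OF s(1)] U fU(1) f(4) _ s0[OF s(1)] s(2)]) (use *(5)[OF s(1)] in auto)
  qed
qed

text \<open>Multiplication by an element permutes \<open>H\<close>, and comparing the products over
  \<open>H\<close> shows that its order divides \<open>card H\<close>. There are at most
  \<open>card H\<close> such roots of unity, so \<open>H\<close> exhausts them.\<close>

lemma symmetry_group_roots:
  fixes H :: "complex set"
  assumes "finite H" "1 \<in> H" "\<And>g h. g \<in> H \<Longrightarrow> h \<in> H \<Longrightarrow> g * h \<in> H" "0 \<notin> H"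
  shows "H = {h. h ^ card H = 1}"
proof -
  have "h ^ card H = 1" if "h \<in> H" for h
  proof -
    have inj: "inj_on (\<lambda>x. h * x) H" using that assms(4) by (auto simp: inj_on_def)
    have "(\<lambda>x. h * x) ` H = H"
      by (rule endo_inj_surj[OF assms(1) _ inj]) (use that assms(3) in auto)
    then have "(\<Prod>x\<in>H. x) = (\<Prod>x\<in>H. h * x)"
      using prod.reindex[OF inj, of "\<lambda>x. x"] by simp
    also have "\<dots> = h ^ card H * (\<Prod>x\<in>H. x)" by (simp add: prod.distrib)
    finally show ?thesis using assms(1,4) by auto
  qed
  then have sub: "H \<subseteq> {h. h ^ card H = 1}" by auto
  have c: "card H \<ge> 1" using assms(1,2) by (metis One_nat_def Suc_leI card_gt_0_iff empty_iff)
  show ?thesis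
  proof (rule card_seteq[OF _ sub])
    show "finite {h :: complex. h ^ card H = 1}" using c by (intro finite_roots_unity) auto
    show "card {h :: complex. h ^ card H = 1} \<le> card H" using c by (intro card_roots_unity) auto
  qed
qed

text \<open>The curve \<open>s\<close> may trace its image several times. The rotations preserving
  it are the \<open>e\<close>-th roots of unity for some \<open>e\<close>, so \<open>s\<close>
  descends to a function of \<open>t ^ e\<close>. The result is injective near 0: equal points have
  equal \<open>f\<close>, hence parameters that differ by an \<open>M\<close>-th root of unity, and
  roots outside the symmetry group separate all small nonzero parameters.\<close>

theorem irreducible_germ_parametrization:
  fixes A :: "(complex^'n) set"
  assumes "irreducible_germ A" "germ_dim A = 1"
  obtains \<psi> \<rho> where "\<rho> > 0" "curve_holomorphic \<psi> (ball 0 \<rho>)" "inj_on \<psi> (ball 0 \<rho>)" "\<psi> 0 = 0"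
    "\<And>\<rho>'. 0 < \<rho>' \<Longrightarrow> \<rho>' \<le> \<rho> \<Longrightarrow> germ_eq A (\<psi> ` ball 0 \<rho>')"
proof (rule irreducible_germ_curve[OF assms])
  fix M :: nat and \<rho> :: real and s f and U :: "(complex^'n) set"
  assume *: "M > 0" "\<rho> > 0" "curve_holomorphic s (ball 0 \<rho>)" "open U" "0 \<in> U" "holomorphic_fun f U" "f 0 = 0"
    "\<And>t. t \<in> ball 0 \<rho> \<Longrightarrow> s t \<in> U \<and> f (s t) = t ^ M" "s 0 = 0" "germ_eq A (s ` ball 0 \<rho>)"
  define R where "R = {\<omega> :: complex. \<omega> ^ M = 1}"
  have finR: "finite R" unfolding R_def using *(1) by (intro finite_roots_unity) auto
  have normR: "norm \<omega> = 1" if "\<omega> \<in> R" for \<omega>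
    using that *(1) power_eq_1_iff[of \<omega> M] by (auto simp: R_def)
  define H where "H = {\<omega> \<in> R. \<forall>t\<in>ball 0 \<rho>. s (\<omega> * t) = s t}"
  have inb: "\<omega> * t \<in> ball 0 \<rho>" if "\<omega> \<in> R" "t \<in> ball 0 \<rho>" for \<omega> t
    using that normR by (simp add: norm_mult)
  define e where "e = card H"
  have Heq: "H = {h. h ^ e = 1}" unfolding e_def
  proof (rule symmetry_group_roots)
    show "g * h \<in> H" if "g \<in> H" "h \<in> H" for g h
      using that inb by (auto simp: H_def R_def power_mult_distrib mult.assoc)
  qed (use finR *(1) in \<open>auto simp: H_def R_def power_0_left\<close>)
  have e: "e > 0" using finR unfolding e_def by (subst card_gt_0_iff) (auto simp: H_def R_def intro: exI[of _ 1])
  have inv: "s t = s t'" if "t \<in> ball 0 \<rho>" "t' \<in> ball 0 \<rho>" "t ^ e = t' ^ e" for t t'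
  proof (cases "t = 0")
    case True
    then show ?thesis using that(3) e by (metis power_eq_0_iff)
  next
    case False
    then have "(t' / t) ^ e = 1" by (simp add: power_divide that(3)[symmetric])
    then have "t' / t \<in> H" by (simp add: Heq)
    then have "s (t' / t * t) = s t" using that(1) unfolding H_def by blast
    then show ?thesis using False by simp
  qed
  have "\<exists>g. g holomorphic_on ball 0 ((\<rho> / 4) ^ e) \<and> (\<forall>t\<in>ball 0 (\<rho> / 4). s t $ i = g (t ^ e))" for i
  proof (rule descend_power[OF e *(2)])
    show "(\<lambda>t. s t $ i) holomorphic_on ball 0 \<rho>" using *(3) by (simp add: curve_holomorphic_def)
    show "s t $ i = s t' $ i" if "t \<in> ball 0 \<rho>" "t' \<in> ball 0 \<rho>" "t ^ e = t' ^ e" for t t'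
      using inv[OF that] by simp
  qed
  then obtain g where g: "\<And>i. g i holomorphic_on ball 0 ((\<rho> / 4) ^ e)" "\<And>i t. t \<in> ball 0 (\<rho> / 4) \<Longrightarrow> s t $ i = g i (t ^ e)"
    by metis
  define \<psi> where "\<psi> x = (\<chi> i. g i x)" for x
  have \<psi>: "curve_holomorphic \<psi> (ball 0 ((\<rho> / 4) ^ e))" using g(1) by (simp add: curve_holomorphic_def \<psi>_def)
  have \<psi>s: "\<psi> (t ^ e) = s t" if "norm t < \<rho> / 4" for t using g(2)[of t] that by (simp add: \<psi>_def vec_eq_iff)
  have "\<exists>\<delta>>0. \<forall>t. 0 < norm t \<longrightarrow> norm t < \<delta> \<longrightarrow> s (\<omega> * t) \<noteq> s t" if \<omega>: "\<omega> \<in> R - H" for \<omega>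
  proof -
    obtain t0 where t0: "t0 \<in> ball 0 \<rho>" "s (\<omega> * t0) \<noteq> s t0" using \<omega> by (auto simp: H_def)
    then obtain i where i: "s (\<omega> * t0) $ i \<noteq> s t0 $ i" by (auto simp: vec_eq_iff)
    define k where "k t = s (\<omega> * t) $ i - s t $ i" for t
    have "curve_holomorphic (\<lambda>t. s (\<omega> * t)) (ball 0 \<rho>)"
      by (rule curve_holomorphic_compose[OF *(3)]) (use inb \<omega> in \<open>auto intro!: holomorphic_intros\<close>)
    then have k: "k holomorphic_on ball 0 \<rho>"
      unfolding k_def[abs_def] using *(3) by (auto simp: curve_holomorphic_def intro!: holomorphic_intros)
    show ?thesis
    proof (rule holomorphic_zero_dichotomy[OF k *(2)])
      fix \<delta> assume d: "0 < \<delta>" "\<delta> \<le> \<rho>" "(\<forall>t\<in>ball 0 \<delta>. k t = 0) \<or> (\<forall>t\<in>ball 0 \<delta>. t \<noteq> 0 \<longrightarrow> k t \<noteq> 0)"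
      have "\<not> (\<forall>t\<in>ball 0 \<delta>. k t = 0)"
      proof
        assume z: "\<forall>t\<in>ball 0 \<delta>. k t = 0"
        \<comment> \<open>Agreement near 0 would spread to the whole disc.\<close>
        have "k t0 = 0"
          by (rule analytic_continuation_open[of "ball 0 \<delta>" "ball 0 \<rho>" k "\<lambda>_. 0"]) (use d z k t0 in auto)
        then show False using i by (simp add: k_def)
      qed
      then have "\<forall>t. 0 < norm t \<longrightarrow> norm t < \<delta> \<longrightarrow> s (\<omega> * t) \<noteq> s t" using d(3) by (force simp: k_def)
      then show ?thesis using d(1) by blast
    qed
  qed
  then obtain \<delta> where \<delta>: "\<And>\<omega>. \<omega> \<in> R - H \<Longrightarrow> \<delta> \<omega> > 0"
    "\<And>\<omega> t. \<omega> \<in> R - H \<Longrightarrow> 0 < norm t \<Longrightarrow> norm t < \<delta> \<omega> \<Longrightarrow> s (\<omega> * t) \<noteq> s t" by metis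
  define \<delta>0 where "\<delta>0 = Min (insert (\<rho> / 4) (\<delta> ` (R - H)))"
  have \<delta>0: "\<delta>0 > 0" using \<delta>(1) *(2) finR by (auto simp: \<delta>0_def)
  have \<delta>0': "\<delta>0 \<le> \<rho> / 4" "\<And>\<omega>. \<omega> \<in> R - H \<Longrightarrow> \<delta>0 \<le> \<delta> \<omega>" unfolding \<delta>0_def by (rule Min_le; use finR in auto)+
  have rt: "\<exists>t. x = t ^ e \<and> norm t < \<tau>" if "norm x < \<tau> ^ e" "\<tau> > 0" for x :: complex and \<tau>
  proof (rule complex_root_exists[OF e, of x])
    fix t assume "t ^ e = x" "norm t ^ e = norm x"
    then show ?thesis using that power_less_imp_less_base[of "norm t" e \<tau>] by (intro exI[of _ t]) auto
  qed
  show ?thesis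
  proof (rule that[of "\<delta>0 ^ e" \<psi>])
    show "\<delta>0 ^ e > 0" using \<delta>0 by simp
    have "\<delta>0 ^ e \<le> (\<rho> / 4) ^ e" using \<delta>0 \<delta>0' by (intro power_mono) auto
    then show "curve_holomorphic \<psi> (ball 0 (\<delta>0 ^ e))" by (intro curve_holomorphic_subset[OF \<psi>]) auto
    show "inj_on \<psi> (ball 0 (\<delta>0 ^ e))"
    proof (rule inj_onI)
      fix x x' assume x: "x \<in> ball 0 (\<delta>0 ^ e)" "x' \<in> ball 0 (\<delta>0 ^ e)" "\<psi> x = \<psi> x'"
      obtain t t' where t: "x = t ^ e" "norm t < \<delta>0" "x' = t' ^ e" "norm t' < \<delta>0" using rt[of x \<delta>0] rt[of x' \<delta>0] x \<delta>0 by auto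
      have st: "s t = s t'" using x(3) \<psi>s[of t] \<psi>s[of t'] t \<delta>0' by simp
      then have tM: "t ^ M = t' ^ M" using *(8)[of t] *(8)[of t'] t \<delta>0' *(2) by auto
      show "x = x'"
      proof (cases "t = 0")
        case True
        then show ?thesis using tM t *(1) by (metis power_eq_0_iff)
      next
        case False
        then have "t' / t \<in> R" by (simp add: R_def power_divide tM[symmetric])
        moreover have "t' / t \<notin> R - H"
        proof
          assume R: "t' / t \<in> R - H"
          then have "s (t' / t * t) \<noteq> s t" using \<delta>(2)[OF R, of t] False t(2) \<delta>0'(2)[OF R] by simp
          then show False using st False by (simp add: field_simps)
        qed
        ultimately have "(t' / t) ^ e = 1" using Heq by blast
        then show ?thesis using t False by (simp add: power_divide)
      qed
    qed
    show "\<psi> 0 = 0" using \<psi>s[of 0] *(2,9) by (simp add: zero_power[OF e])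
    fix \<rho>' assume \<rho>': "0 < \<rho>'" "\<rho>' \<le> \<delta>0 ^ e"
    define \<tau> where "\<tau> = root e \<rho>'"
    have \<tau>: "\<tau> > 0" "\<tau> ^ e = \<rho>'" using e \<rho>' by (auto simp: \<tau>_def)
    have "\<tau> \<le> \<delta>0" using \<tau> \<rho>' \<delta>0 e by (metis power_mono_iff less_imp_le)
    then have \<tau>\<rho>: "\<tau> \<le> \<rho> / 4" using \<delta>0' by simp
    have "isCont f 0"
      using holomorphic_fun_continuous[OF *(6)] *(4,5) continuous_on_eq_continuous_at by blast
    from isCont_small[OF this *(7), of "\<tau> ^ M"] \<tau> obtain c where c: "c > 0" "\<And>z. norm z < c \<Longrightarrow> norm (f z) < \<tau> ^ M" by auto
    \<comment> \<open>Since \<open>f\<close> recovers \<open>t ^ M\<close>, small points of the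
      curve have small parameters; shrinking the parameter disc does not change the germ.\<close>
    have eq: "z \<in> s ` ball 0 \<rho> \<longleftrightarrow> z \<in> \<psi> ` ball 0 \<rho>'" if z: "norm z < c" for z
    proof
      assume "z \<in> s ` ball 0 \<rho>"
      then obtain t where t: "t \<in> ball 0 \<rho>" "z = s t" by auto
      have "norm t ^ M < \<tau> ^ M" using c(2)[OF z] *(8)[OF t(1)] t(2) by (simp add: norm_power)
      then have "norm t < \<tau>" using \<tau>(1) by (meson not_le power_mono less_imp_le)
      then have "z = \<psi> (t ^ e)" "norm (t ^ e) < \<rho>'"
        using \<psi>s[of t] t(2) \<tau>\<rho> e by (auto simp: norm_power power_strict_mono \<tau>(2)[symmetric])
      then show "z \<in> \<psi> ` ball 0 \<rho>'" by auto
    next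
      assume "z \<in> \<psi> ` ball 0 \<rho>'"
      then obtain x where x: "norm x < \<rho>'" "z = \<psi> x" by auto
      obtain t where t: "x = t ^ e" "norm t < \<tau>" using rt[of x \<tau>] x(1) \<tau> by auto
      then have "z = s t" "t \<in> ball 0 \<rho>" using \<psi>s[of t] x(2) \<tau>\<rho> *(2) by auto
      then show "z \<in> s ` ball 0 \<rho>" by auto
    qed
    have "\<forall>\<^sub>F z in nhds 0. norm (z :: complex^'n) < c"
      using eventually_nhds_in_open[of "ball (0 :: complex^'n) c" 0] c(1) by auto
    then have "germ_eq (s ` ball 0 \<rho>) (\<psi> ` ball 0 \<rho>')"
      unfolding germ_eq_def by (rule eventually_mono) (rule eq)
    then show "germ_eq A (\<psi> ` ball 0 \<rho>')" by (rule germ_eq_trans[OF *(10)])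
  qed
qed

section \<open>Normal form of a branch\<close>

definition lform :: "complex^'n \<Rightarrow> complex^'n \<Rightarrow> complex" where
  "lform c z = (\<Sum>i\<in>UNIV. c $ i * z $ i)"

lemma lform_add: "lform c (x + y) = lform c x + lform c y"
  and lform_diff: "lform c (x - y) = lform c x - lform c y"
  and lform_scale: "lform c (a *s x) = a * lform c x"
  and lform_0 [simp]: "lform c 0 = 0"
  by (simp_all add: lform_def algebra_simps sum.distrib sum_subtractf sum_distrib_left)

lemma lform_linear: "Vector_Spaces.linear (*s) (*) (lform c)"
  by unfold_locales (simp_all add: lform_add lform_scale algebra_simps)

lemma linear_eq_lform:
  fixes l :: "complex^'n \<Rightarrow> complex"
  assumes "Vector_Spaces.linear (*s) (*) l"
  obtains c where "l = lform c"
proof -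
  interpret Vector_Spaces.linear "(*s)" "(*)" l by fact
  have "l z = lform (\<chi> i. l (axis i 1)) z" for z
  proof -
    have "z = (\<Sum>i\<in>UNIV. z $ i *s axis i 1)" by (simp add: basis_expansion)
    then have "l z = l (\<Sum>i\<in>UNIV. z $ i *s axis i 1)" by simp
    also have "\<dots> = (\<Sum>i\<in>UNIV. z $ i * l (axis i 1))" by (simp add: sum scale)
    finally show ?thesis by (simp add: lform_def mult.commute)
  qed
  then show ?thesis using that by blast
qed

lemma holomorphic_lform_curve:
  "curve_holomorphic s D \<Longrightarrow> (\<lambda>t. lform c (s t)) holomorphic_on D"
  unfolding lform_def curve_holomorphic_def by (intro holomorphic_intros) auto

lemma continuous_on_lform: "continuous_on A (lform c)"
  unfolding lform_def by (intro continuous_intros)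

lemma tendsto_lform: "(f \<longlongrightarrow> v) F \<Longrightarrow> ((\<lambda>x. lform c (f x)) \<longlongrightarrow> lform c v) F"
  unfolding lform_def by (intro tendsto_intros)

lemma curve_holomorphicI:
  "(\<And>i. (\<lambda>t. s t $ i) holomorphic_on D) \<Longrightarrow> curve_holomorphic s D"
  by (simp add: curve_holomorphic_def)

lemma curve_holomorphic_add: "curve_holomorphic s D \<Longrightarrow> curve_holomorphic s' D \<Longrightarrow> curve_holomorphic (\<lambda>t. s t + s' t) D"
  and curve_holomorphic_diff: "curve_holomorphic s D \<Longrightarrow> curve_holomorphic s' D \<Longrightarrow> curve_holomorphic (\<lambda>t. s t - s' t) D"
  and curve_holomorphic_scale: "f holomorphic_on D \<Longrightarrow> curve_holomorphic s D \<Longrightarrow> curve_holomorphic (\<lambda>t. f t *s s t) D"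
  and curve_holomorphic_const: "curve_holomorphic (\<lambda>t. v) D"
  by (auto simp: curve_holomorphic_def intro!: holomorphic_intros)

text \<open>The difference quotient is defined by its formula everywhere, so the identity holds for
  all \<open>t\<close> and later uses carry no condition on \<open>t\<close>.\<close>

lemma holomorphic_divide_id:
  assumes "f holomorphic_on ball 0 r" "r > 0"
  obtains g where "g holomorphic_on ball 0 r" "\<And>t. f t = f 0 + t * g t"
proof -
  define g where "g z = (if z = 0 then deriv f 0 else (f z - f 0) / (z - 0))" for z
  have "g holomorphic_on ball 0 r" unfolding g_def[abs_def] by (rule pole_lemma_open[OF assms(1) open_ball])
  moreover have "f t = f 0 + t * g t" for t by (simp add: g_def)
  ultimately show ?thesis using that by blast
qed

lemma curve_divide_id:
  assumes "curve_holomorphic s (ball 0 r)" "r > 0"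
  obtains b where "curve_holomorphic b (ball 0 r)" "\<And>t. s t = s 0 + t *s b t"
proof -
  have "\<exists>g. g holomorphic_on ball 0 r \<and> (\<forall>t. s t $ i = s 0 $ i + t * g t)" for i
  proof -
    have "(\<lambda>t. s t $ i) holomorphic_on ball 0 r" using assms(1) by (simp add: curve_holomorphic_def)
    then show ?thesis by (rule holomorphic_divide_id[OF _ assms(2)]) blast
  qed
  then obtain g where g: "\<And>i. g i holomorphic_on ball 0 r" "\<And>i t. s t $ i = s 0 $ i + t * g i t" by metis
  show ?thesis
  proof (rule that[of "\<lambda>t. \<chi> i. g i t"])
    show "s t = s 0 + t *s (\<chi> i. g i t)" for t using g(2)[of t] by (simp add: vec_eq_iff)
  qed (use g in \<open>simp add: curve_holomorphic_def\<close>)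
qed

text \<open>\<open>curve_leads d k D\<close>: the expansion of \<open>d\<close> at \<open>0\<close> starts with \<open>D\<close> in degree \<open>k\<close>; \<open>D = 0\<close> encodes \<open>d = 0\<close> near \<open>0\<close>.\<close>

definition curve_leads :: "(complex \<Rightarrow> complex^'n) \<Rightarrow> nat \<Rightarrow> complex^'n \<Rightarrow> bool" where
  "curve_leads d k D \<longleftrightarrow> (\<exists>\<delta>>0. \<exists>e. curve_holomorphic e (ball 0 \<delta>) \<and> e 0 = D \<and>
     (\<forall>t\<in>ball 0 \<delta>. d t = t ^ k *s e t) \<and> (D = 0 \<longrightarrow> (\<forall>t\<in>ball 0 \<delta>. e t = 0)))"

text \<open>The degree is the least order among the coordinates that do not vanish identically; if
  there is none, degree 0 and vector 0 are taken.\<close>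

lemma curve_leads_exists:
  fixes d :: "complex \<Rightarrow> complex^'n"
  assumes "curve_holomorphic d (ball 0 r)" "r > 0"
  shows "\<exists>k D. curve_leads d k D"
proof -
  have "\<exists>n \<delta> u. 0 < \<delta> \<and> \<delta> \<le> r \<and> u holomorphic_on ball 0 \<delta> \<and> (\<forall>x\<in>ball 0 \<delta>. d x $ i = x ^ n * u x) \<and>
    ((\<forall>x\<in>ball 0 \<delta>. u x \<noteq> 0) \<or> (\<forall>x\<in>ball 0 \<delta>. u x = 0))" for i
  proof -
    have "(\<lambda>t. d t $ i) holomorphic_on ball 0 r" using assms(1) by (simp add: curve_holomorphic_def)
    then show ?thesis by (rule holomorphic_order_at_0[OF _ assms(2)]) blast
  qed
  then obtain n \<delta> u where nu: "\<And>i. 0 < \<delta> i" "\<And>i. u i holomorphic_on ball 0 (\<delta> i)"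
    "\<And>i x. x \<in> ball 0 (\<delta> i) \<Longrightarrow> d x $ i = x ^ n i * u i x"
    "\<And>i. (\<forall>x\<in>ball 0 (\<delta> i). u i x \<noteq> 0) \<or> (\<forall>x\<in>ball 0 (\<delta> i). u i x = 0)" by metis
  define \<delta>0 where "\<delta>0 = Min (range \<delta>)"
  have \<delta>0: "\<delta>0 > 0" "\<And>i. \<delta>0 \<le> \<delta> i" using nu(1) by (auto simp: \<delta>0_def)
  have sub: "ball 0 \<delta>0 \<subseteq> ball (0::complex) (\<delta> i)" for i using \<delta>0(2)[of i] by auto
  define K where "K = {i. u i 0 \<noteq> 0}"
  have u0: "u i x = 0" if "i \<notin> K" "x \<in> ball 0 \<delta>0" for i x
    using nu(4)[of i] that sub[of i] nu(1)[of i] by (auto simp: K_def)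
  show ?thesis
  proof (cases "K = {}")
    case True
    have "curve_leads d 0 0" unfolding curve_leads_def
    proof (intro exI[of _ \<delta>0] exI[of _ "\<lambda>_. 0"] conjI ballI impI)
      fix t assume "t \<in> ball (0::complex) \<delta>0"
      then show "d t = t ^ 0 *s 0" using nu(3) sub u0 True by (force simp: vec_eq_iff)
    qed (use \<delta>0 in \<open>auto intro: curve_holomorphic_const\<close>)
    then show ?thesis by blast
  next
    case False
    define k where "k = Min (n ` K)"
    have k: "k \<le> n i" if "i \<in> K" for i unfolding k_def by (rule Min_le) (use that in auto)
    have "k \<in> n ` K" unfolding k_def using False by (intro Min_in) auto
    then obtain i0 where i0: "i0 \<in> K" "n i0 = k" by auto
    define e where "e t = (\<chi> i. if i \<in> K then t ^ (n i - k) * u i t else 0)" for t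
    have e0: "e 0 \<noteq> 0"
    proof
      assume "e 0 = 0"
      then have "e 0 $ i0 = 0" by simp
      then show False using i0 by (simp add: e_def K_def)
    qed
    have "curve_leads d k (e 0)" unfolding curve_leads_def
    proof (intro exI[of _ \<delta>0] exI[of _ e] conjI ballI impI)
      show "curve_holomorphic e (ball 0 \<delta>0)"
      proof (rule curve_holomorphicI)
        fix i
        show "(\<lambda>t. e t $ i) holomorphic_on ball 0 \<delta>0"
          using holomorphic_on_subset[OF nu(2) sub, of i]
          by (cases "i \<in> K") (auto simp: e_def intro!: holomorphic_intros)
      qed
      fix t assume t: "t \<in> ball (0::complex) \<delta>0"
      have "d t $ i = (t ^ k *s e t) $ i" for i
      proof (cases "i \<in> K")
        case True
        then have "t ^ n i = t ^ k * t ^ (n i - k)" using k by (metis le_add_diff_inverse power_add)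
        then show ?thesis using nu(3)[of t i] t sub[of i] True by (simp add: e_def subset_iff)
      next
        case False
        then show ?thesis using nu(3)[of t i] t sub[of i] u0[OF False] by (simp add: e_def subset_iff)
      qed
      then show "d t = t ^ k *s e t" by (simp add: vec_eq_iff)
    qed (use \<delta>0 e0 in auto)
    then show ?thesis by blast
  qed
qed

lemma curve_tendsto_0:
  assumes "curve_holomorphic e (ball 0 \<delta>)" "\<delta> > 0"
  shows "(e \<longlongrightarrow> e 0) (at 0)"
proof -
  have "isCont e 0"
    using curve_holomorphic_continuous[OF assms(1)] assms(2) by (auto simp: continuous_on_eq_continuous_at)
  then show ?thesis by (simp add: isCont_def)
qed

lemma eventually_at_ball: "\<delta> > 0 \<Longrightarrow> \<forall>\<^sub>F t in at 0. t \<in> ball (0::complex) \<delta> \<and> t \<noteq> 0"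
  by (auto simp: eventually_at dist_norm intro: exI[of _ \<delta>])

text \<open>If \<open>t ^ l\<close> can be split off, comparing limits at 0 bounds \<open>l\<close>
  by the degree of the nonzero leading vector. Uniqueness of leading terms results from using this
  in both directions.\<close>

lemma curve_leads_less:
  assumes "curve_leads d k D" "D \<noteq> 0"
    and "\<delta> > 0" "curve_holomorphic b (ball 0 \<delta>)" "\<And>t. t \<in> ball 0 \<delta> \<Longrightarrow> d t = t ^ l *s b t"
  shows "l \<le> k \<and> (l = k \<longrightarrow> D = b 0)"
proof -
  obtain \<delta>1 e where e: "\<delta>1 > 0" "curve_holomorphic e (ball 0 \<delta>1)" "e 0 = D" "\<And>t. t \<in> ball 0 \<delta>1 \<Longrightarrow> d t = t ^ k *s e t"
    using assms(1) unfolding curve_leads_def by blast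
  have ev: "\<forall>\<^sub>F t in at 0. t ^ k *s e t = t ^ l *s b t \<and> t \<noteq> 0"
    using eventually_at_ball[OF e(1)] eventually_at_ball[OF assms(3)]
    by eventually_elim (use e(4) assms(5) in metis)
  have te: "(e \<longlongrightarrow> D) (at 0)" using curve_tendsto_0[OF e(2,1)] e(3) by simp
  have tb: "(b \<longlongrightarrow> b 0) (at 0)" using curve_tendsto_0[OF assms(4,3)] .
  have "l \<le> k"
  proof (rule ccontr)
    assume "\<not> l \<le> k"
    then have lk: "t ^ l = t ^ k * t ^ (l - k)" for t :: complex by (metis le_add_diff_inverse nat_le_linear power_add)
    have "\<forall>\<^sub>F t in at 0. e t = t ^ (l - k) *s b t"
      using ev by eventually_elim (auto simp: lk vec_eq_iff)
    moreover have "((\<lambda>t. t ^ (l - k) *s b t) \<longlongrightarrow> 0) (at 0)"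
    proof (rule vec_tendstoI)
      fix i
      have "((\<lambda>t. t ^ (l - k) * b t $ i) \<longlongrightarrow> 0 ^ (l - k) * b 0 $ i) (at 0)"
        by (intro tendsto_intros tb)
      then show "((\<lambda>t. (t ^ (l - k) *s b t) $ i) \<longlongrightarrow> 0 $ i) (at 0)"
        using \<open>\<not> l \<le> k\<close> by (simp add: power_0_left)
    qed
    ultimately have "(e \<longlongrightarrow> 0) (at 0)" by (subst tendsto_cong) auto
    then show False using tendsto_unique[OF _ te] assms(2) by auto
  qed
  moreover have "D = b 0" if "l = k"
  proof -
    have "\<forall>\<^sub>F t in at 0. e t = b t" using ev by eventually_elim (auto simp: that vec_eq_iff)
    then have "(e \<longlongrightarrow> b 0) (at 0)" using tb by (subst tendsto_cong) auto
    then show ?thesis using tendsto_unique[OF _ te] by auto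
  qed
  ultimately show ?thesis by blast
qed

lemma curve_leads_unique:
  assumes "curve_leads d k D" "curve_leads d k' D'" "D \<noteq> 0"
  shows "D' \<noteq> 0 \<and> k' = k \<and> D' = D"
proof -
  obtain \<delta> e where e: "\<delta> > 0" "curve_holomorphic e (ball 0 \<delta>)" "e 0 = D" "\<And>t. t \<in> ball 0 \<delta> \<Longrightarrow> d t = t ^ k *s e t"
    using assms(1) unfolding curve_leads_def by blast
  obtain \<delta>' e' where e': "\<delta>' > 0" "curve_holomorphic e' (ball 0 \<delta>')" "e' 0 = D'" "\<And>t. t \<in> ball 0 \<delta>' \<Longrightarrow> d t = t ^ k' *s e' t"
      "D' = 0 \<longrightarrow> (\<forall>t\<in>ball 0 \<delta>'. e' t = 0)"
    using assms(2) unfolding curve_leads_def by blast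
  have "D' \<noteq> 0"
  proof
    assume "D' = 0"
    then have "d t = t ^ Suc k *s 0" if "t \<in> ball 0 \<delta>'" for t using e'(4,5) that by auto
    from curve_leads_less[OF assms(1,3) e'(1) curve_holomorphic_const this] show False by auto
  qed
  moreover have "k' \<le> k \<and> (k' = k \<longrightarrow> D = D')" using curve_leads_less[OF assms(1,3) e'(1,2,4)] e'(3) by simp
  moreover have "k \<le> k' \<and> (k = k' \<longrightarrow> D' = D)" using curve_leads_less[OF assms(2) \<open>D' \<noteq> 0\<close> e(1,2,4)] e(3) by simp
  ultimately show ?thesis by (metis le_antisym)
qed

text \<open>Near 0 the quotient \<open>g t / g 0\<close> stays within distance 1 of 1 and avoids the
  cut of the logarithm; the constant \<open>Ln (g 0)\<close> is added separately, so the position of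
  \<open>g 0\<close> does not matter.\<close>

lemma holomorphic_nth_root:
  assumes "g holomorphic_on ball 0 r" "r > 0" "g 0 \<noteq> (0::complex)" "k > 0"
  obtains q \<delta> where "0 < \<delta>" "\<delta> \<le> r" "q holomorphic_on ball 0 \<delta>" "\<And>t. t \<in> ball 0 \<delta> \<Longrightarrow> q t ^ k = g t \<and> q t \<noteq> 0"
proof -
  have "isCont g 0" using assms(1,2) holomorphic_on_imp_continuous_on continuous_on_eq_continuous_at
    by (metis centre_in_ball open_ball)
  then have "isCont (\<lambda>t. g t / g 0 - 1) 0" using assms(3) by (intro continuous_intros)
  from isCont_small[OF this, of 1] assms(3) obtain e where e: "e > 0" "\<And>t. norm t < e \<Longrightarrow> norm (g t / g 0 - 1) < 1" by auto
  define \<delta> where "\<delta> = min e r"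
  have nonpos: "g t / g 0 \<notin> \<real>\<^sub>\<le>\<^sub>0" if "t \<in> ball 0 \<delta>" for t
  proof
    assume "g t / g 0 \<in> \<real>\<^sub>\<le>\<^sub>0"
    then obtain x where x: "g t / g 0 = of_real x" "x \<le> 0" by (auto elim: nonpos_Reals_cases)
    have "norm (of_real (x - 1) :: complex) < 1" using e(2)[of t] that x(1) by (auto simp: \<delta>_def)
    then show False using x(2) by (simp only: norm_of_real)
  qed
  define q where "q t = exp ((Ln (g t / g 0) + Ln (g 0)) / of_nat k)" for t
  have "g holomorphic_on ball 0 \<delta>" by (rule holomorphic_on_subset[OF assms(1)]) (auto simp: \<delta>_def)
  then have "q holomorphic_on ball 0 \<delta>"
    unfolding q_def[abs_def] using assms by (intro holomorphic_intros nonpos) auto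
  moreover have "q t ^ k = g t \<and> q t \<noteq> 0" if "t \<in> ball 0 \<delta>" for t
  proof -
    have "g t \<noteq> 0" using nonpos[OF that] by auto
    have "q t ^ k = exp (Ln (g t / g 0) + Ln (g 0))" using assms(4) by (simp add: q_def exp_of_nat_mult[symmetric])
    also have "\<dots> = g t" using \<open>g t \<noteq> 0\<close> assms(3) by (simp add: exp_add)
    finally show ?thesis by (simp add: q_def)
  qed
  ultimately show ?thesis using that[of \<delta> q] e assms(2) by (auto simp: \<delta>_def)
qed

text \<open>Near \<open>0\<close> a function with a zero of order \<open>k\<close> is the \<open>k\<close>-th power of a local coordinate \<open>h\<close>, with inverse \<open>h'\<close>.\<close>

lemma local_coordinate:
  assumes "g holomorphic_on ball 0 r" "r > 0" "g 0 \<noteq> (0::complex)" "k > 0"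
  obtains h h' \<delta> \<tau> where "0 < \<delta>" "\<delta> \<le> r" "h holomorphic_on ball 0 \<delta>" "inj_on h (ball 0 \<delta>)" "h 0 = 0"
    "\<And>t. t \<in> ball 0 \<delta> \<Longrightarrow> h t ^ k = t ^ k * g t"
    "0 < \<tau>" "h' holomorphic_on ball 0 \<tau>" "\<And>x. x \<in> ball 0 \<tau> \<Longrightarrow> h' x \<in> ball 0 \<delta> \<and> h (h' x) = x" "h' 0 = 0"
proof -
  obtain q \<delta>1 where q: "0 < \<delta>1" "\<delta>1 \<le> r" "q holomorphic_on ball 0 \<delta>1" "\<And>t. t \<in> ball 0 \<delta>1 \<Longrightarrow> q t ^ k = g t \<and> q t \<noteq> 0"
    by (rule holomorphic_nth_root[OF assms]) blast
  define h where "h t = t * q t" for t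
  have hol: "h holomorphic_on ball 0 \<delta>1" unfolding h_def[abs_def] by (intro holomorphic_intros q(3))
  have "(q has_field_derivative deriv q 0) (at 0)" using holomorphic_derivI[OF q(3)] q(1) by auto
  then have "(h has_field_derivative (0 * deriv q 0 + 1 * q 0)) (at 0)" unfolding h_def[abs_def]
    by (auto intro!: derivative_eq_intros)
  then have "deriv h 0 = q 0" by (simp add: DERIV_imp_deriv)
  then have "deriv h 0 \<noteq> 0" using q(1,4) by auto
  then obtain \<delta> where \<delta>: "\<delta> > 0" "ball 0 \<delta> \<subseteq> ball (0::complex) \<delta>1" "inj_on h (ball 0 \<delta>)"
    using has_complex_derivative_locally_injective[OF hol _ open_ball] q(1) by (metis centre_in_ball)
  have \<delta>r: "\<delta> \<le> r" using \<delta>(1,2) q(1,2) by (simp add: ball_subset_ball_iff)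
  have hol': "h holomorphic_on ball 0 \<delta>" by (rule holomorphic_on_subset[OF hol \<delta>(2)])
  obtain h' where h': "h' holomorphic_on h ` ball 0 \<delta>" "\<And>z. z \<in> ball 0 \<delta> \<Longrightarrow> h' (h z) = z"
    using holomorphic_has_inverse[OF hol' open_ball \<delta>(3)] by metis
  have "open (h ` ball 0 \<delta>)" by (rule open_mapping_thm3[OF hol' open_ball \<delta>(3)])
  moreover have "0 \<in> h ` ball 0 \<delta>" by (rule image_eqI[of _ _ 0]) (use \<delta> in \<open>auto simp: h_def\<close>)
  ultimately obtain \<tau> where \<tau>: "\<tau> > 0" "ball 0 \<tau> \<subseteq> h ` ball 0 \<delta>" using openE by blast
  show ?thesis
  proof (rule that[OF \<delta>(1) \<delta>r hol' \<delta>(3)])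
    show "h t ^ k = t ^ k * g t" if "t \<in> ball 0 \<delta>" for t
      using q(4)[of t] that \<delta>(2) by (auto simp: h_def power_mult_distrib)
    show "h' holomorphic_on ball 0 \<tau>" by (rule holomorphic_on_subset[OF h'(1) \<tau>(2)])
    show "h' x \<in> ball 0 \<delta> \<and> h (h' x) = x" if "x \<in> ball 0 \<tau>" for x
      using \<tau>(2) that h'(2) by force
    show "h' 0 = 0" using h'(2)[of 0] \<delta>(1) by (simp add: h_def)
  qed (use \<tau> in \<open>auto simp: h_def\<close>)
qed

text \<open>In this parameter the form with coefficients \<open>c\<close> becomes
  \<open>t ^ m\<close>: its fibres on the branch are orbits of the \<open>m\<close>-th roots of
  unity, and branches with the same \<open>c\<close> can be compared fibre by fibre. The
  normalization \<open>lform c u = 1\<close> makes two tangent lines equal iff the vectors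
  \<open>u\<close> are equal.\<close>

definition normal_curve :: "complex^'n \<Rightarrow> nat \<Rightarrow> complex^'n \<Rightarrow> real \<Rightarrow> (complex \<Rightarrow> complex^'n) \<Rightarrow> bool" where
  "normal_curve c m u r \<phi> \<longleftrightarrow> m > 0 \<and> r > 0 \<and> curve_holomorphic \<phi> (ball 0 r) \<and> inj_on \<phi> (ball 0 r) \<and>
     (\<forall>t\<in>ball 0 r. lform c (\<phi> t) = t ^ m) \<and> lform c u = 1 \<and>
     (\<exists>b. curve_holomorphic b (ball 0 r) \<and> (\<forall>t\<in>ball 0 r. \<phi> t = t ^ m *s u + t ^ Suc m *s b t))"

lemma normal_curveD:
  assumes "normal_curve c m u r \<phi>"
  shows "m > 0" "r > 0" "curve_holomorphic \<phi> (ball 0 r)" "inj_on \<phi> (ball 0 r)"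
     "\<And>t. t \<in> ball 0 r \<Longrightarrow> lform c (\<phi> t) = t ^ m" "lform c u = 1"
     "\<exists>b. curve_holomorphic b (ball 0 r) \<and> (\<forall>t\<in>ball 0 r. \<phi> t = t ^ m *s u + t ^ Suc m *s b t)" "\<phi> 0 = 0" "u \<noteq> 0"
proof -
  show *: "m > 0" "r > 0" "curve_holomorphic \<phi> (ball 0 r)" "inj_on \<phi> (ball 0 r)"
     "\<And>t. t \<in> ball 0 r \<Longrightarrow> lform c (\<phi> t) = t ^ m" "lform c u = 1"
     "\<exists>b. curve_holomorphic b (ball 0 r) \<and> (\<forall>t\<in>ball 0 r. \<phi> t = t ^ m *s u + t ^ Suc m *s b t)"
    using assms by (auto simp: normal_curve_def)
  from *(7) obtain b where "\<forall>t\<in>ball 0 r. \<phi> t = t ^ m *s u + t ^ Suc m *s b t" by blast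
  then have "\<phi> 0 = 0 ^ m *s u + 0 ^ Suc m *s b 0" using *(2) by (metis centre_in_ball)
  then show "\<phi> 0 = 0" using *(1) by (simp add: zero_power)
  show "u \<noteq> 0" using *(6) by auto
qed

lemma germ_eq_sandwich:
  assumes "germ_eq A B" "germ_eq A C" "B \<subseteq> D" "D \<subseteq> C"
  shows "germ_eq A D"
  using assms(1,2) unfolding germ_eq_def by eventually_elim (use assms(3,4) in blast)

text \<open>\<open>m\<close> and \<open>u\<close> come from the leading term of an injective
  parametrization, before any form is chosen. This order of quantifiers allows one generic form to
  be picked for all branches afterwards.\<close>

lemma irreducible_germ_normal_form:
  fixes A :: "(complex^'n) set"
  assumes "irreducible_germ A" "germ_dim A = 1"
  shows "\<exists>m u. m > 0 \<and> u \<noteq> 0 \<and> (\<forall>c. lform c u \<noteq> 0 \<longrightarrow>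
    (\<exists>\<phi> r. normal_curve c m ((1 / lform c u) *s u) r \<phi> \<and> (\<forall>r'. 0 < r' \<longrightarrow> r' \<le> r \<longrightarrow> germ_eq A (\<phi> ` ball 0 r'))))"
proof (rule irreducible_germ_parametrization[OF assms])
  fix \<psi> :: "complex \<Rightarrow> complex^'n" and \<rho> :: real
  assume \<psi>: "\<rho> > 0" "curve_holomorphic \<psi> (ball 0 \<rho>)" "inj_on \<psi> (ball 0 \<rho>)" "\<psi> 0 = 0"
    "\<And>\<rho>'. 0 < \<rho>' \<Longrightarrow> \<rho>' \<le> \<rho> \<Longrightarrow> germ_eq A (\<psi> ` ball 0 \<rho>')"
  obtain m u where mu: "curve_leads \<psi> m u" using curve_leads_exists[OF \<psi>(2,1)] by blast
  obtain \<delta>0 e where e0: "\<delta>0 > 0" "curve_holomorphic e (ball 0 \<delta>0)" "e 0 = u" "\<And>t. t \<in> ball 0 \<delta>0 \<Longrightarrow> \<psi> t = t ^ m *s e t"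
     "u = 0 \<longrightarrow> (\<forall>t\<in>ball 0 \<delta>0. e t = 0)"
    using mu unfolding curve_leads_def by blast
  define \<delta>1 where "\<delta>1 = min \<delta>0 \<rho>"
  have \<delta>1: "\<delta>1 > 0" "\<delta>1 \<le> \<rho>" "ball 0 \<delta>1 \<subseteq> ball (0::complex) \<delta>0" using e0 \<psi>(1) by (auto simp: \<delta>1_def)
  have e: "curve_holomorphic e (ball 0 \<delta>1)" "\<And>t. t \<in> ball 0 \<delta>1 \<Longrightarrow> \<psi> t = t ^ m *s e t"
    using curve_holomorphic_subset[OF e0(2) \<delta>1(3)] e0(4) \<delta>1(3) by blast+
  \<comment> \<open>A vanishing leading vector would make the curve constant near 0, against
    injectivity.\<close>
  have "u \<noteq> 0"
  proof
    assume "u = 0"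
    define t where "t = (of_real (\<delta>1 / 2) :: complex)"
    have t: "t \<in> ball 0 \<delta>1" "t \<noteq> 0" using \<delta>1 by (auto simp: t_def)
    have "\<psi> t = 0" using e(2)[OF t(1)] e0(5) \<open>u = 0\<close> \<delta>1(3) t(1) by (auto simp: vec_eq_iff)
    moreover have "t \<in> ball 0 \<rho>" "0 \<in> ball (0::complex) \<rho>" using t \<delta>1 \<psi>(1) by auto
    ultimately show False using inj_onD[OF \<psi>(3), of t 0] \<psi>(4) t(2) by simp
  qed
  have "m > 0"
  proof (rule ccontr)
    assume "\<not> m > 0"
    then have "\<psi> 0 = u" using e(2)[of 0] \<delta>1 e0(3) by (simp add: vec_eq_iff)
    then show False using \<psi>(4) \<open>u \<noteq> 0\<close> by simp
  qed
  have "\<exists>\<phi> r. normal_curve c m ((1 / lform c u) *s u) r \<phi> \<and> (\<forall>r'. 0 < r' \<longrightarrow> r' \<le> r \<longrightarrow> germ_eq A (\<phi> ` ball 0 r'))"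
    if c: "lform c u \<noteq> 0" for c
  proof -
    have g: "(\<lambda>t. lform c (e t)) holomorphic_on ball 0 \<delta>1" by (rule holomorphic_lform_curve[OF e(1)])
    have "lform c (e 0) \<noteq> 0" using c e0(3) by simp
    from local_coordinate[OF g \<delta>1(1) this \<open>m > 0\<close>]
    obtain h h' \<delta> \<tau> where h: "0 < \<delta>" "\<delta> \<le> \<delta>1" "h holomorphic_on ball 0 \<delta>" "inj_on h (ball 0 \<delta>)" "h 0 = 0"
      "\<And>t. t \<in> ball 0 \<delta> \<Longrightarrow> h t ^ m = t ^ m * lform c (e t)"
      "0 < \<tau>" "h' holomorphic_on ball 0 \<tau>" "\<And>x. x \<in> ball 0 \<tau> \<Longrightarrow> h' x \<in> ball 0 \<delta> \<and> h (h' x) = x" "h' 0 = 0" by metis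
    \<comment> \<open>The coordinate \<open>h\<close> satisfies
      \<open>h t ^ m = lform c (\<psi> t)\<close>; reparametrizing by its inverse turns the form
      into a pure power.\<close>
    define \<phi> where "\<phi> x = \<psi> (h' x)" for x
    have h'\<rho>: "h' ` ball 0 \<tau> \<subseteq> ball 0 \<rho>" "h' ` ball 0 \<tau> \<subseteq> ball 0 \<delta>1" using h(9) h(2) \<delta>1(2) by (force+)
    have \<phi>hol: "curve_holomorphic \<phi> (ball 0 \<tau>)"
      unfolding \<phi>_def[abs_def] by (rule curve_holomorphic_compose[OF \<psi>(2) h(8) h'\<rho>(1)])
    have inj: "inj_on \<phi> (ball 0 \<tau>)"
    proof (rule inj_onI)
      fix x y assume xy: "x \<in> ball 0 \<tau>" "y \<in> ball 0 \<tau>" "\<phi> x = \<phi> y"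
      have "h' x \<in> ball 0 \<rho>" "h' y \<in> ball 0 \<rho>" using h'\<rho> xy by blast+
      then have "h' x = h' y" using inj_onD[OF \<psi>(3)] xy(3) by (simp add: \<phi>_def)
      then show "x = y" using h(9)[OF xy(1)] h(9)[OF xy(2)] by metis
    qed
    have \<phi>e: "\<phi> x = (h' x) ^ m *s e (h' x)" if "x \<in> ball 0 \<tau>" for x
    proof -
      have "h' x \<in> ball 0 \<delta>1" using h'\<rho>(2) that by blast
      then show ?thesis using e(2) by (simp add: \<phi>_def)
    qed
    have l\<phi>: "lform c (\<phi> x) = x ^ m" if "x \<in> ball 0 \<tau>" for x
      using \<phi>e[OF that] h(6)[of "h' x"] h(9)[OF that] by (simp add: lform_scale)
    obtain \<kappa> where \<kappa>: "\<kappa> holomorphic_on ball 0 \<tau>" "\<And>x. h' x = h' 0 + x * \<kappa> x"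
      by (rule holomorphic_divide_id[OF h(8,7)]) blast
    define w where "w x = \<kappa> x ^ m *s e (h' x)" for x
    have w: "curve_holomorphic w (ball 0 \<tau>)" unfolding w_def[abs_def]
      by (intro curve_holomorphic_scale holomorphic_intros \<kappa>(1) curve_holomorphic_compose[OF e(1) h(8) h'\<rho>(2)])
    have \<phi>w: "\<phi> x = x ^ m *s w x" if "x \<in> ball 0 \<tau>" for x
    proof -
      have "(h' x) ^ m = x ^ m * \<kappa> x ^ m" using \<kappa>(2)[of x] h(10) by (simp add: power_mult_distrib)
      then show ?thesis using \<phi>e[OF that] by (simp add: w_def vec_eq_iff mult.assoc)
    qed
    have "((\<lambda>x. lform c (w x)) \<longlongrightarrow> lform c (w 0)) (at 0)"
      by (intro tendsto_lform curve_tendsto_0[OF w h(7)])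
    moreover have "\<forall>\<^sub>F x in at 0. lform c (w x) = 1"
      using eventually_at_ball[OF h(7)]
    proof eventually_elim
      case (elim x)
      then have "x ^ m * lform c (w x) = x ^ m" using l\<phi>[of x] \<phi>w[of x] by (simp add: lform_scale)
      then show ?case using elim by simp
    qed
    \<comment> \<open>Comparison with \<open>x ^ m\<close> determines \<open>\<kappa> 0 ^ m\<close>,
      and the leading vector involves \<kappa> only through this power.\<close>
    ultimately have w1: "lform c (w 0) = 1"
      using tendsto_unique[OF _ _ tendsto_eventually] by (metis at_neq_bot)
    have w0: "w 0 = \<kappa> 0 ^ m *s u" using h(10) e0(3) by (simp add: w_def)
    then have "\<kappa> 0 ^ m * lform c u = 1" using w1 by (simp add: lform_scale)
    then have "\<kappa> 0 ^ m = 1 / lform c u" using c by (simp add: field_simps)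
    then have w0': "w 0 = (1 / lform c u) *s u" using w0 by simp
    obtain b where b: "curve_holomorphic b (ball 0 \<tau>)" "\<And>x. w x = w 0 + x *s b x" by (rule curve_divide_id[OF w h(7)]) blast
    have "normal_curve c m (w 0) \<tau> \<phi>" unfolding normal_curve_def
    proof (intro conjI ballI exI[of _ b])
      fix x assume "x \<in> ball (0::complex) \<tau>"
      from \<phi>w[OF this] show "\<phi> x = x ^ m *s w 0 + x ^ Suc m *s b x"
        using b(2)[of x] by (simp add: vec_eq_iff algebra_simps)
    qed (use \<open>m > 0\<close> h(7) \<phi>hol inj l\<phi> w1 b(1) in auto)
    moreover have "germ_eq A (\<phi> ` ball 0 r')" if r': "0 < r'" "r' \<le> \<tau>" for r'
    proof -
      have "isCont h 0" using h(1,3) holomorphic_on_imp_continuous_on continuous_on_eq_continuous_at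
        by (metis centre_in_ball open_ball)
      from isCont_small[OF this h(5) r'(1)] obtain d where d: "d > 0" "\<And>t. norm t < d \<Longrightarrow> norm (h t) < r'" by auto
      define \<rho>' where "\<rho>' = min d \<delta>"
      have \<rho>': "0 < \<rho>'" "\<rho>' \<le> \<rho>" using d h(1,2) \<delta>1(2) by (auto simp: \<rho>'_def)
      have "\<psi> ` ball 0 \<rho>' \<subseteq> \<phi> ` ball 0 r'"
      proof
        fix z assume "z \<in> \<psi> ` ball 0 \<rho>'"
        then obtain t where t: "norm t < \<rho>'" "z = \<psi> t" by auto
        have ht: "norm (h t) < r'" using d(2)[of t] t(1) by (simp add: \<rho>'_def)
        then have "h t \<in> ball 0 \<tau>" using r'(2) by simp
        then have "h (h' (h t)) = h t" "h' (h t) \<in> ball 0 \<delta>" using h(9) by auto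
        then have "h' (h t) = t" using inj_onD[OF h(4)] t(1) by (simp add: \<rho>'_def)
        then have "z = \<phi> (h t)" using t(2) by (simp add: \<phi>_def)
        then show "z \<in> \<phi> ` ball 0 r'" using ht by auto
      qed
      moreover have "\<phi> ` ball 0 r' \<subseteq> \<psi> ` ball 0 \<rho>"
        using h'\<rho>(1) r'(2) by (auto simp: \<phi>_def intro!: imageI)
      ultimately show ?thesis using germ_eq_sandwich[OF \<psi>(5)[OF \<rho>'] \<psi>(5)[OF \<psi>(1) order_refl]] by blast
    qed
    ultimately show ?thesis unfolding w0' by blast
  qed
  then show ?thesis using \<open>m > 0\<close> \<open>u \<noteq> 0\<close> by blast
qed

section \<open>Tangent line, multiplicity and smoothness read off the normal form\<close>

lemma germ_eq_sequence:
  assumes "germ_eq A B" "w \<longlonglongrightarrow> 0" "\<forall>\<^sub>F s in sequentially. w s \<in> A"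
  shows "\<forall>\<^sub>F s in sequentially. w s \<in> B"
proof -
  have "\<forall>\<^sub>F s in sequentially. w s \<in> A \<longleftrightarrow> w s \<in> B"
    using assms(1,2) unfolding germ_eq_def by (rule eventually_compose_filterlim)
  then show ?thesis using assms(3) by eventually_elim simp
qed

text \<open>The modulus of the parameter is the \<open>m\<close>-th root of the modulus of the form,
  so it tends to 0 with the point.\<close>

lemma normal_curve_sequence:
  assumes "normal_curve c m u r \<phi>" "w \<longlonglongrightarrow> 0" "\<forall>\<^sub>F s in sequentially. w s \<in> \<phi> ` ball 0 r"
  obtains t where "t \<longlonglongrightarrow> 0" "\<forall>\<^sub>F s in sequentially. t s \<in> ball 0 r \<and> w s = \<phi> (t s)"
proof -
  note n = normal_curveD[OF assms(1)]
  define t where "t s = inv_into (ball 0 r) \<phi> (w s)" for s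
  have ev: "\<forall>\<^sub>F s in sequentially. t s \<in> ball 0 r \<and> w s = \<phi> (t s)"
    using assms(3)
  proof eventually_elim
    case (elim s)
    then show ?case using inv_into_into[OF elim] f_inv_into_f[OF elim] unfolding t_def by metis
  qed
  have eq: "\<forall>\<^sub>F s in sequentially. root m (norm (lform c (w s))) = norm (t s)"
    using ev
  proof eventually_elim
    case (elim s)
    then have "lform c (w s) = t s ^ m" using n(5) by auto
    then show ?case using n(1) by (simp add: norm_power real_root_power_cancel)
  qed
  have "(\<lambda>s. root m (norm (lform c (w s)))) \<longlonglongrightarrow> root m (norm (lform c (0::complex^'a)))"
    by (intro tendsto_real_root tendsto_norm tendsto_lform assms(2))
  then have "(\<lambda>s. root m (norm (lform c (w s)))) \<longlonglongrightarrow> 0" by simp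
  then have "(\<lambda>s. norm (t s)) \<longlonglongrightarrow> 0" using eq by (rule Lim_transform_eventually)
  then show ?thesis using ev that tendsto_norm_zero_cancel by blast
qed

lemma curve_sequence_tendsto:
  assumes "curve_holomorphic e (ball 0 \<delta>)" "\<delta> > 0" "t \<longlonglongrightarrow> 0"
  shows "(\<lambda>s. e (t s)) \<longlonglongrightarrow> e 0"
proof -
  have "isCont e 0"
    using curve_holomorphic_continuous[OF assms(1)] assms(2) by (auto simp: continuous_on_eq_continuous_at)
  then show ?thesis using assms(3) by (rule isCont_tendsto_compose)
qed

lemma tendsto_vec_scale:
  fixes f :: "'a \<Rightarrow> complex" and g :: "'a \<Rightarrow> complex^'n"
  assumes "(f \<longlongrightarrow> a) F" "(g \<longlongrightarrow> v) F"
  shows "((\<lambda>x. f x *s g x) \<longlongrightarrow> a *s v) F"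
proof (rule vec_tendstoI)
  show "((\<lambda>x. (f x *s g x) $ i) \<longlongrightarrow> (a *s v) $ i) F" for i
    by (simp, intro tendsto_intros assms)
qed

lemma nonzero_null_sequence:
  obtains t :: "nat \<Rightarrow> complex" where "t \<longlonglongrightarrow> 0" "\<And>s. t s \<noteq> 0"
proof
  have "(\<lambda>s. of_real (inverse (real (Suc s)))) \<longlonglongrightarrow> (of_real 0 :: complex)"
    by (rule tendsto_of_real[OF LIMSEQ_inverse_real_of_nat])
  then show "(\<lambda>s. of_real (inverse (real (Suc s)))) \<longlonglongrightarrow> (0 :: complex)" by (simp only: of_real_0)
  show "(of_real (inverse (real (Suc s))) :: complex) \<noteq> 0" for s by (simp del: of_nat_Suc)
qed

text \<open>On the curve \<open>w s\<close> is \<open>lform c (w s)\<close> times a vector tending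
  to \<open>u\<close>; hence the limit of the rescaled points is determined by the limit of their
  form.\<close>

lemma tangent_cone_normal:
  assumes n: "normal_curve c m u r \<phi>" and A: "germ_eq A (\<phi> ` ball 0 r)"
  shows "tangent_cone A = range (\<lambda>a. a *s u)"
proof (intro equalityI subsetI)
  note n' = normal_curveD[OF n]
  obtain b where b: "curve_holomorphic b (ball 0 r)" "\<And>t. t\<in>ball 0 r \<Longrightarrow> \<phi> t = t ^ m *s u + t ^ Suc m *s b t"
    using n'(7) by blast
  {
    fix v assume "v \<in> tangent_cone A"
    then obtain w k where w: "\<forall>s. w s \<in> A" "w \<longlonglongrightarrow> 0" "(\<lambda>s. k s *s w s) \<longlonglongrightarrow> v"
      unfolding tangent_cone_def by blast
    obtain t where t: "t \<longlonglongrightarrow> 0" "\<forall>\<^sub>F s in sequentially. t s \<in> ball 0 r \<and> w s = \<phi> (t s)"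
      by (rule normal_curve_sequence[OF n w(2) germ_eq_sequence[OF A w(2)]]) (use w in auto)
    have "(\<lambda>s. lform c (k s *s w s) *s (u + t s *s b (t s))) \<longlonglongrightarrow> lform c v *s (u + 0 *s b 0)"
      by (intro tendsto_vec_scale tendsto_lform w(3) tendsto_add tendsto_const t(1) curve_sequence_tendsto[OF b(1) n'(2) t(1)])
    moreover have "\<forall>\<^sub>F s in sequentially. lform c (k s *s w s) *s (u + t s *s b (t s)) = k s *s w s"
      using t(2)
    proof eventually_elim
      case (elim s)
      then have "lform c (w s) = t s ^ m" "w s = t s ^ m *s u + t s ^ Suc m *s b (t s)"
        using b(2)[of "t s"] n'(5)[of "t s"] by auto
      then show ?case by (simp only: lform_scale) (simp add: vec_eq_iff algebra_simps)
    qed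
    ultimately have "(\<lambda>s. k s *s w s) \<longlonglongrightarrow> lform c v *s (u + 0 *s b 0)"
      by (subst (asm) tendsto_cong)
    then have "v = lform c v *s (u + 0 *s b 0)" using w(3) LIMSEQ_unique by blast
    then show "v \<in> range (\<lambda>a. a *s u)" by (metis add.right_neutral rangeI vec.scale_zero_left)
  }
  fix v assume "v \<in> range (\<lambda>a. a *s u)"
  then obtain a where a: "v = a *s u" by auto
  obtain t :: "nat \<Rightarrow> complex" where t: "t \<longlonglongrightarrow> 0" and t0: "\<And>s. t s \<noteq> 0" by (rule nonzero_null_sequence) blast
  have tb: "\<forall>\<^sub>F s in sequentially. t s \<in> ball 0 r"
    using t n'(2) by (intro topological_tendstoD) auto
  have w0: "(\<lambda>s. \<phi> (t s)) \<longlonglongrightarrow> 0" using curve_sequence_tendsto[OF n'(3,2) t] n'(8) by simp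
  have "\<forall>\<^sub>F s in sequentially. \<phi> (t s) \<in> A"
    by (rule germ_eq_sequence[OF germ_eq_sym[OF A] w0]) (use tb in \<open>auto elim: eventually_mono\<close>)
  then obtain N where N: "\<And>s. s \<ge> N \<Longrightarrow> t s \<in> ball 0 r \<and> \<phi> (t s) \<in> A"
    using tb unfolding eventually_sequentially by (metis le_cases order_trans)
  have "(\<lambda>s. a *s (u + t s *s b (t s))) \<longlonglongrightarrow> a *s (u + 0 *s b 0)"
    by (intro tendsto_vec_scale tendsto_add tendsto_const t curve_sequence_tendsto[OF b(1) n'(2) t])
  then have "(\<lambda>s. a *s (u + t (s + N) *s b (t (s + N)))) \<longlonglongrightarrow> a *s (u + 0 *s b 0)"
    by (rule LIMSEQ_ignore_initial_segment)
  moreover have "a *s (u + t (s + N) *s b (t (s + N))) = (a / t (s + N) ^ m) *s \<phi> (t (s + N))" for s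
    using b(2)[of "t (s + N)"] N[of "s + N"] t0[of "s + N"] by (simp add: vec_eq_iff field_simps)
  ultimately have "(\<lambda>s. (a / t (s + N) ^ m) *s \<phi> (t (s + N))) \<longlonglongrightarrow> v" using a by simp
  moreover have "(\<lambda>s. \<phi> (t (s + N))) \<longlonglongrightarrow> 0" by (rule LIMSEQ_ignore_initial_segment[OF w0])
  ultimately show "v \<in> tangent_cone A" unfolding tangent_cone_def
    using N by (intro CollectI exI[of _ "\<lambda>s. \<phi> (t (s + N))"] exI[of _ "\<lambda>s. a / t (s + N) ^ m"]) auto
qed

text \<open>Since \<open>l\<close> restricted to the branch is \<open>h ^ k\<close> for a local
  coordinate \<open>h\<close>, a fibre over a small nonzero \<open>x\<close> is the image of the
  \<open>k\<close>-th roots of \<open>x\<close> under \<open>h'\<close> and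
  \<open>\<phi>\<close>.\<close>

lemma fibre_card:
  fixes \<phi> :: "complex \<Rightarrow> complex^'n" and l :: "complex^'n \<Rightarrow> complex" and h h' :: "complex \<Rightarrow> complex"
  assumes \<rho>: "\<rho> > 0" and \<phi>: "inj_on \<phi> (ball 0 \<rho>)" "continuous_on (ball 0 \<rho>) \<phi>" "\<phi> 0 = 0" and A: "germ_eq A (\<phi> ` ball 0 \<rho>)"
    and h: "inj_on h (ball 0 \<rho>)" "\<And>t. t \<in> ball 0 \<rho> \<Longrightarrow> l (\<phi> t) = h t ^ k" and "k > 0"
    and h': "\<tau> > 0" "continuous_on (ball 0 \<tau>) h'" "\<And>x. x \<in> ball 0 \<tau> \<Longrightarrow> h' x \<in> ball 0 \<rho> \<and> h (h' x) = x" "h' 0 = 0"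
  shows "\<forall>\<^sub>F e in at_right 0. \<forall>\<^sub>F x in at 0. card {z \<in> A. norm z < e \<and> l z = x} = k"
proof -
  obtain e0 where e0: "e0 > 0" "\<And>z. norm z < e0 \<Longrightarrow> z \<in> A \<longleftrightarrow> z \<in> \<phi> ` ball 0 \<rho>"
    using A unfolding germ_eq_def eventually_nhds_metric by (auto simp: dist_norm)
  have "\<forall>\<^sub>F x in at 0. card {z \<in> A. norm z < e \<and> l z = x} = k" if e: "0 < e" "e < e0" for e
  proof -
    have cont: "continuous_on (ball 0 \<tau>) (\<lambda>y. \<phi> (h' y))"
      by (rule continuous_on_compose2[OF \<phi>(2) h'(2)]) (use h'(3) in blast)
    have "open ((\<lambda>y. \<phi> (h' y)) -` ball 0 e \<inter> ball 0 \<tau>)"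
      using continuous_open_preimage[OF cont open_ball open_ball] by (simp add: Int_commute)
    moreover have "0 \<in> (\<lambda>y. \<phi> (h' y)) -` ball 0 e \<inter> ball 0 \<tau>" using e h'(1,4) \<phi>(3) by simp
    ultimately obtain d where d: "d > 0" "ball 0 d \<subseteq> (\<lambda>y. \<phi> (h' y)) -` ball 0 e \<inter> ball 0 \<tau>" using openE by blast
    have "card {z \<in> A. norm z < e \<and> l z = x} = k" if x: "x \<in> ball 0 (d ^ k)" "x \<noteq> 0" for x
    proof -
      have yd: "norm y < d" if "y ^ k = x" for y
      proof (rule power_less_imp_less_base)
        show "norm y ^ k < d ^ k" using that x(1) by (simp add: norm_power flip: that)
      qed (use d in simp)
      have "{z \<in> A. norm z < e \<and> l z = x} = (\<lambda>y. \<phi> (h' y)) ` {y. y ^ k = x}"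
      proof (intro equalityI subsetI)
        fix z assume z: "z \<in> {z \<in> A. norm z < e \<and> l z = x}"
        then obtain t where t: "t \<in> ball 0 \<rho>" "z = \<phi> t" using e0(2)[of z] e by auto
        have y: "h t ^ k = x" using h(2)[OF t(1)] t(2) z by simp
        have "h t \<in> ball 0 \<tau>" using yd[OF y] d(2) by auto
        then have "h' (h t) = t" using inj_onD[OF h(1)] h'(3) t(1) by metis
        then show "z \<in> (\<lambda>y. \<phi> (h' y)) ` {y. y ^ k = x}" using y t(2) by (intro image_eqI[of _ _ "h t"]) auto
      next
        fix z assume "z \<in> (\<lambda>y. \<phi> (h' y)) ` {y. y ^ k = x}"
        then obtain y where y: "y ^ k = x" "z = \<phi> (h' y)" by auto
        have "y \<in> ball 0 d" using yd[OF y(1)] by simp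
        then have "norm z < e" "y \<in> ball 0 \<tau>" using d(2) y(2) by auto
        moreover have "z \<in> \<phi> ` ball 0 \<rho>" "l z = x" using h'(3)[OF \<open>y \<in> ball 0 \<tau>\<close>] y h(2)[of "h' y"] by auto
        ultimately show "z \<in> {z \<in> A. norm z < e \<and> l z = x}" using e0(2)[of z] e by auto
      qed
      moreover have "inj_on (\<lambda>y. \<phi> (h' y)) {y. y ^ k = x}"
      proof (rule inj_onI)
        fix y y' assume y: "y \<in> {y. y ^ k = x}" "y' \<in> {y. y ^ k = x}" "\<phi> (h' y) = \<phi> (h' y')"
        have "y \<in> ball 0 d" "y' \<in> ball 0 d" using yd y by auto
        then have *: "y \<in> ball 0 \<tau>" "y' \<in> ball 0 \<tau>" using d(2) by auto
        then have "h' y = h' y'" using inj_onD[OF \<phi>(1) y(3)] h'(3) by blast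
        then show "y = y'" using h'(3) * by metis
      qed
      ultimately show ?thesis using card_nth_roots[OF x(2) \<open>k > 0\<close>] by (simp add: card_image)
    qed
    then show ?thesis using eventually_at_ball[of "d ^ k"] d(1) by (auto elim: eventually_mono)
  qed
  then show ?thesis using e0(1) unfolding eventually_at_right_field by blast
qed

lemma holomorphic_exponent_le:
  assumes "\<delta> > 0" "v holomorphic_on ball 0 \<delta>" "w holomorphic_on ball 0 \<delta>" "v 0 \<noteq> (0::complex)"
    and "\<And>t. t \<in> ball 0 \<delta> \<Longrightarrow> t ^ n * v t = t ^ m * w t"
  shows "m \<le> n"
proof (rule ccontr)
  assume "\<not> m \<le> n"
  then have mn: "t ^ m = t ^ n * t ^ (m - n)" for t :: complex by (metis le_add_diff_inverse nat_le_linear power_add)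
  have lim: "(f \<longlongrightarrow> f 0) (at 0)" if "f holomorphic_on ball 0 \<delta>" for f
    using holomorphic_on_imp_continuous_on[OF that] assms(1) by (simp add: continuous_on_eq_continuous_at isCont_def)
  have "\<forall>\<^sub>F t in at 0. v t = t ^ (m - n) * w t"
    using eventually_at_ball[OF assms(1)] by eventually_elim (use assms(5) mn in fastforce)
  moreover have "((\<lambda>t. t ^ (m - n) * w t) \<longlongrightarrow> 0 ^ (m - n) * w 0) (at 0)"
    by (intro tendsto_intros lim assms(3))
  ultimately have "(v \<longlongrightarrow> 0 ^ (m - n) * w 0) (at 0)" by (subst tendsto_cong)
  then have "v 0 = 0 ^ (m - n) * w 0" using lim[OF assms(2)] tendsto_unique[OF at_neq_bot] by blast
  then show False using assms(4) \<open>\<not> m \<le> n\<close> by (simp add: power_0_left)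
qed

text \<open>An admissible form has some order \<open>k\<close> along the branch, and
  \<open>k\<close> is its projection degree. All orders are at least \<open>m\<close>, the degree of
  the leading term, and the form of the normal curve attains \<open>m\<close>.\<close>

lemma germ_mult_normal:
  assumes n: "normal_curve c m u r \<phi>" and A: "\<And>r'. 0 < r' \<Longrightarrow> r' \<le> r \<Longrightarrow> germ_eq A (\<phi> ` ball 0 r')"
  shows "germ_mult A = m"
  unfolding germ_mult_def
proof (rule Least_equality)
  note n' = normal_curveD[OF n]
  have cont: "continuous_on (ball 0 r) \<phi>" by (rule curve_holomorphic_continuous[OF n'(3)])
  have "projection_degree A (lform c) m" unfolding projection_degree_def
  proof (intro conjI lform_linear)
    show "\<forall>\<^sub>F z in nhds 0. z \<in> A \<and> lform c z = 0 \<longrightarrow> z = 0"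
      using A[OF n'(2) order_refl] unfolding germ_eq_def
      by eventually_elim (use n'(1,5,8) in auto)
    show "\<forall>\<^sub>F \<rho> in at_right 0. \<forall>\<^sub>F x in at 0. card {z \<in> A. norm z < \<rho> \<and> lform c z = x} = m"
      by (rule fibre_card[OF n'(2,4) cont n'(8) A[OF n'(2) order_refl], where h = "\<lambda>t. t" and h' = "\<lambda>t. t" and \<tau> = r])
         (use n' in auto)
  qed
  then show "\<exists>l. projection_degree A l m" by blast
  fix d assume "\<exists>l. projection_degree A l d"
  then obtain l where l: "projection_degree A l d" by blast
  then obtain c' where c': "l = lform c'" using linear_eq_lform unfolding projection_degree_def by metis
  obtain b where b: "curve_holomorphic b (ball 0 r)" "\<And>t. t\<in>ball 0 r \<Longrightarrow> \<phi> t = t ^ m *s u + t ^ Suc m *s b t"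
    using n'(7) by blast
  define w where "w t = lform c' u + t * lform c' (b t)" for t
  have w: "w holomorphic_on ball 0 r" unfolding w_def[abs_def] by (intro holomorphic_intros holomorphic_lform_curve b)
  have fw: "l (\<phi> t) = t ^ m * w t" if "t \<in> ball 0 r" for t
    by (simp add: c' b(2)[OF that] lform_add lform_scale w_def algebra_simps)
  have "(\<lambda>t. l (\<phi> t)) holomorphic_on ball 0 r" unfolding c' by (rule holomorphic_lform_curve[OF n'(3)])
  then show "m \<le> d"
  proof (rule holomorphic_order_at_0[OF _ n'(2)])
    fix k v \<delta>
    assume v: "0 < \<delta>" "\<delta> \<le> r" "v holomorphic_on ball 0 \<delta>" "\<And>x. x \<in> ball 0 \<delta> \<Longrightarrow> l (\<phi> x) = x ^ k * v x"
      "(\<forall>x\<in>ball 0 \<delta>. v x \<noteq> 0) \<or> (\<forall>x\<in>ball 0 \<delta>. v x = 0)"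
    \<comment> \<open>Otherwise the form would vanish on the branch near 0, although 0 is its
      isolated zero on \<open>A\<close>.\<close>
    have v0: "v 0 \<noteq> 0"
    proof
      assume "v 0 = 0"
      then have z: "l (\<phi> x) = 0" if "x \<in> ball 0 \<delta>" for x using v that by auto
      have "(\<phi> \<longlongrightarrow> 0) (at 0)" using curve_tendsto_0[OF n'(3,2)] n'(8) by simp
      moreover have "\<forall>\<^sub>F z in nhds 0. (z \<in> A \<and> l z = 0 \<longrightarrow> z = 0) \<and> (z \<in> A \<longleftrightarrow> z \<in> \<phi> ` ball 0 r)"
        using l A[OF n'(2) order_refl] unfolding projection_degree_def germ_eq_def by (auto intro: eventually_conj)
      ultimately have "\<forall>\<^sub>F t in at 0. (\<phi> t \<in> A \<and> l (\<phi> t) = 0 \<longrightarrow> \<phi> t = 0) \<and> (\<phi> t \<in> A \<longleftrightarrow> \<phi> t \<in> \<phi> ` ball 0 r)"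
        by (rule eventually_compose_filterlim[rotated])
      then have "\<forall>\<^sub>F t in at (0::complex). False"
        using eventually_at_ball[OF v(1)]
      proof eventually_elim
        case (elim t)
        then have "t \<in> ball 0 r" using v(2) by auto
        then have "\<phi> t = 0" using elim z[of t] by auto
        then show False using inj_onD[OF n'(4), of t 0] n'(2,8) \<open>t \<in> ball 0 r\<close> elim by auto
      qed
      then show False by simp
    qed
    have "ball 0 \<delta> \<subseteq> ball (0::complex) r" using v(2) by auto
    have mk: "m \<le> k"
      by (rule holomorphic_exponent_le[OF v(1,3) holomorphic_on_subset[OF w \<open>ball 0 \<delta> \<subseteq> ball 0 r\<close>] v0])
         (use v(4) fw \<open>ball 0 \<delta> \<subseteq> ball 0 r\<close> in \<open>metis subsetD\<close>)
    then have "k > 0" using n'(1) by simp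
    from local_coordinate[OF v(3,1) v0 this]
    obtain h h' \<delta>' \<tau> where h: "0 < \<delta>'" "\<delta>' \<le> \<delta>" "h holomorphic_on ball 0 \<delta>'" "inj_on h (ball 0 \<delta>')" "h 0 = 0"
      "\<And>t. t \<in> ball 0 \<delta>' \<Longrightarrow> h t ^ k = t ^ k * v t"
      "0 < \<tau>" "h' holomorphic_on ball 0 \<tau>" "\<And>x. x \<in> ball 0 \<tau> \<Longrightarrow> h' x \<in> ball 0 \<delta>' \<and> h (h' x) = x" "h' 0 = 0" by metis
    have sub: "ball 0 \<delta>' \<subseteq> ball (0::complex) r" "\<delta>' \<le> r" using h(2) v(2) by auto
    have "\<forall>\<^sub>F e in at_right 0. \<forall>\<^sub>F x in at 0. card {z \<in> A. norm z < e \<and> l z = x} = k"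
    proof (rule fibre_card[OF h(1) _ _ n'(8) A[OF h(1) sub(2)] h(4) _ \<open>k > 0\<close> h(7) _ h(9,10)])
      show "inj_on \<phi> (ball 0 \<delta>')" using n'(4) sub(1) by (rule inj_on_subset)
      show "continuous_on (ball 0 \<delta>') \<phi>" using cont sub(1) by (rule continuous_on_subset)
      show "l (\<phi> t) = h t ^ k" if "t \<in> ball 0 \<delta>'" for t using h(2,6) v(4) that by auto
    qed (use h(8) in \<open>auto intro: holomorphic_on_imp_continuous_on\<close>)
    moreover have "\<forall>\<^sub>F e in at_right 0. \<forall>\<^sub>F x in at 0. card {z \<in> A. norm z < e \<and> l z = x} = d"
      using l unfolding projection_degree_def by blast
    ultimately have "\<forall>\<^sub>F e in at_right 0. (\<forall>\<^sub>F x in at 0. card {z \<in> A. norm z < e \<and> l z = x} = k) \<and>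
        (\<forall>\<^sub>F x in at 0. card {z \<in> A. norm z < e \<and> l z = x} = d)"
      by (rule eventually_conj)
    then obtain e where e: "\<forall>\<^sub>F x in at 0. card {z \<in> A. norm z < e \<and> l z = x} = k"
        "\<forall>\<^sub>F x in at 0. card {z \<in> A. norm z < e \<and> l z = x} = d"
      using eventually_happens'[OF trivial_limit_at_right_real] by blast
    then have "\<forall>\<^sub>F x in at (0::complex). k = d" by eventually_elim simp
    then have "k = d" by simp
    then show "m \<le> d" using mk by simp
  qed
qed

lemma curve_chain:
  fixes s B :: "complex \<Rightarrow> complex^'n"
  assumes B: "curve_holomorphic B (ball 0 \<delta>)" "\<delta> > 0" and s: "\<And>t. t \<in> ball 0 \<delta> \<Longrightarrow> s t = s 0 + t *s B t"
    and f: "(f has_derivative f') (at (s 0))" "\<And>c v. f' (c *s v) = c * f' v"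
  shows "((\<lambda>t. f (s t)) has_field_derivative f' (B 0)) (at 0)"
proof -
  have "((\<lambda>t. s t $ i) has_field_derivative B 0 $ i) (at 0)" for i
  proof -
    have "(\<lambda>t. B t $ i) holomorphic_on ball 0 \<delta>" using B(1) by (simp add: curve_holomorphic_def)
    then have "((\<lambda>t. B t $ i) has_field_derivative deriv (\<lambda>t. B t $ i) 0) (at 0)"
      using holomorphic_derivI[OF _ open_ball] B(2) by auto
    then have "((\<lambda>t. s 0 $ i + t * B t $ i) has_field_derivative (0 * deriv (\<lambda>t. B t $ i) 0 + 1 * B 0 $ i)) (at 0)"
      by (auto intro!: derivative_eq_intros)
    moreover have "\<forall>\<^sub>F t in nhds 0. t \<in> ball (0::complex) \<delta>"
      by (rule eventually_nhds_in_open) (use B(2) in auto)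
    then have "\<forall>\<^sub>F t in nhds 0. s 0 $ i + t * B t $ i = s t $ i"
      by (rule eventually_mono) (metis s vector_add_component vector_smult_component)
    ultimately show ?thesis using DERIV_cong_ev[OF refl] by fastforce
  qed
  then have "(s has_derivative (\<lambda>h. h *s B 0)) (at 0)" by (rule has_derivative_curve)
  from diff_chain_at[OF this f(1)] show ?thesis
    by (simp add: o_def has_field_derivative_def f(2) mult_commute_abs)
qed

text \<open>The linear model \<open>L\<close> lies in a line, namely that of the image
  \<open>w\<close> of \<open>u\<close> under the derivative of \<Phi>. Thus one coordinate of the
  transformed curve is an injective holomorphic function, with nonzero derivative; but for
  \<open>m \<ge> 2\<close> the curve has velocity 0 at 0.\<close>

lemma smooth_germ_imp_mult_1:
  fixes A :: "(complex^'n) set"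
  assumes n: "normal_curve c m u r \<phi>" and A: "germ_eq A (\<phi> ` ball 0 r)" and "smooth_germ A"
  shows "m = 1"
proof (rule ccontr)
  note n' = normal_curveD[OF n]
  assume "m \<noteq> 1"
  then have m: "m \<ge> 2" using n'(1) by linarith
  obtain U V \<Phi> \<Psi> L where *: "open U" "0 \<in> U" "open V" "homeomorphism U V \<Phi> \<Psi>" "holomorphic_map \<Phi> U" "holomorphic_map \<Psi> V"
     "\<Phi> 0 = (0 :: complex^'n)" "vec.subspace L" "\<Phi> ` (A \<inter> U) = L \<inter> V"
    using \<open>smooth_germ A\<close> unfolding smooth_germ_def by blast
  have hm: "\<And>x. x \<in> U \<Longrightarrow> \<Psi> (\<Phi> x) = x" "\<And>y. y \<in> V \<Longrightarrow> \<Phi> (\<Psi> y) = y" "\<And>x. x \<in> U \<Longrightarrow> \<Phi> x \<in> V" "\<And>y. y \<in> V \<Longrightarrow> \<Psi> y \<in> U"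
    using *(4) by (auto simp: homeomorphism_def)
  have V0: "0 \<in> V" "\<Psi> 0 = 0" using hm(1,3)[OF *(2)] *(7) by auto
  have "\<exists>f'. ((\<lambda>z. \<Phi> z $ i) has_derivative f') (at 0) \<and> (\<forall>c v. f' (c *s v) = c * f' v)" for i
    using *(5,2) unfolding holomorphic_map_def holomorphic_fun_def by blast
  then obtain f' where f': "\<And>i. ((\<lambda>z. \<Phi> z $ i) has_derivative f' i) (at 0)" "\<And>i c v. f' i (c *s v) = c * f' i v" by metis
  define w where "w = (\<chi> i. f' i u)"
  \<comment> \<open>A complex line in \<open>L\<close> is pulled back by \<Psi> to a curve in
    \<open>A\<close>, whose velocity at 0 belongs to the tangent cone and so is a multiple of
    \<open>u\<close>. Applying the derivative of \<Phi> returns the direction of the line.\<close>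
  have Lw: "\<exists>a. v = a *s w" if v: "v \<in> L" for v
  proof -
    have "continuous_on UNIV (\<lambda>t. t *s v)" by (intro continuous_on_vec_lambda continuous_intros | simp add: vector_scalar_mult_def)+
    then have "open ((\<lambda>t. t *s v) -` V)" using continuous_open_preimage[OF _ open_UNIV *(3)] by simp
    moreover have "0 \<in> (\<lambda>t. t *s v) -` V" using V0 by simp
    ultimately obtain \<delta> where \<delta>: "\<delta> > 0" "ball 0 \<delta> \<subseteq> (\<lambda>t. t *s v) -` V" using openE by blast
    define \<gamma> where "\<gamma> t = \<Psi> (t *s v)" for t
    have \<gamma>: "curve_holomorphic \<gamma> (ball 0 \<delta>)" unfolding \<gamma>_def[abs_def]
    proof (rule curve_holomorphicI)
      fix i
      show "(\<lambda>t. \<Psi> (t *s v) $ i) holomorphic_on ball 0 \<delta>"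
      proof (rule holomorphic_fun_curve[where f = "\<lambda>z. \<Psi> z $ i" and U = V and s = "\<lambda>t. t *s v"])
        show "holomorphic_fun (\<lambda>z. \<Psi> z $ i) V" using *(6) by (simp add: holomorphic_map_def)
        show "curve_holomorphic (\<lambda>t. t *s v) (ball 0 \<delta>)" by (rule curve_holomorphicI) (auto intro!: holomorphic_intros)
      qed (use \<delta> in auto)
    qed
    have \<gamma>0: "\<gamma> 0 = 0" using V0 by (simp add: \<gamma>_def)
    obtain B where B: "curve_holomorphic B (ball 0 \<delta>)" "\<And>t. \<gamma> t = \<gamma> 0 + t *s B t" by (rule curve_divide_id[OF \<gamma> \<delta>(1)]) blast
    have inA: "\<gamma> t \<in> A" if "t \<in> ball 0 \<delta>" for t
    proof -
      have "t *s v \<in> L \<inter> V" using \<delta>(2) that *(8) v by (auto intro: vec.subspace_scale)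
      then obtain z where "z \<in> A \<inter> U" "\<Phi> z = t *s v" using *(9) by (metis imageE)
      then show ?thesis using hm(1)[of z] by (auto simp: \<gamma>_def)
    qed
    have "B 0 \<in> tangent_cone A"
    proof -
      obtain t :: "nat \<Rightarrow> complex" where t: "t \<longlonglongrightarrow> 0" "\<And>s. t s \<noteq> 0" by (rule nonzero_null_sequence) blast
      have "\<forall>\<^sub>F s in sequentially. t s \<in> ball 0 \<delta>" using t(1) \<delta>(1) by (intro topological_tendstoD) auto
      then obtain N where N: "\<And>s. s \<ge> N \<Longrightarrow> t s \<in> ball 0 \<delta>" unfolding eventually_sequentially by blast
      have "(\<lambda>s. B (t (s + N))) \<longlonglongrightarrow> B 0"
        by (rule LIMSEQ_ignore_initial_segment[OF curve_sequence_tendsto[OF B(1) \<delta>(1) t(1)]])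
      moreover have "B (t (s + N)) = (1 / t (s + N)) *s \<gamma> (t (s + N))" for s
        using B(2)[of "t (s + N)"] \<gamma>0 t(2) by (simp add: vec_eq_iff)
      ultimately have "(\<lambda>s. (1 / t (s + N)) *s \<gamma> (t (s + N))) \<longlonglongrightarrow> B 0" by simp
      moreover have "(\<lambda>s. \<gamma> (t (s + N))) \<longlonglongrightarrow> 0"
        using LIMSEQ_ignore_initial_segment[OF curve_sequence_tendsto[OF \<gamma> \<delta>(1) t(1)]] \<gamma>0 by simp
      ultimately show ?thesis unfolding tangent_cone_def using inA N
        by (intro CollectI exI[of _ "\<lambda>s. \<gamma> (t (s + N))"] exI[of _ "\<lambda>s. 1 / t (s + N)"]) auto
    qed
    then obtain a where a: "B 0 = a *s u" using tangent_cone_normal[OF n A] by auto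
    have "v $ i = a * f' i u" for i
    proof -
      have "((\<lambda>t. \<Phi> (\<gamma> t) $ i) has_field_derivative f' i (B 0)) (at 0)"
        by (rule curve_chain[OF B(1) \<delta>(1) B(2)]) (use f' \<gamma>0 in auto)
      moreover have "\<forall>\<^sub>F t in nhds 0. \<Phi> (\<gamma> t) $ i = t * v $ i"
      proof (rule eventually_mono[OF eventually_nhds_in_open[OF open_ball, of 0 0 \<delta>]])
        show "\<Phi> (\<gamma> t) $ i = t * v $ i" if "t \<in> ball 0 \<delta>" for t
          using \<delta>(2) hm(2)[of "t *s v"] that by (auto simp: \<gamma>_def)
      qed (use \<delta> in auto)
      ultimately have "((\<lambda>t. t * v $ i) has_field_derivative f' i (B 0)) (at 0)"
        using DERIV_cong_ev[OF refl] by fastforce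
      moreover have "((\<lambda>t. t * v $ i) has_field_derivative v $ i) (at 0)" by (auto intro!: derivative_eq_intros)
      ultimately have "f' i (B 0) = v $ i" by (rule DERIV_unique)
      then show ?thesis by (simp add: a f'(2))
    qed
    then show ?thesis by (intro exI[of _ a]) (simp add: w_def vec_eq_iff)
  qed
  have "\<forall>\<^sub>F z in nhds 0. z \<in> U \<and> (z \<in> A \<longleftrightarrow> z \<in> \<phi> ` ball 0 r)"
    using eventually_nhds_in_open[OF *(1,2)] A unfolding germ_eq_def by (rule eventually_conj)
  then obtain W where W: "open W" "0 \<in> W" "\<And>z. z \<in> W \<Longrightarrow> z \<in> U \<and> (z \<in> A \<longleftrightarrow> z \<in> \<phi> ` ball 0 r)"
    unfolding eventually_nhds by blast
  have cont: "continuous_on (ball 0 r) \<phi>" by (rule curve_holomorphic_continuous[OF n'(3)])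
  have "open (\<phi> -` W \<inter> ball 0 r)" using continuous_open_preimage[OF cont open_ball W(1)] by (simp add: Int_commute)
  moreover have "0 \<in> \<phi> -` W \<inter> ball 0 r" using W(2) n'(2,8) by simp
  ultimately obtain \<delta> where \<delta>: "\<delta> > 0" "ball 0 \<delta> \<subseteq> \<phi> -` W \<inter> ball 0 r" using openE by blast
  have \<phi>U: "\<phi> t \<in> A \<inter> U" "t \<in> ball 0 r" if "t \<in> ball 0 \<delta>" for t
  proof -
    have t: "t \<in> \<phi> -` W \<inter> ball 0 r" using \<delta>(2) that by blast
    then show "t \<in> ball 0 r" by blast
    show "\<phi> t \<in> A \<inter> U" using W(3)[of "\<phi> t"] t by blast
  qed
  have "\<exists>a. \<Phi> (\<phi> t) = a *s w" if "t \<in> ball 0 \<delta>" for t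
    using Lw *(9) \<phi>U(1)[OF that] by blast
  then obtain a where a: "\<And>t. t \<in> ball 0 \<delta> \<Longrightarrow> \<Phi> (\<phi> t) = a t *s w" by metis
  have inj: "t = t'" if "t \<in> ball 0 \<delta>" "t' \<in> ball 0 \<delta>" "\<Phi> (\<phi> t) = \<Phi> (\<phi> t')" for t t'
  proof -
    have "\<phi> t = \<phi> t'" using hm(1)[of "\<phi> t"] hm(1)[of "\<phi> t'"] \<phi>U that by (metis IntD2)
    then show ?thesis using inj_onD[OF n'(4)] \<phi>U(2) that by blast
  qed
  have "w \<noteq> 0"
  proof
    assume "w = 0"
    then have "\<Phi> (\<phi> (of_real (\<delta> / 2))) = \<Phi> (\<phi> 0)" using a[of "of_real (\<delta> / 2)"] a[of 0] \<delta>(1) by simp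
    from inj[OF _ _ this] show False using \<delta>(1) by auto
  qed
  then obtain i where i: "w $ i \<noteq> 0" by (auto simp: vec_eq_iff)
  define G where "G t = \<Phi> (\<phi> t) $ i" for t
  have "G holomorphic_on ball 0 \<delta>" unfolding G_def[abs_def]
  proof (rule holomorphic_fun_curve[where f = "\<lambda>z. \<Phi> z $ i" and U = U and s = \<phi>])
    show "holomorphic_fun (\<lambda>z. \<Phi> z $ i) U" using *(5) by (simp add: holomorphic_map_def)
    show "curve_holomorphic \<phi> (ball 0 \<delta>)" by (rule curve_holomorphic_subset[OF n'(3)]) (use \<phi>U in auto)
  qed (use \<phi>U in auto)
  moreover have "inj_on G (ball 0 \<delta>)"
  proof (rule inj_onI)
    fix t t' assume t: "t \<in> ball 0 \<delta>" "t' \<in> ball 0 \<delta>" "G t = G t'"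
    then have "a t = a t'" using a i by (simp add: G_def)
    then show "t = t'" using inj[OF t(1,2)] a t by simp
  qed
  ultimately have "deriv G 0 \<noteq> 0" using \<delta>(1) by (intro holomorphic_injective_imp_regular[of G "ball 0 \<delta>"]) auto
  obtain b where b: "curve_holomorphic b (ball 0 r)" "\<And>t. t\<in>ball 0 r \<Longrightarrow> \<phi> t = t ^ m *s u + t ^ Suc m *s b t"
    using n'(7) by blast
  define B where "B t = t ^ (m - 1) *s u + t ^ m *s b t" for t
  have "curve_holomorphic B (ball 0 r)" unfolding B_def[abs_def]
    by (intro curve_holomorphic_add curve_holomorphic_scale curve_holomorphic_const b(1) holomorphic_intros)
  moreover have "\<phi> t = \<phi> 0 + t *s B t" if "t \<in> ball 0 r" for t
  proof -
    have "t ^ m = t * t ^ (m - 1)" using m by (cases m) auto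
    then show ?thesis using b(2)[OF that] n'(8) by (simp add: B_def vec_eq_iff algebra_simps)
  qed
  ultimately have "((\<lambda>t. \<Phi> (\<phi> t) $ i) has_field_derivative f' i (B 0)) (at 0)"
    using curve_chain[of B r \<phi> "\<lambda>z. \<Phi> z $ i" "f' i"] n'(2,8) f' by auto
  moreover have "B 0 = 0" using m by (simp add: B_def power_0_left vec_eq_iff)
  moreover have "f' i 0 = 0" using f'(2)[of i 0 0] by simp
  ultimately have "deriv G 0 = 0" unfolding G_def[abs_def] by (simp add: DERIV_imp_deriv)
  then show False using \<open>deriv G 0 \<noteq> 0\<close> by blast
qed

lemma holomorphic_fun_lform: "holomorphic_fun (lform c) U"
  unfolding lform_def[abs_def]
  by (intro holomorphic_fun_sum holomorphic_fun_mult holomorphic_fun_const holomorphic_fun_nth)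

text \<open>The shear subtracts, at the value of the form, the deviation of the curve from its
  tangent line. It leaves the form unchanged, so the opposite shear inverts it, and it carries
  \<open>\<phi> t\<close> to \<open>t *s u\<close>.\<close>

lemma mult_1_imp_smooth_germ:
  fixes A :: "(complex^'n) set"
  assumes n: "normal_curve c 1 u r \<phi>" and A: "germ_eq A (\<phi> ` ball 0 r)"
  shows "smooth_germ A"
proof -
  note n' = normal_curveD[OF n]
  have l\<phi>: "lform c (\<phi> t) = t" if "t \<in> ball 0 r" for t using n'(5)[OF that] by simp
  define D where "D = {z :: complex^'n. lform c z \<in> ball 0 r}"
  define \<Phi> where "\<Phi> z = z - \<phi> (lform c z) + lform c z *s u" for z
  define \<Psi> where "\<Psi> z = z + \<phi> (lform c z) - lform c z *s u" for z
  have openD: "open D"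
    unfolding D_def mem_ball dist_0_norm by (intro open_Collect_less continuous_on_norm continuous_on_lform continuous_on_const)
  have l: "lform c (\<Phi> z) = lform c z" "lform c (\<Psi> z) = lform c z" if "z \<in> D" for z
    using that l\<phi>[of "lform c z"] n'(6)
    by (simp_all add: \<Phi>_def \<Psi>_def D_def lform_add lform_diff lform_scale)
  have inv: "\<Psi> (\<Phi> z) = z" "\<Phi> (\<Psi> z) = z" if "z \<in> D" for z
    using l[OF that] unfolding \<Psi>_def[of "\<Phi> z"] \<Phi>_def[of "\<Psi> z"] by (simp_all add: \<Phi>_def \<Psi>_def)
  have hol: "holomorphic_fun (\<lambda>z. \<Phi> z $ i) D" "holomorphic_fun (\<lambda>z. \<Psi> z $ i) D" for i
  proof -
    have p: "holomorphic_fun (\<lambda>z. \<phi> (lform c z) $ i) D"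
      by (rule holomorphic_fun_compose[OF holomorphic_fun_lform _ open_ball, of "\<lambda>t. \<phi> t $ i" 0 r])
         (use n'(3) in \<open>auto simp: curve_holomorphic_def D_def\<close>)
    have "holomorphic_fun (\<lambda>z. z $ i + (- 1) * \<phi> (lform c z) $ i + lform c z * u $ i) D"
      by (intro holomorphic_fun_add holomorphic_fun_mult holomorphic_fun_nth holomorphic_fun_const holomorphic_fun_lform p)
    then show "holomorphic_fun (\<lambda>z. \<Phi> z $ i) D" by (simp add: \<Phi>_def)
    have "holomorphic_fun (\<lambda>z. z $ i + \<phi> (lform c z) $ i + lform c z * (- u $ i)) D"
      by (intro holomorphic_fun_add holomorphic_fun_mult holomorphic_fun_nth holomorphic_fun_const holomorphic_fun_lform p)
    then show "holomorphic_fun (\<lambda>z. \<Psi> z $ i) D" by (simp add: \<Psi>_def)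
  qed
  have cont: "continuous_on D \<Phi>" "continuous_on D \<Psi>"
    using continuous_on_vec_lambda[of D "\<lambda>i z. \<Phi> z $ i"] continuous_on_vec_lambda[of D "\<lambda>i z. \<Psi> z $ i"]
      holomorphic_fun_continuous[OF hol(1)] holomorphic_fun_continuous[OF hol(2)]
    by (simp_all add: vec_lambda_eta)
  obtain W where W: "open W" "0 \<in> W" "\<And>z. z \<in> W \<Longrightarrow> z \<in> A \<longleftrightarrow> z \<in> \<phi> ` ball 0 r"
    using A unfolding germ_eq_def eventually_nhds by blast
  define U where "U = W \<inter> D"
  define V where "V = \<Psi> -` W \<inter> D"
  have VU: "\<Psi> z \<in> U" if "z \<in> V" for z using that l(2)[of z] by (auto simp: U_def V_def D_def)
  have UV: "\<Phi> z \<in> V" if "z \<in> U" for z using that l(1)[of z] inv(1)[of z] by (auto simp: U_def V_def D_def)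
  have UVD: "U \<subseteq> D" "V \<subseteq> D" by (auto simp: U_def V_def)
  have 0: "\<Phi> 0 = 0" using n'(8) by (simp add: \<Phi>_def)
  show ?thesis unfolding smooth_germ_def
  proof (intro exI conjI)
    show "open U" using W openD by (auto simp: U_def)
    show "0 \<in> U" using W n'(2) by (simp add: U_def D_def)
    show "open V" using continuous_open_preimage[OF cont(2) openD W(1)] by (simp add: V_def Int_commute)
    show "homeomorphism U V \<Phi> \<Psi>" unfolding homeomorphism_def
    proof (intro conjI ballI)
      show "\<Phi> ` U = V"
      proof (intro equalityI subsetI)
        fix y assume y: "y \<in> V"
        then have "y = \<Phi> (\<Psi> y)" using inv(2)[of y] UVD by auto
        then show "y \<in> \<Phi> ` U" using VU[OF y] by blast
      qed (use UV in blast)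
      show "\<Psi> ` V = U"
      proof (intro equalityI subsetI)
        fix y assume y: "y \<in> U"
        then have "y = \<Psi> (\<Phi> y)" using inv(1)[of y] UVD by auto
        then show "y \<in> \<Psi> ` V" using UV[OF y] by blast
      qed (use VU in blast)
    qed (use inv UVD cont in \<open>auto intro: continuous_on_subset\<close>)
    show "holomorphic_map \<Phi> U" "holomorphic_map \<Psi> V"
      unfolding holomorphic_map_def using hol UVD holomorphic_fun_subset by blast+
    show "\<Phi> 0 = 0" by (rule 0)
    show "vec.subspace (range (\<lambda>a. a *s u))"
      unfolding vec.subspace_def
    proof (intro conjI ballI allI)
      show "0 \<in> range (\<lambda>a. a *s u)" by (rule range_eqI[of _ _ 0]) simp
      fix x assume "x \<in> range (\<lambda>a. a *s u)"
      then obtain a where x: "x = a *s u" by blast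
      show "k *s x \<in> range (\<lambda>a. a *s u)" for k
        by (rule range_eqI[of _ _ "k * a"]) (simp add: x)
      fix y assume "y \<in> range (\<lambda>a. a *s u)"
      then obtain b where y: "y = b *s u" by blast
      show "x + y \<in> range (\<lambda>a. a *s u)"
        by (rule range_eqI[of _ _ "a + b"]) (simp add: x y vec.scale_left_distrib)
    qed
    show "\<Phi> ` (A \<inter> U) = range (\<lambda>a. a *s u) \<inter> V"
    proof (intro equalityI subsetI)
      fix y assume "y \<in> \<Phi> ` (A \<inter> U)"
      then obtain z where z: "z \<in> A" "z \<in> U" "y = \<Phi> z" by auto
      then obtain t where t: "t \<in> ball 0 r" "z = \<phi> t" using W(3)[of z] by (auto simp: U_def)
      then have "y = t *s u" using z(3) l\<phi>[OF t(1)] by (simp add: \<Phi>_def)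
      then show "y \<in> range (\<lambda>a. a *s u) \<inter> V" using UV[OF z(2)] z(3) by auto
    next
      fix y assume y: "y \<in> range (\<lambda>a. a *s u) \<inter> V"
      then obtain a where a: "y = a *s u" by auto
      have la: "lform c y = a" using a n'(6) by (simp add: lform_scale)
      have "y \<in> D" "\<Psi> y \<in> U" using y UVD VU by auto
      have "\<Psi> y = \<phi> a" by (simp add: \<Psi>_def la) (simp add: a)
      moreover have "a \<in> ball 0 r" using \<open>y \<in> D\<close> la by (simp add: D_def)
      ultimately have "\<Psi> y \<in> A" using W(3)[of "\<Psi> y"] \<open>\<Psi> y \<in> U\<close> by (auto simp: U_def)
      then show "y \<in> \<Phi> ` (A \<inter> U)" using \<open>\<Psi> y \<in> U\<close> inv(2)[OF \<open>y \<in> D\<close>] by (metis IntI imageI)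
    qed
  qed
qed

section \<open>Limits of secants of a pair of branches\<close>

lemma prod_roots_unity:
  fixes a b :: complex
  assumes "m > 0"
  shows "(\<Prod>\<omega> | \<omega> ^ m = 1. b - \<omega> * a) = b ^ m - a ^ m"
proof -
  let ?R = "{\<omega> :: complex. \<omega> ^ m = 1}"
  have R: "finite ?R" "card ?R = m" using finite_roots_unity[of m] card_roots_unity_eq[OF assms] assms by auto
  define p where "p = (\<Prod>\<omega>\<in>?R. [:- \<omega>, 1:])"
  have dp: "degree p = m" using R by (simp add: p_def degree_prod_eq_sum_degree)
  have "lead_coeff p = 1" by (simp add: p_def lead_coeff_prod)
  then have lp: "coeff p m = 1" using dp by simp
  have "p = monom 1 m - 1"
  proof (rule poly_eqI_degree_lead_coeff[where n = m and A = ?R])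
    show "coeff p m = coeff (monom 1 m - 1) m" using lp assms by simp
    show "degree (monom 1 m - 1 :: complex poly) \<le> m" by (rule degree_diff_le) (auto simp: degree_monom_le)
    show "poly p z = poly (monom 1 m - 1) z" if "z \<in> ?R" for z
    proof -
      have "poly p z = 0" using that R(1) unfolding p_def poly_prod by (intro prod_zero) auto
      then show ?thesis using that by (simp add: poly_monom)
    qed
  qed (use dp R in auto)
  then have "poly p x = poly (monom 1 m - 1) x" for x by simp
  then have p: "(\<Prod>\<omega>\<in>?R. x - \<omega>) = x ^ m - 1" for x unfolding p_def poly_prod by (simp add: poly_monom)
  show ?thesis
  proof (cases "a = 0")
    case True
    then show ?thesis using R assms by (simp add: zero_power)
  next
    case False
    have "(\<Prod>\<omega>\<in>?R. b - \<omega> * a) = (\<Prod>\<omega>\<in>?R. a * (b / a - \<omega>))"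
      by (rule prod.cong) (use False in \<open>auto simp: field_simps\<close>)
    also have "\<dots> = a ^ m * ((b / a) ^ m - 1)" using R p[of "b / a"] by (simp add: prod.distrib)
    also have "\<dots> = b ^ m - a ^ m" using False by (simp add: power_divide field_simps)
    finally show ?thesis .
  qed
qed

text \<open>If \<open>a\<close> is the root of \<open>a ^ m\<close> closest to \<open>b\<close>, then all other factors of \<open>b ^ m - a ^ m\<close> are bounded below.\<close>

lemma closest_root_estimate:
  assumes "m > 0"
  obtains K :: real where "K > 0"
    "\<And>a b :: complex. (\<And>\<omega>. \<omega> ^ m = 1 \<Longrightarrow> norm (a - b) \<le> norm (\<omega> * a - b)) \<Longrightarrow>
       norm a ^ m * norm (a - b) \<le> K * norm a * norm (a ^ m - b ^ m)"
proof -
  let ?R = "{\<omega> :: complex. \<omega> ^ m = 1}"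
  have R: "finite ?R" "card ?R = m" using finite_roots_unity[of m] card_roots_unity_eq[OF assms] assms by auto
  have fin: "finite (insert 1 ((\<lambda>\<omega>. norm (\<omega> - 1) / 2) ` (?R - {1})))" using R by auto
  \<comment> \<open>Half the least distance from 1 to another root of unity:
    \<open>norm (\<omega> - 1) * norm a\<close> is at most twice
    \<open>norm (\<omega> * a - b)\<close>. The inserted 1 covers \<open>m = 1\<close>, where no
    other root exists.\<close>
  define \<kappa> where "\<kappa> = Min (insert 1 ((\<lambda>\<omega>. norm (\<omega> - 1) / 2) ` (?R - {1})))"
  have \<kappa>0: "\<kappa> > 0" unfolding \<kappa>_def using R by (subst Min_gr_iff[OF fin]) auto
  have \<kappa>: "\<kappa> \<le> norm (\<omega> - 1) / 2" if "\<omega> \<in> ?R - {1}" for \<omega>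
    unfolding \<kappa>_def by (rule Min_le[OF fin]) (use that in auto)
  show ?thesis
  proof (rule that[of "1 / \<kappa> ^ (m - 1)"])
    fix a b :: complex
    assume ab: "\<And>\<omega>. \<omega> ^ m = 1 \<Longrightarrow> norm (a - b) \<le> norm (\<omega> * a - b)"
    have "\<kappa> * norm a \<le> norm (b - \<omega> * a)" if "\<omega> \<in> ?R - {1}" for \<omega>
    proof -
      have "(\<omega> - 1) * a = (\<omega> * a - b) - (a - b)" by (simp add: algebra_simps)
      then have "norm (\<omega> - 1) * norm a \<le> norm (\<omega> * a - b) + norm (a - b)"
        by (metis norm_mult norm_triangle_ineq4)
      also have "\<dots> \<le> 2 * norm (b - \<omega> * a)" using ab[of \<omega>] that by (simp add: norm_minus_commute)
      finally have *: "norm (\<omega> - 1) * norm a \<le> 2 * norm (b - \<omega> * a)" .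
      have "\<kappa> * norm a \<le> norm (\<omega> - 1) / 2 * norm a" using \<kappa>[OF that] by (intro mult_right_mono) auto
      then show ?thesis using * by simp
    qed
    then have "(\<Prod>\<omega>\<in>?R - {1}. \<kappa> * norm a) \<le> (\<Prod>\<omega>\<in>?R - {1}. norm (b - \<omega> * a))"
      using \<kappa>0 by (intro prod_mono) auto
    then have P: "(\<kappa> * norm a) ^ (m - 1) \<le> (\<Prod>\<omega>\<in>?R - {1}. norm (b - \<omega> * a))" using R by simp
    have "norm (b ^ m - a ^ m) = (\<Prod>\<omega>\<in>?R. norm (b - \<omega> * a))"
      using prod_roots_unity[OF assms, of b a] by (simp add: prod_norm)
    also have "\<dots> = norm (b - a) * (\<Prod>\<omega>\<in>?R - {1}. norm (b - \<omega> * a))"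
      using R prod.remove[of ?R 1 "\<lambda>\<omega>. norm (b - \<omega> * a)"] by simp
    also have "\<dots> \<ge> norm (b - a) * (\<kappa> * norm a) ^ (m - 1)" using P by (intro mult_left_mono) auto
    finally have "norm (b - a) * (\<kappa> * norm a) ^ (m - 1) * norm a \<le> norm (b ^ m - a ^ m) * norm a"
      by (intro mult_right_mono) auto
    moreover have "norm a ^ m = norm a ^ (m - 1) * norm a" using assms by (cases m) auto
    ultimately show "norm a ^ m * norm (a - b) \<le> 1 / \<kappa> ^ (m - 1) * norm a * norm (a ^ m - b ^ m)"
      using \<kappa>0 by (simp add: power_mult_distrib field_simps norm_minus_commute)
  qed (use \<kappa>0 in simp)
qed

lemma norm_vec_le_sum: "norm (x :: complex^'n) \<le> (\<Sum>i\<in>UNIV. norm (x $ i))"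
  unfolding norm_vec_def by (rule L2_set_le_sum) auto

lemma norm_scale_vec: "norm (a *s (x :: complex^'n)) = norm a * norm x"
  by (simp add: norm_vec_def L2_set_right_distrib norm_mult)

lemma norm_root_unity: "\<eta> ^ m = 1 \<Longrightarrow> m > 0 \<Longrightarrow> norm (\<eta> :: complex) = 1"
  using power_eq_imp_eq_norm[of \<eta> m 1] by simp

lemma curve_lipschitz:
  fixes s :: "complex \<Rightarrow> complex^'n"
  assumes "curve_holomorphic s (ball 0 r)" "0 < \<delta>" "\<delta> < r"
  obtains L where "L \<ge> 0" "\<And>a b. a \<in> ball 0 \<delta> \<Longrightarrow> b \<in> ball 0 \<delta> \<Longrightarrow> norm (s a - s b) \<le> L * norm (a - b)"
proof -
  have "\<exists>L\<ge>0. \<forall>a\<in>ball 0 \<delta>. \<forall>b\<in>ball 0 \<delta>. norm (s a $ i - s b $ i) \<le> L * norm (a - b)" for i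
  proof -
    have hol: "(\<lambda>t. s t $ i) holomorphic_on ball 0 r" using assms(1) by (simp add: curve_holomorphic_def)
    have sub: "cball 0 \<delta> \<subseteq> ball (0::complex) r" using assms(3) by auto
    have "continuous_on (cball 0 \<delta>) (deriv (\<lambda>t. s t $ i))"
      using holomorphic_on_imp_continuous_on[OF holomorphic_deriv[OF hol open_ball]] sub by (rule continuous_on_subset)
    then have "bounded (deriv (\<lambda>t. s t $ i) ` cball 0 \<delta>)"
      using compact_continuous_image[OF _ compact_cball] compact_imp_bounded by blast
    then obtain L where L: "L > 0" "\<And>z. z \<in> cball 0 \<delta> \<Longrightarrow> norm (deriv (\<lambda>t. s t $ i) z) \<le> L"
      unfolding bounded_pos by auto
    have "norm (s a $ i - s b $ i) \<le> L * norm (a - b)" if "a \<in> ball 0 \<delta>" "b \<in> ball 0 \<delta>" for a b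
    proof (rule field_differentiable_bound[of "cball 0 \<delta>" "\<lambda>t. s t $ i" "deriv (\<lambda>t. s t $ i)"])
      show "((\<lambda>t. s t $ i) has_field_derivative deriv (\<lambda>t. s t $ i) z) (at z within cball 0 \<delta>)" if "z \<in> cball 0 \<delta>" for z
        using holomorphic_derivI[OF hol open_ball] sub that by blast
    qed (use L that in \<open>auto simp: mem_ball mem_cball\<close>)
    then show ?thesis using L(1) by (intro exI[of _ L]) auto
  qed
  then obtain L where L: "\<And>i. L i \<ge> 0" "\<And>i a b. a\<in>ball 0 \<delta> \<Longrightarrow> b\<in>ball 0 \<delta> \<Longrightarrow> norm (s a $ i - s b $ i) \<le> L i * norm (a - b)" by metis
  show ?thesis
  proof (rule that[of "\<Sum>i\<in>UNIV. L i"])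
    fix a b :: complex assume ab: "a \<in> ball 0 \<delta>" "b \<in> ball 0 \<delta>"
    have "norm (s a - s b) \<le> (\<Sum>i\<in>UNIV. norm ((s a - s b) $ i))" by (rule norm_vec_le_sum)
    also have "\<dots> \<le> (\<Sum>i\<in>UNIV. L i * norm (a - b))" using L(2)[OF ab] by (intro sum_mono) simp
    finally show "norm (s a - s b) \<le> (\<Sum>i\<in>UNIV. L i) * norm (a - b)" by (simp add: sum_distrib_right)
  qed (use L in \<open>auto intro: sum_nonneg\<close>)
qed

lemma normal_curve_remainder:
  assumes "normal_curve c m u r \<phi>"
  obtains H L \<delta> where "0 < \<delta>" "\<delta> \<le> r" "L \<ge> 0" "curve_holomorphic H (ball 0 \<delta>)" "H 0 = 0"
    "\<And>t. t \<in> ball 0 \<delta> \<Longrightarrow> \<phi> t = t ^ m *s (u + H t)"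
    "\<And>a b. a \<in> ball 0 \<delta> \<Longrightarrow> b \<in> ball 0 \<delta> \<Longrightarrow> norm (H a - H b) \<le> L * norm (a - b)"
proof -
  note n = normal_curveD[OF assms]
  obtain b where b: "curve_holomorphic b (ball 0 r)" "\<And>t. t \<in> ball 0 r \<Longrightarrow> \<phi> t = t ^ m *s u + t ^ Suc m *s b t"
    using n(7) by blast
  define H where "H t = t *s b t" for t
  have H: "curve_holomorphic H (ball 0 r)" unfolding H_def[abs_def] by (intro curve_holomorphic_scale holomorphic_intros b)
  have \<delta>: "0 < r / 2" "r / 2 < r" using n(2) by auto
  obtain L where L: "L \<ge> 0" "\<And>a b. a \<in> ball 0 (r/2) \<Longrightarrow> b \<in> ball 0 (r/2) \<Longrightarrow> norm (H a - H b) \<le> L * norm (a - b)"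
    by (rule curve_lipschitz[OF H \<delta>]) blast
  show ?thesis
  proof (rule that[of "r / 2" L H])
    show "curve_holomorphic H (ball 0 (r / 2))" by (rule curve_holomorphic_subset[OF H]) (use n(2) in auto)
    show "\<phi> t = t ^ m *s (u + H t)" if "t \<in> ball 0 (r / 2)" for t
      using b(2)[of t] that n(2) by (simp add: H_def vec_eq_iff algebra_simps)
  qed (use L n(2) in \<open>auto simp: H_def\<close>)
qed

text \<open>The contribution to \<open>C5\<close> of the secants between two branches, expressed by
  parameters tending to 0; equal arguments give the secants within one branch.\<close>

definition pair_cone :: "(complex \<Rightarrow> complex^'n) \<Rightarrow> (complex \<Rightarrow> complex^'n) \<Rightarrow> (complex^'n) set" where
  "pair_cone \<phi> \<psi> = {v. \<exists>t t' k. t \<longlonglongrightarrow> 0 \<and> t' \<longlonglongrightarrow> 0 \<and> (\<forall>\<^sub>F s in sequentially. \<phi> (t s) \<noteq> \<psi> (t' s)) \<and>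
     (\<lambda>s. k s *s (\<phi> (t s) - \<psi> (t' s))) \<longlonglongrightarrow> v}"

lemma finite_range_subsequence:
  fixes f :: "nat \<Rightarrow> 'a"
  assumes "finite (range f)"
  obtains h :: "nat \<Rightarrow> nat" and k where "strict_mono h" "\<And>s. f (h s) = k"
proof -
  obtain a where "infinite {s \<in> UNIV. f s = f a}"
    using pigeonhole_infinite[OF infinite_UNIV_nat assms] by blast
  then have inf: "infinite {s. f s = f a}" by simp
  show ?thesis
  proof (rule that[of "enumerate {s. f s = f a}" "f a"])
    show "strict_mono (enumerate {s. f s = f a})" using inf by (rule strict_mono_enumerate)
    show "f (enumerate {s. f s = f a} s) = f a" for s using enumerate_in_set[OF inf, of s] by simp
  qed
qed

text \<open>Among the parameters \<open>a = \<eta> * \<tau> ^ q\<close> in the fibre of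
  \<open>\<phi> (\<tau> ^ p)\<close> take the one nearest to the given parameter \<open>b\<close>.
  Then \<open>\<psi> a - \<psi> b\<close> is \<open>a ^ m' - b ^ m'\<close> times a vector tending
  to \<open>u'\<close>, plus \<open>a ^ m'\<close> times a Lipschitz difference. The form controls
  the first part; by \<open>closest_root_estimate\<close> the second becomes negligible since
  \<open>a\<close> tends to 0. What is left is the difference within the fibre, with leading vector
  \<open>D \<eta>\<close>.\<close>

lemma pair_cone_subset:
  fixes \<phi> \<psi> :: "complex \<Rightarrow> complex^'n" and p q :: nat
  assumes n: "normal_curve c m u r \<phi>" and n': "normal_curve c m' u' r' \<psi>"
    and pq: "p > 0" "q > 0" "p * m = q * m'" and v: "v \<in> pair_cone \<phi> \<psi>"
    and D: "\<And>\<eta>. \<eta> ^ m' = 1 \<Longrightarrow> \<exists>k. curve_leads (\<lambda>\<tau>. \<phi> (\<tau> ^ p) - \<psi> (\<eta> * \<tau> ^ q)) k (D \<eta>)"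
  shows "\<exists>\<eta> \<alpha> \<beta>. \<eta> ^ m' = 1 \<and> v = \<alpha> *s u' + \<beta> *s D \<eta>"
proof -
  obtain t0 t0' k0 where t0: "t0 \<longlonglongrightarrow> 0" "t0' \<longlonglongrightarrow> 0" "(\<lambda>s. k0 s *s (\<phi> (t0 s) - \<psi> (t0' s))) \<longlonglongrightarrow> v"
    using v unfolding pair_cone_def by blast
  have "\<exists>\<tau>. \<tau> ^ p = t0 s \<and> norm \<tau> ^ p = norm (t0 s)" for s by (rule complex_root_exists[OF pq(1), of "t0 s"]) blast
  then obtain \<tau>0 where \<tau>0: "\<And>s. \<tau>0 s ^ p = t0 s" by metis
  let ?R = "{\<omega> :: complex. \<omega> ^ m' = 1}"
  have m': "m' > 0" using normal_curveD(1)[OF n'] .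
  have R: "finite ?R" "1 \<in> ?R" using finite_roots_unity[of m'] m' by auto
  have "\<exists>\<eta>\<in>?R. \<forall>\<omega>\<in>?R. norm (\<eta> * \<tau>0 s ^ q - t0' s) \<le> norm (\<omega> * \<tau>0 s ^ q - t0' s)" for s
  proof -
    define A where "A = (\<lambda>\<omega>. norm (\<omega> * \<tau>0 s ^ q - t0' s)) ` ?R"
    have A: "finite A" "A \<noteq> {}" unfolding A_def using R by blast+
    have "Min A \<in> A" using Min_in[OF A] .
    then obtain \<eta> where "\<eta> \<in> ?R" "Min A = norm (\<eta> * \<tau>0 s ^ q - t0' s)" unfolding A_def by blast
    then show ?thesis using Min_le[OF A(1)] by (intro bexI[of _ \<eta>]) (auto simp: A_def)
  qed
  then obtain \<eta>0 where \<eta>0: "\<And>s. \<eta>0 s ^ m' = 1"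
    "\<And>s \<omega>. \<omega> ^ m' = 1 \<Longrightarrow> norm (\<eta>0 s * \<tau>0 s ^ q - t0' s) \<le> norm (\<omega> * \<tau>0 s ^ q - t0' s)" by (simp, metis)
  have "finite (range \<eta>0)" by (rule finite_subset[OF _ R(1)]) (use \<eta>0 in auto)
  \<comment> \<open>Some root of unity is the nearest one infinitely often; the subsequence fixes
    it.\<close>
  then obtain h :: "nat \<Rightarrow> nat" and \<eta> where h: "strict_mono h" "\<And>s. \<eta>0 (h s) = \<eta>" by (rule finite_range_subsequence) blast
  have \<eta>: "\<eta> ^ m' = 1" using \<eta>0(1)[of "h 0"] h(2) by simp
  define \<tau> where "\<tau> s = \<tau>0 (h s)" for s
  define b where "b s = t0' (h s)" for s
  define a where "a s = \<eta> * \<tau> s ^ q" for s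
  define k where "k s = k0 (h s)" for s
  have b0: "b \<longlonglongrightarrow> 0" using LIMSEQ_subseq_LIMSEQ[OF t0(2) h(1)] by (simp add: b_def[abs_def] o_def)
  have "(\<lambda>s. \<tau>0 s ^ p) \<longlonglongrightarrow> 0" using t0(1) \<tau>0 by simp
  then have "(\<lambda>s. norm (\<tau>0 s) ^ p) \<longlonglongrightarrow> 0" unfolding norm_power[symmetric] by (rule tendsto_norm_zero)
  then have "(\<lambda>s. root p (norm (\<tau>0 s) ^ p)) \<longlonglongrightarrow> root p 0" by (rule tendsto_real_root)
  then have "\<tau>0 \<longlonglongrightarrow> 0" using pq(1) by (simp add: real_root_power_cancel tendsto_norm_zero_iff)
  then have \<tau>: "\<tau> \<longlonglongrightarrow> 0" using LIMSEQ_subseq_LIMSEQ[OF _ h(1)] by (simp add: \<tau>_def[abs_def] o_def)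
  have "a \<longlonglongrightarrow> \<eta> * 0 ^ q" unfolding a_def[abs_def] by (intro tendsto_intros \<tau>)
  then have a0: "a \<longlonglongrightarrow> 0" using pq(2) by (simp add: zero_power)
  have close: "norm (a s - b s) \<le> norm (\<omega> * a s - b s)" if "\<omega> ^ m' = 1" for \<omega> s
  proof -
    have "(\<omega> * \<eta>) ^ m' = 1" unfolding power_mult_distrib that \<eta> by simp
    from \<eta>0(2)[OF this, of "h s"] show ?thesis unfolding a_def b_def \<tau>_def h(2) mult.assoc .
  qed
  have lim: "(\<lambda>s. k s *s (\<phi> (\<tau> s ^ p) - \<psi> (b s))) \<longlonglongrightarrow> v"
    using LIMSEQ_subseq_LIMSEQ[OF t0(3) h(1)] \<tau>0 by (simp add: o_def k_def \<tau>_def b_def)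
  obtain H L \<delta> where H: "0 < \<delta>" "\<delta> \<le> r'" "L \<ge> 0" "curve_holomorphic H (ball 0 \<delta>)" "H 0 = 0"
    "\<And>t. t \<in> ball 0 \<delta> \<Longrightarrow> \<psi> t = t ^ m' *s (u' + H t)"
    "\<And>a b. a \<in> ball 0 \<delta> \<Longrightarrow> b \<in> ball 0 \<delta> \<Longrightarrow> norm (H a - H b) \<le> L * norm (a - b)"
    by (rule normal_curve_remainder[OF n']) blast
  obtain K where K: "K > 0" "\<And>a b :: complex. (\<And>\<omega>. \<omega> ^ m' = 1 \<Longrightarrow> norm (a - b) \<le> norm (\<omega> * a - b)) \<Longrightarrow>
       norm a ^ m' * norm (a - b) \<le> K * norm a * norm (a ^ m' - b ^ m')"
    by (rule closest_root_estimate[OF m']) blast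
  have tp: "(\<lambda>s. \<tau> s ^ p) \<longlonglongrightarrow> 0" using tendsto_power[OF \<tau>, of p] pq(1) by (simp add: zero_power)
  have ball: "\<forall>\<^sub>F s in sequentially. \<tau> s ^ p \<in> ball 0 r \<and> a s \<in> ball 0 \<delta> \<and> b s \<in> ball 0 \<delta>"
    using H(1) normal_curveD(2)[OF n] by (intro eventually_conj topological_tendstoD[OF tp] topological_tendstoD[OF a0] topological_tendstoD[OF b0]) auto
  have am: "a s ^ m' = \<tau> s ^ (p * m)" for s
    using \<eta> pq(3) by (simp add: a_def power_mult_distrib mult.commute flip: power_mult)
  \<comment> \<open>The value of the form on the rescaled secant, both branches being in normal
    form; its limit is the coefficient of \<open>u'\<close> in \<open>v\<close>.\<close>
  define \<Delta> where "\<Delta> s = k s * (a s ^ m' - b s ^ m')" for s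
  have \<Delta>: "\<Delta> \<longlonglongrightarrow> lform c v"
  proof (rule Lim_transform_eventually[OF tendsto_lform[OF lim]])
    show "\<forall>\<^sub>F s in sequentially. lform c (k s *s (\<phi> (\<tau> s ^ p) - \<psi> (b s))) = \<Delta> s"
      using ball
    proof eventually_elim
      case (elim s)
      then have "lform c (\<phi> (\<tau> s ^ p)) = a s ^ m'" "lform c (\<psi> (b s)) = b s ^ m'"
        using normal_curveD(5)[OF n, of "\<tau> s ^ p"] normal_curveD(5)[OF n', of "b s"] am[of s] H(2) by (auto simp flip: power_mult)
      then show ?case by (simp add: lform_scale lform_diff \<Delta>_def right_diff_distrib)
    qed
  qed
  have "(\<lambda>s. (k s * a s ^ m') *s (H (a s) - H (b s))) \<longlonglongrightarrow> 0"
  proof (rule Lim_null_comparison)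
    show "\<forall>\<^sub>F s in sequentially. norm ((k s * a s ^ m') *s (H (a s) - H (b s))) \<le> L * K * norm (a s) * norm (\<Delta> s)"
      using ball
    proof eventually_elim
      case (elim s)
      have "norm ((k s * a s ^ m') *s (H (a s) - H (b s))) = norm (k s) * norm (a s) ^ m' * norm (H (a s) - H (b s))"
        unfolding norm_scale_vec norm_mult norm_power ..
      also have "\<dots> \<le> norm (k s) * norm (a s) ^ m' * (L * norm (a s - b s))"
        using H(7)[of "a s" "b s"] elim by (intro mult_left_mono) auto
      also have "\<dots> = norm (k s) * L * (norm (a s) ^ m' * norm (a s - b s))" by simp
      also have "\<dots> \<le> norm (k s) * L * (K * norm (a s) * norm (a s ^ m' - b s ^ m'))"
        using K(2)[OF close, of s] H(3) by (intro mult_left_mono) auto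
      finally show ?case by (simp add: \<Delta>_def norm_mult mult_ac)
    qed
    have "(\<lambda>s. L * K * norm (a s) * norm (\<Delta> s)) \<longlonglongrightarrow> L * K * norm (0::complex) * norm (lform c v)"
      by (intro tendsto_intros a0 \<Delta>)
    then show "(\<lambda>s. L * K * norm (a s) * norm (\<Delta> s)) \<longlonglongrightarrow> 0" by simp
  qed
  moreover have "(\<lambda>s. \<Delta> s *s (u' + H (b s))) \<longlonglongrightarrow> lform c v *s (u' + H 0)"
    by (intro tendsto_vec_scale tendsto_add tendsto_const \<Delta> curve_sequence_tendsto[OF H(4,1) b0])
  ultimately have "(\<lambda>s. \<Delta> s *s (u' + H (b s)) + (k s * a s ^ m') *s (H (a s) - H (b s))) \<longlonglongrightarrow> lform c v *s (u' + H 0) + 0"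
    by (rule tendsto_add[rotated])
  from tendsto_diff[OF lim this]
  have lim2: "(\<lambda>s. k s *s (\<phi> (\<tau> s ^ p) - \<psi> (b s)) - (\<Delta> s *s (u' + H (b s)) + (k s * a s ^ m') *s (H (a s) - H (b s))))
     \<longlonglongrightarrow> v - lform c v *s u'" using H(5) by simp
  define y where "y = v - lform c v *s u'"
  have "(\<lambda>s. k s *s (\<phi> (\<tau> s ^ p) - \<psi> (a s))) \<longlonglongrightarrow> y"
  proof (rule Lim_transform_eventually[OF lim2[folded y_def]])
    show "\<forall>\<^sub>F s in sequentially. k s *s (\<phi> (\<tau> s ^ p) - \<psi> (b s)) - (\<Delta> s *s (u' + H (b s)) + (k s * a s ^ m') *s (H (a s) - H (b s)))
       = k s *s (\<phi> (\<tau> s ^ p) - \<psi> (a s))" using ball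
    proof eventually_elim
      case (elim s)
      then have "\<psi> (a s) = a s ^ m' *s (u' + H (a s))" "\<psi> (b s) = b s ^ m' *s (u' + H (b s))" using H(6) by blast+
      then show ?case by (simp add: vec_eq_iff \<Delta>_def algebra_simps)
    qed
  qed
  moreover obtain l where "curve_leads (\<lambda>\<tau>. \<phi> (\<tau> ^ p) - \<psi> (\<eta> * \<tau> ^ q)) l (D \<eta>)" using D[OF \<eta>] by blast
  then obtain \<delta>' e where e: "\<delta>' > 0" "curve_holomorphic e (ball 0 \<delta>')" "e 0 = D \<eta>"
    "\<And>\<tau>. \<tau> \<in> ball 0 \<delta>' \<Longrightarrow> \<phi> (\<tau> ^ p) - \<psi> (\<eta> * \<tau> ^ q) = \<tau> ^ l *s e \<tau>" "D \<eta> = 0 \<longrightarrow> (\<forall>t\<in>ball 0 \<delta>'. e t = 0)"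
    unfolding curve_leads_def by blast
  have \<tau>b: "\<forall>\<^sub>F s in sequentially. \<tau> s \<in> ball 0 \<delta>'" using e(1) by (intro topological_tendstoD[OF \<tau>]) auto
  have eq: "\<forall>\<^sub>F s in sequentially. k s *s (\<phi> (\<tau> s ^ p) - \<psi> (a s)) = (k s * \<tau> s ^ l) *s e (\<tau> s)"
    using \<tau>b by (rule eventually_mono) (simp add: a_def e(4))
  ultimately have y: "(\<lambda>s. (k s * \<tau> s ^ l) *s e (\<tau> s)) \<longlonglongrightarrow> y" by (rule Lim_transform_eventually)
  \<comment> \<open>A nonzero coordinate of \<open>D \<eta>\<close> shows that the scalar factors
    converge. If \<open>D \<eta> = 0\<close>, the difference vanishes near 0 and so does the
    limit.\<close>
  have "\<exists>\<beta>. y = \<beta> *s D \<eta>"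
  proof (cases "D \<eta> = 0")
    case True
    have "\<forall>\<^sub>F s in sequentially. (k s * \<tau> s ^ l) *s e (\<tau> s) = 0"
      using \<tau>b by (rule eventually_mono) (use True e(5) in simp)
    from LIMSEQ_unique[OF Lim_transform_eventually[OF y this] tendsto_const] have "y = 0" .
    then show ?thesis by (intro exI[of _ 0]) simp
  next
    case False
    then obtain i where i: "D \<eta> $ i \<noteq> 0" by (auto simp: vec_eq_iff)
    have te: "(\<lambda>s. e (\<tau> s)) \<longlonglongrightarrow> D \<eta>" using curve_sequence_tendsto[OF e(2,1) \<tau>] e(3) by simp
    have tei: "(\<lambda>s. e (\<tau> s) $ i) \<longlonglongrightarrow> D \<eta> $ i" by (rule tendsto_vec_nth[OF te])
    have "(\<lambda>s. ((k s * \<tau> s ^ l) *s e (\<tau> s)) $ i / e (\<tau> s) $ i) \<longlonglongrightarrow> y $ i / D \<eta> $ i"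
      by (intro tendsto_divide tendsto_vec_nth[OF y] tei i)
    moreover have "\<forall>\<^sub>F s in sequentially. ((k s * \<tau> s ^ l) *s e (\<tau> s)) $ i / e (\<tau> s) $ i = k s * \<tau> s ^ l"
      using tendsto_imp_eventually_ne[OF tei i] by (rule eventually_mono) simp
    ultimately have "(\<lambda>s. k s * \<tau> s ^ l) \<longlonglongrightarrow> y $ i / D \<eta> $ i" by (rule Lim_transform_eventually)
    from LIMSEQ_unique[OF y tendsto_vec_scale[OF this te]] have "y = (y $ i / D \<eta> $ i) *s D \<eta>" .
    then show ?thesis by blast
  qed
  then obtain \<beta> where "y = \<beta> *s D \<eta>" by blast
  then have "v = lform c v *s u' + \<beta> *s D \<eta>" by (simp add: y_def algebra_simps)
  then show ?thesis using \<eta> by blast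
qed

text \<open>Both curves start in degree \<open>p * m = q * m'\<close>, and there \<eta> disappears
  because \<open>\<eta> ^ m' = 1\<close>. The coefficient in this degree is \<open>u - u'\<close>,
  which is zero exactly for a common tangent.\<close>

lemma pair_expansion:
  fixes \<phi> \<psi> :: "complex \<Rightarrow> complex^'n" and p q :: nat
  assumes n: "normal_curve c m u r \<phi>" and n': "normal_curve c m' u' r' \<psi>"
    and pq: "p > 0" "q > 0" "p * m = q * m'" and \<eta>: "\<eta> ^ m' = 1"
  obtains B \<rho> where "0 < \<rho>" "\<rho> \<le> r" "\<rho> \<le> r'" "\<rho> \<le> 1" "curve_holomorphic B (ball 0 \<rho>)" "B 0 = u - u'"
    "\<And>\<tau>. \<tau> \<in> ball 0 \<rho> \<Longrightarrow> \<phi> (\<tau> ^ p) - \<psi> (\<eta> * \<tau> ^ q) = \<tau> ^ (p * m) *s B \<tau>"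
proof -
  have m': "m' > 0" using normal_curveD(1)[OF n'] .
  have n\<eta>: "norm \<eta> = 1" by (rule norm_root_unity[OF \<eta> m'])
  obtain H L \<delta> where H: "0 < \<delta>" "\<delta> \<le> r" "curve_holomorphic H (ball 0 \<delta>)" "H 0 = 0"
    "\<And>t. t \<in> ball 0 \<delta> \<Longrightarrow> \<phi> t = t ^ m *s (u + H t)"
    by (rule normal_curve_remainder[OF n]) blast
  obtain H' L' \<delta>' where H': "0 < \<delta>'" "\<delta>' \<le> r'" "curve_holomorphic H' (ball 0 \<delta>')" "H' 0 = 0"
    "\<And>t. t \<in> ball 0 \<delta>' \<Longrightarrow> \<psi> t = t ^ m' *s (u' + H' t)"
    by (rule normal_curve_remainder[OF n']) blast
  define \<rho> where "\<rho> = min 1 (min \<delta> \<delta>')"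
  have \<rho>: "0 < \<rho>" "\<rho> \<le> \<delta>" "\<rho> \<le> \<delta>'" "\<rho> \<le> 1" using H H' by (auto simp: \<rho>_def)
  have pow: "norm (\<tau> ^ j) < \<rho>" if "norm \<tau> < \<rho>" "j > 0" for \<tau> :: complex and j :: nat
  proof -
    have "norm \<tau> ^ j \<le> norm \<tau> ^ 1" by (rule power_decreasing) (use that \<rho> in auto)
    then show ?thesis using that by (simp add: norm_power)
  qed
  have "\<tau> ^ p \<in> ball 0 \<delta> \<and> \<eta> * \<tau> ^ q \<in> ball 0 \<delta>'" if "\<tau> \<in> ball 0 \<rho>" for \<tau>
    using pow[of \<tau> p] pow[of \<tau> q] pq(1,2) \<rho>(2,3) n\<eta> that by (simp add: norm_mult)
  then have im: "(\<lambda>\<tau>::complex. \<tau> ^ p) ` ball 0 \<rho> \<subseteq> ball 0 \<delta>" "(\<lambda>\<tau>. \<eta> * \<tau> ^ q) ` ball 0 \<rho> \<subseteq> ball 0 \<delta>'" by blast+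
  define B where "B \<tau> = (u + H (\<tau> ^ p)) - (u' + H' (\<eta> * \<tau> ^ q))" for \<tau>
  show ?thesis
  proof (rule that[of \<rho> B])
    show "curve_holomorphic B (ball 0 \<rho>)" unfolding B_def[abs_def]
      by (intro curve_holomorphic_diff curve_holomorphic_add curve_holomorphic_const
        curve_holomorphic_compose[OF H(3) _ im(1)] curve_holomorphic_compose[OF H'(3) _ im(2)] holomorphic_intros)
    show "\<phi> (\<tau> ^ p) - \<psi> (\<eta> * \<tau> ^ q) = \<tau> ^ (p * m) *s B \<tau>" if "\<tau> \<in> ball 0 \<rho>" for \<tau>
    proof -
      have "\<phi> (\<tau> ^ p) = (\<tau> ^ p) ^ m *s (u + H (\<tau> ^ p))" "\<psi> (\<eta> * \<tau> ^ q) = (\<eta> * \<tau> ^ q) ^ m' *s (u' + H' (\<eta> * \<tau> ^ q))"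
        using im H(5) H'(5) that by blast+
      moreover have "(\<tau> ^ p) ^ m = \<tau> ^ (p * m)" "(\<eta> * \<tau> ^ q) ^ m' = \<tau> ^ (p * m)"
        using pq(3) \<eta> by (simp_all add: power_mult_distrib flip: power_mult)
      ultimately show ?thesis by (simp add: B_def vec_eq_iff algebra_simps)
    qed
    show "B 0 = u - u'" using pq H(4) H'(4) by (simp add: B_def zero_power)
  qed (use \<rho> H H' in auto)
qed

text \<open>The factor \<open>1 + l * \<tau> ^ n\<close> changes an \<open>m\<close>-th power at
  first order by \<open>m * l * \<tau> ^ n\<close>, so \<open>l = - x / m\<close> produces the
  prescribed limit. For \<open>n = 0\<close> nothing is infinitesimal, and an \<open>m\<close>-th
  root of \<open>1 - x\<close> is used instead.\<close>

lemma power_perturbation_limit: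
  fixes \<tau> :: "nat \<Rightarrow> complex"
  assumes "m > 0" "\<tau> \<longlonglongrightarrow> 0" "\<And>s. \<tau> s \<noteq> 0"
  obtains l where "(\<lambda>s. (1 - (1 + l * \<tau> s ^ n) ^ m) / \<tau> s ^ n) \<longlonglongrightarrow> x"
proof (cases "n = 0")
  case True
  obtain t where "t ^ m = 1 - x" by (rule complex_root_exists[OF assms(1)]) blast
  then have "(\<lambda>s. (1 - (1 + (t - 1) * \<tau> s ^ n) ^ m) / \<tau> s ^ n) = (\<lambda>s. x)" using True by simp
  then show ?thesis using that[of "t - 1"] by simp
next
  case False
  define l where "l = - x / of_nat m"
  define f where "f = (\<lambda>h. (1 + l * h) ^ m)"
  have "(f has_field_derivative (of_nat m * (1 + l * 0) ^ (m - 1) * l)) (at 0)"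
    unfolding f_def by (auto intro!: derivative_eq_intros)
  then have "(f has_field_derivative - x) (at 0)" using assms(1) by (simp add: l_def)
  then have "((\<lambda>h. (f (0 + h) - f 0) / h) \<longlongrightarrow> - x) (at 0)" by (simp add: DERIV_def)
  moreover have "filterlim (\<lambda>s. \<tau> s ^ n) (at 0) sequentially"
    using tendsto_power[OF assms(2), of n] assms(3) False by (simp add: filterlim_at zero_power)
  ultimately have "(\<lambda>s. (f (0 + \<tau> s ^ n) - f 0) / \<tau> s ^ n) \<longlonglongrightarrow> - x" by (rule filterlim_compose)
  from tendsto_minus[OF this] have "(\<lambda>s. - ((f (0 + \<tau> s ^ n) - f 0) / \<tau> s ^ n)) \<longlonglongrightarrow> x" by simp
  moreover have "- ((f (0 + \<tau> s ^ n) - f 0) / \<tau> s ^ n) = (1 - (1 + l * \<tau> s ^ n) ^ m) / \<tau> s ^ n" for s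
    by (simp add: f_def minus_divide_left)
  ultimately show ?thesis using that[of l] by simp
qed

text \<open>These limits come from the secants joining the common point 0 to the points of the
  second branch.\<close>

lemma pair_cone_line:
  fixes \<phi> \<psi> :: "complex \<Rightarrow> complex^'n"
  assumes n: "normal_curve c m u r \<phi>" and n': "normal_curve c m' u' r' \<psi>"
  shows "\<alpha> *s u' \<in> pair_cone \<phi> \<psi>"
proof -
  obtain H L \<delta> where H: "0 < \<delta>" "\<delta> \<le> r'" "curve_holomorphic H (ball 0 \<delta>)" "H 0 = 0"
    "\<And>t. t \<in> ball 0 \<delta> \<Longrightarrow> \<psi> t = t ^ m' *s (u' + H t)"
    by (rule normal_curve_remainder[OF n']) blast
  obtain t :: "nat \<Rightarrow> complex" where t: "t \<longlonglongrightarrow> 0" "\<And>s. t s \<noteq> 0" by (rule nonzero_null_sequence) blast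
  have tb: "\<forall>\<^sub>F s in sequentially. t s \<in> ball 0 \<delta>" using H(1) by (intro topological_tendstoD[OF t(1)]) auto
  have "(\<lambda>s. \<alpha> *s (u' + H (t s))) \<longlonglongrightarrow> \<alpha> *s (u' + H 0)"
    by (intro tendsto_vec_scale tendsto_add tendsto_const curve_sequence_tendsto[OF H(3,1) t(1)])
  moreover have "\<forall>\<^sub>F s in sequentially. \<alpha> *s (u' + H (t s)) = (- \<alpha> / t s ^ m') *s (\<phi> 0 - \<psi> (t s))"
    using tb
  proof (rule eventually_mono)
    fix s assume "t s \<in> ball 0 \<delta>"
    then have "\<psi> (t s) = t s ^ m' *s (u' + H (t s))" by (rule H(5))
    then show "\<alpha> *s (u' + H (t s)) = (- \<alpha> / t s ^ m') *s (\<phi> 0 - \<psi> (t s))"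
      using t(2)[of s] normal_curveD(8)[OF n] by (simp add: vec_eq_iff field_simps)
  qed
  ultimately have "(\<lambda>s. (- \<alpha> / t s ^ m') *s (\<phi> 0 - \<psi> (t s))) \<longlonglongrightarrow> \<alpha> *s (u' + H 0)" by (rule Lim_transform_eventually)
  moreover have "\<forall>\<^sub>F s in sequentially. \<phi> 0 \<noteq> \<psi> (t s)"
    using tb
  proof (rule eventually_mono)
    fix s assume "t s \<in> ball 0 \<delta>"
    then have "lform c (\<psi> (t s)) = t s ^ m'" using normal_curveD(5)[OF n', of "t s"] H(2) by auto
    then show "\<phi> 0 \<noteq> \<psi> (t s)" using normal_curveD(8)[OF n] t(2)[of s] by (metis lform_0 power_not_zero)
  qed
  ultimately show ?thesis unfolding pair_cone_def using t(1) H(4)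
    by (intro CollectI exI[of _ "\<lambda>_. 0"] exI[of _ t] exI[of _ "\<lambda>s. - \<alpha> / t s ^ m'"]) auto
qed

text \<open>The two points in one fibre differ in degree \<open>k\<close>. Displacing the second
  point along its branch by the relative amount \<open>l * \<tau> ^ j\<close>, with
  \<open>j = k - p * m\<close>, adds a multiple of \<open>u'\<close> in the same degree, and
  \<open>l\<close> is tuned to the ratio \<open>\<alpha> / \<beta>\<close>. For \<beta> = 0 the
  secants from the origin suffice.\<close>

lemma pair_cone_plane:
  fixes \<phi> \<psi> :: "complex \<Rightarrow> complex^'n" and p q :: nat
  assumes n: "normal_curve c m u r \<phi>" and n': "normal_curve c m' u' r' \<psi>"
    and pq: "p > 0" "q > 0" "p * m = q * m'" and \<eta>: "\<eta> ^ m' = 1"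
    and D: "curve_leads (\<lambda>\<tau>. \<phi> (\<tau> ^ p) - \<psi> (\<eta> * \<tau> ^ q)) k D" "D \<noteq> 0"
  shows "\<alpha> *s u' + \<beta> *s D \<in> pair_cone \<phi> \<psi>"
proof (cases "\<beta> = 0")
  case True
  then show ?thesis using pair_cone_line[OF n n', of \<alpha>] by simp
next
  case False
  have m': "m' > 0" using normal_curveD(1)[OF n'] .
  obtain B \<rho> where B: "0 < \<rho>" "\<rho> \<le> r" "\<rho> \<le> r'" "\<rho> \<le> 1" "curve_holomorphic B (ball 0 \<rho>)" "B 0 = u - u'"
    "\<And>\<tau>. \<tau> \<in> ball 0 \<rho> \<Longrightarrow> \<phi> (\<tau> ^ p) - \<psi> (\<eta> * \<tau> ^ q) = \<tau> ^ (p * m) *s B \<tau>"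
    by (rule pair_expansion[OF n n' pq \<eta>]) blast
  have lk: "p * m \<le> k" using curve_leads_less[OF D B(1,5,7)] by blast
  define j where "j = k - p * m"
  obtain \<delta>1 e where e: "\<delta>1 > 0" "curve_holomorphic e (ball 0 \<delta>1)" "e 0 = D"
    "\<And>\<tau>. \<tau> \<in> ball 0 \<delta>1 \<Longrightarrow> \<phi> (\<tau> ^ p) - \<psi> (\<eta> * \<tau> ^ q) = \<tau> ^ k *s e \<tau>"
    using D(1) unfolding curve_leads_def by blast
  obtain H L \<delta> where H: "0 < \<delta>" "\<delta> \<le> r'" "L \<ge> 0" "curve_holomorphic H (ball 0 \<delta>)" "H 0 = 0"
    "\<And>t. t \<in> ball 0 \<delta> \<Longrightarrow> \<psi> t = t ^ m' *s (u' + H t)"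
    "\<And>a b. a \<in> ball 0 \<delta> \<Longrightarrow> b \<in> ball 0 \<delta> \<Longrightarrow> norm (H a - H b) \<le> L * norm (a - b)"
    by (rule normal_curve_remainder[OF n']) blast
  obtain \<tau> :: "nat \<Rightarrow> complex" where \<tau>: "\<tau> \<longlonglongrightarrow> 0" "\<And>s. \<tau> s \<noteq> 0" by (rule nonzero_null_sequence) blast
  obtain l where l: "(\<lambda>s. (1 - (1 + l * \<tau> s ^ j) ^ m') / \<tau> s ^ j) \<longlonglongrightarrow> \<alpha> / \<beta>"
    by (rule power_perturbation_limit[OF m' \<tau>, of j "\<alpha> / \<beta>"]) blast
  define a where "a s = \<eta> * \<tau> s ^ q" for s
  define b where "b s = a s * (1 + l * \<tau> s ^ j)" for s
  have "a \<longlonglongrightarrow> \<eta> * 0 ^ q" unfolding a_def[abs_def] by (intro tendsto_intros \<tau>(1))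
  then have a0: "a \<longlonglongrightarrow> 0" using pq(2) by (simp add: zero_power)
  have "b \<longlonglongrightarrow> 0 * (1 + l * 0 ^ j)" unfolding b_def[abs_def] by (intro tendsto_intros \<tau>(1) a0)
  then have b0: "b \<longlonglongrightarrow> 0" by simp
  have "(\<lambda>s. \<tau> s ^ p) \<longlonglongrightarrow> 0 ^ p" by (intro tendsto_intros \<tau>(1))
  then have tp: "(\<lambda>s. \<tau> s ^ p) \<longlonglongrightarrow> 0" using pq(1) by (simp add: zero_power)
  have ball: "\<forall>\<^sub>F s in sequentially. \<tau> s \<in> ball 0 \<delta>1 \<and> \<tau> s \<in> ball 0 \<rho> \<and> a s \<in> ball 0 \<delta> \<and> b s \<in> ball 0 \<delta>"
    using H(1) e(1) B(1) by (intro eventually_conj topological_tendstoD[OF \<tau>(1)] topological_tendstoD[OF a0] topological_tendstoD[OF b0]) auto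
  have am: "a s ^ m' = \<tau> s ^ (p * m)" for s
    using \<eta> pq(3) by (simp add: a_def power_mult_distrib mult.commute flip: power_mult)
  define Q where "Q s = (1 - (1 + l * \<tau> s ^ j) ^ m') / \<tau> s ^ j" for s
  have "(\<lambda>s. (\<beta> / \<tau> s ^ j) *s (H (a s) - H (b s))) \<longlonglongrightarrow> 0"
  proof (rule Lim_null_comparison)
    show "\<forall>\<^sub>F s in sequentially. norm ((\<beta> / \<tau> s ^ j) *s (H (a s) - H (b s))) \<le> norm \<beta> * L * norm l * norm (a s)"
      using ball
    proof eventually_elim
      case (elim s)
      have ab: "norm (a s - b s) = norm l * norm (a s) * norm (\<tau> s) ^ j"
        by (simp add: b_def algebra_simps norm_mult norm_power)
      have "norm ((\<beta> / \<tau> s ^ j) *s (H (a s) - H (b s))) = norm \<beta> / norm (\<tau> s) ^ j * norm (H (a s) - H (b s))"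
        unfolding norm_scale_vec norm_divide norm_power ..
      also have "\<dots> \<le> norm \<beta> / norm (\<tau> s) ^ j * (L * norm (a s - b s))"
        using H(7)[of "a s" "b s"] elim by (intro mult_left_mono) auto
      also have "\<dots> = norm \<beta> * L * norm l * norm (a s)" using \<tau>(2)[of s] by (simp add: ab)
      finally show ?case .
    qed
    have "(\<lambda>s. norm \<beta> * L * norm l * norm (a s)) \<longlonglongrightarrow> norm \<beta> * L * norm l * norm (0::complex)"
      by (intro tendsto_intros a0)
    then show "(\<lambda>s. norm \<beta> * L * norm l * norm (a s)) \<longlonglongrightarrow> 0" by simp
  qed
  moreover have "(\<lambda>s. (\<beta> * Q s) *s (u' + H (b s))) \<longlonglongrightarrow> (\<beta> * (\<alpha> / \<beta>)) *s (u' + H 0)"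
    using l unfolding Q_def
    by (intro tendsto_vec_scale tendsto_add tendsto_mult tendsto_const curve_sequence_tendsto[OF H(4,1) b0])
  moreover have "(\<lambda>s. \<beta> *s e (\<tau> s)) \<longlonglongrightarrow> \<beta> *s e 0"
    by (intro tendsto_vec_scale tendsto_const curve_sequence_tendsto[OF e(2,1) \<tau>(1)])
  ultimately have "(\<lambda>s. (\<beta> *s e (\<tau> s) + (\<beta> * Q s) *s (u' + H (b s))) + (\<beta> / \<tau> s ^ j) *s (H (a s) - H (b s)))
      \<longlonglongrightarrow> (\<beta> *s e 0 + (\<beta> * (\<alpha> / \<beta>)) *s (u' + H 0)) + 0" by (intro tendsto_add)
  moreover have "\<forall>\<^sub>F s in sequentially. (\<beta> *s e (\<tau> s) + (\<beta> * Q s) *s (u' + H (b s))) + (\<beta> / \<tau> s ^ j) *s (H (a s) - H (b s))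
      = (\<beta> / \<tau> s ^ k) *s (\<phi> (\<tau> s ^ p) - \<psi> (b s))"
    using ball
  proof eventually_elim
    case (elim s)
    have k: "\<tau> s ^ k = \<tau> s ^ (p * m) * \<tau> s ^ j" using lk by (simp add: j_def flip: power_add)
    have "\<phi> (\<tau> s ^ p) = \<psi> (a s) + \<tau> s ^ k *s e (\<tau> s)" using e(4)[of "\<tau> s"] elim by (simp add: a_def algebra_simps)
    moreover have "\<psi> (a s) = \<tau> s ^ (p * m) *s (u' + H (a s))" using H(6) elim am by metis
    moreover have "\<psi> (b s) = (\<tau> s ^ (p * m) * (1 + l * \<tau> s ^ j) ^ m') *s (u' + H (b s))"
      using H(6)[of "b s"] elim am[of s] by (simp add: b_def power_mult_distrib)
    ultimately show ?case using \<tau>(2)[of s] unfolding k Q_def by (simp add: vec_eq_iff field_simps)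
  qed
  ultimately have "(\<lambda>s. (\<beta> / \<tau> s ^ k) *s (\<phi> (\<tau> s ^ p) - \<psi> (b s))) \<longlonglongrightarrow> (\<beta> *s e 0 + (\<beta> * (\<alpha> / \<beta>)) *s (u' + H 0)) + 0"
    by (rule Lim_transform_eventually)
  moreover have "(\<beta> *s e 0 + (\<beta> * (\<alpha> / \<beta>)) *s (u' + H 0)) + 0 = \<alpha> *s u' + \<beta> *s D"
    using False e(3) H(5) by simp
  ultimately have lim: "(\<lambda>s. (\<beta> / \<tau> s ^ k) *s (\<phi> (\<tau> s ^ p) - \<psi> (b s))) \<longlonglongrightarrow> \<alpha> *s u' + \<beta> *s D" by simp
  \<comment> \<open>The undisplaced points have equal values under the form, so \<open>D\<close>
    lies in its kernel while \<open>u'\<close> does not. Hence the limit is nonzero, which makes the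
    displaced points eventually distinct, as \<open>pair_cone\<close> demands.\<close>
  have "lform c D = 0"
  proof -
    have "\<forall>\<^sub>F s in sequentially. lform c (e (\<tau> s)) = 0" using ball
    proof eventually_elim
      case (elim s)
      have small: "norm (\<tau> s ^ i) < \<rho>" if "i > 0" for i :: nat
      proof -
        have "norm (\<tau> s) ^ i \<le> norm (\<tau> s) ^ 1" by (rule power_decreasing) (use that elim B(4) in auto)
        then show ?thesis using elim by (simp add: norm_power)
      qed
      have "norm \<eta> = 1" by (rule norm_root_unity[OF \<eta> m'])
      then have "\<tau> s ^ p \<in> ball 0 r" "a s \<in> ball 0 r'" using small[OF pq(1)] small[OF pq(2)] B(2,3) by (auto simp: a_def norm_mult)
      then have "lform c (\<phi> (\<tau> s ^ p) - \<psi> (\<eta> * \<tau> s ^ q)) = 0"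
        using normal_curveD(5)[OF n, of "\<tau> s ^ p"] normal_curveD(5)[OF n', of "a s"] am[of s]
        by (simp add: lform_diff a_def flip: power_mult)
      moreover have "lform c (\<phi> (\<tau> s ^ p) - \<psi> (\<eta> * \<tau> s ^ q)) = \<tau> s ^ k * lform c (e (\<tau> s))"
        using e(4)[of "\<tau> s"] elim by (simp add: lform_scale)
      ultimately show ?case using \<tau>(2)[of s] by simp
    qed
    moreover have "(\<lambda>s. lform c (e (\<tau> s))) \<longlonglongrightarrow> lform c (e 0)"
      by (intro tendsto_lform curve_sequence_tendsto[OF e(2,1) \<tau>(1)])
    ultimately have "(\<lambda>s. 0) \<longlonglongrightarrow> lform c (e 0)" by (rule Lim_transform_eventually[rotated])
    then show ?thesis using e(3) LIMSEQ_unique[OF tendsto_const] by metis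
  qed
  have "\<alpha> *s u' + \<beta> *s D \<noteq> 0"
  proof
    assume 0: "\<alpha> *s u' + \<beta> *s D = 0"
    then have "lform c (\<alpha> *s u' + \<beta> *s D) = 0" by simp
    then have "\<alpha> = 0" using \<open>lform c D = 0\<close> normal_curveD(6)[OF n'] by (simp add: lform_add lform_scale)
    then show False using 0 False D(2) by simp
  qed
  from tendsto_imp_eventually_ne[OF lim this]
  have "\<forall>\<^sub>F s in sequentially. \<phi> (\<tau> s ^ p) \<noteq> \<psi> (b s)" by (rule eventually_mono) auto
  then show ?thesis unfolding pair_cone_def using tp b0 lim
    by (intro CollectI exI[of _ "\<lambda>s. \<tau> s ^ p"] exI[of _ b] exI[of _ "\<lambda>s. \<beta> / \<tau> s ^ k"] conjI)
qed

section \<open>Nested divisors\<close>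

lemma nested_divisors_bound:
  assumes "nested_divisors n ds" "d \<in> set ds"
  shows "d \<le> n"
proof -
  have *: "i < length ds \<Longrightarrow> ds ! i dvd n" for i
  proof (induction i)
    case 0
    then show ?case using assms(1) by (cases ds) (auto simp: nested_divisors_def)
  next
    case (Suc i)
    then have "ds ! Suc i dvd ds ! i" using assms(1) by (simp add: nested_divisors_def)
    then show ?case using Suc by (auto intro: dvd_trans)
  qed
  obtain i where "i < length ds" "d = ds ! i" using assms(2) by (metis in_set_conv_nth)
  then have "d dvd n" using * by simp
  moreover have "n > 0" using assms(1) unfolding nested_divisors_def by (metis hd_in_set)
  ultimately show ?thesis by (rule dvd_imp_le)
qed

lemma finite_nested_lengths: "finite {length ds | ds. nested_divisors n ds}"
proof (rule finite_subset)
  show "{length ds | ds. nested_divisors n ds} \<subseteq> {..Suc n}"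
  proof
    fix l assume "l \<in> {length ds | ds. nested_divisors n ds}"
    then obtain ds where ds: "l = length ds" "nested_divisors n ds" by blast
    have "card (set ds) \<le> card {..n}" using nested_divisors_bound[OF ds(2)] by (intro card_mono) auto
    then show "l \<in> {..Suc n}" using ds by (simp add: nested_divisors_def distinct_card)
  qed
qed simp

lemma sigma_upper: "nested_divisors n ds \<Longrightarrow> length ds \<le> \<sigma> n"
  unfolding \<sigma>_def by (rule Max_ge[OF finite_nested_lengths]) blast

lemma nested_divisors_exists:
  assumes "n > 0"
  shows "\<exists>ds. nested_divisors n ds"
proof (cases "n = 1")
  case True
  then show ?thesis by (intro exI[of _ "[1]"]) (auto simp: nested_divisors_def)
next
  case False
  then show ?thesis using assms by (intro exI[of _ "[n, 1]"]) (auto simp: nested_divisors_def)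
qed

lemma sigma_ge_1:
  assumes "n > 0"
  shows "1 \<le> \<sigma> n"
proof -
  obtain ds where ds: "nested_divisors n ds" using nested_divisors_exists[OF assms] by blast
  then have "length ds > 0" by (simp add: nested_divisors_def)
  then show ?thesis using sigma_upper[OF ds] by linarith
qed

text \<open>A longest sequence for \<open>k\<close> is prolonged by putting \<open>n\<close> in
  front.\<close>

lemma sigma_step:
  assumes "k dvd n" "k < n" "k > 0"
  shows "\<sigma> k + 1 \<le> \<sigma> n"
proof -
  have "{length ds | ds. nested_divisors k ds} \<noteq> {}" using nested_divisors_exists[OF assms(3)] by blast
  then have "\<sigma> k \<in> {length ds | ds. nested_divisors k ds}" unfolding \<sigma>_def by (rule Max_in[OF finite_nested_lengths])
  then obtain ds where ds: "\<sigma> k = length ds" "nested_divisors k ds" by blast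
  have "nested_divisors n (n # ds)" unfolding nested_divisors_def
  proof (intro conjI allI impI)
    have "n \<notin> set ds" using nested_divisors_bound[OF ds(2), of n] assms(2) by auto
    then show "distinct (n # ds)" using ds(2) by (simp add: nested_divisors_def)
    show "(n # ds) ! Suc i dvd (n # ds) ! i" if "Suc i < length (n # ds)" for i
      using that ds(2) assms(1) by (cases i; cases ds) (auto simp: nested_divisors_def)
  qed (use ds(2) assms in \<open>auto simp: nested_divisors_def\<close>)
  from sigma_upper[OF this] show ?thesis using ds(1) by simp
qed

text \<open>Each distinct least exponent cuts the group of roots of unity down to a proper subgroup.\<close>

lemma card_least_exponents:
  assumes "e > 0" "\<And>\<eta> :: complex. \<eta> ^ e = 1 \<Longrightarrow> \<eta> \<noteq> 1 \<Longrightarrow> \<exists>v\<in>S. \<eta> ^ v \<noteq> 1"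
  shows "card ((\<lambda>\<eta>. LEAST v. v \<in> S \<and> \<eta> ^ v \<noteq> 1) ` ({\<eta> :: complex. \<eta> ^ e = 1} - {1})) \<le> \<sigma> e - 1"
  using assms
proof (induction e rule: less_induct)
  case (less e)
  let ?v = "\<lambda>\<eta> :: complex. LEAST v. v \<in> S \<and> \<eta> ^ v \<noteq> 1"
  let ?R = "\<lambda>e. {\<eta> :: complex. \<eta> ^ e = 1} - {1}"
  have fin: "finite (?v ` ?R e)" if "e > 0" for e :: nat using finite_roots_unity[of e] that by (intro finite_imageI finite_Diff) auto
  show ?case
  proof (cases "?R e = {}")
    case True
    then show ?thesis unfolding True by simp
  next
    case False
    then obtain \<eta>0 :: complex where \<eta>0: "\<eta>0 ^ e = 1" "\<eta>0 \<noteq> 1" by blast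
    obtain v0 where v0: "v0 \<in> S" "\<eta>0 ^ v0 \<noteq> 1" using less.prems(2)[OF \<eta>0] by blast
    have "\<not> e dvd v0" using v0(2) \<eta>0(1) by (metis dvdE power_mult power_one)
    \<comment> \<open>Exponents of \<open>S\<close> below \<open>w\<close> are multiples of
      \<open>e\<close> and act trivially on all \<open>e\<close>-th roots of unity. So
      \<open>w\<close> is the least exponent of every root with
      \<open>\<eta> ^ w \<noteq> 1\<close>, and a single value accounts for all of these
      roots.\<close>
    define w where "w = (LEAST v. v \<in> S \<and> \<not> e dvd v)"
    have w: "w \<in> S" "\<not> e dvd w" using LeastI[of "\<lambda>v. v \<in> S \<and> \<not> e dvd v" v0] v0(1) \<open>\<not> e dvd v0\<close> by (auto simp: w_def)
    have wl: "e dvd v" if "v \<in> S" "v < w" for v using not_less_Least[of v "\<lambda>v. v \<in> S \<and> \<not> e dvd v"] that by (auto simp: w_def)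
    define e1 where "e1 = gcd e w"
    have e1: "e1 > 0" "e1 dvd e" "e1 dvd w" using less.prems(1) by (auto simp: e1_def)
    have "e1 \<noteq> e" using w(2) e1(3) by auto
    then have "e1 < e" using dvd_imp_le[OF e1(2) less.prems(1)] by simp
    have sub: "\<eta> ^ e = 1" if "\<eta> ^ e1 = 1" for \<eta> :: complex using that e1(2) by (metis dvdE power_mult power_one)
    have IH: "card (?v ` ?R e1) \<le> \<sigma> e1 - 1"
      by (rule less.IH[OF \<open>e1 < e\<close> e1(1)]) (use less.prems(2) sub in blast)
    have "?v ` ?R e \<subseteq> insert w (?v ` ?R e1)"
    proof
      fix x assume "x \<in> ?v ` ?R e"
      then obtain \<eta> where \<eta>: "\<eta> ^ e = 1" "\<eta> \<noteq> 1" "x = ?v \<eta>" by blast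
      show "x \<in> insert w (?v ` ?R e1)"
      proof (cases "\<eta> ^ w = 1")
        case False
        have "?v \<eta> = w"
        proof (rule Least_equality)
          fix y assume y: "y \<in> S \<and> \<eta> ^ y \<noteq> 1"
          show "w \<le> y"
          proof (rule ccontr)
            assume "\<not> w \<le> y"
            then have "e dvd y" using wl y by simp
            then show False using y \<eta>(1) by (metis dvdE power_mult power_one)
          qed
        qed (use w(1) False in simp)
        then show ?thesis using \<eta>(3) by simp
      next
        case True
        \<comment> \<open>By Bezout, a root of unity trivial under both \<open>e\<close> and
          \<open>w\<close> is an \<open>e1\<close>-th root of unity, to which the induction
          applies.\<close>
        obtain a b where ab: "e * a = w * b + e1" using bezout_nat[of e w] less.prems(1) unfolding e1_def by blast
        have "(\<eta> ^ e) ^ a = (\<eta> ^ w) ^ b * \<eta> ^ e1" using ab by (metis power_add power_mult)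
        then have "\<eta> ^ e1 = 1" using \<eta>(1) True by simp
        then show ?thesis using \<eta> by blast
      qed
    qed
    then have "card (?v ` ?R e) \<le> card (insert w (?v ` ?R e1))" using fin[OF e1(1)] by (intro card_mono) auto
    also have "\<dots> \<le> card (?v ` ?R e1) + 1" using fin[OF e1(1)] by (simp add: card_insert_if)
    \<comment> \<open>The bound \<open>1 \<le> \<sigma> e1\<close> keeps the truncated subtraction
      exact.\<close>
    also have "\<dots> \<le> \<sigma> e - 1" using IH sigma_step[OF e1(2) \<open>e1 < e\<close> e1(1)] sigma_ge_1[OF e1(1)] by linarith
    finally show ?thesis .
  qed
qed

section \<open>The planes of a pair of branches\<close>

text \<open>The degree is forgotten because only the leading vector enters a plane. For a curve
  vanishing near 0 the value is 0.\<close>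

definition lead :: "(complex \<Rightarrow> complex^'n) \<Rightarrow> complex^'n" where
  "lead d = (SOME D. \<exists>k. curve_leads d k D)"

lemma lead_eq:
  assumes "curve_leads d k D"
  shows "lead d = D"
proof -
  have "\<exists>k. curve_leads d k (lead d)"
    unfolding lead_def by (rule someI[where P = "\<lambda>D. \<exists>k. curve_leads d k D" and x = D]) (use assms in blast)
  then obtain k' where k': "curve_leads d k' (lead d)" by blast
  show ?thesis
  proof (cases "D = 0")
    case True
    then show ?thesis using curve_leads_unique[OF k' assms] by blast
  next
    case False
    then show ?thesis using curve_leads_unique[OF assms k'] by blast
  qed
qed

text \<open>The two reparametrizations are chosen such that both branches have the same value
  \<open>\<tau> ^ lcm m m'\<close> under the linear form of the normal curves.\<close>

definition contact_curve :: "(complex \<Rightarrow> complex^'n) \<Rightarrow> nat \<Rightarrow> (complex \<Rightarrow> complex^'n) \<Rightarrow> nat \<Rightarrow> complex \<Rightarrow> complex \<Rightarrow> complex^'n" where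
  "contact_curve \<phi> m \<psi> m' \<eta> \<tau> = \<phi> (\<tau> ^ (m' div gcd m m')) - \<psi> (\<eta> * \<tau> ^ (m div gcd m m'))"

text \<open>When \<open>lead\<close> is 0 this degenerates to the line of \<open>u'\<close>, as
  happens for \<eta> = 1 on a single branch.\<close>

definition contact_plane :: "(complex \<Rightarrow> complex^'n) \<Rightarrow> nat \<Rightarrow> (complex \<Rightarrow> complex^'n) \<Rightarrow> nat \<Rightarrow> complex^'n \<Rightarrow> complex \<Rightarrow> (complex^'n) set" where
  "contact_plane \<phi> m \<psi> m' u' \<eta> = vec.span {u', lead (contact_curve \<phi> m \<psi> m' \<eta>)}"

lemma span_pair: "v \<in> vec.span {a, b} \<longleftrightarrow> (\<exists>\<alpha> \<beta>. v = \<alpha> *s a + \<beta> *s b)"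
proof
  assume "v \<in> vec.span {a, b}"
  then obtain k where "v - k *s a \<in> vec.span {b}" using vec.span_insert[of a "{b}"] by blast
  then obtain j where "v - k *s a = j *s b" using vec.span_singleton[of b] by blast
  then have "v = k *s a + j *s b" by (metis add.commute diff_add_cancel)
  then show "\<exists>\<alpha> \<beta>. v = \<alpha> *s a + \<beta> *s b" by blast
next
  assume "\<exists>\<alpha> \<beta>. v = \<alpha> *s a + \<beta> *s b"
  then obtain \<alpha> \<beta> where "v = \<alpha> *s a + \<beta> *s b" by blast
  moreover have "a \<in> vec.span {a, b}" "b \<in> vec.span {a, b}" by (auto intro: vec.span_base)
  ultimately show "v \<in> vec.span {a, b}" by (auto intro: vec.span_add vec.span_scale)
qed

lemma gcd_quotients:
  fixes m m' :: nat
  assumes "m > 0" "m' > 0"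
  shows "m' div gcd m m' > 0" "m div gcd m m' > 0" "m' div gcd m m' * m = m div gcd m m' * m'"
proof -
  have g: "gcd m m' > 0" using assms by simp
  obtain a b where ab: "m = gcd m m' * a" "m' = gcd m m' * b" by (metis dvdE gcd_dvd1 gcd_dvd2)
  have "m div gcd m m' = a" "m' div gcd m m' = b" using ab g by (metis nonzero_mult_div_cancel_left less_numeral_extra(3))+
  moreover have "a > 0" "b > 0" using ab assms by (auto intro: gr0I)
  moreover have "b * m = a * m'" using ab by (metis mult.assoc mult.commute)
  ultimately show "m' div gcd m m' > 0" "m div gcd m m' > 0" "m' div gcd m m' * m = m div gcd m m' * m'" by simp_all
qed

lemma contact_curve_expansion:
  fixes \<phi> \<psi> :: "complex \<Rightarrow> complex^'n"
  assumes n: "normal_curve c m u r \<phi>" and n': "normal_curve c m' u' r' \<psi>" and \<eta>: "\<eta> ^ m' = 1"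
  obtains B \<rho> l where "0 < \<rho>" "curve_holomorphic B (ball 0 \<rho>)" "B 0 = u - u'"
    "\<And>\<tau>. \<tau> \<in> ball 0 \<rho> \<Longrightarrow> contact_curve \<phi> m \<psi> m' \<eta> \<tau> = \<tau> ^ l *s B \<tau>"
proof (rule pair_expansion[OF n n' gcd_quotients[OF normal_curveD(1)[OF n] normal_curveD(1)[OF n']] \<eta>])
qed (use that contact_curve_def in metis)

lemma contact_curve_leads:
  fixes \<phi> \<psi> :: "complex \<Rightarrow> complex^'n"
  assumes n: "normal_curve c m u r \<phi>" and n': "normal_curve c m' u' r' \<psi>" and \<eta>: "\<eta> ^ m' = 1"
  shows "\<exists>k. curve_leads (contact_curve \<phi> m \<psi> m' \<eta>) k (lead (contact_curve \<phi> m \<psi> m' \<eta>))"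
proof -
  obtain B \<rho> l where B: "0 < \<rho>" "curve_holomorphic B (ball 0 \<rho>)"
    "\<And>\<tau>. \<tau> \<in> ball 0 \<rho> \<Longrightarrow> contact_curve \<phi> m \<psi> m' \<eta> \<tau> = \<tau> ^ l *s B \<tau>"
    by (rule contact_curve_expansion[OF n n' \<eta>]) blast
  have "curve_holomorphic (\<lambda>\<tau>. \<tau> ^ l *s B \<tau>) (ball 0 \<rho>)" by (intro curve_holomorphic_scale B(2) holomorphic_intros)
  then have "curve_holomorphic (contact_curve \<phi> m \<psi> m' \<eta>) (ball 0 \<rho>)"
    unfolding curve_holomorphic_def using B(3) by (metis (no_types, lifting) holomorphic_transform)
  then show ?thesis using curve_leads_exists[OF _ B(1)] lead_eq by metis
qed

lemma pair_cone_eq: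
  fixes \<phi> \<psi> :: "complex \<Rightarrow> complex^'n"
  assumes n: "normal_curve c m u r \<phi>" and n': "normal_curve c m' u' r' \<psi>"
  shows "pair_cone \<phi> \<psi> = (\<Union>\<eta>\<in>{\<eta>. \<eta> ^ m' = 1}. contact_plane \<phi> m \<psi> m' u' \<eta>)"
proof (intro equalityI subsetI)
  note pq = gcd_quotients[OF normal_curveD(1)[OF n] normal_curveD(1)[OF n']]
  note L = contact_curve_leads[OF n n', unfolded contact_curve_def[abs_def]]
  {
    fix v assume "v \<in> pair_cone \<phi> \<psi>"
    from pair_cone_subset[OF n n' pq this, of "\<lambda>\<eta>. lead (contact_curve \<phi> m \<psi> m' \<eta>)"] L
    show "v \<in> (\<Union>\<eta>\<in>{\<eta>. \<eta> ^ m' = 1}. contact_plane \<phi> m \<psi> m' u' \<eta>)"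
      by (auto simp: contact_plane_def span_pair contact_curve_def[abs_def])
  }
  fix v assume "v \<in> (\<Union>\<eta>\<in>{\<eta>. \<eta> ^ m' = 1}. contact_plane \<phi> m \<psi> m' u' \<eta>)"
  then obtain \<eta> \<alpha> \<beta> where v: "\<eta> ^ m' = 1" "v = \<alpha> *s u' + \<beta> *s lead (contact_curve \<phi> m \<psi> m' \<eta>)"
    by (auto simp: contact_plane_def span_pair)
  show "v \<in> pair_cone \<phi> \<psi>"
  proof (cases "lead (contact_curve \<phi> m \<psi> m' \<eta>) = 0")
    case True
    then show ?thesis using v(2) pair_cone_line[OF n n', of \<alpha>] by simp
  next
    case False
    obtain k where "curve_leads (contact_curve \<phi> m \<psi> m' \<eta>) k (lead (contact_curve \<phi> m \<psi> m' \<eta>))"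
      using contact_curve_leads[OF n n' v(1)] by blast
    then show ?thesis unfolding v(2)
      by (intro pair_cone_plane[OF n n' pq v(1) _ False]) (simp add: contact_curve_def[abs_def])
  qed
qed

text \<open>The leading coefficient \<open>u - u'\<close> does not involve \<eta>, so a pair with
  distinct tangents contributes one plane.\<close>

lemma contact_plane_transversal:
  fixes \<phi> \<psi> :: "complex \<Rightarrow> complex^'n"
  assumes n: "normal_curve c m u r \<phi>" and n': "normal_curve c m' u' r' \<psi>" and \<eta>: "\<eta> ^ m' = 1" and "u \<noteq> u'"
  shows "contact_plane \<phi> m \<psi> m' u' \<eta> = vec.span {u', u - u'}"
proof -
  obtain B \<rho> l where B: "0 < \<rho>" "curve_holomorphic B (ball 0 \<rho>)" "B 0 = u - u'"
    "\<And>\<tau>. \<tau> \<in> ball 0 \<rho> \<Longrightarrow> contact_curve \<phi> m \<psi> m' \<eta> \<tau> = \<tau> ^ l *s B \<tau>"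
    by (rule contact_curve_expansion[OF n n' \<eta>]) blast
  have "curve_leads (contact_curve \<phi> m \<psi> m' \<eta>) l (u - u')"
    unfolding curve_leads_def using B \<open>u \<noteq> u'\<close> by (intro exI[of _ \<rho>] exI[of _ B]) auto
  then show ?thesis by (simp add: contact_plane_def lead_eq)
qed

lemma curve_leads_rotate:
  assumes "curve_leads d k D" "norm (w::complex) = 1"
  shows "curve_leads (\<lambda>t. d (w * t)) k (w ^ k *s D)"
proof -
  obtain \<delta> e where e: "\<delta> > 0" "curve_holomorphic e (ball 0 \<delta>)" "e 0 = D" "\<And>t. t \<in> ball 0 \<delta> \<Longrightarrow> d t = t ^ k *s e t"
     "D = 0 \<longrightarrow> (\<forall>t\<in>ball 0 \<delta>. e t = 0)"
    using assms(1) unfolding curve_leads_def by blast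
  have im: "(\<lambda>t. w * t) ` ball 0 \<delta> \<subseteq> ball 0 \<delta>" using assms(2) by (auto simp: norm_mult)
  have "curve_holomorphic (\<lambda>t. e (w * t)) (ball 0 \<delta>)"
    by (rule curve_holomorphic_compose[OF e(2) _ im]) (intro holomorphic_intros)
  then have "curve_holomorphic (\<lambda>t. w ^ k *s e (w * t)) (ball 0 \<delta>)" by (intro curve_holomorphic_scale holomorphic_intros)
  moreover have "d (w * t) = t ^ k *s (w ^ k *s e (w * t))" if "t \<in> ball 0 \<delta>" for t
  proof -
    have "w * t \<in> ball 0 \<delta>" using im that by blast
    from e(4)[OF this] show ?thesis by (simp add: power_mult_distrib mult.commute)
  qed
  moreover have "w ^ k *s e (w * t) = 0" if "t \<in> ball 0 \<delta>" "w ^ k *s D = 0" for t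
  proof -
    have "w \<noteq> 0" using assms(2) by auto
    then have "D = 0" using that(2) by simp
    moreover have "w * t \<in> ball 0 \<delta>" using im that by blast
    ultimately show ?thesis using e(5) by simp
  qed
  ultimately show ?thesis unfolding curve_leads_def
    using e(1,3) by (intro exI[of _ \<delta>] exI[of _ "\<lambda>t. w ^ k *s e (w * t)"]) auto
qed

lemma span_pair_scale:
  assumes "w \<noteq> 0"
  shows "vec.span {a, w *s b} = vec.span {a :: complex^'n, b}"
proof (intro set_eqI iffI)
  fix x assume "x \<in> vec.span {a, w *s b}"
  then obtain \<alpha> \<beta> where "x = \<alpha> *s a + \<beta> *s (w *s b)" by (auto simp: span_pair)
  then show "x \<in> vec.span {a, b}" unfolding span_pair by (intro exI[of _ \<alpha>] exI[of _ "\<beta> * w"]) simp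
next
  fix x assume "x \<in> vec.span {a, b}"
  then obtain \<alpha> \<beta> where "x = \<alpha> *s a + \<beta> *s b" by (auto simp: span_pair)
  then show "x \<in> vec.span {a, w *s b}" unfolding span_pair using assms by (intro exI[of _ \<alpha>] exI[of _ "\<beta> / w"]) simp
qed

text \<open>The quotient \<open>b = \<eta>' / \<eta>\<close> is a \<open>p\<close>-th root of unity.
  As \<open>q\<close> is invertible modulo \<open>p\<close>, some power \<open>w\<close> of
  \<open>b\<close> satisfies \<open>w ^ q = b\<close> and \<open>w ^ p = 1\<close>; rotating \<tau>
  by \<open>w\<close> leaves the first parameter alone and replaces \<eta> by \<eta>'. A rotation
  only rescales the leading vector.\<close>

lemma contact_plane_cong:
  fixes \<phi> \<psi> :: "complex \<Rightarrow> complex^'n"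
  assumes n: "normal_curve c m u r \<phi>" and n': "normal_curve c m' u' r' \<psi>" and \<eta>: "\<eta> ^ m' = 1" "\<eta>' ^ m' = 1"
    and eq: "\<eta> ^ (m' div gcd m m') = \<eta>' ^ (m' div gcd m m')"
  shows "contact_plane \<phi> m \<psi> m' u' \<eta>' = contact_plane \<phi> m \<psi> m' u' \<eta>"
proof -
  note m = normal_curveD(1)[OF n] and m' = normal_curveD(1)[OF n']
  define p q where "p = m' div gcd m m'" and "q = m div gcd m m'"
  have pq: "p > 0" "q > 0" using gcd_quotients[OF m m'] by (auto simp: p_def q_def)
  have "coprime q p" unfolding p_def q_def using m by (intro div_gcd_coprime) simp
  then have "gcd q p = 1" by simp
  moreover obtain x y where "q * x = p * y + gcd q p" using bezout_nat[of q p] pq(2) by blast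
  ultimately have xy: "q * x = p * y + 1" by metis
  have "\<eta> \<noteq> 0" using \<eta>(1) m' by (auto simp: zero_power)
  define b where "b = \<eta>' / \<eta>"
  have bp: "b ^ p = 1" unfolding b_def power_divide p_def eq[symmetric] using \<open>\<eta> \<noteq> 0\<close> by simp
  define w where "w = b ^ x"
  have "w ^ p = (b ^ p) ^ x" unfolding w_def power_mult[symmetric] mult.commute[of x p] ..
  then have wp: "w ^ p = 1" using bp by simp
  have wq: "w ^ q = b"
  proof -
    have "w ^ q = b ^ (q * x)" unfolding w_def power_mult[symmetric] mult.commute[of x q] ..
    also have "\<dots> = b ^ (p * y + 1)" unfolding xy ..
    also have "\<dots> = (b ^ p) ^ y * b" by (simp add: power_mult)
    also have "\<dots> = b" unfolding bp by simp
    finally show ?thesis .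
  qed
  have w1: "norm w = 1" by (rule norm_root_unity[OF wp pq(1)])
  obtain k where k: "curve_leads (contact_curve \<phi> m \<psi> m' \<eta>) k (lead (contact_curve \<phi> m \<psi> m' \<eta>))"
    using contact_curve_leads[OF n n' \<eta>(1)] by blast
  have "contact_curve \<phi> m \<psi> m' \<eta> (w * t) = contact_curve \<phi> m \<psi> m' \<eta>' t" for t
    using wp wq \<open>\<eta> \<noteq> 0\<close> by (simp add: contact_curve_def power_mult_distrib b_def flip: p_def q_def)
  then have "curve_leads (contact_curve \<phi> m \<psi> m' \<eta>') k (w ^ k *s lead (contact_curve \<phi> m \<psi> m' \<eta>))"
    using curve_leads_rotate[OF k w1] by simp
  from lead_eq[OF this] show ?thesis unfolding contact_plane_def
    using w1 by (metis span_pair_scale norm_zero power_not_zero zero_neq_one)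
qed

lemma card_image_factor:
  assumes "finite (h ` A)" "\<And>x y. x \<in> A \<Longrightarrow> y \<in> A \<Longrightarrow> h x = h y \<Longrightarrow> f x = f y"
  shows "finite (f ` A)" "card (f ` A) \<le> card (h ` A)"
proof -
  have "f ` A \<subseteq> (\<lambda>z. f (inv_into A h z)) ` (h ` A)"
  proof
    fix y assume "y \<in> f ` A"
    then obtain x where x: "x \<in> A" "y = f x" by blast
    then have "f (inv_into A h (h x)) = f x"
      using assms(2)[OF inv_into_into[OF imageI[OF x(1)]] x(1)] f_inv_into_f[OF imageI[OF x(1)]] by metis
    then show "y \<in> (\<lambda>z. f (inv_into A h z)) ` (h ` A)" using x by (metis imageI)
  qed
  then show "finite (f ` A)" "card (f ` A) \<le> card (h ` A)"
    using assms(1) by (auto intro: finite_surj surj_card_le)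
qed

lemma card_contact_planes:
  fixes \<phi> \<psi> :: "complex \<Rightarrow> complex^'n"
  assumes n: "normal_curve c m u r \<phi>" and n': "normal_curve c m' u' r' \<psi>"
  shows "card (contact_plane \<phi> m \<psi> m' u' ` {\<eta>. \<eta> ^ m' = 1}) \<le> gcd m m'"
proof -
  note m' = normal_curveD(1)[OF n']
  define p where "p = m' div gcd m m'"
  have g: "gcd m m' > 0" using m' by simp
  have pg: "p * gcd m m' = m'" by (simp add: p_def)
  have sub: "(\<lambda>\<eta>. \<eta> ^ p) ` {\<eta> :: complex. \<eta> ^ m' = 1} \<subseteq> {z. z ^ gcd m m' = 1}"
    using pg by (auto simp flip: power_mult)
  have fin: "finite {z :: complex. z ^ gcd m m' = 1}" using g by (intro finite_roots_unity) linarith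
  have "card (contact_plane \<phi> m \<psi> m' u' ` {\<eta>. \<eta> ^ m' = 1}) \<le> card ((\<lambda>\<eta>. \<eta> ^ p) ` {\<eta> :: complex. \<eta> ^ m' = 1})"
  proof (rule card_image_factor(2)[OF finite_subset[OF sub fin]])
    fix x y :: complex assume "x \<in> {\<eta>. \<eta> ^ m' = 1}" "y \<in> {\<eta>. \<eta> ^ m' = 1}" "x ^ p = y ^ p"
    then show "contact_plane \<phi> m \<psi> m' u' x = contact_plane \<phi> m \<psi> m' u' y"
      using contact_plane_cong[OF n n', of y x] by (simp add: p_def)
  qed
  also have "\<dots> \<le> card {z :: complex. z ^ gcd m m' = 1}" by (rule card_mono[OF fin sub])
  also have "\<dots> = gcd m m'" by (rule card_roots_unity_eq) (use g in simp)
  finally show ?thesis .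
qed

text \<open>Iterated division by the parameter: the vectors \<open>f j 0\<close> are the Taylor
  coefficients, and \<open>f v\<close> is the remainder after \<open>v\<close> terms.\<close>

lemma curve_taylor:
  fixes \<phi> :: "complex \<Rightarrow> complex^'n"
  assumes "curve_holomorphic \<phi> (ball 0 r)" "r > 0"
  obtains f where "\<And>v. curve_holomorphic (f v) (ball 0 r)" "\<And>v t. \<phi> t = (\<Sum>j<v. t ^ j *s f j 0) + t ^ v *s f v t"
proof -
  define step where "step g = (SOME b. curve_holomorphic b (ball 0 r) \<and> (\<forall>t. g t = g 0 + t *s b t))" for g :: "complex \<Rightarrow> complex^'n"
  have step: "curve_holomorphic (step g) (ball 0 r)" "g t = g 0 + t *s step g t" if g: "curve_holomorphic g (ball 0 r)" for g t
  proof -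
    have "\<exists>b. curve_holomorphic b (ball 0 r) \<and> (\<forall>t. g t = g 0 + t *s b t)"
      by (rule curve_divide_id[OF g assms(2)]) blast
    from someI_ex[OF this] show "curve_holomorphic (step g) (ball 0 r)" "g t = g 0 + t *s step g t"
      unfolding step_def by blast+
  qed
  define f where "f v = (step ^^ v) \<phi>" for v
  have hol: "curve_holomorphic (f v) (ball 0 r)" for v by (induction v) (auto simp: f_def assms step(1))
  have "\<phi> t = (\<Sum>j<v. t ^ j *s f j 0) + t ^ v *s f v t" for v t
  proof (induction v)
    case (Suc v)
    have "f v t = f v 0 + t *s f (Suc v) t" using step(2)[OF hol, of v t] by (simp add: f_def)
    then show ?case using Suc by (simp add: vec_eq_iff algebra_simps)
  qed (simp add: f_def)
  then show ?thesis using that hol by blast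
qed

lemma card_self_contact_planes:
  fixes \<phi> :: "complex \<Rightarrow> complex^'n"
  assumes n: "normal_curve c m u r \<phi>"
  shows "card (contact_plane \<phi> m \<phi> m u ` ({\<eta>. \<eta> ^ m = 1} - {1})) \<le> \<sigma> m - 1"
proof -
  note n' = normal_curveD[OF n]
  obtain f where f: "\<And>v. curve_holomorphic (f v) (ball 0 r)" "\<And>v t. \<phi> t = (\<Sum>j<v. t ^ j *s f j 0) + t ^ v *s f v t"
    by (rule curve_taylor[OF n'(3,2)]) blast
  define S where "S = {v. f v 0 \<noteq> 0}"
  let ?R = "{\<eta> :: complex. \<eta> ^ m = 1} - {1}"
  let ?v = "\<lambda>\<eta> :: complex. LEAST v. v \<in> S \<and> \<eta> ^ v \<noteq> 1"
  have cc: "contact_curve \<phi> m \<phi> m \<eta> t = \<phi> t - \<phi> (\<eta> * t)" for \<eta> t using n'(1) by (simp add: contact_curve_def)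
  define e where "e \<eta> v t = f v t - \<eta> ^ v *s f v (\<eta> * t)" for \<eta> :: complex and v t
  have e: "curve_holomorphic (e \<eta> v) (ball 0 r)" if "\<eta> ^ m = 1" for \<eta> v
  proof -
    have im: "(\<lambda>t. \<eta> * t) ` ball 0 r \<subseteq> ball 0 r" using norm_root_unity[OF that n'(1)] by (auto simp: norm_mult)
    have "curve_holomorphic (\<lambda>t. f v (\<eta> * t)) (ball 0 r)"
      by (rule curve_holomorphic_compose[OF f(1) _ im]) (intro holomorphic_intros)
    then show ?thesis unfolding e_def[abs_def] by (intro curve_holomorphic_diff curve_holomorphic_scale f(1) holomorphic_intros)
  qed
  \<comment> \<open>All terms of degree below \<open>v\<close> cancel when \<eta> acts trivially on
    the exponents that occur.\<close>
  have de: "contact_curve \<phi> m \<phi> m \<eta> t = t ^ v *s e \<eta> v t" if "\<And>j. j < v \<Longrightarrow> j \<in> S \<Longrightarrow> \<eta> ^ j = 1" for \<eta> v t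
  proof -
    have "(\<Sum>j<v. (\<eta> * t) ^ j *s f j 0) = (\<Sum>j<v. t ^ j *s f j 0)"
      using that by (intro sum.cong) (auto simp: S_def power_mult_distrib)
    then show ?thesis unfolding cc f(2)[of t v] f(2)[of "\<eta> * t" v]
      by (simp add: e_def vec_eq_iff power_mult_distrib algebra_simps)
  qed
  \<comment> \<open>If \<eta> acted trivially on all exponents of the branch, the difference would
    be divisible by every power of \<open>t\<close> and hence vanish near 0; then
    \<open>\<phi> t = \<phi> (\<eta> * t)\<close> contradicts injectivity.\<close>
  have ex: "\<exists>v\<in>S. \<eta> ^ v \<noteq> 1" if \<eta>: "\<eta> ^ m = 1" "\<eta> \<noteq> 1" for \<eta> :: complex
  proof (rule ccontr)
    assume "\<not> ?thesis"
    then have d: "contact_curve \<phi> m \<phi> m \<eta> t = t ^ v *s e \<eta> v t" for v t by (intro de) auto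
    obtain k D where kD: "curve_leads (contact_curve \<phi> m \<phi> m \<eta>) k D" using contact_curve_leads[OF n n \<eta>(1)] by blast
    show False
    proof (cases "D = 0")
      case False
      have "Suc k \<le> k" using curve_leads_less[OF kD False n'(2) e[OF \<eta>(1)] d, of "Suc k"] by blast
      then show False by simp
    next
      case True
      then obtain \<delta> where \<delta>: "\<delta> > 0" "\<And>t. t \<in> ball 0 \<delta> \<Longrightarrow> contact_curve \<phi> m \<phi> m \<eta> t = 0"
        using kD unfolding curve_leads_def by (metis vec.scale_zero_right)
      define t where "t = (of_real (min \<delta> r / 2) :: complex)"
      have "norm t = min \<delta> r / 2" unfolding t_def norm_of_real using \<delta>(1) n'(2) by simp
      then have t: "t \<in> ball 0 \<delta>" "t \<in> ball 0 r" "\<eta> * t \<in> ball 0 r" "t \<noteq> 0"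
        using \<delta>(1) n'(2) norm_root_unity[OF \<eta>(1) n'(1)] by (auto simp: norm_mult t_def)
      then have "\<phi> t = \<phi> (\<eta> * t)" using \<delta>(2)[OF t(1)] cc by simp
      then have "t = \<eta> * t" using inj_onD[OF n'(4)] t by blast
      then show False using t(4) \<eta>(2) by simp
    qed
  qed
  \<comment> \<open>The leading vector is a Taylor coefficient times the nonzero scalar
    \<open>1 - \<eta> ^ v\<close>, so the plane depends on \<eta> through the least exponent
    only.\<close>
  have plane: "contact_plane \<phi> m \<phi> m u \<eta> = vec.span {u, f (?v \<eta>) 0}" if "\<eta> \<in> ?R" for \<eta>
  proof -
    have \<eta>: "\<eta> ^ m = 1" "\<eta> \<noteq> 1" using that by auto
    obtain v0 where v0: "v0 \<in> S \<and> \<eta> ^ v0 \<noteq> 1" using ex[OF \<eta>] by blast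
    have v: "?v \<eta> \<in> S \<and> \<eta> ^ ?v \<eta> \<noteq> 1" using LeastI[of "\<lambda>v. v \<in> S \<and> \<eta> ^ v \<noteq> 1", OF v0] .
    have "\<eta> ^ j = 1" if "j < ?v \<eta>" "j \<in> S" for j using not_less_Least[OF that(1)] that(2) by blast
    from de[OF this] have d: "contact_curve \<phi> m \<phi> m \<eta> t = t ^ ?v \<eta> *s e \<eta> (?v \<eta>) t" for t by blast
    have e0: "e \<eta> (?v \<eta>) 0 = (1 - \<eta> ^ ?v \<eta>) *s f (?v \<eta>) 0" by (simp add: e_def vec_eq_iff algebra_simps)
    have v1: "1 - \<eta> ^ ?v \<eta> \<noteq> 0" using v by simp
    have "e \<eta> (?v \<eta>) 0 \<noteq> 0" unfolding e0 vec.scale_eq_0_iff using v v1 S_def by blast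
    then have "curve_leads (contact_curve \<phi> m \<phi> m \<eta>) (?v \<eta>) (e \<eta> (?v \<eta>) 0)"
      unfolding curve_leads_def using e[OF \<eta>(1)] n'(2) d by (intro exI[of _ r] exI[of _ "e \<eta> (?v \<eta>)"]) auto
    from lead_eq[OF this] show ?thesis unfolding contact_plane_def e0 using span_pair_scale[OF v1] by simp
  qed
  have fin: "finite (?v ` ?R)" using finite_roots_unity[of m] n'(1) by (intro finite_imageI finite_Diff) auto
  have "card (contact_plane \<phi> m \<phi> m u ` ?R) \<le> card (?v ` ?R)"
    by (rule card_image_factor(2)[OF fin]) (use plane in simp)
  also have "\<dots> \<le> \<sigma> m - 1" by (rule card_least_exponents[OF n'(1) ex])
  finally show ?thesis .
qed

section \<open>Irreducible components of unions of subspaces\<close>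

lemma analytic_at_Int:
  assumes "analytic_at p A" "analytic_at p B"
  shows "analytic_at p (A \<inter> B)"
proof -
  obtain U F where F: "open U" "p \<in> U" "finite F" "\<forall>f\<in>F. holomorphic_fun f U" "A \<inter> U = {z \<in> U. \<forall>f\<in>F. f z = 0}"
    using assms(1) unfolding analytic_at_def by blast
  obtain V G where G: "open V" "p \<in> V" "finite G" "\<forall>f\<in>G. holomorphic_fun f V" "B \<inter> V = {z \<in> V. \<forall>f\<in>G. f z = 0}"
    using assms(2) unfolding analytic_at_def by blast
  have "z \<in> A \<inter> B \<inter> (U \<inter> V) \<longleftrightarrow> z \<in> {z \<in> U \<inter> V. \<forall>f\<in>F \<union> G. f z = 0}" for z
    using eqset_imp_iff[OF F(5), of z] eqset_imp_iff[OF G(5), of z] by auto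
  then have "A \<inter> B \<inter> (U \<inter> V) = {z \<in> U \<inter> V. \<forall>f\<in>F \<union> G. f z = 0}" by blast
  moreover have "\<forall>f\<in>F \<union> G. holomorphic_fun f (U \<inter> V)" using F(4) G(4) holomorphic_fun_subset by blast
  ultimately show ?thesis unfolding analytic_at_def using F G
    by (intro exI[of _ "U \<inter> V"] exI[of _ "F \<union> G"]) auto
qed

text \<open>A linear projection \<open>g\<close> onto \<open>P\<close> describes \<open>P\<close> by
  the equations \<open>g z = z\<close>, whose coordinates are linear forms.\<close>

lemma subspace_analytic:
  fixes P :: "(complex^'n) set"
  assumes "vec.subspace P"
  shows "analytic_subset P"
proof -
  have "Vector_Spaces.linear (*s) (*s) (id :: complex^'n \<Rightarrow> complex^'n)"
    by unfold_locales (simp_all add: vec.scale_right_distrib)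
  from vec.linear_exists_left_inverse_on[OF this assms]
  obtain g where g: "range g \<subseteq> P" "Vector_Spaces.linear (*s) (*s) g" "\<And>v. v \<in> P \<Longrightarrow> g v = v" by auto
  interpret g: Vector_Spaces.linear "(*s)" "(*s)" g by (rule g(2))
  have "holomorphic_fun (\<lambda>z. (g z - z) $ i) UNIV" for i
  proof -
    have "Vector_Spaces.linear (*s) (*) (\<lambda>z. (g z - z) $ i)"
      by unfold_locales (simp_all add: g.add g.scale algebra_simps)
    from linear_eq_lform[OF this] show ?thesis using holomorphic_fun_lform by metis
  qed
  then have "\<forall>f\<in>range (\<lambda>i z. (g z - z) $ i). holomorphic_fun f UNIV" by blast
  moreover have "P = {z. \<forall>f\<in>range (\<lambda>i z. (g z - z) $ i). f z = 0}"
  proof (intro set_eqI iffI)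
    fix z assume "z \<in> {z. \<forall>f\<in>range (\<lambda>i z. (g z - z) $ i). f z = 0}"
    then have "g z = z" by (simp add: vec_eq_iff)
    then show "z \<in> P" using g(1) by (metis rangeI subsetD)
  qed (use g(3) in simp)
  ultimately show ?thesis unfolding analytic_subset_def analytic_at_def
    by (intro allI exI[of _ UNIV] exI[of _ "range (\<lambda>i z. (g z - z) $ i)"]) auto
qed

lemma line_chart:
  fixes b d :: "complex^'n"
  assumes "analytic_at (b + t *s d) B"
  obtains e F where "e > 0" "finite F" "\<And>f. f \<in> F \<Longrightarrow> f holomorphic_on ball t e"
    "\<And>x. x \<in> ball t e \<Longrightarrow> b + x *s d \<in> B \<longleftrightarrow> (\<forall>f\<in>F. f x = 0)"
proof -
  obtain U F where F: "open U" "b + t *s d \<in> U" "finite F" "\<forall>f\<in>F. holomorphic_fun f U" "B \<inter> U = {z \<in> U. \<forall>f\<in>F. f z = 0}"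
    using assms unfolding analytic_at_def by blast
  have hol: "curve_holomorphic (\<lambda>x. b + x *s d) D" for D
    by (rule curve_holomorphicI) (auto intro!: holomorphic_intros)
  have "open ((\<lambda>x. b + x *s d) -` U)"
    using continuous_open_preimage[OF curve_holomorphic_continuous[OF hol] open_UNIV F(1)] by simp
  then obtain e where e: "e > 0" "ball t e \<subseteq> (\<lambda>x. b + x *s d) -` U" using F(2) openE by (metis vimageI)
  show ?thesis
  proof (rule that[of e "(\<lambda>f x. f (b + x *s d)) ` F"])
    fix f assume "f \<in> (\<lambda>f x. f (b + x *s d)) ` F"
    then obtain g where g: "g \<in> F" "f = (\<lambda>x. g (b + x *s d))" by blast
    show "f holomorphic_on ball t e" unfolding g(2)
      by (rule holomorphic_fun_curve[where f = g and U = U and s = "\<lambda>x. b + x *s d"]) (use F(4) g(1) hol e(2) in auto)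
  next
    fix x assume "x \<in> ball t e"
    then have "b + x *s d \<in> U" using e(2) by blast
    then show "b + x *s d \<in> B \<longleftrightarrow> (\<forall>f\<in>(\<lambda>f x. f (b + x *s d)) ` F. f x = 0)"
      using eqset_imp_iff[OF F(5), of "b + x *s d"] by simp
  qed (use e F(3) in auto)
qed

text \<open>By the identity theorem in a chart, the interior of the set of parameters belonging to
  \<open>B\<close> is also closed, hence it is the whole complex plane.\<close>

lemma analytic_contains_line:
  fixes b d :: "complex^'n"
  assumes "analytic_subset B" "interior {t. b + t *s d \<in> B} \<noteq> {}"
  shows "b + t *s d \<in> B"
proof -
  define T where "T = interior {t. b + t *s d \<in> B}"
  have "closure T \<subseteq> T"
  proof
    fix p assume p: "p \<in> closure T"
    have "analytic_at (b + p *s d) B" using assms(1) by (simp add: analytic_subset_def)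
    then obtain e F where e: "e > 0" "\<And>f. f \<in> F \<Longrightarrow> f holomorphic_on ball p e"
      "\<And>x. x \<in> ball p e \<Longrightarrow> b + x *s d \<in> B \<longleftrightarrow> (\<forall>f\<in>F. f x = 0)"
      by (rule line_chart) blast
    obtain y where "y \<in> T" "dist y p < e" using p e(1) unfolding closure_approachable by blast
    then have ne: "T \<inter> ball p e \<noteq> {}" by (auto simp: dist_commute)
    have "f x = 0" if "f \<in> F" "x \<in> ball p e" for f x
    proof (rule analytic_continuation_open[of "T \<inter> ball p e" "ball p e" f "\<lambda>_. 0"])
      show "f z = 0" if "z \<in> T \<inter> ball p e" for z
        using that e(3)[of z] \<open>f \<in> F\<close> interior_subset unfolding T_def by blast
    qed (use that e(2) ne in \<open>auto simp: T_def\<close>)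
    then have "ball p e \<subseteq> {t. b + t *s d \<in> B}" using e(3) by blast
    then show "p \<in> T" unfolding T_def using e(1) by (metis centre_in_ball interiorI open_ball)
  qed
  then have "closed T" using closure_subset closed_closure by (metis subset_antisym)
  then have "T = UNIV" using clopen[of T] assms(2) by (auto simp: T_def)
  then show ?thesis using interior_subset unfolding T_def by blast
qed

text \<open>Points \<open>x\<close> outside \<open>B\<close> and \<open>y\<close> outside
  \<open>C\<close> span a complex line in \<open>P\<close>. Near \<open>x\<close> an equation of
  \<open>B\<close> stays nonzero, so the line runs in \<open>C\<close> there; then all of it lies in
  \<open>C\<close>, against the choice of \<open>y\<close>.\<close>

lemma subspace_irreducible:
  fixes P :: "(complex^'n) set"
  assumes "vec.subspace P"
  shows "irreducible_analytic P"
  unfolding irreducible_analytic_def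
proof (intro conjI allI impI)
  show "analytic_subset P" by (rule subspace_analytic[OF assms])
  show "P \<noteq> {}" using vec.subspace_0[OF assms] by blast
  fix B C assume BC: "analytic_subset B \<and> analytic_subset C \<and> P = B \<union> C"
  show "P = B \<or> P = C"
  proof (rule ccontr)
    assume "\<not> ?thesis"
    then obtain x y where x: "x \<in> P" "x \<notin> B" and y: "y \<in> P" "y \<notin> C" using BC by blast
    define d where "d = x - y"
    have dP: "y + t *s d \<in> P" for t
      unfolding d_def by (intro vec.subspace_add[OF assms] vec.subspace_scale[OF assms] vec.subspace_diff[OF assms] x y)
    have x1: "y + 1 *s d = x" by (simp add: d_def)
    have "analytic_at (y + 1 *s d) B" using BC by (simp add: analytic_subset_def)
    then obtain e F where e: "e > 0" "\<And>f. f \<in> F \<Longrightarrow> f holomorphic_on ball 1 e"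
      "\<And>t. t \<in> ball 1 e \<Longrightarrow> y + t *s d \<in> B \<longleftrightarrow> (\<forall>f\<in>F. f t = 0)"
      by (rule line_chart) blast
    obtain f where f: "f \<in> F" "f 1 \<noteq> 0" using e(3)[of 1] e(1) x1 x(2) by auto
    have "continuous_on (ball 1 e) f" by (rule holomorphic_on_imp_continuous_on[OF e(2)[OF f(1)]])
    moreover have "open (- {0 :: complex})" by (intro open_Compl) simp
    ultimately have o: "open (f -` (- {0}) \<inter> ball 1 e)" using continuous_open_preimage[OF _ open_ball, of 1 e f "- {0}"] by (simp add: Int_commute)
    have "f -` (- {0}) \<inter> ball 1 e \<subseteq> {t. y + t *s d \<in> C}"
      using e(3) f(1) dP BC by blast
    then have "1 \<in> interior {t. y + t *s d \<in> C}" using o f(2) e(1) by (intro interiorI) auto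
    then have "y + 0 *s d \<in> C" using BC by (intro analytic_contains_line) auto
    then show False using y(2) by simp
  qed
qed

lemma irreducible_analytic_subset_Union:
  assumes "irreducible_analytic B" "finite \<P>" "\<And>P. P \<in> \<P> \<Longrightarrow> analytic_subset P" "B \<subseteq> \<Union>\<P>"
  shows "\<exists>P\<in>\<P>. B \<subseteq> P"
  using assms(2,3,4)
proof (induction \<P> rule: finite_induct)
  case empty
  then show ?case using assms(1) by (auto simp: irreducible_analytic_def)
next
  case (insert P \<P>)
  have B: "analytic_subset B" using assms(1) by (simp add: irreducible_analytic_def)
  have "analytic_subset (B \<inter> P)" using B insert.prems(1)[of P] unfolding analytic_subset_def by (intro allI analytic_at_Int) auto
  moreover have "analytic_at p (\<Union>P\<in>\<P>. P)" for p
    using insert.hyps(1) insert.prems(1) by (intro analytic_at_UN) (auto simp: analytic_subset_def)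
  then have "analytic_subset (B \<inter> \<Union>\<P>)" using B unfolding analytic_subset_def by (intro allI analytic_at_Int) auto
  moreover have "B = (B \<inter> P) \<union> (B \<inter> \<Union>\<P>)" using insert.prems(2) by blast
  ultimately have "B = B \<inter> P \<or> B = B \<inter> \<Union>\<P>" using assms(1) unfolding irreducible_analytic_def by blast
  then show ?case
  proof
    assume "B = B \<inter> \<Union>\<P>"
    then show ?thesis using insert.IH insert.prems(1) by blast
  qed blast
qed

text \<open>A component lies in one of the subspaces, and maximality makes it equal to that
  subspace. Subspaces contained in others drop out, so this gives an inclusion and an upper bound
  for the count.\<close>

lemma Irred_Union_subspaces:
  assumes "finite \<P>" "\<And>P. P \<in> \<P> \<Longrightarrow> vec.subspace P"
  shows "Irred (\<Union>\<P>) \<subseteq> \<P>"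
proof
  fix B assume B: "B \<in> Irred (\<Union>\<P>)"
  then obtain P where P: "P \<in> \<P>" "B \<subseteq> P"
    using irreducible_analytic_subset_Union[of B \<P>] assms subspace_analytic unfolding Irred_def by blast
  moreover have "irreducible_analytic P" using P(1) assms(2) subspace_irreducible by blast
  ultimately have "P = B" using B unfolding Irred_def by blast
  then show "B \<in> \<P>" using P(1) by simp
qed

text \<open>For one more vector, \<open>c\<close> is perturbed along a coordinate in which that
  vector is nonzero; only finitely many values of the perturbation parameter \<open>t\<close> spoil
  one of the conditions.\<close>

lemma generic_linear_form:
  fixes u :: "'i \<Rightarrow> complex^'n"
  assumes "finite I" "\<And>i. i \<in> I \<Longrightarrow> u i \<noteq> 0"
  shows "\<exists>c. \<forall>i\<in>I. lform c (u i) \<noteq> 0"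
  using assms
proof (induction I rule: finite_induct)
    case (insert k I)
    then obtain c where c: "\<And>i. i \<in> I \<Longrightarrow> lform c (u i) \<noteq> 0" by auto
    obtain j where j: "u k $ j \<noteq> 0" using insert.prems[of k] by (auto simp: vec_eq_iff)
    have l: "lform (c + t *s axis j 1) z = lform c z + t * z $ j" for t z
    proof -
      have "lform (c + t *s axis j 1) z = lform c z + (\<Sum>i\<in>UNIV. t * axis j 1 $ i * z $ i)"
        by (simp add: lform_def algebra_simps sum.distrib)
      also have "(\<Sum>i\<in>UNIV. t * axis j 1 $ i * z $ i) = (\<Sum>i\<in>UNIV. if i = j then t * z $ j else 0)"
        by (intro sum.cong) (auto simp: axis_def)
      finally show ?thesis by simp
    qed
    have "finite ((\<lambda>i. - lform c (u i) / u i $ j) ` insert k I)" using insert.hyps(1) by simp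
    then obtain t where t: "t \<notin> (\<lambda>i. - lform c (u i) / u i $ j) ` insert k I" using ex_new_if_finite[OF infinite_UNIV_char_0] by blast
    have "lform (c + t *s axis j 1) (u i) \<noteq> 0" if "i \<in> insert k I" for i
    proof
      assume 0: "lform (c + t *s axis j 1) (u i) = 0"
      show False
      proof (cases "u i $ j = 0")
        case True
        then show False using that c[of i] j 0 l[of t "u i"] by auto
      next
        case False
        then have "t = - lform c (u i) / u i $ j" using 0 l[of t "u i"] by (simp add: field_simps eq_neg_iff_add_eq_0)
        then show False using t that by blast
      qed
    qed
    then show ?case by blast
qed simp

section \<open>Assembly of the cone from pairs of branches\<close>

lemma pair_cone_sym: "pair_cone \<phi> \<psi> = pair_cone \<psi> \<phi>"
proof -
  have "v \<in> pair_cone \<psi> \<phi>" if v: "v \<in> pair_cone \<phi> \<psi>" for v and \<phi> \<psi> :: "complex \<Rightarrow> complex^'a"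
  proof -
    obtain t t' k where t: "t \<longlonglongrightarrow> 0" "t' \<longlonglongrightarrow> 0" "\<forall>\<^sub>F s in sequentially. \<phi> (t s) \<noteq> \<psi> (t' s)"
      "(\<lambda>s. k s *s (\<phi> (t s) - \<psi> (t' s))) \<longlonglongrightarrow> v"
      using v unfolding pair_cone_def by blast
    have "\<forall>\<^sub>F s in sequentially. \<psi> (t' s) \<noteq> \<phi> (t s)" using t(3) by (rule eventually_mono) metis
    moreover have "(\<lambda>s. - k s *s (\<psi> (t' s) - \<phi> (t s))) = (\<lambda>s. k s *s (\<phi> (t s) - \<psi> (t' s)))"
      by (simp add: fun_eq_iff vec_eq_iff algebra_simps)
    ultimately show ?thesis unfolding pair_cone_def using t(1,2,4)
      by (intro CollectI exI[of _ t'] exI[of _ t] exI[of _ "\<lambda>s. - k s"]) simp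
  qed
  then show ?thesis by blast
qed

text \<open>The two sequences run through finitely many branches, so a subsequence stays on one pair
  of them. Initial terms, where the germs may differ, are cut off by \<open>N\<close>.\<close>

lemma C5_curves:
  fixes X :: "(complex^'n) set" and \<phi> :: "'i \<Rightarrow> complex \<Rightarrow> complex^'n"
  assumes "finite I" and n: "\<And>i. i \<in> I \<Longrightarrow> normal_curve c (m i) (u i) (R i) (\<phi> i)"
    and X: "germ_eq X (\<Union>i\<in>I. \<phi> i ` ball 0 (R i))"
  shows "C5 X = (\<Union>i\<in>I. \<Union>j\<in>I. pair_cone (\<phi> i) (\<phi> j))"
proof (intro equalityI subsetI)
  fix v assume "v \<in> C5 X"
  then obtain w w' k where w: "\<forall>s. w s \<in> X \<and> w' s \<in> X \<and> w s \<noteq> w' s" "w \<longlonglongrightarrow> 0" "w' \<longlonglongrightarrow> 0"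
     "(\<lambda>s. k s *s (w s - w' s)) \<longlonglongrightarrow> v"
    unfolding C5_def by blast
  have "\<forall>\<^sub>F s in sequentially. w s \<in> (\<Union>i\<in>I. \<phi> i ` ball 0 (R i))" "\<forall>\<^sub>F s in sequentially. w' s \<in> (\<Union>i\<in>I. \<phi> i ` ball 0 (R i))"
    using germ_eq_sequence[OF X w(2)] germ_eq_sequence[OF X w(3)] w(1) by auto
  then have "\<forall>\<^sub>F s in sequentially. w s \<in> (\<Union>i\<in>I. \<phi> i ` ball 0 (R i)) \<and> w' s \<in> (\<Union>i\<in>I. \<phi> i ` ball 0 (R i))"
    by (rule eventually_conj)
  then obtain N where N: "\<And>s. s \<ge> N \<Longrightarrow> w s \<in> (\<Union>i\<in>I. \<phi> i ` ball 0 (R i)) \<and> w' s \<in> (\<Union>i\<in>I. \<phi> i ` ball 0 (R i))"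
    unfolding eventually_sequentially by blast
  have "\<forall>s. \<exists>i j. i \<in> I \<and> j \<in> I \<and> w (s + N) \<in> \<phi> i ` ball 0 (R i) \<and> w' (s + N) \<in> \<phi> j ` ball 0 (R j)"
  proof
    fix s
    have *: "w (s + N) \<in> (\<Union>i\<in>I. \<phi> i ` ball 0 (R i))" "w' (s + N) \<in> (\<Union>i\<in>I. \<phi> i ` ball 0 (R i))"
      using N[of "s + N"] by simp_all
    obtain i where "i \<in> I" "w (s + N) \<in> \<phi> i ` ball 0 (R i)" using *(1) by (rule UN_E)
    moreover obtain j where "j \<in> I" "w' (s + N) \<in> \<phi> j ` ball 0 (R j)" using *(2) by (rule UN_E)
    ultimately show "\<exists>i j. i \<in> I \<and> j \<in> I \<and> w (s + N) \<in> \<phi> i ` ball 0 (R i) \<and> w' (s + N) \<in> \<phi> j ` ball 0 (R j)" by blast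
  qed
  then obtain f g where fg: "\<And>s. f s \<in> I" "\<And>s. g s \<in> I" "\<And>s. w (s + N) \<in> \<phi> (f s) ` ball 0 (R (f s))"
     "\<And>s. w' (s + N) \<in> \<phi> (g s) ` ball 0 (R (g s))" by metis
  have "finite (range (\<lambda>s. (f s, g s)))"
    by (rule finite_subset[of _ "I \<times> I"]) (use assms(1) fg in auto)
  then obtain h :: "nat \<Rightarrow> nat" and ij where h: "strict_mono h" "\<And>s. (f (h s), g (h s)) = ij"
    by (rule finite_range_subsequence) blast
  obtain i j where ij: "ij = (i, j)" by fastforce
  have fh: "f (h s) = i" "g (h s) = j" for s using h(2)[of s] ij by auto
  have i: "i \<in> I" "j \<in> I" using fg(1)[of "h 0"] fg(2)[of "h 0"] fh by auto
  have sub: "strict_mono (\<lambda>s. h s + N)" using h(1) by (simp add: strict_mono_def)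
  have lim: "(\<lambda>s. w (h s + N)) \<longlonglongrightarrow> 0" "(\<lambda>s. w' (h s + N)) \<longlonglongrightarrow> 0"
    "(\<lambda>s. k (h s + N) *s (w (h s + N) - w' (h s + N))) \<longlonglongrightarrow> v"
    using LIMSEQ_subseq_LIMSEQ[OF w(2) sub] LIMSEQ_subseq_LIMSEQ[OF w(3) sub] LIMSEQ_subseq_LIMSEQ[OF w(4) sub]
    by (simp_all add: o_def)
  have ev: "\<forall>\<^sub>F s in sequentially. w (h s + N) \<in> \<phi> i ` ball 0 (R i)" "\<forall>\<^sub>F s in sequentially. w' (h s + N) \<in> \<phi> j ` ball 0 (R j)"
  proof -
    have "w (h s + N) \<in> \<phi> i ` ball 0 (R i) \<and> w' (h s + N) \<in> \<phi> j ` ball 0 (R j)" for s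
      using fg(3)[of "h s"] fg(4)[of "h s"] unfolding fh by blast
    then show "\<forall>\<^sub>F s in sequentially. w (h s + N) \<in> \<phi> i ` ball 0 (R i)" "\<forall>\<^sub>F s in sequentially. w' (h s + N) \<in> \<phi> j ` ball 0 (R j)"
      by simp_all
  qed
  obtain t where t: "t \<longlonglongrightarrow> 0" "\<forall>\<^sub>F s in sequentially. t s \<in> ball 0 (R i) \<and> w (h s + N) = \<phi> i (t s)"
    by (rule normal_curve_sequence[OF n[OF i(1)] lim(1) ev(1)]) blast
  obtain t' where t': "t' \<longlonglongrightarrow> 0" "\<forall>\<^sub>F s in sequentially. t' s \<in> ball 0 (R j) \<and> w' (h s + N) = \<phi> j (t' s)"
    by (rule normal_curve_sequence[OF n[OF i(2)] lim(2) ev(2)]) blast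
  have eq: "\<forall>\<^sub>F s in sequentially. w (h s + N) = \<phi> i (t s) \<and> w' (h s + N) = \<phi> j (t' s)"
    using t(2) t'(2) by eventually_elim simp
  have "\<forall>\<^sub>F s in sequentially. \<phi> i (t s) \<noteq> \<phi> j (t' s)"
    using eq by (rule eventually_mono) (metis w(1))
  moreover have "(\<lambda>s. k (h s + N) *s (\<phi> i (t s) - \<phi> j (t' s))) \<longlonglongrightarrow> v"
    by (rule Lim_transform_eventually[OF lim(3)], rule eventually_mono[OF eq]) simp
  ultimately have "v \<in> pair_cone (\<phi> i) (\<phi> j)" unfolding pair_cone_def using t(1) t'(1)
    by (intro CollectI exI[of _ t] exI[of _ t'] exI[of _ "\<lambda>s. k (h s + N)"] conjI)
  then show "v \<in> (\<Union>i\<in>I. \<Union>j\<in>I. pair_cone (\<phi> i) (\<phi> j))" using i by blast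
next
  fix v assume "v \<in> (\<Union>i\<in>I. \<Union>j\<in>I. pair_cone (\<phi> i) (\<phi> j))"
  then obtain i j t t' k where i: "i \<in> I" "j \<in> I" and t: "t \<longlonglongrightarrow> 0" "t' \<longlonglongrightarrow> 0" "\<forall>\<^sub>F s in sequentially. \<phi> i (t s) \<noteq> \<phi> j (t' s)"
      "(\<lambda>s. k s *s (\<phi> i (t s) - \<phi> j (t' s))) \<longlonglongrightarrow> v"
    unfolding pair_cone_def by blast
  have in_X: "(\<lambda>s. \<phi> i (t s)) \<longlonglongrightarrow> 0 \<and> (\<forall>\<^sub>F s in sequentially. \<phi> i (t s) \<in> X)" if "i \<in> I" "t \<longlonglongrightarrow> 0" for i and t :: "nat \<Rightarrow> complex"
  proof -
    note n' = normal_curveD[OF n[OF that(1)]]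
    have w0: "(\<lambda>s. \<phi> i (t s)) \<longlonglongrightarrow> 0" using curve_sequence_tendsto[OF n'(3,2) that(2)] n'(8) by simp
    have "\<forall>\<^sub>F s in sequentially. t s \<in> ball 0 (R i)" using n'(2) by (intro topological_tendstoD[OF that(2)]) auto
    then have "\<forall>\<^sub>F s in sequentially. \<phi> i (t s) \<in> (\<Union>i\<in>I. \<phi> i ` ball 0 (R i))"
      by (rule eventually_mono) (use that(1) in blast)
    from germ_eq_sequence[OF germ_eq_sym[OF X] w0 this] w0 show ?thesis by blast
  qed
  have "\<forall>\<^sub>F s in sequentially. \<phi> i (t s) \<in> X \<and> \<phi> j (t' s) \<in> X \<and> \<phi> i (t s) \<noteq> \<phi> j (t' s)"
    using in_X[OF i(1) t(1)] in_X[OF i(2) t(2)] t(3) by (auto intro: eventually_conj)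
  then obtain N where N: "\<And>s. s \<ge> N \<Longrightarrow> \<phi> i (t s) \<in> X \<and> \<phi> j (t' s) \<in> X \<and> \<phi> i (t s) \<noteq> \<phi> j (t' s)"
    unfolding eventually_sequentially by blast
  have "(\<lambda>s. \<phi> i (t (s + N))) \<longlonglongrightarrow> 0" "(\<lambda>s. \<phi> j (t' (s + N))) \<longlonglongrightarrow> 0"
    using LIMSEQ_ignore_initial_segment in_X i t by blast+
  moreover have "(\<lambda>s. k (s + N) *s (\<phi> i (t (s + N)) - \<phi> j (t' (s + N)))) \<longlonglongrightarrow> v"
    using LIMSEQ_ignore_initial_segment[OF t(4), of N] .
  ultimately show "v \<in> C5 X" unfolding C5_def using N
    by (intro CollectI exI[of _ "\<lambda>s. \<phi> i (t (s + N))"] exI[of _ "\<lambda>s. \<phi> j (t' (s + N))"] exI[of _ "\<lambda>s. k (s + N)"]) simp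
qed

lemma contact_plane_1:
  fixes \<phi> :: "complex \<Rightarrow> complex^'n"
  assumes n: "normal_curve c m u r \<phi>"
  shows "contact_plane \<phi> m \<phi> m u 1 = vec.span {u}"
proof -
  have "curve_leads (contact_curve \<phi> m \<phi> m 1) 0 0" unfolding curve_leads_def
    by (intro exI[of _ 1] conjI exI[of _ "\<lambda>_. 0"])
      (use normal_curveD(1)[OF n] in \<open>auto simp: contact_curve_def intro: curve_holomorphic_const\<close>)
  from lead_eq[OF this] have "contact_plane \<phi> m \<phi> m u 1 = vec.span {u, 0}" by (simp add: contact_plane_def)
  also have "\<dots> = vec.span {u}" by (metis insert_commute vec.span_insert_0)
  finally show ?thesis .
qed

lemma branch_normal_forms:
  assumes "finite I" "\<And>i. i \<in> I \<Longrightarrow> irreducible_germ (Xb i)" "\<And>i. i \<in> I \<Longrightarrow> germ_dim (Xb i) = 1"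
  shows "\<exists>c m u R \<phi>. \<forall>i\<in>I. normal_curve c (m i) (u i) (R i) (\<phi> i) \<and>
    (\<forall>r'. 0 < r' \<longrightarrow> r' \<le> R i \<longrightarrow> germ_eq (Xb i) (\<phi> i ` ball 0 r'))"
proof -
  have "\<exists>u m. i \<in> I \<longrightarrow> u \<noteq> 0 \<and> (\<forall>c. lform c u \<noteq> 0 \<longrightarrow>
    (\<exists>\<phi> r. normal_curve c m ((1 / lform c u) *s u) r \<phi> \<and> (\<forall>r'. 0 < r' \<longrightarrow> r' \<le> r \<longrightarrow> germ_eq (Xb i) (\<phi> ` ball 0 r'))))" for i
    using irreducible_germ_normal_form[OF assms(2,3), of i] by metis
  then obtain v m where v: "\<And>i. i \<in> I \<Longrightarrow> v i \<noteq> 0" "\<And>i c. i \<in> I \<Longrightarrow> lform c (v i) \<noteq> 0 \<Longrightarrow>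
    \<exists>\<phi> r. normal_curve c (m i) ((1 / lform c (v i)) *s v i) r \<phi> \<and> (\<forall>r'. 0 < r' \<longrightarrow> r' \<le> r \<longrightarrow> germ_eq (Xb i) (\<phi> ` ball 0 r'))"
    by metis
  have "\<exists>c. \<forall>i\<in>I. lform c (v i) \<noteq> 0" by (rule generic_linear_form[OF assms(1) v(1)])
  then obtain c where c: "\<And>i. i \<in> I \<Longrightarrow> lform c (v i) \<noteq> 0" by blast
  have "\<exists>\<phi> r. i \<in> I \<longrightarrow> normal_curve c (m i) ((1 / lform c (v i)) *s v i) r \<phi> \<and> (\<forall>r'. 0 < r' \<longrightarrow> r' \<le> r \<longrightarrow> germ_eq (Xb i) (\<phi> ` ball 0 r'))" for i
    using v(2)[OF _ c] by blast
  then obtain \<phi> R where "\<forall>i. i \<in> I \<longrightarrow> normal_curve c (m i) ((1 / lform c (v i)) *s v i) (R i) (\<phi> i) \<and>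
    (\<forall>r'. 0 < r' \<longrightarrow> r' \<le> R i \<longrightarrow> germ_eq (Xb i) (\<phi> i ` ball 0 r'))" by metis
  then show ?thesis
    by (intro exI[of _ c] exI[of _ m] exI[of _ "\<lambda>i. (1 / lform c (v i)) *s v i"] exI[of _ R] exI[of _ \<phi>]) blast
qed

lemma germ_eq_UN:
  assumes "finite I" "\<And>i. i \<in> I \<Longrightarrow> germ_eq (A i) (B i)"
  shows "germ_eq (\<Union>i\<in>I. A i) (\<Union>i\<in>I. B i)"
proof -
  have "\<forall>\<^sub>F z in nhds 0. \<forall>i\<in>I. z \<in> A i \<longleftrightarrow> z \<in> B i"
    using assms unfolding germ_eq_def by (intro eventually_ball_finite) auto
  then show ?thesis unfolding germ_eq_def by (rule eventually_mono) blast
qed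

text \<open>Secant limits are symmetric in the two branches, so pairs with \<open>i < j\<close>
  suffice off the diagonal. On the diagonal \<eta> = 1 contributes the tangent line alone, and this
  line has to be found in another plane: with a single branch \<open>m i \<noteq> 1\<close> provides
  a further root of unity, with several branches a mixed pair does.\<close>

lemma C5_planes:
  fixes \<phi> :: "'i::linorder \<Rightarrow> complex \<Rightarrow> complex^'n"
  assumes I: "finite I" and n: "\<And>i. i \<in> I \<Longrightarrow> normal_curve c (m i) (u i) (R i) (\<phi> i)"
    and X: "germ_eq X (\<Union>i\<in>I. \<phi> i ` ball 0 (R i))" and single: "\<And>i. I = {i} \<Longrightarrow> m i \<noteq> 1"
  shows "C5 X = (\<Union>i\<in>I. \<Union>\<eta>\<in>{\<eta>. \<eta> ^ m i = 1} - {1}. contact_plane (\<phi> i) (m i) (\<phi> i) (m i) (u i) \<eta>) \<union>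
    (\<Union>(i, j)\<in>{(i, j). i \<in> I \<and> j \<in> I \<and> i < j}. \<Union>\<eta>\<in>{\<eta>. \<eta> ^ m j = 1}. contact_plane (\<phi> i) (m i) (\<phi> j) (m j) (u j) \<eta>)"
    (is "_ = ?D \<union> ?O")
proof -
  let ?P = "\<lambda>i j. contact_plane (\<phi> i) (m i) (\<phi> j) (m j) (u j)"
  have pc: "pair_cone (\<phi> i) (\<phi> j) = (\<Union>\<eta>\<in>{\<eta>. \<eta> ^ m j = 1}. ?P i j \<eta>)" if "i \<in> I" "j \<in> I" for i j
    by (rule pair_cone_eq[OF n[OF that(1)] n[OF that(2)]])
  have 1: "(1::complex) \<in> {\<eta>. \<eta> ^ k = 1}" for k by simp
  have C: "C5 X = (\<Union>i\<in>I. \<Union>j\<in>I. pair_cone (\<phi> i) (\<phi> j))" by (rule C5_curves[OF I n X])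
  have Dsub: "?P i i \<eta> \<subseteq> ?D \<union> ?O" if "i \<in> I" "\<eta> \<in> {\<eta>. \<eta> ^ m i = 1} - {1}" for i \<eta> using that by blast
  have Osub: "?P i j \<eta> \<subseteq> ?D \<union> ?O" if "i \<in> I" "j \<in> I" "i < j" "\<eta> \<in> {\<eta>. \<eta> ^ m j = 1}" for i j \<eta>
  proof -
    have "?P i j \<eta> \<subseteq> ?O" by (rule subset_trans[OF _ UN_upper[of "(i, j)"]]) (use that in auto)
    then show ?thesis by (rule le_supI2)
  qed
  have line: "?P i i 1 \<subseteq> ?D \<union> ?O" if i: "i \<in> I" for i
  proof -
    have in_plane: "?P i i 1 \<subseteq> ?P k j \<eta>" if "u i \<in> ?P k j \<eta>" for k j \<eta>
      unfolding contact_plane_1[OF n[OF i]] using that unfolding contact_plane_def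
      by (intro vec.span_minimal vec.subspace_span) auto
    show ?thesis
    proof (cases "I = {i}")
      case True
      have "card {\<eta> :: complex. \<eta> ^ m i = 1} = m i"
        using normal_curveD(1)[OF n[OF i]] by (intro card_roots_unity_eq) simp
      then have "\<not> {\<eta> :: complex. \<eta> ^ m i = 1} \<subseteq> {1}"
        using single[OF True] normal_curveD(1)[OF n[OF i]] card_mono[of "{1::complex}" "{\<eta>. \<eta> ^ m i = 1}"] by auto
      then obtain \<eta> :: complex where \<eta>: "\<eta> \<in> {\<eta>. \<eta> ^ m i = 1} - {1}" by blast
      have "u i \<in> ?P i i \<eta>" unfolding contact_plane_def by (intro vec.span_base) simp
      from subset_trans[OF in_plane[OF this] Dsub[OF i \<eta>]] show ?thesis .
    next
      case False
      then obtain j where j: "j \<in> I" "j \<noteq> i" using i by blast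
      show ?thesis
      proof (cases "j < i")
        case True
        have "u i \<in> ?P j i 1" unfolding contact_plane_def by (intro vec.span_base) simp
        from subset_trans[OF in_plane[OF this] Osub[OF j(1) i True 1]] show ?thesis .
      next
        case False
        then have "i < j" using j(2) by simp
        \<comment> \<open>The plane is built from the tangent vector \<open>u j\<close> of the
          second branch; for distinct tangents it is spanned by \<open>u j\<close> and
          \<open>u i - u j\<close> and thus contains \<open>u i\<close> as well.\<close>
        have "u i \<in> ?P i j 1"
        proof (cases "u i = u j")
          case True
          then show ?thesis unfolding contact_plane_def by (intro vec.span_base) simp
        next
          case ne: False
          have "u j + (u i - u j) \<in> vec.span {u j, u i - u j}" by (intro vec.span_add vec.span_base) auto
          then show ?thesis
            using contact_plane_transversal[OF n[OF i] n[OF j(1)] _ ne, of 1] by simp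
        qed
        from subset_trans[OF in_plane[OF this] Osub[OF i j(1) \<open>i < j\<close> 1]] show ?thesis .
      qed
    qed
  qed
  have sub: "pair_cone (\<phi> i) (\<phi> j) \<subseteq> ?D \<union> ?O" if "i \<in> I" "j \<in> I" "i \<le> j" for i j
  proof (cases "i = j")
    case True
    have "?P i i \<eta> \<subseteq> ?D \<union> ?O" if "\<eta> \<in> {\<eta>. \<eta> ^ m i = 1}" for \<eta>
    proof (cases "\<eta> = 1")
      case True
      then show ?thesis using line[OF \<open>i \<in> I\<close>] by (simp only:)
    qed (rule Dsub[OF \<open>i \<in> I\<close>], use that in blast)
    then show ?thesis unfolding True[symmetric] pc[OF that(1) that(1)] by (rule UN_least)
  next
    case False
    then have "i < j" using that(3) by simp
    then show ?thesis unfolding pc[OF that(1,2)] by (intro UN_least Osub that)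
  qed
  show ?thesis
  proof (intro equalityI)
    show "C5 X \<subseteq> ?D \<union> ?O"
    proof
      fix v assume "v \<in> C5 X"
      then obtain i j where ij: "i \<in> I" "j \<in> I" "v \<in> pair_cone (\<phi> i) (\<phi> j)" unfolding C by blast
      have "i \<le> j \<or> j \<le> i" by auto
      then show "v \<in> ?D \<union> ?O"
      proof
        assume "i \<le> j"
        from subsetD[OF sub[OF ij(1,2) this] ij(3)] show ?thesis .
      next
        assume "j \<le> i"
        from subsetD[OF sub[OF ij(2,1) this, unfolded pair_cone_sym[of "\<phi> j" "\<phi> i"]] ij(3)] show ?thesis .
      qed
    qed
    have PC: "?P i j \<eta> \<subseteq> C5 X" if "i \<in> I" "j \<in> I" "\<eta> \<in> {\<eta>. \<eta> ^ m j = 1}" for i j \<eta>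
    proof -
      have "?P i j \<eta> \<subseteq> pair_cone (\<phi> i) (\<phi> j)" unfolding pc[OF that(1,2)] by (rule UN_upper[OF that(3)])
      also have "\<dots> \<subseteq> C5 X" unfolding C using that(1,2) by blast
      finally show ?thesis .
    qed
    have "(case p of (i, j) \<Rightarrow> \<Union>\<eta>\<in>{\<eta>. \<eta> ^ m j = 1}. ?P i j \<eta>) \<subseteq> C5 X" if p0: "p \<in> {(i, j). i \<in> I \<and> j \<in> I \<and> i < j}" for p
    proof -
      obtain i j where p: "p = (i, j)" "i \<in> I" "j \<in> I" using p0 by blast
      show ?thesis unfolding p(1) prod.case by (rule UN_least) (rule PC[OF p(2,3)])
    qed
    moreover have "?P i i \<eta> \<subseteq> C5 X" if "i \<in> I" "\<eta> \<in> {\<eta>. \<eta> ^ m i = 1} - {1}" for i \<eta>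
      using that by (intro PC) auto
    ultimately show "?D \<union> ?O \<subseteq> C5 X" by (intro Un_least UN_least)
  qed
qed

theorem proposition5p4:
  fixes X :: "(complex^'n) set" and r :: nat and Xb :: "nat \<Rightarrow> (complex^'n) set"
  assumes "CARD('n) \<ge> 2"
    and "curve_germ X r Xb"
    and "\<not> smooth_germ X"
  shows "finite (Irred (C5 X)) \<and>
         card (Irred (C5 X)) \<le>
           (\<Sum>i\<in>S_set r Xb. \<sigma> (germ_mult (Xb i)) - 1)
           + (\<Sum>(i, j)\<in>T_set r Xb. gcd (germ_mult (Xb i)) (germ_mult (Xb j)))
           + card (NT_set r Xb)
         \<and> (irreducible_germ X \<longrightarrow> card (Irred (C5 X)) \<le> \<sigma> (germ_mult X) - 1)"
proof -
  define I where "I = {1..r}"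
  have finI: "finite I" by (simp add: I_def)
  have XI: "germ_eq X (\<Union>i\<in>I. Xb i)" and irr: "\<And>i. i \<in> I \<Longrightarrow> irreducible_germ (Xb i)"
    and dim: "\<And>i. i \<in> I \<Longrightarrow> germ_dim (Xb i) = 1" and min: "\<And>i j. i \<in> I \<Longrightarrow> j \<in> I \<Longrightarrow> i \<noteq> j \<Longrightarrow> \<not> germ_le (Xb i) (Xb j)"
    using assms(2) unfolding curve_germ_def irreducible_decomposition_def I_def by auto
  obtain c m u R \<phi> where n: "\<And>i. i \<in> I \<Longrightarrow> normal_curve c (m i) (u i) (R i) (\<phi> i)"
    and eq: "\<And>i r'. i \<in> I \<Longrightarrow> 0 < r' \<Longrightarrow> r' \<le> R i \<Longrightarrow> germ_eq (Xb i) (\<phi> i ` ball 0 r')"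
    using branch_normal_forms[of I Xb, OF finI irr dim] by metis
  have eqR: "germ_eq (Xb i) (\<phi> i ` ball 0 (R i))" if "i \<in> I" for i using eq[OF that] normal_curveD(2)[OF n[OF that]] by simp
  have mult: "germ_mult (Xb i) = m i" if "i \<in> I" for i by (rule germ_mult_normal[OF n[OF that] eq[OF that]])
  have X\<phi>: "germ_eq X (\<Union>i\<in>I. \<phi> i ` ball 0 (R i))" by (rule germ_eq_trans[OF XI germ_eq_UN[OF finI eqR]])
  \<comment> \<open>A lone branch of multiplicity 1 would make \<open>X\<close> smooth.\<close>
  have single: "m i \<noteq> 1" if "I = {i}" for i
  proof
    assume "m i = 1"
    then have "normal_curve c 1 (u i) (R i) (\<phi> i)" using n[of i] that by simp
    then have "smooth_germ X" by (rule mult_1_imp_smooth_germ) (use X\<phi> that in simp)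
    then show False using assms(3) by blast
  qed
  let ?P = "\<lambda>i j. contact_plane (\<phi> i) (m i) (\<phi> j) (m j) (u j)"
  let ?R = "\<lambda>k. {\<eta> :: complex. \<eta> ^ k = 1}"
  let ?S = "S_set r Xb" and ?T = "T_set r Xb" and ?N = "NT_set r Xb"
  \<comment> \<open>Only singular branches contribute planes of their own: for
    \<open>m i = 1\<close> the number 1 is the sole root of unity.\<close>
  have S: "i \<in> ?S" if "i \<in> I" "m i \<noteq> 1" for i
    using smooth_germ_imp_mult_1[OF n[OF that(1)] eqR[OF that(1)]] that by (auto simp: S_set_def I_def)
  have SI: "?S \<subseteq> I" "?T \<subseteq> I \<times> I" "?N \<subseteq> I \<times> I" "?T \<union> ?N = {(i, j). i \<in> I \<and> j \<in> I \<and> i < j}"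
    unfolding S_set_def T_set_def NT_set_def I_def by blast+
  have fin: "finite ?S" "finite ?T" "finite ?N" using finite_subset[OF SI(1) finI] finite_subset[OF SI(2)] finite_subset[OF SI(3)] finI by simp_all
  have finR: "finite (?R (m i))" if "i \<in> I" for i
    using normal_curveD(1)[OF n[OF that]] by (intro finite_roots_unity) linarith
  define \<A> where "\<A> = (\<Union>i\<in>?S. ?P i i ` (?R (m i) - {1}))"
  define \<B> where "\<B> = (\<Union>(i, j)\<in>?T. ?P i j ` ?R (m j))"
  define \<C> where "\<C> = (\<Union>(i, j)\<in>?N. ?P i j ` ?R (m j))"
  have fin\<P>: "finite \<A>" "finite \<B>" "finite \<C>"
    unfolding \<A>_def \<B>_def \<C>_def using fin finR SI(1-3) by (auto intro!: finite_UN_I finite_imageI)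
  have "C5 X = (\<Union>i\<in>I. \<Union>\<eta>\<in>?R (m i) - {1}. ?P i i \<eta>) \<union> (\<Union>(i, j)\<in>?T \<union> ?N. \<Union>\<eta>\<in>?R (m j). ?P i j \<eta>)"
    unfolding SI(4) by (rule C5_planes[OF finI n X\<phi> single])
  also have "(\<Union>i\<in>I. \<Union>\<eta>\<in>?R (m i) - {1}. ?P i i \<eta>) = (\<Union>i\<in>?S. \<Union>\<eta>\<in>?R (m i) - {1}. ?P i i \<eta>)"
  proof (rule equalityI)
    show "(\<Union>i\<in>I. \<Union>\<eta>\<in>?R (m i) - {1}. ?P i i \<eta>) \<subseteq> (\<Union>i\<in>?S. \<Union>\<eta>\<in>?R (m i) - {1}. ?P i i \<eta>)"
    proof
      fix v assume "v \<in> (\<Union>i\<in>I. \<Union>\<eta>\<in>?R (m i) - {1}. ?P i i \<eta>)"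
      then obtain i \<eta> where *: "i \<in> I" "\<eta> \<in> ?R (m i) - {1}" "v \<in> ?P i i \<eta>" by blast
      then have "m i \<noteq> 1" by auto
      from S[OF *(1) this] show "v \<in> (\<Union>i\<in>?S. \<Union>\<eta>\<in>?R (m i) - {1}. ?P i i \<eta>)" using * by blast
    qed
  qed (rule UN_mono[OF SI(1) subset_refl])
  also have "\<dots> \<union> (\<Union>(i, j)\<in>?T \<union> ?N. \<Union>\<eta>\<in>?R (m j). ?P i j \<eta>) = \<Union>(\<A> \<union> \<B> \<union> \<C>)"
    unfolding \<A>_def \<B>_def \<C>_def by blast
  finally have C5: "C5 X = \<Union>(\<A> \<union> \<B> \<union> \<C>)" .
  have "Irred (C5 X) \<subseteq> \<A> \<union> \<B> \<union> \<C>" unfolding C5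
  proof (rule Irred_Union_subspaces)
    show "vec.subspace P" if "P \<in> \<A> \<union> \<B> \<union> \<C>" for P
      using that unfolding \<A>_def \<B>_def \<C>_def contact_plane_def by (auto simp: vec.subspace_span)
  qed (use fin\<P> in simp)
  then have finI: "finite (Irred (C5 X))" and "card (Irred (C5 X)) \<le> card (\<A> \<union> \<B> \<union> \<C>)"
    using fin\<P> by (auto intro: finite_subset card_mono)
  moreover have "card (\<A> \<union> \<B> \<union> \<C>) \<le> card \<A> + card \<B> + card \<C>"
    by (metis add_le_mono1 card_Un_le order_trans)
  moreover have "card \<A> \<le> (\<Sum>i\<in>?S. \<sigma> (germ_mult (Xb i)) - 1)"
  proof -
    have "card \<A> \<le> (\<Sum>i\<in>?S. card (?P i i ` (?R (m i) - {1})))" unfolding \<A>_def by (rule card_UN_le[OF fin(1)])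
    also have "\<dots> \<le> (\<Sum>i\<in>?S. \<sigma> (germ_mult (Xb i)) - 1)"
      by (rule sum_mono) (use SI(1) mult card_self_contact_planes[OF n] in auto)
    finally show ?thesis .
  qed
  moreover have "card \<B> \<le> (\<Sum>(i, j)\<in>?T. gcd (germ_mult (Xb i)) (germ_mult (Xb j)))"
  proof -
    have "card \<B> \<le> (\<Sum>p\<in>?T. card (case p of (i, j) \<Rightarrow> ?P i j ` ?R (m j)))" unfolding \<B>_def by (rule card_UN_le[OF fin(2)])
    also have "\<dots> \<le> (\<Sum>(i, j)\<in>?T. gcd (germ_mult (Xb i)) (germ_mult (Xb j)))"
      by (rule sum_mono) (use SI(2) mult card_contact_planes[OF n n] in auto)
    finally show ?thesis .
  qed
  moreover have "card \<C> \<le> card ?N"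
  proof -
    have "card \<C> \<le> (\<Sum>p\<in>?N. card (case p of (i, j) \<Rightarrow> ?P i j ` ?R (m j)))" unfolding \<C>_def by (rule card_UN_le[OF fin(3)])
    also have "\<dots> \<le> (\<Sum>p\<in>?N. 1)"
    proof (rule sum_mono)
      fix p assume "p \<in> ?N"
      then obtain i j where ij: "p = (i, j)" "i \<in> I" "j \<in> I" "tangent_cone (Xb i) \<noteq> tangent_cone (Xb j)"
        by (auto simp: NT_set_def I_def)
      \<comment> \<open>The tangent cones are the lines of \<open>u i\<close> and
        \<open>u j\<close>; distinct vectors give the same plane for all \<eta>.\<close>
      then have "u i \<noteq> u j" using tangent_cone_normal[OF n eqR] by metis
      then have "?P i j ` ?R (m j) \<subseteq> {vec.span {u j, u i - u j}}"
        using contact_plane_transversal[OF n[OF ij(2)] n[OF ij(3)]] by auto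
      then show "card (case p of (i, j) \<Rightarrow> ?P i j ` ?R (m j)) \<le> 1"
        using card_mono[of "{vec.span {u j, u i - u j}}" "?P i j ` ?R (m j)"] ij(1) by simp
    qed
    finally show ?thesis by simp
  qed
  ultimately have bound: "card (Irred (C5 X)) \<le> (\<Sum>i\<in>?S. \<sigma> (germ_mult (Xb i)) - 1)
           + (\<Sum>(i, j)\<in>?T. gcd (germ_mult (Xb i)) (germ_mult (Xb j))) + card ?N"
    by linarith
  have "card (Irred (C5 X)) \<le> \<sigma> (germ_mult X) - 1" if X: "irreducible_germ X"
  proof -
    have "\<exists>k\<in>I. germ_eq X (Xb k)"
      by (rule irreducible_germ_UN[OF X _ _ XI]) (use irr in \<open>auto simp: I_def irreducible_germ_def analytic_germ_def\<close>)
    then obtain k where k: "k \<in> I" "germ_eq X (Xb k)" by blast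
    \<comment> \<open>A further branch would be contained in \<open>Xb k\<close>, against the
      irredundancy of the decomposition.\<close>
    have "i = k" if i: "i \<in> I" for i
    proof (rule ccontr)
      assume "i \<noteq> k"
      have "germ_le (Xb i) (Xb k)" unfolding germ_le_def
        using XI k(2) unfolding germ_eq_def by eventually_elim (use i in auto)
      then show False using min[OF i k(1) \<open>i \<noteq> k\<close>] by blast
    qed
    then have Ik: "I = {k}" using k(1) by blast
    have "germ_eq X (\<phi> k ` ball 0 r')" if "0 < r'" "r' \<le> R k" for r'
      by (rule germ_eq_trans[OF k(2) eq[OF k(1) that]])
    then have "germ_mult X = m k" by (rule germ_mult_normal[OF n[OF k(1)]])
    then have m: "germ_mult X = germ_mult (Xb k)" using mult[OF k(1)] by simp
    have "?T = {}" "?N = {}" using SI(4) Ik by auto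
    then have "card (Irred (C5 X)) \<le> (\<Sum>i\<in>?S. \<sigma> (germ_mult (Xb i)) - 1)" using bound by simp
    also have "\<dots> \<le> (\<Sum>i\<in>{k}. \<sigma> (germ_mult (Xb i)) - 1)" by (rule sum_mono2) (use SI(1) Ik in auto)
    finally show ?thesis using m by simp
  qed
  then show ?thesis using finI bound by blast
qed

end
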